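(* Suppose $1<p<\infty$, $\alpha$ is real, and $\beta$ is real. Let $\frac1p+\frac1q=1$, and let $s_1$ and $s_2$ be complex parameters such that both $R_{s_1,\alpha/p}$ and $R_{s_2,\beta/q}$ are well-defined operators. Then $(A^p_\alpha)^*=A^q_\beta$ (with equivalent norms) under the integral pairing $$\langle f,g\rangle=\int_{\mathbb B_n}R_{s_1,\alpha/p}f\,\overline{R_{s_2,\beta/q}g}\,dv,\qquad f\in A^p_\alpha,\ g\in A^q_\beta.$$
   Context: Fix a positive integer $n$. $\mathbb B_n$ is the open unit ball of $\mathbb C^n$, $dv$ is volume measure, and $dv_\alpha(z)=(1-|z|^2)^\alpha dv(z)$ for real $\alpha$ (normalized to be a probability measure when $\alpha>-1$). The radial derivative is $Rf(z)=\sum_{k=1}^n z_k\frac{\partial f}{\partial z_k}(z)$, $R^k$ is its $k$-fold iterate, $R^0f=f$. For $p>0$ and real $\alpha$, $A^p_\alpha$ is the space of holomorphic $f$ in $\mathbb B_n$ such that, for a nonnegative integer $k$ with $pk+\alpha>-1$, $(1-|z|^2)^kR^kf(z)\in L^p(\mathbb B_n,dv_\alpha)$ (independent of the choice of such $k$). With $N$ the smallest nonnegative integer such that $pN+\alpha>-1$, $$\|f\|_{p,\alpha}=|f(0)|+\left[\int_{\mathbb B_n}(1-|z|^2)^{pN}|R^Nf(z)|^p\,dv_\alpha(z)\right]^{1/p}.$$ For complex $s,t$ such that neither $n+s$ nor $n+s+t$ is a negative integer (the condition for $R_{s,t}$ to be well defined), and $f=\sum_{k\ge0}f_k$ the homogeneous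 expansion of a holomorphic $f$ in $\mathbb B_n$, $$R_{s,t}f(z)=\sum_{k=0}^\infty\frac{\Gamma(n+1+s+t)\Gamma(n+1+k+s)}{\Gamma(n+1+s)\Gamma(n+1+k+s+t)}f_k(z).$$ $(A^p_\alpha)^*$ is the space of linear functionals $F$ on $A^p_\alpha$ with $|F(f)|\le C\|f\|_{p,\alpha}$, normed by the smallest such $C$. "$(A^p_\alpha)^*=A^q_\beta$ with equivalent norms under the pairing" means: each $g\in A^q_\beta$ defines a bounded linear functional $f\mapsto\langle f,g\rangle$, every bounded linear functional on $A^p_\alpha$ is of this form for a unique $g\in A^q_\beta$, and the norm of the functional is comparable to $\|g\|_{q,\beta}$ with constants independent of $g$. *)

theory Defs
  imports "HOL-Analysis.Analysis"
begin

section \<open>Holomorphic functions in the unit ball\<close>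

abbreviation unit_ball :: "(complex ^ 'n) set" where
  "unit_ball \<equiv> ball 0 1"

text \<open>Complex Frechet differentiability: the derivative exists and is complex linear.\<close>

definition holomorphic_in_ball :: "(complex ^ 'n \<Rightarrow> complex) \<Rightarrow> bool" where
  "holomorphic_in_ball f \<longleftrightarrow>
     (\<forall>z\<in>unit_ball. \<exists>D. (f has_derivative D) (at z) \<and> (\<forall>c v. D (c *s v) = c * D v))"

definition partial_deriv :: "'n \<Rightarrow> (complex ^ 'n \<Rightarrow> complex) \<Rightarrow> complex ^ 'n \<Rightarrow> complex" where
  "partial_deriv k f z = deriv (\<lambda>w. f (\<chi> j. if j = k then w else z $ j)) (z $ k)"

definition radial_deriv :: "(complex ^ 'n \<Rightarrow> complex) \<Rightarrow> complex ^ 'n \<Rightarrow> complex" where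
  "radial_deriv f z = (\<Sum>k\<in>UNIV. z $ k * partial_deriv k f z)"

text \<open>Multi-indices are functions \<open>'n \<Rightarrow> nat\<close>; those of a given length form a finite set.\<close>

definition homogeneous_poly :: "nat \<Rightarrow> (complex ^ 'n \<Rightarrow> complex) \<Rightarrow> bool" where
  "homogeneous_poly k h \<longleftrightarrow>
     (\<exists>a :: ('n \<Rightarrow> nat) \<Rightarrow> complex.
        \<forall>z. h z = (\<Sum>m | (\<Sum>i\<in>UNIV. m i) = k. a m * (\<Prod>i\<in>UNIV. (z $ i) ^ m i)))"

text \<open>The expansion exists and is unique for every holomorphic function in the ball
  (the \<open>k\<close>-th component at \<open>z\<close> is the \<open>k\<close>-th Taylor coefficient at 0 of the slice
  function \<open>\<lambda>w. f (w *s z)\<close>).\<close>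

definition homogeneous_expansion ::
    "(complex ^ 'n \<Rightarrow> complex) \<Rightarrow> nat \<Rightarrow> complex ^ 'n \<Rightarrow> complex" where
  "homogeneous_expansion f =
     (THE \<phi>. (\<forall>k. homogeneous_poly k (\<phi> k)) \<and> (\<forall>z\<in>unit_ball. (\<lambda>k. \<phi> k z) sums f z))"

section \<open>The operators \<open>R\<^sub>s\<^sub>,\<^sub>t\<close>\<close>

definition Rst_well_defined :: "nat \<Rightarrow> complex \<Rightarrow> complex \<Rightarrow> bool" where
  "Rst_well_defined n s t \<longleftrightarrow>
     (\<forall>m::nat. m > 0 \<longrightarrow> of_nat n + s \<noteq> - of_nat m \<and> of_nat n + s + t \<noteq> - of_nat m)"

definition Rst :: "complex \<Rightarrow> complex \<Rightarrow> (complex ^ 'n \<Rightarrow> complex) \<Rightarrow> complex ^ 'n \<Rightarrow> complex" where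
  "Rst s t f z =
     (let n = of_nat CARD('n) in
       \<Sum>k. (Gamma (n + 1 + s + t) * Gamma (n + 1 + of_nat k + s)) /
            (Gamma (n + 1 + s) * Gamma (n + 1 + of_nat k + s + t)) *
            homogeneous_expansion f k z)"

section \<open>Weighted volume measures and the spaces \<open>A\<^sup>p\<^sub>\<alpha>\<close>\<close>

definition vol :: "(complex ^ 'n) measure" where
  "vol = restrict_space lborel unit_ball"

text \<open>The measure \<open>wvol \<alpha>\<close> is a probability measure for \<open>\<alpha> > -1\<close>; otherwise it is an
  infinite measure and no constant is inserted.\<close>

definition wvol_const :: "'n::finite itself \<Rightarrow> real \<Rightarrow> real" where
  "wvol_const _ \<alpha> =
     (if \<alpha> > -1 then 1 / (LINT z|(vol :: (complex ^ 'n) measure). (1 - (norm z)\<^sup>2) powr \<alpha>) else 1)"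

definition wvol :: "real \<Rightarrow> (complex ^ 'n) measure" where
  "wvol \<alpha> = density vol (\<lambda>z. ennreal (wvol_const TYPE('n) \<alpha> * (1 - (norm z)\<^sup>2) powr \<alpha>))"

definition in_Lp :: "'a measure \<Rightarrow> real \<Rightarrow> ('a \<Rightarrow> complex) \<Rightarrow> bool" where
  "in_Lp M p f \<longleftrightarrow> f \<in> borel_measurable M \<and> integrable M (\<lambda>z. norm (f z) powr p)"

text \<open>Functions on the ball are represented by their extension by zero to all of
  \<open>complex ^ 'n\<close>, so that equality of elements of the space is equality on the ball.\<close>

definition bergman :: "real \<Rightarrow> real \<Rightarrow> (complex ^ 'n \<Rightarrow> complex) set" where
  "bergman p \<alpha> =
     {f. holomorphic_in_ball f \<and> (\<forall>z. z \<notin> unit_ball \<longrightarrow> f z = 0) \<and>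
         (\<exists>k::nat. p * real k + \<alpha> > -1 \<and>
            in_Lp (wvol \<alpha>) p (\<lambda>z. of_real ((1 - (norm z)\<^sup>2) ^ k) * (radial_deriv ^^ k) f z))}"

definition bergman_norm :: "real \<Rightarrow> real \<Rightarrow> (complex ^ 'n \<Rightarrow> complex) \<Rightarrow> real" where
  "bergman_norm p \<alpha> f =
     (let N = (LEAST N::nat. p * real N + \<alpha> > -1) in
       norm (f 0) +
       (LINT z|wvol \<alpha>. (1 - (norm z)\<^sup>2) powr (p * real N) *
                        norm ((radial_deriv ^^ N) f z) powr p) powr (1 / p))"

section \<open>Duality\<close>

text \<open>Here \<open>X\<close> is a space of complex functions under the pointwise operations and \<open>\<nu>\<close> is
  its norm. A functional is only considered through its values on \<open>X\<close>.\<close>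

definition bounded_functional ::
    "('a \<Rightarrow> complex) set \<Rightarrow> (('a \<Rightarrow> complex) \<Rightarrow> real) \<Rightarrow> (('a \<Rightarrow> complex) \<Rightarrow> complex) \<Rightarrow> bool" where
  "bounded_functional X \<nu> F \<longleftrightarrow>
     (\<forall>f\<in>X. \<forall>g\<in>X. F (\<lambda>z. f z + g z) = F f + F g) \<and>
     (\<forall>c. \<forall>f\<in>X. F (\<lambda>z. c * f z) = c * F f) \<and>
     (\<exists>C. \<forall>f\<in>X. norm (F f) \<le> C * \<nu> f)"

definition functional_norm ::
    "('a \<Rightarrow> complex) set \<Rightarrow> (('a \<Rightarrow> complex) \<Rightarrow> real) \<Rightarrow> (('a \<Rightarrow> complex) \<Rightarrow> complex) \<Rightarrow> real" where
  "functional_norm X \<nu> F = Inf {C. 0 \<le> C \<and> (\<forall>f\<in>X. norm (F f) \<le> C * \<nu> f)}"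

definition dual_under_pairing ::
    "('a \<Rightarrow> complex) set \<Rightarrow> (('a \<Rightarrow> complex) \<Rightarrow> real) \<Rightarrow>
     ('a \<Rightarrow> complex) set \<Rightarrow> (('a \<Rightarrow> complex) \<Rightarrow> real) \<Rightarrow>
     (('a \<Rightarrow> complex) \<Rightarrow> ('a \<Rightarrow> complex) \<Rightarrow> complex) \<Rightarrow> bool" where
  "dual_under_pairing X \<nu> Y \<mu> B \<longleftrightarrow>
     (\<forall>g\<in>Y. bounded_functional X \<nu> (\<lambda>f. B f g)) \<and>
     (\<forall>F. bounded_functional X \<nu> F \<longrightarrow> (\<exists>!g. g \<in> Y \<and> (\<forall>f\<in>X. F f = B f g))) \<and>
     (\<exists>c>0. \<exists>C>0. \<forall>g\<in>Y. c * \<mu> g \<le> functional_norm X \<nu> (\<lambda>f. B f g) \<and>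
                          functional_norm X \<nu> (\<lambda>f. B f g) \<le> C * \<mu> g)"

end

theory Submission
  imports Defs "HOL-Complex_Analysis.Complex_Analysis" "HOL-Real_Asymp.Real_Asymp"
begin

text \<open>
  The operator \<open>Rst s1 (\<alpha>/p)\<close> multiplies the component of degree \<open>k\<close> of the homogeneous expansion
  by a quotient of rising factorials that behaves like \<open>k powr (- \<alpha>/p)\<close>. It should therefore be an
  isomorphism from the weighted space \<open>bergman p \<alpha>\<close> onto the unweighted space \<open>Ap p\<close>, and likewise
  \<open>Rst s2 (\<beta>/q)\<close> from \<open>bergman q \<beta>\<close> onto \<open>Ap q\<close>. The pairing of the theorem is the pull-back of
  \<open>\<integral> f cnj g\<close> under these two isomorphisms, so that the theorem reduces to the classical duality between
  \<open>Ap p\<close> and \<open>Ap q\<close>, whatever \<open>\<alpha>\<close> and \<open>\<beta>\<close> are.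

  The isomorphism is proved in \<open>Rst_ball_bounded\<close>, \<open>Rst_ball_surj\<close> and \<open>Rst_ball_inj\<close>. On holomorphic
  functions an integral operator whose kernel is a power series in the Hermitian pairing \<open>cip z w\<close> acts as a
  coefficient multiplier (\<open>integral_power_series_kernel\<close>), because a radial weight separates the degrees.
  Read backwards, the multipliers in question, combined with radial derivatives, are integral operators
  whose kernels grow at the boundary like a power of \<open>1 - cip z w\<close>. Their boundedness between weighted
  \<open>L\<close> spaces is Schur's test with the Forelli-Rudin estimate (\<open>Bergman_type_operator_bounded\<close>). Since the
  parameters are complex, growth is measured by the predicate \<open>kernel_order\<close>, which absorbs the imaginary parts.

  The duality of the unweighted spaces (\<open>Ap_dual\<close>) does not use a representation theorem for functionals on
  \<open>L\<close> spaces. The representing function is written down through its expansion: its component of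
  degree \<open>j\<close> at \<open>z\<close> is, up to a constant and conjugation, the value of the functional at
  \<open>w \<mapsto> cip w z ^ j\<close>. For dilations of Bergman projections the representation holds term by term
  (\<open>F_dil_bergman_proj\<close>); boundedness of the Bergman projection then bounds the dilations of the representing
  function uniformly, and the dilation is removed by a limit.

  The expansion of a function into homogeneous polynomials is also obtained by integration. A slice
  coefficient is homogeneous and holomorphic along all complex lines of the whole space, hence is
  reproduced by the Gaussian integral against \<open>cip z w ^ k\<close> (\<open>fock_power\<close>), and this kernel expands into
  monomials by the multinomial theorem.
\<close>


section \<open>Scaling, rotations and polar coordinates\<close>

lemma nn_integral_lborel_affine:
  fixes c :: "'a::euclidean_space" and r :: real
  assumes [measurable]: "f \<in> borel_measurable borel" and "r \<noteq> 0"
  shows "(\<integral>\<^sup>+x. f x \<partial>lborel) = ennreal (\<bar>r\<bar> ^ DIM('a)) * (\<integral>\<^sup>+x. f (c + r *\<^sub>R x) \<partial>lborel)"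
  by (subst lborel_affine[OF \<open>r \<noteq> 0\<close>, of c])
     (simp add: nn_integral_density nn_integral_distr nn_integral_cmult)

text \<open>The image measure is translation invariant, hence a multiple of Lebesgue measure, and the unit ball, which an isometry preserves, shows that the factor is 1.\<close>

lemma lborel_distr_linear_isometry:
  fixes T :: "'a::euclidean_space \<Rightarrow> 'a"
  assumes lin: "linear T" and iso: "\<And>x. norm (T x) = norm x"
  shows "distr lborel borel T = lborel"
proof (rule measure_eqI)
  have cont: "continuous_on UNIV T"
    using lin by (simp add: linear_continuous_on linear_conv_bounded_linear)
  have [measurable]: "T \<in> borel_measurable borel"
    using cont by (rule borel_measurable_continuous_onI)
  have "inj T"
    using lin iso by (metis linear_injective_0 norm_eq_zero)
  then have "surj T"
    using lin linear_injective_imp_surjective by blast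
  fix A assume "A \<in> sets (distr lborel borel T)"
  then have A[measurable]: "A \<in> sets borel" by simp
  let ?B = "ball 0 1 :: 'a set"
  let ?l = "emeasure lborel :: 'a set \<Rightarrow> ennreal"
  have B[measurable]: "?B \<in> sets borel" by simp
  have shift: "(\<integral>\<^sup>+y. indicator ?B y \<partial>lborel) = (\<integral>\<^sup>+y. indicator ?B (y - T x) \<partial>lborel)" for x
    using nn_integral_lborel_affine[of "indicator ?B" 1 "- T x"] borel_measurable_indicator[OF B] by simp
  have "(\<integral>\<^sup>+x. indicator A (T x) \<partial>lborel) = (\<integral>\<^sup>+x. indicator (T -` A) x \<partial>lborel)"
    by (intro nn_integral_cong) (auto simp: indicator_def)
  also have "\<dots> = ?l (T -` A)"
    using measurable_sets_borel[of T borel A] by (simp add: nn_integral_indicator)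
  finally have "?l (T -` A) * ?l ?B = (\<integral>\<^sup>+x. (\<integral>\<^sup>+y. indicator A (T x) * indicator ?B y \<partial>lborel) \<partial>lborel)"
    by (simp add: nn_integral_cmult nn_integral_multc)
  also have "\<dots> = (\<integral>\<^sup>+x. (\<integral>\<^sup>+y. indicator A (T x) * indicator ?B (y - T x) \<partial>lborel) \<partial>lborel)"
    using shift by (simp add: nn_integral_cmult)
  also have "\<dots> = (\<integral>\<^sup>+y. (\<integral>\<^sup>+x. indicator A (T x) * indicator ?B (y - T x) \<partial>lborel) \<partial>lborel)"
    by (rule lborel_pair.Fubini') measurable
  also have "\<dots> = (\<integral>\<^sup>+y. (\<integral>\<^sup>+x. indicator A (y - T x) * indicator ?B x \<partial>lborel) \<partial>lborel)"
  proof (rule nn_integral_cong)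
    fix y :: 'a
    obtain v where v: "T v = y" using \<open>surj T\<close> by (metis surj_f_inv_f)
    have Tv: "T (v - x) = y - T x" for x
      using v lin by (simp add: linear_diff)
    have "(\<integral>\<^sup>+x. indicator A (T x) * indicator ?B (y - T x) \<partial>lborel)
        = (\<integral>\<^sup>+x. indicator A (T (v - x)) * indicator ?B (y - T (v - x)) \<partial>lborel)"
      using nn_integral_lborel_affine[of "\<lambda>x. indicator A (T x) * indicator ?B (y - T x)" "-1" v]
      by simp
    also have "\<dots> = (\<integral>\<^sup>+x. indicator A (y - T x) * indicator ?B x \<partial>lborel)"
      unfolding Tv by (simp add: iso indicator_def)
    finally show "(\<integral>\<^sup>+x. indicator A (T x) * indicator ?B (y - T x) \<partial>lborel)
        = (\<integral>\<^sup>+x. indicator A (y - T x) * indicator ?B x \<partial>lborel)" .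
  qed
  also have "\<dots> = (\<integral>\<^sup>+x. (\<integral>\<^sup>+y. indicator A (y - T x) * indicator ?B x \<partial>lborel) \<partial>lborel)"
    by (rule lborel_pair.Fubini') measurable
  also have "\<dots> = (\<integral>\<^sup>+x. ?l A * indicator ?B x \<partial>lborel)"
  proof (rule nn_integral_cong)
    fix x
    have "(\<integral>\<^sup>+y. indicator A y \<partial>lborel) = (\<integral>\<^sup>+y. indicator A (y - T x) \<partial>lborel)"
      using nn_integral_lborel_affine[of "indicator A" 1 "- T x"] by simp
    then show "(\<integral>\<^sup>+y. indicator A (y - T x) * indicator ?B x \<partial>lborel) = ?l A * indicator ?B x"
      by (simp add: nn_integral_multc)
  qed
  also have "\<dots> = ?l A * ?l ?B"
    by (simp add: nn_integral_cmult)
  finally have eq: "?l (T -` A) * ?l ?B = ?l A * ?l ?B" .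
  have "?l ?B \<noteq> 0"
    using content_ball_pos[of 1 "0::'a"] by (auto simp: measure_def)
  moreover have "?l ?B \<noteq> \<infinity>"
    using emeasure_lborel_ball_finite[of "0::'a" 1] by auto
  ultimately have "?l (T -` A) = ?l A"
    using eq by (metis ennreal_mult_cancel_left infinity_ennreal_def mult.commute top.not_eq_extremum)
  then show "emeasure (distr lborel borel T) A = ?l A"
    by (simp add: emeasure_distr)
qed simp

lemma nn_integral_powr_tail:
  assumes "0 < (a::real)" "0 < n"
  shows "(\<integral>\<^sup>+v. ennreal (indicator {a..} v * (real n * a ^ n * inverse (v ^ Suc n))) \<partial>lborel) = 1"
proof -
  have "((\<lambda>v::real. - (a ^ n * inverse (v ^ n))) \<longlongrightarrow> - (a ^ n * 0)) at_top"
    using assms by (intro tendsto_intros tendsto_inverse_0_at_top filterlim_pow_at_top filterlim_ident) auto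
  then have lim: "((\<lambda>v::real. - (a ^ n * inverse (v ^ n))) \<longlongrightarrow> 0) at_top" by simp
  have "(\<integral>\<^sup>+v. ennreal (real n * a ^ n * inverse (v ^ Suc n)) * indicator {a..} v \<partial>lborel)
      = ennreal (0 - (- (a ^ n * inverse (a ^ n))))"
  proof (rule nn_integral_FTC_atLeast[OF _ _ _ lim])
    fix x assume "a \<le> x"
    then have x: "0 < x" using assms by simp
    show "((\<lambda>v. - (a ^ n * inverse (v ^ n))) has_field_derivative real n * a ^ n * inverse (x ^ Suc n)) (at x)"
      using x assms
      by (auto intro!: derivative_eq_intros simp: field_simps power_Suc[symmetric] simp del: power_Suc)
         (cases n; simp add: field_simps power_add)
    show "0 \<le> real n * a ^ n * inverse (x ^ Suc n)" using x assms by simp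
  qed measurable
  also have "\<dots> = 1" using assms by simp
  finally show ?thesis
    by (subst (asm) nn_integral_cong[where v="\<lambda>v. ennreal (indicator {a..} v * (real n * a ^ n * inverse (v ^ Suc n)))"])
       (auto simp: indicator_def)
qed

text \<open>Polar coordinates without a surface measure: the sphere is replaced by the ball, on which the integrand is constant along rays. The variable \<open>u\<close> is the squared radius, which makes the weights of the ball polynomial.\<close>

lemma nn_integral_polar:
  fixes f :: "'a::euclidean_space \<Rightarrow> ennreal"
  assumes dim: "DIM('a) = 2 * n" and f[measurable]: "f \<in> borel_measurable borel"
  shows "(\<integral>\<^sup>+w. f w \<partial>lborel) =
    (\<integral>\<^sup>+u. (\<integral>\<^sup>+w. ennreal (indicator {0<..} u * (real n * u ^ (n - 1))) *
        (indicator (ball 0 1) w * f (sqrt u *\<^sub>R (w /\<^sub>R norm w))) \<partial>lborel) \<partial>lborel)"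
proof -
  have n: "0 < n" using dim DIM_positive[where 'a='a] by simp
  have [measurable]: "ball 0 1 \<in> sets (borel :: 'a measure)" by simp
  let ?c = "\<lambda>u::real. ennreal (indicator {0<..} u * (real n * u ^ (n - 1)))"
  have "(\<integral>\<^sup>+u. (\<integral>\<^sup>+w. ?c u * (indicator (ball 0 1) w * f (sqrt u *\<^sub>R (w /\<^sub>R norm w))) \<partial>lborel) \<partial>lborel)
     = (\<integral>\<^sup>+w. (\<integral>\<^sup>+u. ?c u * (indicator (ball 0 1) w * f (sqrt u *\<^sub>R (w /\<^sub>R norm w))) \<partial>lborel) \<partial>lborel)"
    by (rule lborel_pair.Fubini') measurable
  also have "\<dots> = (\<integral>\<^sup>+w. (\<integral>\<^sup>+v. ?c v * ennreal (norm w ^ (2*n)) * (indicator (ball 0 1) w * f (sqrt v *\<^sub>R w)) \<partial>lborel) \<partial>lborel)"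
  proof (intro nn_integral_cong_AE, use AE_lborel_singleton[of "0::'a"] in eventually_elim)
    fix w :: 'a assume w: "w \<noteq> 0"
    let ?a = "(norm w)\<^sup>2"
    have a: "?a > 0" using w by simp
    have "(\<integral>\<^sup>+u. ?c u * (indicator (ball 0 1) w * f (sqrt u *\<^sub>R (w /\<^sub>R norm w))) \<partial>lborel)
      = ennreal ?a * (\<integral>\<^sup>+v. ?c (?a * v) * (indicator (ball 0 1) w * f (sqrt (?a * v) *\<^sub>R (w /\<^sub>R norm w))) \<partial>lborel)"
      using a by (subst nn_integral_real_affine[where c="?a" and t=0]) auto
    also have "\<dots> = (\<integral>\<^sup>+v. ennreal ?a * (?c (?a * v) * (indicator (ball 0 1) w * f (sqrt (?a * v) *\<^sub>R (w /\<^sub>R norm w)))) \<partial>lborel)"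
      by (rule nn_integral_cmult[symmetric]) measurable
    also have "\<dots> = (\<integral>\<^sup>+v. ?c v * ennreal (norm w ^ (2*n)) * (indicator (ball 0 1) w * f (sqrt v *\<^sub>R w)) \<partial>lborel)"
    proof (rule nn_integral_cong)
      fix v :: real
      have p: "norm w ^ (2*n) = ?a * ?a ^ (n - 1)"
        using n by (cases n) (simp_all add: power_mult power2_eq_square power_mult_distrib)
      have c: "ennreal ?a * ?c (?a * v) = ?c v * ennreal (norm w ^ (2*n))"
        using a w unfolding p by (auto simp: indicator_def zero_less_mult_iff power_mult_distrib mult_ac simp flip: ennreal_mult)
      have s: "sqrt (?a * v) *\<^sub>R (w /\<^sub>R norm w) = sqrt v *\<^sub>R w"
        using w by (simp add: real_sqrt_mult)
      show "ennreal ?a * (?c (?a * v) * (indicator (ball 0 1) w * f (sqrt (?a * v) *\<^sub>R (w /\<^sub>R norm w))))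
        = ?c v * ennreal (norm w ^ (2*n)) * (indicator (ball 0 1) w * f (sqrt v *\<^sub>R w))"
        unfolding s by (subst c[symmetric]) (simp only: mult.assoc)
    qed
    finally show "(\<integral>\<^sup>+u. ?c u * (indicator (ball 0 1) w * f (sqrt u *\<^sub>R (w /\<^sub>R norm w))) \<partial>lborel) = \<dots>" .
  qed
  also have "\<dots> = (\<integral>\<^sup>+v. (\<integral>\<^sup>+w. ?c v * ennreal (norm w ^ (2*n)) * (indicator (ball 0 1) w * f (sqrt v *\<^sub>R w)) \<partial>lborel) \<partial>lborel)"
    by (rule lborel_pair.Fubini') measurable
  also have "\<dots> = (\<integral>\<^sup>+v. (\<integral>\<^sup>+w. indicator {w. (norm w)\<^sup>2 < v} w * (ennreal (real n * norm w ^ (2*n) * inverse (v ^ Suc n)) * f w) \<partial>lborel) \<partial>lborel)"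
  proof (rule nn_integral_cong)
    fix v :: real
    show "(\<integral>\<^sup>+w. ?c v * ennreal (norm w ^ (2*n)) * (indicator (ball 0 1) w * f (sqrt v *\<^sub>R w)) \<partial>lborel)
      = (\<integral>\<^sup>+w. indicator {w. (norm w)\<^sup>2 < v} w * (ennreal (real n * norm w ^ (2*n) * inverse (v ^ Suc n)) * f w) \<partial>lborel)"
    proof (cases "0 < v")
      case False
      then have "\<not> (norm w)\<^sup>2 < v" for w :: 'a using zero_le_power2[of "norm w"] by linarith
      with False show ?thesis by (simp add: indicator_def)
    next
      case True
      have "(\<integral>\<^sup>+w. indicator {w. (norm w)\<^sup>2 < v} w * (ennreal (real n * norm w ^ (2*n) * inverse (v ^ Suc n)) * f w) \<partial>lborel)
        = ennreal (sqrt v ^ (2*n)) * (\<integral>\<^sup>+w. indicator {w. (norm w)\<^sup>2 < v} (sqrt v *\<^sub>R w) * 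
            (ennreal (real n * norm (sqrt v *\<^sub>R w) ^ (2*n) * inverse (v ^ Suc n)) * f (sqrt v *\<^sub>R w)) \<partial>lborel)"
        using True dim by (subst nn_integral_lborel_affine[where r="sqrt v" and c=0]) auto
      also have "\<dots> = (\<integral>\<^sup>+w. ennreal (sqrt v ^ (2*n)) * (indicator {w. (norm w)\<^sup>2 < v} (sqrt v *\<^sub>R w) * 
            (ennreal (real n * norm (sqrt v *\<^sub>R w) ^ (2*n) * inverse (v ^ Suc n)) * f (sqrt v *\<^sub>R w))) \<partial>lborel)"
        by (rule nn_integral_cmult[symmetric]) measurable
      also have "\<dots> = (\<integral>\<^sup>+w. ?c v * ennreal (norm w ^ (2*n)) * (indicator (ball 0 1) w * f (sqrt v *\<^sub>R w)) \<partial>lborel)"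
      proof (rule nn_integral_cong)
        fix w :: 'a
        have i: "indicator {w. (norm w)\<^sup>2 < v} (sqrt v *\<^sub>R w) = (indicator (ball 0 1) w :: ennreal)"
          using True by (auto simp: indicator_def power_mult_distrib power_less_one_iff abs_square_less_1)
        have "sqrt v ^ (2*n) = v ^ n" using True by (simp add: power_mult)
        moreover have "v ^ Suc n = v * v * v ^ (n - 1)" "v ^ n = v * v ^ (n - 1)"
          using n by (cases n; simp)+
        ultimately have "sqrt v ^ (2*n) * (real n * norm (sqrt v *\<^sub>R w) ^ (2*n) * inverse (v ^ Suc n))
           = indicator {0<..} v * (real n * v ^ (n - 1)) * norm w ^ (2*n)"
          using True by (simp add: power_mult_distrib field_simps)
        then have c: "ennreal (sqrt v ^ (2*n)) * ennreal (real n * norm (sqrt v *\<^sub>R w) ^ (2*n) * inverse (v ^ Suc n))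
           = ?c v * ennreal (norm w ^ (2*n))"
          using True by (simp flip: ennreal_mult)
        show "ennreal (sqrt v ^ (2*n)) * (indicator {w. (norm w)\<^sup>2 < v} (sqrt v *\<^sub>R w) * 
            (ennreal (real n * norm (sqrt v *\<^sub>R w) ^ (2*n) * inverse (v ^ Suc n)) * f (sqrt v *\<^sub>R w)))
          = ?c v * ennreal (norm w ^ (2*n)) * (indicator (ball 0 1) w * f (sqrt v *\<^sub>R w))"
          unfolding i c[symmetric] by (simp add: mult_ac)
      qed
      finally show ?thesis by simp
    qed
  qed
  also have "\<dots> = (\<integral>\<^sup>+w. (\<integral>\<^sup>+v. indicator {w. (norm w)\<^sup>2 < v} w * (ennreal (real n * norm w ^ (2*n) * inverse (v ^ Suc n)) * f w) \<partial>lborel) \<partial>lborel)"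
    by (rule lborel_pair.Fubini') (simp add: indicator_def, measurable)
  also have "\<dots> = (\<integral>\<^sup>+w. f w \<partial>lborel)"
  proof (intro nn_integral_cong_AE, use AE_lborel_singleton[of "0::'a"] in eventually_elim)
    fix w :: 'a assume w: "w \<noteq> 0"
    have "(\<integral>\<^sup>+v. indicator {w. (norm w)\<^sup>2 < v} w * (ennreal (real n * norm w ^ (2*n) * inverse (v ^ Suc n)) * f w) \<partial>lborel)
       = (\<integral>\<^sup>+v. ennreal (indicator {(norm w)\<^sup>2..} v * (real n * ((norm w)\<^sup>2) ^ n * inverse (v ^ Suc n))) * f w \<partial>lborel)"
      by (intro nn_integral_cong_AE, use AE_lborel_singleton[of "(norm w)\<^sup>2"] in eventually_elim)
         (auto simp: indicator_def power_mult)
    also have "\<dots> = f w"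
      using w n by (simp add: nn_integral_multc nn_integral_powr_tail del: power_Suc)
    finally show "(\<integral>\<^sup>+v. indicator {w. (norm w)\<^sup>2 < v} w * (ennreal (real n * norm w ^ (2*n) * inverse (v ^ Suc n)) * f w) \<partial>lborel) = f w" .
  qed
  finally show ?thesis ..
qed

section \<open>Radial integrals\<close>

lemma Gamma_integral_nat:
  assumes "0 < m"
  shows "has_bochner_integral lborel (\<lambda>u::real. indicator {0<..} u * (u ^ (m - 1) * exp (- u))) (fact (m - 1))"
proof (rule has_bochner_integral_nn_integral)
  have "(\<integral>\<^sup>+u. ennreal (indicator {0<..} u * (u ^ (m - 1) * exp (- u))) \<partial>lborel)
    = (\<integral>\<^sup>+t. ennreal (indicator {0..} t * t powr (real m - 1) / exp t) \<partial>lborel)"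
    using assms
    by (intro nn_integral_cong_AE, use AE_lborel_singleton[of "0::real"] in eventually_elim)
       (auto simp: indicator_def exp_minus field_simps of_nat_diff simp flip: powr_realpow)
  also have "\<dots> = ennreal (Gamma (real m))"
    using assms by (simp add: Gamma_conv_nn_integral_real)
  also have "Gamma (real m) = fact (m - 1)"
    using assms Gamma_fact[of "m - 1", where 'a=real] by simp
  finally show "(\<integral>\<^sup>+u. ennreal (indicator {0<..} u * (u ^ (m - 1) * exp (- u))) \<partial>lborel) = ennreal (fact (m - 1))" .
qed (auto simp: indicator_def)

lemma nn_integral_radial:
  fixes \<psi> :: "real \<Rightarrow> ennreal"
  assumes dim: "DIM('a::euclidean_space) = 2 * n" and [measurable]: "\<psi> \<in> borel_measurable borel"
  shows "(\<integral>\<^sup>+w. \<psi> ((norm (w::'a))\<^sup>2) \<partial>lborel) =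
    emeasure lborel (ball 0 1 :: 'a set) *
    (\<integral>\<^sup>+u. ennreal (indicator {0<..} u * (real n * u ^ (n - 1))) * \<psi> u \<partial>lborel)"
proof -
  have [measurable]: "ball 0 1 \<in> sets (borel :: 'a measure)" by simp
  let ?c = "\<lambda>u::real. ennreal (indicator {0<..} u * (real n * u ^ (n - 1)))"
  have "(\<integral>\<^sup>+w. \<psi> ((norm (w::'a))\<^sup>2) \<partial>lborel) = (\<integral>\<^sup>+u. (\<integral>\<^sup>+w. ?c u *
        (indicator (ball 0 1) w * \<psi> ((norm (sqrt u *\<^sub>R ((w::'a) /\<^sub>R norm w)))\<^sup>2)) \<partial>lborel) \<partial>lborel)"
    by (rule nn_integral_polar[OF dim]) measurable
  also have "\<dots> = (\<integral>\<^sup>+u. emeasure lborel (ball 0 1 :: 'a set) * (?c u * \<psi> u) \<partial>lborel)"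
  proof (rule nn_integral_cong)
    fix u :: real
    have "(\<integral>\<^sup>+w. ?c u * (indicator (ball 0 1) w * \<psi> ((norm (sqrt u *\<^sub>R ((w::'a) /\<^sub>R norm w)))\<^sup>2)) \<partial>lborel)
       = (\<integral>\<^sup>+w. ?c u * \<psi> u * indicator (ball 0 1 :: 'a set) w \<partial>lborel)"
      by (intro nn_integral_cong_AE, use AE_lborel_singleton[of "0::'a"] in eventually_elim)
         (auto simp: indicator_def mult.assoc)
    also have "\<dots> = emeasure lborel (ball 0 1 :: 'a set) * (?c u * \<psi> u)"
      by (subst nn_integral_cmult) (auto simp: mult_ac)
    finally show "(\<integral>\<^sup>+w. ?c u * (indicator (ball 0 1) w * \<psi> ((norm (sqrt u *\<^sub>R ((w::'a) /\<^sub>R norm w)))\<^sup>2)) \<partial>lborel)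
      = emeasure lborel (ball 0 1 :: 'a set) * (?c u * \<psi> u)" .
  qed
  also have "\<dots> = emeasure lborel (ball 0 1 :: 'a set) * (\<integral>\<^sup>+u. ?c u * \<psi> u \<partial>lborel)"
    by (rule nn_integral_cmult) measurable
  finally show ?thesis .
qed

lemma integrable_radial_iff:
  fixes \<psi> :: "real \<Rightarrow> 'b::{banach, second_countable_topology}"
  assumes dim: "DIM('a::euclidean_space) = 2 * n" and [measurable]: "\<psi> \<in> borel_measurable borel"
  shows "integrable lborel (\<lambda>w::'a. \<psi> ((norm w)\<^sup>2)) \<longleftrightarrow>
    integrable lborel (\<lambda>u. (indicator {0<..} u * u ^ (n - 1)) *\<^sub>R \<psi> u)"
proof -
  have n: "0 < n" using dim DIM_positive[where 'a='a] by simp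
  let ?V = "emeasure lborel (ball 0 1 :: 'a set)"
  let ?I = "\<integral>\<^sup>+u. ennreal (norm ((indicator {0<..} u * u ^ (n - 1)) *\<^sub>R \<psi> u)) \<partial>lborel"
  have "(\<integral>\<^sup>+w. ennreal (norm (\<psi> ((norm (w::'a))\<^sup>2))) \<partial>lborel)
    = ?V * (\<integral>\<^sup>+u. ennreal (indicator {0<..} u * (real n * u ^ (n - 1))) * ennreal (norm (\<psi> u)) \<partial>lborel)"
    by (rule nn_integral_radial[OF dim, of "\<lambda>u. ennreal (norm (\<psi> u))"]) measurable
  also have "(\<integral>\<^sup>+u. ennreal (indicator {0<..} u * (real n * u ^ (n - 1))) * ennreal (norm (\<psi> u)) \<partial>lborel)
     = (\<integral>\<^sup>+u. ennreal (real n) * ennreal (norm ((indicator {0<..} u * u ^ (n - 1)) *\<^sub>R \<psi> u)) \<partial>lborel)"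
    by (intro nn_integral_cong) (auto simp: indicator_def abs_mult power_abs mult_ac simp flip: ennreal_mult)
  also have "\<dots> = ennreal (real n) * ?I"
    by (rule nn_integral_cmult) measurable
  finally have eq: "(\<integral>\<^sup>+w. ennreal (norm (\<psi> ((norm (w::'a))\<^sup>2))) \<partial>lborel) = ?V * (ennreal (real n) * ?I)" .
  have V: "?V \<noteq> 0" "?V < \<infinity>"
    using content_ball_pos[of 1 "0::'a"] emeasure_lborel_ball_finite[of "0::'a" 1] by (auto simp: measure_def)
  have "?V * (ennreal (real n) * ?I) < \<infinity> \<longleftrightarrow> ?I < \<infinity>"
    using V n by (auto simp: ennreal_mult_less_top ennreal_mult_eq_top_iff top.not_eq_extremum[symmetric] infinity_ennreal_def)
  then show ?thesis
    unfolding integrable_iff_bounded eq by (simp del: norm_scaleR)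
qed

lemma integrable_gaussian:
  assumes dim: "DIM('a::euclidean_space) = 2 * n"
  shows "integrable lborel (\<lambda>w::'a. exp (A * norm w - (norm w)\<^sup>2))"
proof (rule Bochner_Integration.integrable_bound)
  have n: "0 < n" using dim DIM_positive[where 'a='a] by simp
  have "integrable lborel (\<lambda>u::real. indicator {0<..} u * (u ^ (n - 1) * exp (- u)))"
    using Gamma_integral_nat[OF n] by (rule has_bochner_integral_iff[THEN iffD1, THEN conjunct1]) 
  then have "integrable lborel (\<lambda>u::real. indicator {0<..} (0 + (1/2) * u) * ((0 + (1/2) * u) ^ (n - 1) * exp (- (0 + (1/2) * u))))"
    by (subst lborel_integrable_real_affine_iff) auto
  then have "integrable lborel (\<lambda>u::real. 2 ^ (n - 1) * (indicator {0<..} (0 + (1/2) * u) * ((0 + (1/2) * u) ^ (n - 1) * exp (- (0 + (1/2) * u)))))"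
    by (rule integrable_mult_right)
  then have "integrable lborel (\<lambda>u::real. (indicator {0<..} u * u ^ (n - 1)) *\<^sub>R exp (- (u / 2)))"
    by (rule Bochner_Integration.integrable_cong[THEN iffD1, rotated -1])
       (auto simp: indicator_def power_mult_distrib power_divide)
  then have "integrable lborel (\<lambda>w::'a. exp (- ((norm w)\<^sup>2 / 2)))"
    by (subst integrable_radial_iff[OF dim, of "\<lambda>u. exp (- (u / 2))"]) auto
  then show "integrable lborel (\<lambda>w::'a. exp (A\<^sup>2 / 2) * exp (- ((norm w)\<^sup>2 / 2)))"
    by (rule integrable_mult_right)
  have "A * norm w - (norm w)\<^sup>2 \<le> A\<^sup>2 / 2 - (norm w)\<^sup>2 / 2" for w :: 'a
    using zero_le_power2[of "A - norm w"] by (simp add: power2_diff)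
  then show "AE w::'a in lborel. norm (exp (A * norm w - (norm w)\<^sup>2)) \<le> norm (exp (A\<^sup>2 / 2) * exp (- ((norm w)\<^sup>2 / 2)))"
    by (simp flip: exp_add)
qed measurable

lemma lborel_polar:
  assumes dim: "DIM('a::euclidean_space) = 2 * n"
  shows "distr (density lborel (\<lambda>u. ennreal (indicator {0<..} u * (real n * u ^ (n - 1)))) \<Otimes>\<^sub>M
            density lborel (\<lambda>w::'a. ennreal (indicator (ball 0 1) w))) borel
          (\<lambda>(u, w). sqrt u *\<^sub>R (w /\<^sub>R norm w)) = lborel"
    (is "distr (?M1 \<Otimes>\<^sub>M ?M2) borel ?\<pi> = lborel")
proof (rule measure_eqI)
  have [measurable]: "ball 0 1 \<in> sets (borel :: 'a measure)" by simp
  interpret M2: sigma_finite_measure ?M2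
    by (subst sigma_finite_measure.sigma_finite_iff_density_finite[OF sigma_finite_lborel]) auto
  have \<pi>[measurable]: "?\<pi> \<in> borel_measurable (?M1 \<Otimes>\<^sub>M ?M2)"
    by measurable
  have sp: "space (?M1 \<Otimes>\<^sub>M ?M2) = UNIV" by (simp add: space_pair_measure)
  fix A assume "A \<in> sets (distr (?M1 \<Otimes>\<^sub>M ?M2) borel ?\<pi>)"
  then have [measurable]: "A \<in> sets borel" by simp
  have "emeasure (distr (?M1 \<Otimes>\<^sub>M ?M2) borel ?\<pi>) A = (\<integral>\<^sup>+z. indicator A z \<partial>distr (?M1 \<Otimes>\<^sub>M ?M2) borel ?\<pi>)"
    by (rule nn_integral_indicator[symmetric]) simp
  also have "\<dots> = (\<integral>\<^sup>+z. indicator A (?\<pi> z) \<partial>(?M1 \<Otimes>\<^sub>M ?M2))"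
    by (rule nn_integral_distr[OF \<pi>]) simp
  also have "\<dots> = (\<integral>\<^sup>+u. (\<integral>\<^sup>+w. indicator A (?\<pi> (u, w)) \<partial>?M2) \<partial>?M1)"
    by (rule M2.nn_integral_fst[symmetric]) measurable
  also have "\<dots> = (\<integral>\<^sup>+u. (\<integral>\<^sup>+w. ennreal (indicator {0<..} u * (real n * u ^ (n - 1))) *
        (indicator (ball 0 1) w * indicator A (sqrt u *\<^sub>R (w /\<^sub>R norm w))) \<partial>lborel) \<partial>lborel)"
    by (simp add: nn_integral_density nn_integral_cmult ennreal_indicator)
  also have "\<dots> = (\<integral>\<^sup>+w. indicator A w \<partial>lborel)"
    by (rule nn_integral_polar[OF dim, symmetric]) measurable
  also have "\<dots> = emeasure lborel A"
    by simp
  finally show "emeasure (distr (?M1 \<Otimes>\<^sub>M ?M2) borel ?\<pi>) A = emeasure lborel A" .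
qed simp

text \<open>A factor that is homogeneous of even degree separates from the radial factor. This is how Gaussian integrals over the whole space and weighted integrals over the ball are compared: only the second factor on the right depends on the weight.\<close>

lemma integral_polar_homogeneous:
  fixes H :: "'a::euclidean_space \<Rightarrow> complex" and \<phi> :: "real \<Rightarrow> complex"
  assumes dim: "DIM('a) = 2 * n"
    and [measurable]: "H \<in> borel_measurable borel" "\<phi> \<in> borel_measurable borel"
    and hom: "\<And>t w. 0 < t \<Longrightarrow> H (t *\<^sub>R w) = of_real (t ^ (2 * k)) * H w"
    and int: "integrable lborel (\<lambda>w. H w * \<phi> ((norm w)\<^sup>2))"
  shows "(\<integral>w. H w * \<phi> ((norm w)\<^sup>2) \<partial>lborel) =
    of_nat n * (\<integral>w. indicator (ball 0 1) w * H (w /\<^sub>R norm w) \<partial>lborel) *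
    (\<integral>u. indicator {0<..} u * (of_real u ^ (n + k - 1) * \<phi> u) \<partial>lborel)"
proof -
  have n: "0 < n" using dim DIM_positive[where 'a='a] by simp
  have [measurable]: "ball 0 1 \<in> sets (borel :: 'a measure)" by simp
  define M1 where "M1 = density lborel (\<lambda>u. ennreal (indicator {0<..} u * (real n * u ^ (n - 1))))"
  define M2 where "M2 = density lborel (\<lambda>w::'a. ennreal (indicator (ball 0 1) w))"
  define \<pi> where "\<pi> = (\<lambda>(u, w::'a). sqrt u *\<^sub>R (w /\<^sub>R norm w))"
  have [measurable_cong]: "sets M1 = sets borel" "sets M2 = sets borel"
    by (simp_all add: M1_def M2_def)
  have polar: "distr (M1 \<Otimes>\<^sub>M M2) borel \<pi> = lborel"
    unfolding M1_def M2_def \<pi>_def by (rule lborel_polar[OF dim])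
  have [measurable]: "\<pi> \<in> borel_measurable (M1 \<Otimes>\<^sub>M M2)"
    unfolding \<pi>_def by measurable
  interpret M1: sigma_finite_measure M1
    unfolding M1_def by (subst sigma_finite_measure.sigma_finite_iff_density_finite[OF sigma_finite_lborel]) auto
  interpret M2: sigma_finite_measure M2
    unfolding M2_def by (subst sigma_finite_measure.sigma_finite_iff_density_finite[OF sigma_finite_lborel]) auto
  interpret pair_sigma_finite M1 M2 ..
  let ?f = "\<lambda>w::'a. H w * \<phi> ((norm w)\<^sup>2)"
  have f[measurable]: "?f \<in> borel_measurable borel" by measurable
  have int': "integrable (M1 \<Otimes>\<^sub>M M2) (\<lambda>z. ?f (\<pi> z))"
    using int by (subst (asm) polar[symmetric], subst (asm) integrable_distr_eq) auto
  have "(\<integral>w. ?f w \<partial>lborel) = (\<integral>z. ?f (\<pi> z) \<partial>(M1 \<Otimes>\<^sub>M M2))"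
    by (subst polar[symmetric], subst integral_distr) auto
  also have "\<dots> = (\<integral>u. (\<integral>w. ?f (\<pi> (u, w)) \<partial>M2) \<partial>M1)"
    by (rule integral_fst'[OF int', symmetric])
  also have "\<dots> = (\<integral>u. indicator {0<..} u * (of_real u ^ k * \<phi> u) * (\<integral>w. H (w /\<^sub>R norm w) \<partial>M2) \<partial>M1)"
  proof (rule integral_cong_AE)
    have "AE u in M1. 0 < u"
      unfolding M1_def by (subst AE_density) (auto simp: indicator_def intro!: AE_I2)
    then show "AE u in M1. (\<integral>w. ?f (\<pi> (u, w)) \<partial>M2) = 
        indicator {0<..} u * (of_real u ^ k * \<phi> u) * (\<integral>w. H (w /\<^sub>R norm w) \<partial>M2)"
    proof eventually_elim
      fix u :: real assume u: "0 < u"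
      have "(\<integral>w. ?f (\<pi> (u, w)) \<partial>M2) = (\<integral>w. (of_real u ^ k * \<phi> u) * H (w /\<^sub>R norm w) \<partial>M2)"
      proof (rule integral_cong_AE)
        have "AE w in M2. w \<noteq> 0"
          unfolding M2_def by (subst AE_density) (use AE_lborel_singleton[of "0::'a"] in auto)
        then show "AE w in M2. ?f (\<pi> (u, w)) = (of_real u ^ k * \<phi> u) * H (w /\<^sub>R norm w)"
        proof eventually_elim
          fix w :: 'a assume "w \<noteq> 0"
          then have "(norm (\<pi> (u, w)))\<^sup>2 = u"
            using u by (simp add: \<pi>_def mult.assoc)
          moreover have "H (\<pi> (u, w)) = of_real u ^ k * H (w /\<^sub>R norm w)"
            using u hom[of "sqrt u" "w /\<^sub>R norm w"] by (simp add: \<pi>_def power_mult flip: of_real_power)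
          ultimately show "?f (\<pi> (u, w)) = (of_real u ^ k * \<phi> u) * H (w /\<^sub>R norm w)"
            by simp
        qed
      qed (auto simp: \<pi>_def)
      then show "(\<integral>w. ?f (\<pi> (u, w)) \<partial>M2) = 
        indicator {0<..} u * (of_real u ^ k * \<phi> u) * (\<integral>w. H (w /\<^sub>R norm w) \<partial>M2)"
        using u by simp
    qed
  qed measurable
  also have "\<dots> = (\<integral>u. indicator {0<..} u * (of_real u ^ k * \<phi> u) \<partial>M1) * (\<integral>w. H (w /\<^sub>R norm w) \<partial>M2)"
    by simp
  also have "(\<integral>u. indicator {0<..} u * (of_real u ^ k * \<phi> u) \<partial>M1)
     = (\<integral>u. of_nat n * (indicator {0<..} u * (of_real u ^ (n + k - 1) * \<phi> u)) \<partial>lborel)"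
    unfolding M1_def using n
    by (subst integral_density)
       (auto simp: indicator_def scaleR_conv_of_real power_add[symmetric] mult_ac add.commute[of k n] Nat.add_diff_assoc2
         intro!: Bochner_Integration.integral_cong AE_I2)
  also have "\<dots> = of_nat n * (\<integral>u. indicator {0<..} u * (of_real u ^ (n + k - 1) * \<phi> u) \<partial>lborel)"
    by simp
  also have "(\<integral>w. H (w /\<^sub>R norm w) \<partial>M2) = (\<integral>w. indicator (ball 0 1) w * H (w /\<^sub>R norm w) \<partial>lborel)"
    unfolding M2_def
    by (subst integral_density)
       (auto simp: indicator_def scaleR_conv_of_real intro!: Bochner_Integration.integral_cong AE_I2)
  finally show ?thesis by (simp add: mult_ac)
qed

lemma norm_vector_smult [simp]: "norm (c *s (z :: complex ^ 'n)) = norm c * norm z"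
  by (simp add: norm_vec_def L2_set_def norm_mult power_mult_distrib flip: sum_distrib_left)
     (simp add: real_sqrt_mult)

lemma DIM_complex_vec: "DIM(complex ^ 'n) = 2 * CARD('n::finite)"
  by simp

lemma linear_vector_smult: "linear ((*s) c :: complex ^ 'n \<Rightarrow> complex ^ 'n)"
  by (intro linearI) (simp_all add: vec_eq_iff scaleR_conv_of_real algebra_simps)

lemma integral_rotation:
  fixes H :: "complex ^ 'n \<Rightarrow> complex"
  assumes [measurable]: "H \<in> borel_measurable borel" and "norm \<omega> = 1"
  shows "(\<integral>w. H (\<omega> *s w) \<partial>lborel) = (\<integral>w. H w \<partial>lborel)"
proof -
  have [measurable]: "(*s) \<omega> \<in> borel_measurable (borel :: (complex ^ 'n) measure)"
    by (intro borel_measurable_continuous_onI linear_continuous_on)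
       (simp add: linear_vector_smult linear_conv_bounded_linear[symmetric])
  have "distr lborel borel ((*s) \<omega>) = (lborel :: (complex ^ 'n) measure)"
    using assms by (intro lborel_distr_linear_isometry linear_vector_smult) simp
  then show ?thesis
    using integral_distr[of "(*s) \<omega>" lborel borel H] by simp
qed

lemma integral_rotation_eq_0:
  fixes H :: "complex ^ 'n \<Rightarrow> complex"
  assumes H: "H \<in> borel_measurable borel" and "i \<noteq> j"
    and rot: "\<And>\<omega> w. norm \<omega> = 1 \<Longrightarrow> H (\<omega> *s w) = \<omega> ^ i * cnj \<omega> ^ j * H w"
  shows "(\<integral>w. H w \<partial>lborel) = 0"
proof -
  define \<theta> where "\<theta> = pi / (real i - real j)"
  have "(real i - real j) * \<theta> = pi"
    using \<open>i \<noteq> j\<close> by (simp add: \<theta>_def)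
  then have "real i * \<theta> - real j * \<theta> = pi"
    by (simp add: left_diff_distrib)
  then have "cis \<theta> ^ i * cnj (cis \<theta>) ^ j = -1"
    by (simp add: cis_cnj Complex.DeMoivre cis_mult)
  then have "(\<integral>w. H w \<partial>lborel) = (\<integral>w. - H w \<partial>lborel)"
    using rot[of "cis \<theta>"] integral_rotation[OF H, of "cis \<theta>"] by simp
  then show ?thesis by simp
qed

section \<open>The Hermitian pairing, monomials and complex lines\<close>

definition cip :: "complex ^ 'n \<Rightarrow> complex ^ 'n \<Rightarrow> complex" where
  "cip z w = (\<Sum>i\<in>UNIV. z $ i * cnj (w $ i))"

definition mon :: "('n \<Rightarrow> nat) \<Rightarrow> complex ^ 'n \<Rightarrow> complex" where
  "mon m z = (\<Prod>i\<in>UNIV. (z $ i) ^ m i)"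

lemma cip_smult_left [simp]: "cip (c *s z) w = c * cip z w"
  by (simp add: cip_def sum_distrib_left mult_ac)

lemma cip_smult_right [simp]: "cip z (c *s w) = cnj c * cip z w"
  by (simp add: cip_def sum_distrib_left mult_ac)

lemma cip_scaleR_left [simp]: "cip (r *\<^sub>R z) w = of_real r * cip z w"
  by (simp add: cip_def sum_distrib_left) (simp add: scaleR_conv_of_real mult_ac)

lemma cip_scaleR_right [simp]: "cip z (r *\<^sub>R w) = of_real r * cip z w"
  by (simp add: cip_def sum_distrib_left) (simp add: scaleR_conv_of_real mult_ac)

lemma cip_add_left: "cip (z + z') w = cip z w + cip z' w"
  by (simp add: cip_def sum.distrib algebra_simps)

lemma cip_add_right: "cip z (w + w') = cip z w + cip z w'"
  by (simp add: cip_def sum.distrib algebra_simps)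

lemma cnj_cip: "cnj (cip z w) = cip w z"
  by (simp add: cip_def mult_ac)

lemma cip_zero [simp]: "cip 0 w = 0" "cip w 0 = 0"
  by (simp_all add: cip_def)

lemma cip_self: "cip z z = of_real ((norm z)\<^sup>2)"
proof -
  have "(norm z)\<^sup>2 = (\<Sum>i\<in>UNIV. (norm (z $ i))\<^sup>2)"
    by (simp add: norm_vec_def L2_set_def sum_nonneg)
  then show ?thesis
    by (simp add: cip_def complex_norm_square del: of_real_power)
qed

lemma norm_cip_le: "norm (cip z w) \<le> norm z * norm w"
proof -
  have "norm (cip z w) \<le> (\<Sum>i\<in>UNIV. norm (z $ i * cnj (w $ i)))"
    unfolding cip_def by (rule norm_sum)
  also have "\<dots> = (\<Sum>i\<in>UNIV. \<bar>norm (z $ i)\<bar> * \<bar>norm (w $ i)\<bar>)"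
    by (simp add: norm_mult)
  also have "\<dots> \<le> norm z * norm w"
    unfolding norm_vec_def by (rule L2_set_mult_ineq)
  finally show ?thesis .
qed

lemma continuous_on_cip [continuous_intros]:
  "continuous_on S f \<Longrightarrow> continuous_on S g \<Longrightarrow> continuous_on S (\<lambda>x. cip (f x) (g x))"
  unfolding cip_def by (intro continuous_intros)

lemma continuous_on_smult [continuous_intros]:
  "continuous_on S f \<Longrightarrow> continuous_on S g \<Longrightarrow> continuous_on S (\<lambda>x. f x *s (g x :: complex ^ 'n))"
  unfolding vector_scalar_mult_def by (intro continuous_intros)

lemma borel_measurable_cip_left [measurable]: "(\<lambda>z. cip z w) \<in> borel_measurable borel"
  by (intro borel_measurable_continuous_onI continuous_intros)

lemma borel_measurable_cip_right [measurable]: "cip z \<in> borel_measurable borel"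
  by (intro borel_measurable_continuous_onI continuous_intros)

lemma borel_measurable_cip_pair [measurable]:
  "(\<lambda>x. cip (fst x) (snd x)) \<in> borel_measurable (borel \<Otimes>\<^sub>M borel)"
  unfolding borel_prod by (intro borel_measurable_continuous_onI continuous_intros)

lemma continuous_on_mon [continuous_intros]:
  "continuous_on S f \<Longrightarrow> continuous_on S (\<lambda>x. mon m (f x))"
  unfolding mon_def by (intro continuous_intros)

lemma borel_measurable_mon [measurable]: "mon m \<in> borel_measurable borel"
  by (intro borel_measurable_continuous_onI continuous_intros)

lemma finite_multiindices: "finite {m :: 'n::finite \<Rightarrow> nat. (\<Sum>i\<in>UNIV. m i) = k}"
proof (rule finite_subset)
  show "{m :: 'n \<Rightarrow> nat. (\<Sum>i\<in>UNIV. m i) = k} \<subseteq> (UNIV \<rightarrow>\<^sub>E {..k})"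
  proof
    fix m :: "'n \<Rightarrow> nat" assume "m \<in> {m. (\<Sum>i\<in>UNIV. m i) = k}"
    then have "m i \<le> k" for i using member_le_sum[of i UNIV m] by simp
    then show "m \<in> UNIV \<rightarrow>\<^sub>E {..k}" by (simp add: PiE_iff)
  qed
  show "finite ((UNIV :: 'n set) \<rightarrow>\<^sub>E {..k})" by (rule finite_PiE) auto
qed

lemma norm_mon_le: "(\<Sum>i\<in>UNIV. m i) = k \<Longrightarrow> norm (mon m z) \<le> norm z ^ k"
proof -
  assume "(\<Sum>i\<in>UNIV. m i) = k"
  then have "norm z ^ k = (\<Prod>i\<in>UNIV. norm z ^ m i)"
    by (simp flip: power_sum)
  moreover have "norm (mon m z) \<le> (\<Prod>i\<in>UNIV. norm z ^ m i)"
    unfolding mon_def prod_norm[symmetric] norm_power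
    by (intro prod_mono conjI power_mono Finite_Cartesian_Product.norm_nth_le zero_le_power norm_ge_zero)
  ultimately show ?thesis by simp
qed

text \<open>The kernel \<open>cip z w ^ k\<close> separates into monomials in \<open>z\<close> and \<open>w\<close>. An integral against it is therefore a homogeneous polynomial, and a linear functional applied to it is a finite sum.\<close>

lemma cip_power_multinomial:
  "\<exists>c :: ('n::finite \<Rightarrow> nat) \<Rightarrow> nat. \<forall>z w :: complex ^ 'n.
     cip z w ^ k = (\<Sum>m | (\<Sum>i\<in>UNIV. m i) = k. of_nat (c m) * mon m z * cnj (mon m w))"
proof -
  define S where "S = ({..<k} \<rightarrow>\<^sub>E (UNIV :: 'n set))"
  define cnt where "cnt = (\<lambda>s i. card {j\<in>{..<k}. s j = (i::'n)})"
  have finS: "finite S" unfolding S_def by (intro finite_PiE) auto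
  have cnt: "(\<Sum>i\<in>UNIV. cnt s i) = k" for s :: "nat \<Rightarrow> 'n"
  proof -
    have "(\<Sum>i\<in>UNIV. cnt s i) = (\<Sum>i\<in>UNIV. \<Sum>j | j\<in>{..<k} \<and> s j = i. 1)"
      by (simp add: cnt_def)
    also have "\<dots> = (\<Sum>j\<in>{..<k}. 1)"
      by (rule sum.group) auto
    finally show ?thesis by simp
  qed
  have prod: "(\<Prod>j<k. x (s j)) = (\<Prod>i\<in>UNIV. x i ^ cnt s i)" for x :: "'n \<Rightarrow> complex" and s
  proof -
    have "(\<Prod>i\<in>UNIV. x i ^ cnt s i) = (\<Prod>i\<in>UNIV. \<Prod>j | j\<in>{..<k} \<and> s j = i. x (s j))"
      by (intro prod.cong refl) (simp add: cnt_def)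
    also have "\<dots> = (\<Prod>j\<in>{..<k}. x (s j))"
      by (rule prod.group) auto
    finally show ?thesis ..
  qed
  have "cip z w ^ k = (\<Sum>m | (\<Sum>i\<in>UNIV. m i) = k. of_nat (card {s\<in>S. cnt s = m}) * mon m z * cnj (mon m w))"
    for z w :: "complex ^ 'n"
  proof -
    have "cip z w ^ k = (\<Prod>j<k. \<Sum>i\<in>UNIV. z $ i * cnj (w $ i))"
      by (simp add: cip_def)
    also have "\<dots> = (\<Sum>s\<in>S. \<Prod>j<k. z $ s j * cnj (w $ s j))"
      unfolding S_def by (rule prod_sum_PiE) auto
    also have "\<dots> = (\<Sum>s\<in>S. mon (cnt s) z * cnj (mon (cnt s) w))"
      using prod[of "\<lambda>i. z $ i * cnj (w $ i)"]
      by (simp add: mon_def prod.distrib power_mult_distrib)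
    also have "\<dots> = (\<Sum>m | (\<Sum>i\<in>UNIV. m i) = k. \<Sum>s | s \<in> S \<and> cnt s = m. mon (cnt s) z * cnj (mon (cnt s) w))"
      by (rule sum.group[symmetric]) (use finS finite_multiindices cnt in auto)
    also have "\<dots> = (\<Sum>m | (\<Sum>i\<in>UNIV. m i) = k. of_nat (card {s\<in>S. cnt s = m}) * mon m z * cnj (mon m w))"
      by (intro sum.cong refl) (simp add: mult.assoc)
    finally show ?thesis .
  qed
  then show ?thesis by (intro exI[of _ "\<lambda>m. card {s\<in>S. cnt s = m}"] allI)
qed

lemma homogeneous_poly_mon: "homogeneous_poly k h \<longleftrightarrow>
  (\<exists>a. \<forall>z. h z = (\<Sum>m | (\<Sum>i\<in>UNIV. m i) = k. a m * mon m z))"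
  by (simp add: homogeneous_poly_def mon_def)

lemma mon_smult: "(\<Sum>i\<in>UNIV. m i) = k \<Longrightarrow> mon m (c *s z) = c ^ k * mon m z"
  by (auto simp: mon_def power_mult_distrib prod.distrib simp flip: power_sum)

lemma homogeneous_poly_smult: "homogeneous_poly k h \<Longrightarrow> h (c *s z) = c ^ k * h z"
  by (auto simp: homogeneous_poly_mon mon_smult sum_distrib_left mult_ac intro!: sum.cong)

lemma homogeneous_poly_mult: "homogeneous_poly k h \<Longrightarrow> homogeneous_poly k (\<lambda>z. c * h z)"
  unfolding homogeneous_poly_mon
  by (elim exE, rename_tac a, rule_tac x="\<lambda>m. c * a m" in exI) (simp add: sum_distrib_left mult_ac)

lemma homogeneous_poly_add: "homogeneous_poly k h \<Longrightarrow> homogeneous_poly k g \<Longrightarrow> homogeneous_poly k (\<lambda>z. h z + g z)"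
  unfolding homogeneous_poly_mon
  by (elim exE, rename_tac a b, rule_tac x="\<lambda>m. a m + b m" in exI) (simp add: sum.distrib algebra_simps)

lemma continuous_on_homogeneous_poly: "homogeneous_poly k h \<Longrightarrow> continuous_on S h"
proof -
  assume "homogeneous_poly k h"
  then obtain a where "h = (\<lambda>z. \<Sum>m | (\<Sum>i\<in>UNIV. m i) = k. a m * mon m z)"
    unfolding homogeneous_poly_mon by blast
  then show ?thesis by (auto intro!: continuous_intros)
qed

lemma borel_measurable_cnj [measurable (raw)]:
  "f \<in> borel_measurable M \<Longrightarrow> (\<lambda>x. cnj (f x)) \<in> borel_measurable M"
  by (rule measurable_compose[where g=cnj]) (auto intro!: borel_measurable_continuous_onI continuous_intros)

lemma homogeneous_poly_cip_expand:
  assumes c: "\<And>z w :: complex ^ 'n. cip z w ^ k = (\<Sum>m | (\<Sum>i\<in>UNIV. m i) = k. of_nat (c m) * mon m z * cnj (mon m w))"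
    and [measurable]: "H \<in> borel_measurable M" "T \<in> M \<rightarrow>\<^sub>M (borel :: (complex ^ 'n) measure)"
    and int: "integrable M (\<lambda>x. norm (H x) * norm (T x) ^ k)"
  shows "integrable M (\<lambda>x. H x * cip z (T x) ^ k)"
    and "\<And>m. (\<Sum>i\<in>UNIV. m i) = k \<Longrightarrow> integrable M (\<lambda>x. H x * cnj (mon m (T x)))"
    and "(LINT x|M. H x * cip z (T x) ^ k) =
      (\<Sum>m | (\<Sum>i\<in>UNIV. m i) = k. of_nat (c m) * (LINT x|M. H x * cnj (mon m (T x))) * mon m z)"
proof -
  show 1: "integrable M (\<lambda>x. H x * cnj (mon m (T x)))" if "(\<Sum>i\<in>UNIV. m i) = k" for m
    by (rule Bochner_Integration.integrable_bound[OF int])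
       (auto simp: norm_mult intro!: mult_left_mono norm_mon_le that)
  have eq: "H x * cip z (T x) ^ k = (\<Sum>m | (\<Sum>i\<in>UNIV. m i) = k. (of_nat (c m) * mon m z) * (H x * cnj (mon m (T x))))" for x
    unfolding c by (simp add: sum_distrib_left mult_ac)
  show "integrable M (\<lambda>x. H x * cip z (T x) ^ k)"
    unfolding eq by (intro Bochner_Integration.integrable_sum integrable_mult_right 1) auto
  have "(LINT x|M. H x * cip z (T x) ^ k) = (\<Sum>m | (\<Sum>i\<in>UNIV. m i) = k. LINT x|M. (of_nat (c m) * mon m z) * (H x * cnj (mon m (T x))))"
    unfolding eq by (intro Bochner_Integration.integral_sum integrable_mult_right 1) auto
  also have "\<dots> = (\<Sum>m | (\<Sum>i\<in>UNIV. m i) = k. of_nat (c m) * (LINT x|M. H x * cnj (mon m (T x))) * mon m z)"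
    by (intro sum.cong refl) (subst integral_mult_right_zero, simp only: mult_ac)
  finally show "(LINT x|M. H x * cip z (T x) ^ k) =
      (\<Sum>m | (\<Sum>i\<in>UNIV. m i) = k. of_nat (c m) * (LINT x|M. H x * cnj (mon m (T x))) * mon m z)" .
qed

lemma homogeneous_poly_integral_cip:
  assumes "H \<in> borel_measurable M" "T \<in> M \<rightarrow>\<^sub>M (borel :: (complex ^ 'n) measure)"
    and "integrable M (\<lambda>x. norm (H x) * norm (T x) ^ k)"
  shows "homogeneous_poly k (\<lambda>z. LINT x|M. H x * cip z (T x) ^ k)"
proof -
  obtain c :: "('n \<Rightarrow> nat) \<Rightarrow> nat" where c: "\<And>z w. cip z w ^ k = (\<Sum>m | (\<Sum>i\<in>UNIV. m i) = k. of_nat (c m) * mon m z * cnj (mon m w))"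
    using cip_power_multinomial[where 'n='n] by blast
  show ?thesis
    unfolding homogeneous_poly_mon homogeneous_poly_cip_expand(3)[OF c assms]
    by (rule exI[of _ "\<lambda>m. of_nat (c m) * (LINT x|M. H x * cnj (mon m (T x)))"]) simp
qed

definition cdiff_at :: "(complex ^ 'n \<Rightarrow> complex) \<Rightarrow> complex ^ 'n \<Rightarrow> bool" where
  "cdiff_at f z \<longleftrightarrow> (\<exists>D. (f has_derivative D) (at z) \<and> (\<forall>c v. D (c *s v) = c * D v))"

lemma cdiff_at_const: "cdiff_at (\<lambda>_. c) z"
  unfolding cdiff_at_def by (rule exI[of _ "\<lambda>_. 0"]) simp

lemma cdiff_at_nth: "cdiff_at (\<lambda>z. z $ i) z"
  unfolding cdiff_at_def
  by (rule exI[of _ "\<lambda>v. v $ i"]) (auto intro: bounded_linear_imp_has_derivative)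

lemma cdiff_at_add: "cdiff_at f z \<Longrightarrow> cdiff_at g z \<Longrightarrow> cdiff_at (\<lambda>z. f z + g z) z"
  unfolding cdiff_at_def
  by (elim exE conjE, rename_tac D E, rule_tac x="\<lambda>v. D v + E v" in exI)
     (auto intro: has_derivative_add simp: algebra_simps)

lemma cdiff_at_mult: "cdiff_at f z \<Longrightarrow> cdiff_at g z \<Longrightarrow> cdiff_at (\<lambda>z. f z * g z) z"
  unfolding cdiff_at_def
  by (elim exE conjE, rename_tac D E, rule_tac x="\<lambda>v. f z * E v + D v * g z" in exI)
     (intro conjI, rule has_derivative_mult, assumption, assumption, simp add: algebra_simps)

lemma cdiff_at_power: "cdiff_at f z \<Longrightarrow> cdiff_at (\<lambda>z. f z ^ k) z"
  by (induction k) (auto intro: cdiff_at_const cdiff_at_mult)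

lemma cdiff_at_prod: "(\<And>i. i \<in> I \<Longrightarrow> cdiff_at (f i) z) \<Longrightarrow> cdiff_at (\<lambda>z. \<Prod>i\<in>I. f i z) z"
  by (induction I rule: infinite_finite_induct) (auto intro: cdiff_at_const cdiff_at_mult)

lemma cdiff_at_sum: "(\<And>i. i \<in> I \<Longrightarrow> cdiff_at (f i) z) \<Longrightarrow> cdiff_at (\<lambda>z. \<Sum>i\<in>I. f i z) z"
  by (induction I rule: infinite_finite_induct) (auto intro: cdiff_at_const cdiff_at_add)

lemma cdiff_at_homogeneous_poly: "homogeneous_poly k h \<Longrightarrow> cdiff_at h z"
proof -
  assume "homogeneous_poly k h"
  then obtain a where "\<And>z. h z = (\<Sum>m | (\<Sum>i\<in>UNIV. m i) = k. a m * mon m z)"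
    unfolding homogeneous_poly_mon by blast
  then have "h = (\<lambda>z. \<Sum>m | (\<Sum>i\<in>UNIV. m i) = k. a m * (\<Prod>i\<in>UNIV. (z $ i) ^ m i))"
    by (auto simp: mon_def)
  then show ?thesis
    by (auto intro!: cdiff_at_sum cdiff_at_mult cdiff_at_prod cdiff_at_power cdiff_at_const cdiff_at_nth)
qed

lemma has_field_derivative_line:
  assumes D: "(f has_derivative D) (at (z + \<mu>0 *s u))" and lin: "\<And>c v. D (c *s v) = c * D (v :: complex ^ 'n)"
  shows "((\<lambda>\<mu>. f (z + \<mu> *s u)) has_field_derivative D u) (at \<mu>0)"
proof -
  have "((\<lambda>\<mu>. z + \<mu> *s u) has_derivative (\<lambda>h. h *s u)) (at \<mu>0)"
  proof -
    have "bounded_linear (\<lambda>h. h *s u)"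
      by (intro linear_conv_bounded_linear[THEN iffD1] linearI)
         (simp add: vec_eq_iff algebra_simps, simp add: vec_eq_iff)
    then have "((\<lambda>h. h *s u) has_derivative (\<lambda>h. h *s u)) (at \<mu>0)"
      by (rule bounded_linear_imp_has_derivative)
    then show ?thesis by (auto intro!: derivative_eq_intros)
  qed
  from diff_chain_at[OF this D] have "((\<lambda>\<mu>. f (z + \<mu> *s u)) has_derivative (\<lambda>h. D (h *s u))) (at \<mu>0)"
    by (simp add: o_def)
  then show ?thesis
    unfolding has_field_derivative_def lin by (simp add: mult.commute[of "D u"] mult_commute_abs)
qed

text \<open>A several-variable holomorphy that can be checked with one complex variable at a time. It is stable under limits and restrictions to slices, and it suffices for everything up to the expansion into homogeneous polynomials.\<close>

definition line_holomorphic :: "real \<Rightarrow> (complex ^ 'n \<Rightarrow> complex) \<Rightarrow> bool" where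
  "line_holomorphic R f \<longleftrightarrow> continuous_on (ball 0 R) f \<and>
     (\<forall>z\<in>ball 0 R. \<forall>u. (\<lambda>\<mu>. f (z + \<mu> *s u)) field_differentiable (at 0))"

lemma line_holomorphic_cdiff: "(\<And>z. z \<in> ball 0 R \<Longrightarrow> cdiff_at f z) \<Longrightarrow> line_holomorphic R f"
  unfolding line_holomorphic_def
proof (intro conjI ballI allI)
  assume f: "\<And>z. z \<in> ball 0 R \<Longrightarrow> cdiff_at f z"
  show "continuous_on (ball 0 R) f"
    using f unfolding cdiff_at_def
    by (intro continuous_at_imp_continuous_on ballI) (blast intro: has_derivative_continuous)
  fix z u :: "complex ^ 'a" assume "z \<in> ball 0 R"
  from f[OF this] obtain D where "(f has_derivative D) (at z)" "\<And>c v. D (c *s v) = c * D v"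
    unfolding cdiff_at_def by blast
  then show "(\<lambda>\<mu>. f (z + \<mu> *s u)) field_differentiable (at 0)"
    using has_field_derivative_line[of f D z 0 u] unfolding field_differentiable_def by auto
qed

lemma line_holomorphic_on_line:
  assumes "line_holomorphic R f"
  shows "(\<lambda>\<mu>. f (z + \<mu> *s u)) holomorphic_on {\<mu>. z + \<mu> *s u \<in> ball 0 R}"
    and "open {\<mu>. z + \<mu> *s u \<in> ball 0 R}"
proof -
  have "continuous_on UNIV (\<lambda>\<mu>. z + \<mu> *s u)" by (intro continuous_intros)
  then have "open ((\<lambda>\<mu>. z + \<mu> *s u) -` ball 0 R)"
    by (rule open_vimage[rotated]) simp
  then show o: "open {\<mu>. z + \<mu> *s u \<in> ball 0 R}" by (simp add: vimage_def)
  show "(\<lambda>\<mu>. f (z + \<mu> *s u)) holomorphic_on {\<mu>. z + \<mu> *s u \<in> ball 0 R}"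
    unfolding holomorphic_on_def
  proof
    fix \<mu>0 assume "\<mu>0 \<in> {\<mu>. z + \<mu> *s u \<in> ball 0 R}"
    then have "(\<lambda>\<mu>. f ((z + \<mu>0 *s u) + \<mu> *s u)) field_differentiable (at 0)"
      using assms unfolding line_holomorphic_def by blast
    then obtain d where "((\<lambda>\<mu>. f ((z + \<mu>0 *s u) + \<mu> *s u)) has_field_derivative d) (at (\<mu>0 - \<mu>0))"
      unfolding field_differentiable_def by auto
    then have "((\<lambda>\<mu>. f ((z + \<mu>0 *s u) + (\<mu> - \<mu>0) *s u)) has_field_derivative d * 1) (at \<mu>0)"
      by (rule DERIV_chain2) (auto intro!: derivative_eq_intros)
    moreover have "(\<lambda>\<mu>. f ((z + \<mu>0 *s u) + (\<mu> - \<mu>0) *s u)) = (\<lambda>\<mu>. f (z + \<mu> *s u))"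
      by (simp add: vec_eq_iff algebra_simps vector_sub_rdistrib)
    ultimately show "(\<lambda>\<mu>. f (z + \<mu> *s u)) field_differentiable at \<mu>0 within {\<mu>. z + \<mu> *s u \<in> ball 0 R}"
      unfolding field_differentiable_def by (auto intro: has_field_derivative_at_within)
  qed
qed

lemma line_holomorphic_const: "line_holomorphic R (\<lambda>_. c)"
  by (intro line_holomorphic_cdiff cdiff_at_const)

lemma line_holomorphic_add: "line_holomorphic R f \<Longrightarrow> line_holomorphic R g \<Longrightarrow> line_holomorphic R (\<lambda>z. f z + g z)"
  unfolding line_holomorphic_def by (auto intro!: continuous_intros field_differentiable_add)

lemma line_holomorphic_diff: "line_holomorphic R f \<Longrightarrow> line_holomorphic R g \<Longrightarrow> line_holomorphic R (\<lambda>z. f z - g z)"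
  unfolding line_holomorphic_def by (auto intro!: continuous_intros field_differentiable_diff)

lemma line_holomorphic_mult: "line_holomorphic R f \<Longrightarrow> line_holomorphic R g \<Longrightarrow> line_holomorphic R (\<lambda>z. f z * g z)"
  unfolding line_holomorphic_def by (auto intro!: continuous_intros field_differentiable_mult)

lemma line_holomorphic_sum: "(\<And>i. i \<in> I \<Longrightarrow> line_holomorphic R (f i)) \<Longrightarrow> line_holomorphic R (\<lambda>z. \<Sum>i\<in>I. f i z)"
  by (induction I rule: infinite_finite_induct) (auto intro: line_holomorphic_const line_holomorphic_add)

lemma line_holomorphic_affine:
  assumes f: "line_holomorphic R f" and R: "\<And>z. norm z < R' \<Longrightarrow> norm (a + c *s z) < R"
  shows "line_holomorphic R' (\<lambda>z. f (a + c *s z))"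
  unfolding line_holomorphic_def
proof (intro conjI ballI allI)
  show "continuous_on (ball 0 R') (\<lambda>z. f (a + c *s z))"
  proof (rule continuous_on_compose2[where g=f and t="ball 0 R"])
    show "continuous_on (ball 0 R) f" using f unfolding line_holomorphic_def by blast
    show "continuous_on (ball 0 R') (\<lambda>z. a + c *s z)" by (intro continuous_intros)
    show "(\<lambda>z. a + c *s z) ` ball 0 R' \<subseteq> ball 0 R"
    proof
      fix x assume "x \<in> (\<lambda>z. a + c *s z) ` ball 0 R'"
      then obtain z where "x = a + c *s z" "z \<in> ball 0 R'" by blast
      with R[of z] show "x \<in> ball 0 R" by simp
    qed
  qed
  fix z u :: "complex ^ 'a" assume "z \<in> ball 0 R'"
  with R[of z] have "a + c *s z \<in> ball 0 R" by simp
  then have "(\<lambda>\<mu>. f ((a + c *s z) + \<mu> *s (c *s u))) field_differentiable (at 0)"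
    using f unfolding line_holomorphic_def by blast
  moreover have "(\<lambda>\<mu>. f ((a + c *s z) + \<mu> *s (c *s u))) = (\<lambda>\<mu>. f (a + c *s (z + \<mu> *s u)))"
    by (simp add: vec_eq_iff algebra_simps)
  ultimately show "(\<lambda>\<mu>. f (a + c *s (z + \<mu> *s u))) field_differentiable (at 0)" by simp
qed

text \<open>Continuity and holomorphy in one variable both survive locally uniform limits, so no theory of several variables is needed.\<close>

lemma line_holomorphic_uniform_limit:
  assumes A: "\<And>m::nat. line_holomorphic R (A m)"
    and lim: "\<And>r. 0 < r \<Longrightarrow> r < R \<Longrightarrow> uniform_limit (cball 0 r) A f sequentially"
  shows "line_holomorphic R f"
  unfolding line_holomorphic_def
proof (intro conjI ballI allI)
  have cont: "continuous_on (cball 0 r) f" if "0 < r" "r < R" for r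
  proof (rule uniform_limit_theorem[OF _ lim[OF that]])
    have "cball 0 r \<subseteq> (ball 0 R :: (complex ^ 'a) set)" using that by auto
    then have "continuous_on (cball 0 r) (A m)" for m
      using A[of m] unfolding line_holomorphic_def by (blast intro: continuous_on_subset)
    then show "\<forall>\<^sub>F m in sequentially. continuous_on (cball 0 r) (A m)" by simp
  qed simp
  have ex: "\<exists>r>0. r < R \<and> norm z < r" if "z \<in> ball 0 R" for z :: "complex ^ 'a"
  proof -
    have "norm z < R" using that by simp
    then obtain r where "norm z < r" "r < R" using dense by blast
    then show ?thesis using norm_ge_zero[of z] by (intro exI[of _ r]) linarith
  qed
  show "continuous_on (ball 0 R) f"
  proof (intro continuous_at_imp_continuous_on ballI)
    fix z :: "complex ^ 'a" assume "z \<in> ball 0 R"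
    from ex[OF this] obtain r where r: "0 < r" "r < R" "norm z < r" by blast
    have "continuous_on (ball 0 r) f" using cont[OF r(1,2)] by (rule continuous_on_subset) auto
    then show "isCont f z" using r by (simp add: continuous_on_eq_continuous_at)
  qed
  fix z u :: "complex ^ 'a" assume "z \<in> ball 0 R"
  from ex[OF this] obtain r where r: "0 < r" "r < R" "norm z < r" by blast
  define \<delta> where "\<delta> = (r - norm z) / (norm u + 1)"
  have \<delta>: "\<delta> > 0" using r by (simp add: \<delta>_def add_nonneg_pos)
  have in_r: "norm (z + \<mu> *s u) \<le> r" if "\<mu> \<in> cball 0 \<delta>" for \<mu>
  proof -
    have "norm (z + \<mu> *s u) \<le> norm z + norm \<mu> * norm u"
      by (metis norm_triangle_ineq norm_vector_smult)
    also have "norm \<mu> * norm u \<le> \<delta> * (norm u + 1)"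
      using that \<delta> by (intro mult_mono) auto
    also have "\<delta> * (norm u + 1) = r - norm z"
      using norm_ge_zero[of u] by (simp add: \<delta>_def add_nonneg_eq_0_iff)
    finally show ?thesis by simp
  qed
  have sub: "cball 0 \<delta> \<subseteq> {\<mu>. z + \<mu> *s u \<in> ball 0 R}"
    using in_r r by force
  have "uniform_limit (cball 0 \<delta>) (\<lambda>m \<mu>. A m (z + \<mu> *s u)) (\<lambda>\<mu>. f (z + \<mu> *s u)) sequentially"
    unfolding uniform_limit_iff
  proof (intro allI impI)
    fix e :: real assume "0 < e"
    then have "\<forall>\<^sub>F m in sequentially. \<forall>z\<in>cball 0 r. dist (A m z) (f z) < e"
      using lim[OF r(1,2)] unfolding uniform_limit_iff by blast
    then show "\<forall>\<^sub>F m in sequentially. \<forall>\<mu>\<in>cball 0 \<delta>. dist (A m (z + \<mu> *s u)) (f (z + \<mu> *s u)) < e"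
    proof eventually_elim
      case (elim m)
      show ?case
      proof
        fix \<mu> :: complex assume "\<mu> \<in> cball 0 \<delta>"
        from in_r[OF this] show "dist (A m (z + \<mu> *s u)) (f (z + \<mu> *s u)) < e"
          using bspec[OF elim, of "z + \<mu> *s u"] by (simp only: mem_cball_0)
      qed
    qed
  qed
  moreover have "continuous_on (cball 0 \<delta>) (\<lambda>\<mu>. A m (z + \<mu> *s u)) \<and> (\<lambda>\<mu>. A m (z + \<mu> *s u)) holomorphic_on ball 0 \<delta>" for m
    using holomorphic_on_subset[OF line_holomorphic_on_line(1)[OF A[of m]] sub]
      holomorphic_on_subset[OF line_holomorphic_on_line(1)[OF A[of m]] order_trans[OF ball_subset_cball sub]]
    by (simp add: holomorphic_on_imp_continuous_on)
  ultimately have "(\<lambda>\<mu>. f (z + \<mu> *s u)) holomorphic_on ball 0 \<delta>"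
    using holomorphic_uniform_limit[where f="\<lambda>m \<mu>. A m (z + \<mu> *s u)" and z=0 and r=\<delta>
        and F=sequentially and g="\<lambda>\<mu>. f (z + \<mu> *s u)", OF always_eventually[rule_format]]
    by (metis trivial_limit_sequentially)
  then show "(\<lambda>\<mu>. f (z + \<mu> *s u)) field_differentiable at 0"
    using \<delta> by (intro holomorphic_on_imp_differentiable_at) auto
qed

section \<open>Taylor coefficients along slices\<close>

text \<open>The \<open>k\<close>-th Taylor coefficient at 0 of the slice function \<open>\<mu> \<mapsto> f (\<mu> *s z)\<close>.\<close>

definition slice_coeff :: "(complex ^ 'n \<Rightarrow> complex) \<Rightarrow> nat \<Rightarrow> complex ^ 'n \<Rightarrow> complex" where
  "slice_coeff f k z = (deriv ^^ k) (\<lambda>\<mu>. f (\<mu> *s z)) 0 / fact k"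

lemma slice_holomorphic:
  assumes "line_holomorphic R f"
  shows "(\<lambda>\<mu>. f (\<mu> *s z)) holomorphic_on {\<mu>. norm \<mu> * norm z < R}" "open {\<mu>::complex. norm \<mu> * norm z < R}"
  using line_holomorphic_on_line[OF assms, of 0 z] by auto

lemma slice_coeff_sums:
  assumes f: "line_holomorphic R f" and z: "norm \<mu> * norm z < R"
  shows "(\<lambda>k. slice_coeff f k z * \<mu> ^ k) sums f (\<mu> *s z)"
proof -
  define r where "r = (if z = 0 then norm \<mu> + 1 else R / norm z)"
  have R: "0 < R" using z mult_nonneg_nonneg[OF norm_ge_zero[of \<mu>] norm_ge_zero[of z]] by linarith
  have "\<mu> \<in> ball 0 r" using z by (simp add: r_def pos_less_divide_eq)
  moreover have "ball (0::complex) r \<subseteq> {\<mu>. norm \<mu> * norm z < R}"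
  proof
    fix x :: complex assume "x \<in> ball 0 r"
    then show "x \<in> {\<mu>. norm \<mu> * norm z < R}"
      using R by (cases "z = 0") (simp_all add: r_def pos_less_divide_eq)
  qed
  then have "(\<lambda>\<mu>. f (\<mu> *s z)) holomorphic_on ball 0 r"
    by (rule holomorphic_on_subset[OF slice_holomorphic(1)[OF f]])
  ultimately show ?thesis
    using holomorphic_power_series[of "\<lambda>\<mu>. f (\<mu> *s z)" 0 r \<mu>] by (simp add: slice_coeff_def)
qed

lemma norm_slice_coeff_le:
  assumes f: "line_holomorphic R f" and r: "r < R" and M: "\<And>z. norm z \<le> r \<Longrightarrow> norm (f z) \<le> M"
    and z: "norm z \<le> r"
  shows "norm (slice_coeff f k z) \<le> M"
proof -
  have "cball (0::complex) 1 \<subseteq> {\<mu>. norm \<mu> * norm z < R}"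
  proof
    fix \<mu> :: complex assume "\<mu> \<in> cball 0 1"
    then have "norm \<mu> * norm z \<le> 1 * norm z" by (intro mult_right_mono) auto
    then show "\<mu> \<in> {\<mu>. norm \<mu> * norm z < R}" using r z by simp
  qed
  then have hol: "(\<lambda>\<mu>. f (\<mu> *s z)) holomorphic_on cball 0 1"
    by (rule holomorphic_on_subset[OF slice_holomorphic(1)[OF f]])
  have "norm ((deriv ^^ k) (\<lambda>\<mu>. f (\<mu> *s z)) 0) \<le> fact k * M / 1 ^ k"
  proof (rule Cauchy_inequality)
    show "(\<lambda>\<mu>. f (\<mu> *s z)) holomorphic_on ball 0 1"
      using hol by (rule holomorphic_on_subset) auto
    show "continuous_on (cball 0 1) (\<lambda>\<mu>. f (\<mu> *s z))"
      using hol by (rule holomorphic_on_imp_continuous_on)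
  qed (use z M in auto)
  then show ?thesis by (simp add: slice_coeff_def norm_divide field_simps)
qed

lemma slice_coeff_smult:
  assumes f: "line_holomorphic R f" and "0 < R"
  shows "slice_coeff f k (c *s z) = c ^ k * slice_coeff f k z"
proof -
  have "(deriv ^^ k) (\<lambda>\<mu>. f ((c * \<mu>) *s z)) 0 = c ^ k * (deriv ^^ k) (\<lambda>\<mu>. f (\<mu> *s z)) (c * 0)"
    using slice_holomorphic[OF f, of z] slice_holomorphic(2)[OF f, of "c *s z"] \<open>0 < R\<close>
    by (intro higher_deriv_compose_linear[where f="\<lambda>\<mu>. f (\<mu> *s z)" and T="{\<mu>. norm \<mu> * norm z < R}"
          and S="{\<mu>. norm \<mu> * norm (c *s z) < R}"]) (simp_all add: norm_mult mult_ac)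
  then show ?thesis by (simp add: slice_coeff_def mult_ac)
qed

lemma slice_coeff_0: "slice_coeff f 0 z = f 0"
  by (simp add: slice_coeff_def)

lemma line_holomorphic_bounded:
  assumes "line_holomorphic R f" "r < R"
  shows "\<exists>M\<ge>0. \<forall>z. norm z \<le> r \<longrightarrow> norm (f z) \<le> M"
proof -
  have "continuous_on (cball 0 r) f"
    using assms unfolding line_holomorphic_def
    by (elim conjE continuous_on_subset) (simp add: cball_subset_ball_iff)
  then have "compact (f ` cball 0 r)" by (intro compact_continuous_image) auto
  then obtain M where "\<forall>x\<in>f ` cball 0 r. norm x \<le> M"
    using compact_imp_bounded bounded_iff by blast
  then have "norm (f z) \<le> M" if "norm z \<le> r" for z using that by simp
  then show ?thesis by (intro exI[of _ "max M 0"]) (simp add: le_max_iff_disj)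
qed

text \<open>The coefficient of order \<open>k\<close> is the uniform limit, as the scaling parameter tends to 0, of the rescaled remainder after the lower coefficients.\<close>

lemma line_holomorphic_slice_coeff:
  assumes f: "line_holomorphic R f" and R: "0 < R"
  shows "line_holomorphic R (slice_coeff f k)"
proof (induction k rule: less_induct)
  case (less k)
  define l where "l = (\<lambda>m::nat. complex_of_real (1 / real (m + 2)))"
  have nl: "norm (l m) = 1 / real (m + 2)" for m
    unfolding l_def norm_of_real by simp
  have l: "l m \<noteq> 0" "norm (l m) \<le> 1/2" for m
  proof -
    have "norm (l m) \<noteq> 0" unfolding nl by simp
    then show "l m \<noteq> 0" by auto
    show "norm (l m) \<le> 1/2" unfolding nl by simp
  qed
  define A where "A = (\<lambda>m z. (f (0 + l m *s z) - (\<Sum>j<k. l m ^ j * slice_coeff f j z)) * inverse (l m ^ k))"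
  have scl: "norm (0 + l m *s z) < R" if "norm z < R" for m and z :: "complex ^ 'a"
    using l(2)[of m] that R mult_mono[of "norm (l m)" "1/2" "norm z" "norm z"] by simp
  have "line_holomorphic R (\<lambda>z. \<Sum>j<k. l m ^ j * slice_coeff f j z)" for m
    by (rule line_holomorphic_sum, rule line_holomorphic_mult[OF line_holomorphic_const less]) simp
  moreover have "line_holomorphic R (\<lambda>z. f (0 + l m *s z))" for m
    using f scl by (rule line_holomorphic_affine)
  ultimately have "line_holomorphic R (A m)" for m
    unfolding A_def by (intro line_holomorphic_mult[OF _ line_holomorphic_const] line_holomorphic_diff)
  moreover have "uniform_limit (cball 0 r) A (slice_coeff f k) sequentially" if r: "0 < r" "r < R" for r
  proof -
    obtain M where M: "M \<ge> 0" "\<And>z. norm z \<le> r \<Longrightarrow> norm (f z) \<le> M"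
      using line_holomorphic_bounded[OF f r(2)] by blast
    have bound: "norm (A m z - slice_coeff f k z) \<le> 2 * M * norm (l m)" if z: "norm z \<le> r" for m z
    proof -
      have "norm (l m) * norm z < R"
        using l(2)[of m] z r mult_mono[of "norm (l m)" "1/2" "norm z" r] by simp
      then have "(\<lambda>j. slice_coeff f j z * l m ^ j) sums f (l m *s z)"
        by (rule slice_coeff_sums[OF f])
      then have "(\<lambda>j. slice_coeff f (j + Suc k) z * l m ^ (j + Suc k)) sums
          (f (l m *s z) - (\<Sum>j<Suc k. slice_coeff f j z * l m ^ j))"
        by (rule sums_split_initial_segment)
      then have "(\<lambda>j. slice_coeff f (j + Suc k) z * l m ^ (j + Suc k) * inverse (l m ^ k)) sums
          ((f (l m *s z) - (\<Sum>j<Suc k. slice_coeff f j z * l m ^ j)) * inverse (l m ^ k))"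
        by (rule sums_mult2)
      moreover have "(f (l m *s z) - (\<Sum>j<Suc k. slice_coeff f j z * l m ^ j)) * inverse (l m ^ k)
         = A m z - slice_coeff f k z"
        using l(1)[of m] by (simp add: A_def left_diff_distrib distrib_right mult.assoc mult.commute[of "l m ^ _"])
      moreover have "slice_coeff f (j + Suc k) z * l m ^ (j + Suc k) * inverse (l m ^ k)
         = slice_coeff f (j + Suc k) z * l m ^ j * l m" for j
        using l(1)[of m] by (simp add: power_add mult.assoc)
      ultimately have sm: "(\<lambda>j. slice_coeff f (j + Suc k) z * l m ^ j * l m) sums (A m z - slice_coeff f k z)"
        by (simp only:)
      have g: "(\<lambda>j. M * (1/2) ^ j * norm (l m)) sums (M * 2 * norm (l m))"
        using geometric_sums[of "1/2::real"] by (intro sums_mult sums_mult2) simp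
      have le: "norm (slice_coeff f (j + Suc k) z * l m ^ j * l m) \<le> M * (1/2) ^ j * norm (l m)" for j
        unfolding norm_mult norm_power
        by (intro mult_mono power_mono norm_slice_coeff_le[OF f r(2) M(2) z] l) (use M in auto)
      show ?thesis
        using norm_sums_le[OF sm g le] by (simp add: mult_ac)
    qed
    have "(\<lambda>m. 2 * M * norm (l m)) \<longlonglongrightarrow> 2 * M * 0"
      using LIMSEQ_ignore_initial_segment[OF lim_inverse_n', of 2]
      by (intro tendsto_mult tendsto_const) (simp add: nl)
    then have lim: "(\<lambda>m. 2 * M * norm (l m)) \<longlonglongrightarrow> 0" by simp
    show ?thesis
      unfolding uniform_limit_iff dist_norm
    proof (intro allI impI)
      fix e :: real assume "0 < e"
      with lim have "eventually (\<lambda>m. 2 * M * norm (l m) < e) sequentially"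
        by (rule order_tendstoD)
      then show "\<forall>\<^sub>F m in sequentially. \<forall>z\<in>cball 0 r. norm (A m z - slice_coeff f k z) < e"
      proof eventually_elim
        case (elim m)
        show ?case
        proof
          fix z :: "complex ^ 'a" assume "z \<in> cball 0 r"
          then show "norm (A m z - slice_coeff f k z) < e"
            using le_less_trans[OF bound elim] by simp
        qed
      qed
    qed
  qed
  ultimately show ?case by (rule line_holomorphic_uniform_limit)
qed

lemma line_holomorphic_slice_coeff_entire:
  assumes f: "line_holomorphic R f" and R: "0 < R"
  shows "line_holomorphic R' (slice_coeff f k)"
proof (cases "0 < R'")
  case True
  define c where "c = complex_of_real (R / R')"
  have c: "c \<noteq> 0" "norm c = R / R'" using True R by (auto simp: c_def norm_divide)
  have "line_holomorphic R' (\<lambda>z. slice_coeff f k (0 + c *s z))"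
    using True R by (intro line_holomorphic_affine[OF line_holomorphic_slice_coeff[OF f R]])
      (auto simp: c(2) field_simps)
  then have "line_holomorphic R' (\<lambda>z. inverse (c ^ k) * slice_coeff f k (0 + c *s z))"
    by (intro line_holomorphic_mult line_holomorphic_const)
  then show ?thesis using c(1) by (simp add: slice_coeff_smult[OF f R] mult.assoc[symmetric])
next
  case False
  then have e: "ball 0 R' = ({} :: (complex ^ 'a) set)" by simp
  show ?thesis unfolding line_holomorphic_def e by simp
qed

section \<open>Entire homogeneous functions are polynomials\<close>

lemma integral_sums_dominated:
  fixes f :: "nat \<Rightarrow> 'a \<Rightarrow> complex"
  assumes [measurable]: "\<And>i. f i \<in> borel_measurable M"
    and sums: "\<And>x. x \<in> space M \<Longrightarrow> (\<lambda>i. f i x) sums F x"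
    and bound: "\<And>n x. x \<in> space M \<Longrightarrow> norm (\<Sum>i<n. f i x) \<le> B x" and B: "integrable M B"
  shows "integrable M F" "(\<lambda>i. LINT x|M. f i x) sums (LINT x|M. F x)"
proof -
  have lim: "(\<lambda>n. \<Sum>i<n. f i x) \<longlonglongrightarrow> F x" if "x \<in> space M" for x
    using sums[OF that] by (simp add: sums_def)
  have [measurable]: "F \<in> borel_measurable M"
    by (rule borel_measurable_LIMSEQ_metric[OF _ lim]) measurable
  have AElim: "AE x in M. (\<lambda>n. \<Sum>i<n. f i x) \<longlonglongrightarrow> F x"
    using lim by (intro AE_I2)
  have AEb: "AE x in M. norm (\<Sum>i<n. f i x) \<le> B x" for n
    using bound by (intro AE_I2)
  have "integrable M (f i)" for i
  proof (rule Bochner_Integration.integrable_bound)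
    show "integrable M (\<lambda>x. B x + B x)" using B by simp
    show "AE x in M. norm (f i x) \<le> norm (B x + B x)"
    proof (rule AE_I2)
      fix x assume x: "x \<in> space M"
      have "f i x = (\<Sum>i<Suc i. f i x) - (\<Sum>i<i. f i x)" by simp
      then have "norm (f i x) \<le> norm (\<Sum>i<Suc i. f i x) + norm (\<Sum>i<i. f i x)"
        by (metis norm_triangle_ineq4)
      also have "\<dots> \<le> B x + B x" using bound[OF x] by (intro add_mono)
      finally show "norm (f i x) \<le> norm (B x + B x)" by simp
    qed
  qed measurable
  then have int: "(LINT x|M. (\<Sum>i<n. f i x)) = (\<Sum>i<n. LINT x|M. f i x)" for n
    by (intro Bochner_Integration.integral_sum)
  have "(\<lambda>n. LINT x|M. (\<Sum>i<n. f i x)) \<longlonglongrightarrow> (LINT x|M. F x)"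
    by (rule integral_dominated_convergence[OF _ _ B AElim AEb]) measurable
  then show "(\<lambda>i. LINT x|M. f i x) sums (LINT x|M. F x)"
    unfolding sums_def int .
  show "integrable M F"
    by (rule integrable_dominated_convergence[OF _ _ B AElim AEb]) measurable
qed

lemma sums_single_unique:
  fixes f :: "nat \<Rightarrow> complex"
  assumes "f sums s" and "\<And>i. i \<noteq> j \<Longrightarrow> f i = 0"
  shows "s = f j"
proof -
  have "f = (\<lambda>i. if i = j then f i else 0)" using assms(2) by auto
  then have "f sums f j" using sums_single[of j f] by metis
  with assms(1) show ?thesis by (rule sums_unique2)
qed

lemma continuous_on_entire:
  assumes "\<And>R. line_holomorphic R g"
  shows "continuous_on S g"
proof (rule continuous_on_subset[OF continuous_at_imp_continuous_on])
  show "\<forall>x\<in>UNIV. isCont g x"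
  proof
    fix x :: "complex ^ 'a"
    have "continuous_on (ball 0 (norm x + 1)) g"
      using assms unfolding line_holomorphic_def by blast
    then show "isCont g x"
      by (simp add: continuous_on_eq_continuous_at)
  qed
qed simp

lemma borel_measurable_slice_coeff:
  assumes "line_holomorphic R f" "0 < R"
  shows "slice_coeff f k \<in> borel_measurable borel"
  by (intro borel_measurable_continuous_onI continuous_on_entire line_holomorphic_slice_coeff_entire[OF assms])

lemma norm_slice_coeff_le_geometric:
  assumes f: "line_holomorphic R f" and r: "0 < r" "r < R" and M: "\<And>z. norm z \<le> r \<Longrightarrow> norm (f z) \<le> M"
  shows "norm (slice_coeff f k z) \<le> M * (norm z / r) ^ k"
proof (cases "z = 0")
  case True
  show ?thesis
  proof (cases k)
    case 0
    then show ?thesis using M[of 0] r True by (simp add: slice_coeff_0)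
  next
    case (Suc n)
    have "slice_coeff f k (0 *s z) = 0"
      using slice_coeff_smult[OF f, of k 0 z] r Suc by simp
    then show ?thesis using True Suc by simp
  qed
next
  case False
  define c where "c = complex_of_real (norm z / r)"
  have c: "c \<noteq> 0" "norm c = norm z / r" using False r by (auto simp: c_def norm_divide)
  have "z = c *s (inverse c *s z)" using c(1) by simp
  then have "slice_coeff f k z = c ^ k * slice_coeff f k (inverse c *s z)"
    using slice_coeff_smult[OF f, of k c] r by (metis order_less_trans)
  moreover have "norm (slice_coeff f k (inverse c *s z)) \<le> M"
    using c False r by (intro norm_slice_coeff_le[OF f r(2) M]) (simp_all add: norm_inverse)
  ultimately have "norm (slice_coeff f k z) \<le> norm c ^ k * M"
    by (simp add: norm_mult norm_power mult_left_mono)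
  then show ?thesis by (simp add: c(2) mult.commute)
qed

text \<open>Averaging over rotations \<open>w \<mapsto> \<omega> w\<close> extracts the slice coefficient of the same homogeneity as \<open>h\<close>, by Cauchy's formula on each slice.\<close>

lemma integral_slice_orthogonal_cutoff:
  fixes f h :: "complex ^ 'n \<Rightarrow> complex"
  assumes f: "line_holomorphic R f" and r: "0 < r" "r < R"
    and h[measurable]: "h \<in> borel_measurable borel" and rot: "\<And>\<omega> w. norm \<omega> = 1 \<Longrightarrow> h (\<omega> *s w) = \<omega> ^ j * h w"
    and W[measurable]: "W \<in> borel_measurable borel"
    and int: "integrable lborel (\<lambda>w. indicator (ball 0 r) w * norm (h w * W ((norm w)\<^sup>2)))"
  shows "(\<integral>w. indicator (ball 0 r) w * (f w * cnj (h w) * W ((norm w)\<^sup>2)) \<partial>lborel)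
    = (\<integral>w. indicator (ball 0 r) w * (slice_coeff f j w * cnj (h w) * W ((norm w)\<^sup>2)) \<partial>lborel)"
proof -
  have [measurable]: "ball 0 r \<in> sets (borel :: (complex ^ 'n) measure)" by simp
  define r' where "r' = (r + R) / 2"
  have r': "0 < r'" "r < r'" "r' < R" using r by (auto simp: r'_def)
  define q where "q = r / r'"
  have q: "0 \<le> q" "q < 1" using r r' by (auto simp: q_def)
  obtain M where M: "M \<ge> 0" "\<And>z. norm z \<le> r' \<Longrightarrow> norm (f z) \<le> M"
    using line_holomorphic_bounded[OF f r'(3)] by blast
  have sc: "norm (slice_coeff f i w) \<le> M * q ^ i" if "w \<in> ball 0 r" for i w
  proof -
    have "norm (slice_coeff f i w) \<le> M * (norm w / r') ^ i"
      by (rule norm_slice_coeff_le_geometric[OF f r'(1,3) M(2)])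
    also have "\<dots> \<le> M * q ^ i"
      using that r' M(1) by (intro mult_left_mono power_mono) (auto simp: q_def divide_right_mono)
    finally show ?thesis .
  qed
  have [measurable]: "slice_coeff f i \<in> borel_measurable borel" for i
    using r by (intro borel_measurable_slice_coeff[OF f]) simp
  let ?f = "\<lambda>i w. indicator (ball 0 r) w * (slice_coeff f i w * cnj (h w) * W ((norm w)\<^sup>2))"
  let ?B = "\<lambda>w. (M / (1 - q)) * (indicator (ball 0 r) w * norm (h w * W ((norm w)\<^sup>2)))"
  have "(\<lambda>i. \<integral>w. ?f i w \<partial>lborel) sums (\<integral>w. indicator (ball 0 r) w * (f w * cnj (h w) * W ((norm w)\<^sup>2)) \<partial>lborel)"
  proof (rule integral_sums_dominated)
    show "integrable lborel ?B" by (intro integrable_mult_right int)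
    fix w :: "complex ^ 'n"
    show "(\<lambda>i. ?f i w) sums (indicator (ball 0 r) w * (f w * cnj (h w) * W ((norm w)\<^sup>2)))"
    proof (cases "w \<in> ball 0 r")
      case True
      then have "(\<lambda>i. slice_coeff f i w * 1 ^ i) sums f (1 *s w)"
        using r by (intro slice_coeff_sums[OF f]) auto
      then show ?thesis by (intro sums_mult sums_mult2) simp
    qed simp
    fix n
    show "norm (\<Sum>i<n. ?f i w) \<le> ?B w"
    proof (cases "w \<in> ball 0 r")
      case True
      have "norm (\<Sum>i<n. slice_coeff f i w) \<le> (\<Sum>i<n. M * q ^ i)"
        by (intro sum_norm_le sc True)
      also have "\<dots> \<le> (\<Sum>i. M * q ^ i)"
        using q M(1) by (intro sum_le_suminf summable_mult summable_geometric) auto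
      also have "\<dots> = M / (1 - q)"
        using q by (subst suminf_mult) (auto simp: suminf_geometric)
      finally have "norm (\<Sum>i<n. slice_coeff f i w) \<le> M / (1 - q)" .
      then have "norm ((\<Sum>i<n. slice_coeff f i w) * (cnj (h w) * W ((norm w)\<^sup>2))) \<le> M / (1 - q) * norm (h w * W ((norm w)\<^sup>2))"
        unfolding norm_mult using M(1) q by (intro mult_mono) auto
      with True show ?thesis by (simp add: sum_distrib_right mult.assoc)
    qed simp
  qed measurable
  moreover have "(\<integral>w. ?f i w \<partial>lborel) = 0" if "i \<noteq> j" for i
  proof (rule integral_rotation_eq_0[OF _ that])
    fix \<omega> :: complex and w assume \<omega>: "norm \<omega> = 1"
    have "slice_coeff f i (\<omega> *s w) = \<omega> ^ i * slice_coeff f i w"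
      using r by (intro slice_coeff_smult[OF f]) simp
    then show "?f i (\<omega> *s w) = \<omega> ^ i * cnj \<omega> ^ j * ?f i w"
      using \<omega> rot[OF \<omega>] by (simp add: indicator_def)
  qed measurable
  ultimately show ?thesis by (rule sums_single_unique)
qed

lemma sum_power_le_exp:
  fixes x :: real assumes "0 \<le> x"
  shows "(\<Sum>i<n. x ^ i / fact i) \<le> exp x"
proof -
  have "(\<lambda>i. x ^ i / fact i) sums exp x"
    using exp_converges[of x] by (simp add: field_simps)
  then show ?thesis
    using assms by (intro sum_le_suminf[of "\<lambda>i. x ^ i / fact i" "{..<n}", THEN order_trans]) (auto simp: sums_iff)
qed

lemma power_le_fact_exp:
  fixes x :: real assumes "0 \<le> x"
  shows "x ^ k \<le> fact k * exp x"
proof -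
  have "x ^ k / fact k \<le> (\<Sum>i<Suc k. x ^ i / fact i)"
    using assms by (intro member_le_sum) auto
  then have "x ^ k / fact k \<le> exp x" using sum_power_le_exp[OF assms] by (rule order_trans)
  then show ?thesis by (simp add: field_simps)
qed

definition gauss_const :: "'n::finite itself \<Rightarrow> real" where
  "gauss_const _ = (\<integral>w. exp (- (norm (w :: complex ^ 'n))\<^sup>2) \<partial>lborel)"

lemma integrable_gaussian_growth:
  fixes g :: "complex ^ 'n \<Rightarrow> complex"
  assumes [measurable]: "g \<in> borel_measurable borel" and g: "\<And>w. norm (g w) \<le> M * exp (A * norm w)"
  shows "integrable lborel (\<lambda>w. g w * of_real (exp (- (norm w)\<^sup>2)))"
proof (rule Bochner_Integration.integrable_bound)
  show "integrable lborel (\<lambda>w::complex ^ 'n. M * exp (A * norm w - (norm w)\<^sup>2))"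
    by (intro integrable_mult_right integrable_gaussian[OF DIM_complex_vec])
  have "norm (g w * of_real (exp (- (norm w)\<^sup>2))) \<le> norm (M * exp (A * norm w - (norm w)\<^sup>2))" for w
  proof -
    have "norm (g w * of_real (exp (- (norm w)\<^sup>2))) \<le> M * exp (A * norm w) * exp (- (norm w)\<^sup>2)"
      unfolding norm_mult using g[of w] order_trans[OF norm_ge_zero g[of w]] by (intro mult_mono) auto
    also have "\<dots> = M * exp (A * norm w - (norm w)\<^sup>2)"
      by (simp add: exp_diff exp_minus field_simps)
    finally show ?thesis by simp
  qed
  then show "AE w in lborel. norm (g w * of_real (exp (- (norm w)\<^sup>2))) \<le> norm (M * exp (A * norm w - (norm w)\<^sup>2))"
    by simp
qed measurable

lemma gauss_const_pos: "gauss_const TYPE('n::finite) > 0"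
proof -
  have int: "integrable lborel (\<lambda>w::complex ^ 'n. exp (0 * norm w - (norm w)\<^sup>2))"
    by (rule integrable_gaussian[OF DIM_complex_vec])
  have "gauss_const TYPE('n) \<noteq> 0"
  proof
    assume "gauss_const TYPE('n) = 0"
    then have "AE w::complex ^ 'n in lborel. exp (- (norm w)\<^sup>2) = 0"
      using int unfolding gauss_const_def by (subst (asm) integral_nonneg_eq_0_iff_AE) auto
    then have "AE w::complex ^ 'n in lborel. False" by simp
    then have "emeasure lborel (UNIV :: (complex ^ 'n) set) = 0" by (simp add: AE_iff_measurable[OF _ refl])
    then show False by simp
  qed
  moreover have "gauss_const TYPE('n) \<ge> 0" unfolding gauss_const_def by simp
  ultimately show ?thesis by simp
qed

text \<open>The Gaussian is invariant under rotations, so only the slice coefficient of order 0 contributes.\<close>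

lemma gaussian_mean_value:
  fixes g :: "complex ^ 'n \<Rightarrow> complex"
  assumes g: "\<And>R. line_holomorphic R g" and growth: "\<And>w. norm (g w) \<le> M * exp (A * norm w)"
  shows "(\<integral>w. g w * of_real (exp (- (norm w)\<^sup>2)) \<partial>lborel) = g 0 * of_real (gauss_const TYPE('n))"
proof -
  have g_meas[measurable]: "g \<in> borel_measurable borel"
    by (intro borel_measurable_continuous_onI continuous_on_entire g)
  let ?e = "\<lambda>w::complex ^ 'n. complex_of_real (exp (- (norm w)\<^sup>2))"
  have int_g: "integrable lborel (\<lambda>w. g w * ?e w)"
    by (rule integrable_gaussian_growth[OF g_meas growth])
  have int_c: "integrable lborel (\<lambda>w. g 0 * ?e w)"
    by (rule integrable_gaussian_growth[where M="norm (g 0)" and A=0]) auto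
  have lim: "(\<lambda>m. \<integral>w. indicator (ball 0 (real (Suc m))) w * H w \<partial>lborel) \<longlonglongrightarrow> (\<integral>w. H w \<partial>lborel)"
    if H: "integrable lborel H" for H :: "complex ^ 'n \<Rightarrow> complex"
  proof (rule integral_dominated_convergence)
    show "integrable lborel (\<lambda>w. norm (H w))" using H by simp
    show "AE w in lborel. (\<lambda>m. indicator (ball 0 (real (Suc m))) w * H w) \<longlonglongrightarrow> H w"
    proof (rule AE_I2)
      fix w :: "complex ^ 'n"
      obtain N :: nat where "norm w < real N" using reals_Archimedean2 by blast
      then have "indicator (ball 0 (real (Suc m))) w * H w = H w" if "m \<ge> N" for m
        using that by (simp add: indicator_def)
      then show "(\<lambda>m. indicator (ball 0 (real (Suc m))) w * H w) \<longlonglongrightarrow> H w"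
        by (intro tendsto_eventually eventually_sequentiallyI[of N])
    qed
  qed (use H in \<open>auto simp: indicator_def\<close>)
  have "(\<integral>w. indicator (ball 0 (real (Suc m))) w * (g w * ?e w) \<partial>lborel)
      = (\<integral>w. indicator (ball 0 (real (Suc m))) w * (g 0 * ?e w) \<partial>lborel)" for m
  proof -
    have "integrable lborel (\<lambda>w::complex ^ 'n. indicator (ball 0 (real (Suc m))) w * norm (1 * complex_of_real (exp (- (norm w)\<^sup>2))))"
      by (rule Bochner_Integration.integrable_bound[OF integrable_gaussian[OF DIM_complex_vec, of 0]])
         (auto simp: indicator_def)
    then show ?thesis
      using integral_slice_orthogonal_cutoff[OF g[of "real (m + 2)"], of "real (Suc m)" "\<lambda>_. 1" 0 "\<lambda>u. complex_of_real (exp (- u))"]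
      by (simp add: slice_coeff_0)
  qed
  with lim[OF int_g] lim[OF int_c] have "(\<integral>w. g w * ?e w \<partial>lborel) = (\<integral>w. g 0 * ?e w \<partial>lborel)"
    using LIMSEQ_unique by simp
  also have "\<dots> = g 0 * of_real (gauss_const TYPE('n))"
    by (simp add: gauss_const_def)
  finally show ?thesis .
qed

lemma line_holomorphic_exp_cip: "line_holomorphic R (\<lambda>w. exp (cip w z))"
  unfolding line_holomorphic_def
proof (intro conjI ballI allI)
  show "continuous_on (ball 0 R) (\<lambda>w. exp (cip w z))" by (intro continuous_intros)
  show "(\<lambda>\<mu>. exp (cip (w + \<mu> *s u) z)) field_differentiable at 0" for w u
  proof -
    have "((\<lambda>\<mu>. exp (cip w z + \<mu> * cip u z)) has_field_derivative exp (cip w z) * cip u z) (at 0)"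
      by (auto intro!: derivative_eq_intros)
    then show ?thesis
      unfolding cip_add_left cip_smult_left field_differentiable_def by blast
  qed
qed

locale homogeneous_entire =
  fixes \<phi> :: "complex ^ 'n \<Rightarrow> complex" and k :: nat
  assumes hol: "\<And>R. line_holomorphic R \<phi>" and hom: "\<And>c w. \<phi> (c *s w) = c ^ k * \<phi> w"
begin

lemma meas [measurable]: "\<phi> \<in> borel_measurable borel"
  by (intro borel_measurable_continuous_onI continuous_on_entire hol)

lemma growth_power: "\<exists>M\<ge>0. \<forall>w. norm (\<phi> w) \<le> M * norm w ^ k"
proof -
  obtain M where M: "M \<ge> 0" "\<And>z. norm z \<le> 1 \<Longrightarrow> norm (\<phi> z) \<le> M"
    using line_holomorphic_bounded[OF hol[of 2], of 1] by auto
  have "norm (\<phi> w) \<le> M * norm w ^ k" for w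
  proof (cases "w = 0")
    case True
    then show ?thesis
      using M(2)[of 0] hom[of 0 0] by (cases k) auto
  next
    case False
    let ?c = "complex_of_real (norm w)"
    have "\<phi> w = ?c ^ k * \<phi> (inverse ?c *s w)"
      using False hom[of ?c "inverse ?c *s w"] by simp
    moreover have "norm (\<phi> (inverse ?c *s w)) \<le> M"
      using False by (intro M) (simp add: norm_inverse)
    ultimately show ?thesis
      using mult_left_mono[of "norm (\<phi> (inverse ?c *s w))" M "norm w ^ k"]
      by (simp add: norm_mult norm_power mult.commute)
  qed
  with M(1) show ?thesis by blast
qed

lemma growth: "\<exists>M\<ge>0. \<forall>w. norm (\<phi> w) \<le> M * exp (norm w)"
proof -
  obtain M where M: "M \<ge> 0" "\<And>w. norm (\<phi> w) \<le> M * norm w ^ k" using growth_power by blast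
  have "norm (\<phi> w) \<le> (M * fact k) * exp (norm w)" for w
    using M(2)[of w] mult_left_mono[OF power_le_fact_exp[of "norm w" k] M(1)] by (simp add: mult.assoc)
  then show ?thesis using M(1) by (intro exI[of _ "M * fact k"]) auto
qed

lemma fock_exp:
  "(\<integral>w. \<phi> w * exp (cip z w) * of_real (exp (- (norm w)\<^sup>2)) \<partial>lborel) = of_real (gauss_const TYPE('n)) * \<phi> z"
proof -
  obtain M where M: "M \<ge> 0" "\<And>w. norm (\<phi> w) \<le> M * exp (norm w)" using growth by blast
  let ?f = "\<lambda>w. \<phi> w * exp (cip z w) * complex_of_real (exp (- (norm w)\<^sup>2))"
  define g where "g = (\<lambda>w. \<phi> (z + 1 *s w) * exp (cip w (- z)))"
  have "line_holomorphic R g" for R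
    unfolding g_def
  proof (intro line_holomorphic_mult line_holomorphic_exp_cip line_holomorphic_affine)
    show "line_holomorphic (norm z + R) \<phi>" by (rule hol)
    show "norm (z + 1 *s w) < norm z + R" if "norm w < R" for w
      using norm_triangle_ineq[of z w] that by simp
  qed
  moreover have "norm (g w) \<le> (M * exp (norm z)) * exp ((1 + norm z) * norm w)" for w
  proof -
    have "norm (\<phi> (z + 1 *s w)) \<le> M * exp (norm z + norm w)"
    proof -
      have "M * exp (norm (z + w)) \<le> M * exp (norm z + norm w)"
        using norm_triangle_ineq[of z w] M(1) by (intro mult_left_mono) auto
      with M(2)[of "z + w"] show ?thesis by simp
    qed
    moreover have "norm (exp (cip w (- z))) \<le> exp (norm w * norm z)"
      using norm_cip_le[of w "- z"] complex_Re_le_cmod[of "cip w (- z)"] by simp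
    ultimately have "norm (g w) \<le> M * exp (norm z + norm w) * exp (norm w * norm z)"
      unfolding g_def norm_mult using M(1) by (intro mult_mono) auto
    also have "\<dots> = (M * exp (norm z)) * exp ((1 + norm z) * norm w)"
      by (simp add: exp_add algebra_simps)
    finally show ?thesis .
  qed
  ultimately have g: "(\<integral>w. g w * of_real (exp (- (norm w)\<^sup>2)) \<partial>lborel) = g 0 * of_real (gauss_const TYPE('n))"
    by (rule gaussian_mean_value)
  have shift: "?f (z + w) = g w * of_real (exp (- (norm w)\<^sup>2))" for w
  proof -
    have "complex_of_real ((norm (z + w))\<^sup>2) = cip z z + cip z w + cip w z + cip w w"
      unfolding cip_self[symmetric] by (simp add: cip_add_left cip_add_right algebra_simps)
    moreover have "cip w (- z) = - cip w z" by (simp add: cip_def sum_negf)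
    moreover have "complex_of_real (exp (- (norm u)\<^sup>2)) = exp (- complex_of_real ((norm u)\<^sup>2))" for u :: "complex ^ 'n"
      by (simp add: exp_of_real[symmetric])
    ultimately have "?f (z + w) = \<phi> (z + w) * exp (cip z (z + w) + (- (cip z z + cip z w + cip w z + cip w w)))"
      "g w * of_real (exp (- (norm w)\<^sup>2)) = \<phi> (z + w) * exp (- cip w z + (- cip w w))"
      by (simp_all only: g_def exp_add mult.assoc vector_smult_lid cip_self)
    then show ?thesis by (simp add: cip_add_right)
  qed
  have "(\<integral>w. ?f w \<partial>lborel) = (\<integral>w. ?f (z + w) \<partial>lborel)"
    using integral_distr[of "(+) z" lborel borel ?f] by (simp add: lborel_distr_plus)
  also have "\<dots> = (\<integral>w. g w * of_real (exp (- (norm w)\<^sup>2)) \<partial>lborel)"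
    by (simp only: shift)
  finally show ?thesis using g by (simp add: g_def mult.commute)
qed

text \<open>The reproducing formula of the Fock space in degree \<open>k\<close>: the exponential kernel reproduces \<open>\<phi>\<close>, and comparing homogeneity in \<open>z\<close> leaves the \<open>k\<close>-th term of the exponential.\<close>

lemma fock_power:
  "(\<integral>w. \<phi> w * cip z w ^ k * of_real (exp (- (norm w)\<^sup>2)) \<partial>lborel) = of_real (gauss_const TYPE('n) * fact k) * \<phi> z"
proof -
  obtain M where M: "M \<ge> 0" "\<And>w. norm (\<phi> w) \<le> M * exp (norm w)" using growth by blast
  let ?e = "\<lambda>w::complex ^ 'n. complex_of_real (exp (- (norm w)\<^sup>2))"
  let ?f = "\<lambda>i w. \<phi> w * (cip z w ^ i / fact i) * ?e w"
  have "(\<lambda>i. \<integral>w. ?f i w \<partial>lborel) sums (\<integral>w. \<phi> w * exp (cip z w) * ?e w \<partial>lborel)"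
  proof (rule integral_sums_dominated)
    show "integrable lborel (\<lambda>w::complex ^ 'n. M * exp ((1 + norm z) * norm w - (norm w)\<^sup>2))"
      by (intro integrable_mult_right integrable_gaussian[OF DIM_complex_vec])
    fix w :: "complex ^ 'n"
    have "(\<lambda>i. cip z w ^ i / fact i) sums exp (cip z w)"
      using exp_converges[of "cip z w"] by (simp add: field_simps scaleR_conv_of_real)
    then show "(\<lambda>i. ?f i w) sums (\<phi> w * exp (cip z w) * ?e w)"
      by (intro sums_mult sums_mult2)
    fix n
    have "norm (\<Sum>i<n. cip z w ^ i / fact i) \<le> (\<Sum>i<n. norm (cip z w) ^ i / fact i)"
      by (intro sum_norm_le) (simp add: norm_divide norm_power)
    also have "\<dots> \<le> exp (norm (cip z w))" by (rule sum_power_le_exp) simp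
    also have "\<dots> \<le> exp (norm z * norm w)" using norm_cip_le by simp
    finally have "norm (\<phi> w * (\<Sum>i<n. cip z w ^ i / fact i) * ?e w)
        \<le> (M * exp (norm w)) * exp (norm z * norm w) * exp (- (norm w)\<^sup>2)"
      unfolding norm_mult using M by (intro mult_mono) auto
    also have "\<dots> = M * exp ((1 + norm z) * norm w - (norm w)\<^sup>2)"
      by (simp add: exp_add exp_diff exp_minus algebra_simps field_simps)
    finally show "norm (\<Sum>i<n. ?f i w) \<le> M * exp ((1 + norm z) * norm w - (norm w)\<^sup>2)"
      by (simp add: sum_distrib_left sum_distrib_right)
  qed measurable
  moreover have "(\<integral>w. ?f i w \<partial>lborel) = 0" if "i \<noteq> k" for i
  proof (rule integral_rotation_eq_0[OF _ that[symmetric]])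
    fix \<omega> :: complex and w assume "norm \<omega> = 1"
    then show "?f i (\<omega> *s w) = \<omega> ^ k * cnj \<omega> ^ i * ?f i w"
      by (simp add: hom power_mult_distrib)
  qed measurable
  ultimately have "(\<integral>w. \<phi> w * exp (cip z w) * ?e w \<partial>lborel) = (\<integral>w. ?f k w \<partial>lborel)"
    by (rule sums_single_unique)
  also have "\<dots> = (\<integral>w. inverse (fact k) * (\<phi> w * cip z w ^ k * ?e w) \<partial>lborel)"
    by (simp add: field_simps)
  also have "\<dots> = inverse (fact k) * (\<integral>w. \<phi> w * cip z w ^ k * ?e w \<partial>lborel)"
    by (rule integral_mult_right_zero)
  finally show ?thesis unfolding fock_exp by (simp add: field_simps)
qed

text \<open>By the reproducing formula the function is an integral against \<open>cip z w ^ k\<close>, which expands into monomials.\<close>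

lemma homogeneous_poly: "homogeneous_poly k \<phi>"
proof -
  obtain M where M: "M \<ge> 0" "\<And>w. norm (\<phi> w) \<le> M * exp (norm w)" using growth by blast
  let ?e = "\<lambda>w::complex ^ 'n. complex_of_real (exp (- (norm w)\<^sup>2))"
  have "integrable lborel (\<lambda>w. norm (\<phi> w * ?e w) * norm w ^ k)"
  proof (rule Bochner_Integration.integrable_bound)
    show "integrable lborel (\<lambda>w::complex ^ 'n. (M * fact k) * exp (2 * norm w - (norm w)\<^sup>2))"
      by (intro integrable_mult_right integrable_gaussian[OF DIM_complex_vec])
    have "norm (norm (\<phi> w * ?e w) * norm w ^ k) \<le> norm ((M * fact k) * exp (2 * norm w - (norm w)\<^sup>2))" for w
    proof -
      have "norm (\<phi> w) * exp (- (norm w)\<^sup>2) * norm w ^ k \<le> (M * exp (norm w)) * exp (- (norm w)\<^sup>2) * (fact k * exp (norm w))"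
        using M power_le_fact_exp[of "norm w" k] by (intro mult_mono) auto
      also have "\<dots> = (M * fact k) * exp (2 * norm w - (norm w)\<^sup>2)"
        by (simp add: exp_diff exp_minus field_simps flip: exp_add)
      finally show ?thesis using M(1) by (simp add: norm_mult)
    qed
    then show "AE w in lborel. norm (norm (\<phi> w * ?e w) * norm w ^ k) \<le> norm ((M * fact k) * exp (2 * norm w - (norm w)\<^sup>2))"
      by simp
  qed measurable
  then have "homogeneous_poly k (\<lambda>z. \<integral>w. (\<phi> w * ?e w) * cip z w ^ k \<partial>lborel)"
    by (intro homogeneous_poly_integral_cip) auto
  then have "homogeneous_poly k (\<lambda>z. inverse (of_real (gauss_const TYPE('n) * fact k)) * (\<integral>w. (\<phi> w * ?e w) * cip z w ^ k \<partial>lborel))"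
    by (rule homogeneous_poly_mult)
  also have "(\<lambda>z. inverse (of_real (gauss_const TYPE('n) * fact k)) * (\<integral>w. (\<phi> w * ?e w) * cip z w ^ k \<partial>lborel)) = \<phi>"
  proof
    fix z
    have "(\<integral>w. (\<phi> w * ?e w) * cip z w ^ k \<partial>lborel) = of_real (gauss_const TYPE('n) * fact k) * \<phi> z"
      unfolding fock_power[symmetric] by (simp add: mult_ac)
    then show "inverse (of_real (gauss_const TYPE('n) * fact k)) * (\<integral>w. (\<phi> w * ?e w) * cip z w ^ k \<partial>lborel) = \<phi> z"
      using gauss_const_pos[where 'n='n] by (simp add: field_simps)
  qed
  finally show ?thesis .
qed

end

section \<open>Homogeneous expansions and coefficient multipliers\<close>

text \<open>Local boundedness, uniform in the degree, replaces convergence: it implies geometric bounds on smaller balls and is preserved by multipliers of subexponential growth.\<close>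

definition homogeneous_series :: "(nat \<Rightarrow> complex ^ 'n \<Rightarrow> complex) \<Rightarrow> bool" where
  "homogeneous_series \<phi> \<longleftrightarrow> (\<forall>k. homogeneous_poly k (\<phi> k)) \<and>
     (\<forall>r. 0 < r \<longrightarrow> r < 1 \<longrightarrow> (\<exists>M. \<forall>k z. norm z \<le> r \<longrightarrow> norm (\<phi> k z) \<le> M))"

definition expansion_of :: "(complex ^ 'n \<Rightarrow> complex) \<Rightarrow> (nat \<Rightarrow> complex ^ 'n \<Rightarrow> complex) \<Rightarrow> bool" where
  "expansion_of f \<phi> \<longleftrightarrow> homogeneous_series \<phi> \<and> (\<forall>z\<in>unit_ball. (\<lambda>k. \<phi> k z) sums f z)"

definition subexponential :: "(nat \<Rightarrow> complex) \<Rightarrow> bool" where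
  "subexponential d \<longleftrightarrow> (\<forall>r. 0 < r \<longrightarrow> r < 1 \<longrightarrow> (\<exists>M. \<forall>k. norm (d k) * r ^ k \<le> M))"

lemma holomorphic_in_ball_cdiff: "holomorphic_in_ball f \<longleftrightarrow> (\<forall>z\<in>unit_ball. cdiff_at f z)"
  by (simp add: holomorphic_in_ball_def cdiff_at_def)

lemma holomorphic_in_ball_line: "holomorphic_in_ball f \<Longrightarrow> line_holomorphic 1 f"
  by (rule line_holomorphic_cdiff) (simp add: holomorphic_in_ball_cdiff)

text \<open>The slice coefficients are entire along lines and homogeneous, hence polynomials; Cauchy estimates on slices give the local bounds.\<close>

lemma expansion_of_slice_coeff:
  assumes "holomorphic_in_ball f"
  shows "expansion_of f (slice_coeff f)"
proof -
  have f: "line_holomorphic 1 f" using assms by (rule holomorphic_in_ball_line)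
  have "homogeneous_poly k (slice_coeff f k)" for k
  proof -
    interpret homogeneous_entire "slice_coeff f k" k
      by unfold_locales (auto intro: line_holomorphic_slice_coeff_entire[OF f] slice_coeff_smult[OF f])
    show ?thesis by (rule homogeneous_poly)
  qed
  moreover have "\<exists>M. \<forall>k z. norm z \<le> r \<longrightarrow> norm (slice_coeff f k z) \<le> M" if r: "0 < r" "r < 1" for r
  proof -
    obtain M where "\<And>z. norm z \<le> r \<Longrightarrow> norm (f z) \<le> M"
      using line_holomorphic_bounded[OF f r(2)] by blast
    then show ?thesis using norm_slice_coeff_le[OF f r(2)] by blast
  qed
  moreover have "(\<lambda>k. slice_coeff f k z) sums f z" if "z \<in> unit_ball" for z
    using slice_coeff_sums[OF f, of 1 z] that by simp
  ultimately show ?thesis by (simp add: expansion_of_def homogeneous_series_def)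
qed

lemma homogeneous_series_bound:
  assumes "homogeneous_series \<phi>" "0 < r" "r < 1"
  shows "\<exists>M\<ge>0. \<forall>k z. norm (\<phi> k z) \<le> M * (norm z / r) ^ k"
proof -
  obtain M where M: "\<And>k z. norm z \<le> r \<Longrightarrow> norm (\<phi> k z) \<le> M"
    using assms unfolding homogeneous_series_def by meson
  have hp: "homogeneous_poly k (\<phi> k)" for k
    using assms(1) unfolding homogeneous_series_def by blast
  have M0: "M \<ge> 0" using M[of 0 0] assms order_trans[OF norm_ge_zero] by auto
  have "norm (\<phi> k z) \<le> M * (norm z / r) ^ k" for k z
  proof (cases "z = 0")
    case True
    then show ?thesis
      using M[of 0 k] assms homogeneous_poly_smult[OF hp, of k 0 0] by (cases k) auto
  next
    case False
    define c where "c = complex_of_real (norm z / r)"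
    have c: "c \<noteq> 0" "norm c = norm z / r" using False assms by (auto simp: c_def norm_divide)
    have "\<phi> k z = c ^ k * \<phi> k (inverse c *s z)"
      using homogeneous_poly_smult[OF hp, of k c "inverse c *s z"] c by simp
    moreover have "norm (\<phi> k (inverse c *s z)) \<le> M"
      using c False assms by (intro M) (simp add: norm_inverse)
    ultimately show ?thesis
      using mult_left_mono[of "norm (\<phi> k (inverse c *s z))" M "norm c ^ k"] assms
      by (simp add: norm_mult norm_power c(2) mult.commute)
  qed
  with M0 show ?thesis by blast
qed

lemma homogeneous_series_summable:
  assumes "homogeneous_series \<phi>" "norm z < 1"
  shows "summable (\<lambda>k. norm (\<phi> k z))"
proof -
  obtain r where r: "norm z < r" "r < 1" using dense assms(2) by blast
  then have r0: "0 < r" using norm_ge_zero[of z] by linarith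
  obtain M where M: "\<And>k. norm (\<phi> k z) \<le> M * (norm z / r) ^ k"
    using homogeneous_series_bound[OF assms(1) r0 r(2)] by blast
  show ?thesis
    by (rule summable_comparison_test'[where g="\<lambda>k. M * (norm z / r) ^ k" and N=0])
       (use M r r0 in \<open>auto intro!: summable_mult summable_geometric\<close>)
qed

text \<open>Homogeneous polynomials are differentiable, and the geometric bound on a larger ball makes the derivatives converge uniformly.\<close>

lemma expansion_imp_holomorphic:
  assumes "expansion_of f \<phi>"
  shows "holomorphic_in_ball f"
  unfolding holomorphic_in_ball_cdiff
proof
  fix z0 :: "complex ^ 'a" assume "z0 \<in> unit_ball"
  then have z0: "norm z0 < 1" by simp
  have series: "homogeneous_series \<phi>" and sums: "\<And>z. norm z < 1 \<Longrightarrow> (\<lambda>k. \<phi> k z) sums f z"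
    using assms by (auto simp: expansion_of_def)
  define r where "r = (norm z0 + 1) / 2"
  define r' where "r' = (r + 1) / 2"
  define R where "R = (r' + 1) / 2"
  obtain x where x: "norm z0 = x" "0 \<le> x" "x < 1" using z0 by auto
  have r: "norm z0 < r" "0 < r" "r < r'" "r' < R" "R < 1" "0 < r'"
    unfolding r_def r'_def R_def x(1) atomize_conj
    by (insert x(2,3)) (intro conjI; argo)
  obtain M where M: "M \<ge> 0" "\<And>k z. norm (\<phi> k z) \<le> M * (norm z / R) ^ k"
    using homogeneous_series_bound[OF series, of R] r by (meson order_less_trans)
  define q where "q = r' / R"
  define \<delta> where "\<delta> = r' - r"
  have q: "0 \<le> q" "q < 1" using r by (auto simp: q_def)
  have \<delta>: "\<delta> > 0" using r by (simp add: \<delta>_def)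
  have hp: "homogeneous_poly k (\<phi> k)" for k
    using series unfolding homogeneous_series_def by blast
  define D where "D = (\<lambda>k z. SOME D. (\<phi> k has_derivative D) (at z) \<and> (\<forall>c v. D (c *s v) = c * D v))"
  have D: "(\<phi> k has_derivative D k z) (at z)" "D k z (c *s v) = c * D k z v" for k z c v
    using someI_ex[OF cdiff_at_homogeneous_poly[OF hp[of k], of z, unfolded cdiff_at_def]]
    unfolding D_def by blast+
  have Db: "norm (D k z u) \<le> M / \<delta> * q ^ k * norm u" if z: "norm z < r" for k z u
  proof (cases "u = 0")
    case True
    have "D k z (0 *s u) = 0" unfolding D(2) by simp
    then show ?thesis using True by simp
  next
    case False
    let ?g = "\<lambda>\<mu>. \<phi> k (z + \<mu> *s u)"
    have g: "(?g has_field_derivative D k (z + \<mu> *s u) u) (at \<mu>)" for \<mu>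
      by (rule has_field_derivative_line[OF D])
    have hol: "?g holomorphic_on A" for A
      using g unfolding holomorphic_on_def field_differentiable_def by (blast intro: has_field_derivative_at_within)
    let ?\<rho> = "\<delta> / norm u"
    have "norm ((deriv ^^ 1) ?g 0) \<le> fact 1 * (M * q ^ k) / ?\<rho> ^ 1"
    proof (rule Cauchy_inequality)
      show "norm (?g \<mu>) \<le> M * q ^ k" if "norm (0 - \<mu>) = ?\<rho>" for \<mu>
      proof -
        have "norm (z + \<mu> *s u) \<le> norm z + norm \<mu> * norm u"
          by (metis norm_triangle_ineq norm_vector_smult)
        also have "\<dots> \<le> r + \<delta>" using that z False by simp
        finally have "norm (z + \<mu> *s u) \<le> r'" by (simp add: \<delta>_def)
        then have "M * (norm (z + \<mu> *s u) / R) ^ k \<le> M * q ^ k"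
          using M(1) r by (intro mult_left_mono power_mono) (auto simp: q_def divide_right_mono)
        then show ?thesis using M(2)[of k "z + \<mu> *s u"] by linarith
      qed
    qed (use \<delta> False in \<open>auto intro: hol holomorphic_on_imp_continuous_on\<close>)
    moreover have "deriv ?g 0 = D k z u"
      using g[of 0] by (intro DERIV_imp_deriv) simp
    ultimately show ?thesis using \<delta> False by (simp add: field_simps)
  qed
  have sD: "summable (\<lambda>k. norm (D k z u))" if "norm z < r" for z u
    by (rule summable_comparison_test'[where g="\<lambda>k. M / \<delta> * q ^ k * norm u" and N=0])
       (use Db[OF that] q in \<open>auto intro!: summable_mult summable_mult2 summable_geometric\<close>)
  define D' where "D' = (\<lambda>z u. \<Sum>k. D k z u)"
  have tail: "norm ((\<Sum>i<n. D i z u) - D' z u) \<le> M / \<delta> / (1 - q) * q ^ n * norm u" if z: "norm z < r" for n z u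
  proof -
    have "D' z u - (\<Sum>i<n. D i z u) = (\<Sum>i. D (i + n) z u)"
      unfolding D'_def by (subst suminf_split_initial_segment[where k=n], rule summable_norm_cancel[OF sD[OF z]]) simp
    also have "norm \<dots> \<le> (\<Sum>i. norm (D (i + n) z u))"
      by (rule summable_norm) (rule summable_ignore_initial_segment[OF sD[OF z]])
    also have "\<dots> \<le> (\<Sum>i. M / \<delta> * q ^ n * norm u * q ^ i)"
    proof (rule suminf_le)
      show "norm (D (i + n) z u) \<le> M / \<delta> * q ^ n * norm u * q ^ i" for i
        using Db[OF z, of "i + n" u] by (simp add: power_add mult_ac)
      show "summable (\<lambda>i. norm (D (i + n) z u))" 
        by (rule summable_ignore_initial_segment[OF sD[OF z]])
      show "summable (\<lambda>i. M / \<delta> * q ^ n * norm u * q ^ i)" using q by (intro summable_mult summable_geometric) auto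
    qed
    also have "\<dots> = M / \<delta> * q ^ n * norm u * (1 / (1 - q))"
      using q by (subst suminf_mult) (auto simp: suminf_geometric)
    finally show ?thesis by (simp add: norm_minus_commute mult_ac)
  qed
  have "\<exists>g. \<forall>z\<in>ball 0 r. (\<lambda>k. \<phi> k z) sums g z \<and> (g has_derivative D' z) (at z within ball 0 r)"
  proof (rule has_derivative_series)
    show "convex (ball (0::complex ^ 'a) r)" by simp
    show "(\<phi> k has_derivative D k z) (at z within ball 0 r)" for k z
      using D(1) by (rule has_derivative_at_withinI)
    show "(0::complex ^ 'a) \<in> ball 0 r" using r by simp
    show "(\<lambda>k. \<phi> k 0) sums f 0" by (rule sums) simp
    fix e :: real assume e: "0 < e"
    have "(\<lambda>n. M / \<delta> / (1 - q) * q ^ n) \<longlonglongrightarrow> M / \<delta> / (1 - q) * 0"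
      using q by (intro tendsto_intros LIMSEQ_power_zero) auto
    then have "\<forall>\<^sub>F n in sequentially. M / \<delta> / (1 - q) * q ^ n < e"
      using e by (intro order_tendstoD(2)[where y=0]) auto
    then show "\<forall>\<^sub>F n in sequentially. \<forall>z\<in>ball 0 r. \<forall>u. norm ((\<Sum>i<n. D i z u) - D' z u) \<le> e * norm u"
    proof eventually_elim
      case (elim n)
      show ?case
      proof (intro ballI allI)
        fix z u :: "complex ^ 'a" assume "z \<in> ball 0 r"
        then have "norm ((\<Sum>i<n. D i z u) - D' z u) \<le> M / \<delta> / (1 - q) * q ^ n * norm u"
          by (intro tail) simp
        also have "\<dots> \<le> e * norm u" using elim by (intro mult_right_mono) auto
        finally show "norm ((\<Sum>i<n. D i z u) - D' z u) \<le> e * norm u" .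
      qed
    qed
  qed
  then obtain g where g': "\<forall>z\<in>ball 0 r. (\<lambda>k. \<phi> k z) sums g z \<and> (g has_derivative D' z) (at z within ball 0 r)"
    by blast
  have g: "(\<lambda>k. \<phi> k z) sums g z" "(g has_derivative D' z) (at z within ball 0 r)" if "norm z < r" for z
    using bspec[OF g', of z] that unfolding mem_ball_0 by blast+
  have "g z = f z" if "norm z < r" for z
    by (rule sums_unique2[OF g(1)[OF that] sums]) (use that r in linarith)
  moreover have "(g has_derivative D' z0) (at z0)"
  proof -
    have "z0 \<in> ball 0 r" using r(1) by simp
    then have "at z0 within ball 0 r = at z0" by (rule at_within_open) simp
    then show ?thesis using g(2)[OF r(1)] by (simp only:)
  qed
  ultimately have "(f has_derivative D' z0) (at z0)"
    using has_derivative_transform_within_open[of g "D' z0" z0 UNIV "ball 0 r" f] r(1) by simp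
  moreover have "D' z0 (c *s v) = c * D' z0 v" for c v
    unfolding D'_def D(2) using summable_norm_cancel[OF sD[OF r(1)]] by (rule suminf_mult)
  ultimately show "cdiff_at f z0" unfolding cdiff_at_def by blast
qed

text \<open>On a slice the two expansions are power series in one variable with the same sum.\<close>

lemma homogeneous_sums_unique:
  assumes a: "\<And>k. homogeneous_poly k (a k)" "\<And>z. z \<in> unit_ball \<Longrightarrow> (\<lambda>k. a k z) sums f z"
    and b: "\<And>k. homogeneous_poly k (b k)" "\<And>z. z \<in> unit_ball \<Longrightarrow> (\<lambda>k. b k z) sums f z"
  shows "a = b"
proof (intro ext)
  fix k and z :: "complex ^ 'a"
  define c where "c = complex_of_real (1 / (2 * (norm z + 1)))"
  have c: "c \<noteq> 0" and cz: "norm (c *s z) < 1"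
  proof -
    have "norm z + 1 > 0" by (rule add_nonneg_pos) simp_all
    then have p: "2 * (norm z + 1) > 0" by simp
    then show "c \<noteq> 0" unfolding c_def of_real_eq_0_iff by simp
    have "norm c = 1 / (2 * (norm z + 1))" unfolding c_def norm_of_real using p by simp
    then have "norm (c *s z) = norm z / (2 * (norm z + 1))" by simp
    also have "\<dots> < 1" using p by (subst divide_less_eq_1_pos) (auto intro: le_less_trans[of _ "2 * norm z"])
    finally show "norm (c *s z) < 1" .
  qed
  define F G where "F = Abs_fps (\<lambda>k. a k (c *s z))" and "G = Abs_fps (\<lambda>k. b k (c *s z))"
  have sums: "(\<lambda>k. a k (c *s z) * \<mu> ^ k) sums f (\<mu> *s (c *s z))" "(\<lambda>k. b k (c *s z) * \<mu> ^ k) sums f (\<mu> *s (c *s z))"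
    if "norm \<mu> \<le> 1" for \<mu>
  proof -
    have "norm \<mu> * norm (c *s z) \<le> 1 * norm (c *s z)" using that by (intro mult_right_mono) auto
    then have "norm (\<mu> *s (c *s z)) < 1" using cz unfolding norm_vector_smult[of \<mu>] by linarith
    then have "\<mu> *s (c *s z) \<in> unit_ball" unfolding mem_ball_0 .
    from a(2)[OF this] b(2)[OF this] show "(\<lambda>k. a k (c *s z) * \<mu> ^ k) sums f (\<mu> *s (c *s z))" "(\<lambda>k. b k (c *s z) * \<mu> ^ k) sums f (\<mu> *s (c *s z))"
      unfolding homogeneous_poly_smult[OF a(1), of _ \<mu>] homogeneous_poly_smult[OF b(1), of _ \<mu>]
      by (simp_all add: mult.commute)
  qed
  have "fps_conv_radius F \<ge> norm (1::complex)" "fps_conv_radius G \<ge> norm (1::complex)"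
    unfolding fps_conv_radius_def F_def G_def
    using sums[of 1] by (intro conv_radius_geI; simp add: sums_iff)+
  then have "fps_conv_radius F > 0" "fps_conv_radius G > 0"
    by (auto intro: less_le_trans[of 0 "ereal 1"] simp: one_ereal_def)
  moreover have "\<forall>\<^sub>F \<mu> in nhds 0. eval_fps F \<mu> = eval_fps G \<mu>"
  proof -
    have "\<forall>\<^sub>F \<mu> in nhds (0::complex). \<mu> \<in> ball 0 1" by (intro eventually_nhds_in_open) auto
    then show ?thesis
    proof eventually_elim
      case (elim \<mu>)
      then have "norm \<mu> \<le> 1" by simp
      from sums[OF this] show ?case by (simp add: eval_fps_def F_def G_def sums_iff)
    qed
  qed
  ultimately have "F = G" by (rule eval_fps_eqD)
  then have "a k (c *s z) = b k (c *s z)" by (metis F_def G_def fps_nth_Abs_fps)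
  then show "a k z = b k z"
    using c by (simp add: homogeneous_poly_smult[OF a(1)] homogeneous_poly_smult[OF b(1)])
qed

lemma homogeneous_expansion_eq:
  assumes "expansion_of f \<phi>"
  shows "homogeneous_expansion f = \<phi>"
  unfolding homogeneous_expansion_def
  using assms homogeneous_sums_unique[of _ f \<phi>]
  by (intro the_equality) (auto simp: expansion_of_def homogeneous_series_def)

lemma expansion_of_unique: "expansion_of f \<phi> \<Longrightarrow> expansion_of f \<psi> \<Longrightarrow> \<phi> = \<psi>"
  by (metis homogeneous_expansion_eq)

lemma expansion_of_slice_coeff_eq: "expansion_of f \<phi> \<Longrightarrow> slice_coeff f = \<phi>"
  using expansion_of_unique expansion_of_slice_coeff expansion_imp_holomorphic by blast

lemma expansion_of_0: "expansion_of f \<phi> \<Longrightarrow> \<phi> 0 z = f 0"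
  using expansion_of_slice_coeff_eq slice_coeff_0 by metis

lemma expansion_of_add:
  assumes "expansion_of f \<phi>" "expansion_of g \<psi>"
  shows "expansion_of (\<lambda>z. f z + g z) (\<lambda>k z. \<phi> k z + \<psi> k z)"
  unfolding expansion_of_def homogeneous_series_def
proof (intro conjI allI impI ballI)
  show "homogeneous_poly k (\<lambda>z. \<phi> k z + \<psi> k z)" for k
    using assms by (intro homogeneous_poly_add) (auto simp: expansion_of_def homogeneous_series_def)
  fix r :: real assume r: "0 < r" "r < 1"
  obtain M N where "\<And>k z. norm z \<le> r \<Longrightarrow> norm (\<phi> k z) \<le> M" "\<And>k z. norm z \<le> r \<Longrightarrow> norm (\<psi> k z) \<le> N"
    using assms r unfolding expansion_of_def homogeneous_series_def by meson
  then have "norm (\<phi> k z + \<psi> k z) \<le> M + N" if "norm z \<le> r" for k z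
    using that by (intro norm_triangle_mono)
  then show "\<exists>M. \<forall>k z. norm z \<le> r \<longrightarrow> norm (\<phi> k z + \<psi> k z) \<le> M" by blast
next
  show "(\<lambda>k. \<phi> k z + \<psi> k z) sums (f z + g z)" if "z \<in> unit_ball" for z
    using assms that by (intro sums_add) (auto simp: expansion_of_def)
qed

lemma homogeneous_series_multiplier:
  assumes \<phi>: "homogeneous_series \<phi>" and d: "subexponential d"
  shows "homogeneous_series (\<lambda>k z. d k * \<phi> k z)"
  unfolding homogeneous_series_def
proof (intro conjI allI impI)
  show "homogeneous_poly k (\<lambda>z. d k * \<phi> k z)" for k
    using \<phi> by (intro homogeneous_poly_mult) (simp add: homogeneous_series_def)
  fix r :: real assume r: "0 < r" "r < 1"
  define R where "R = (r + 1) / 2"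
  have R: "r < R" "R < 1" "0 < R" using r by (auto simp: R_def)
  obtain M where M: "M \<ge> 0" "\<And>k z. norm (\<phi> k z) \<le> M * (norm z / R) ^ k"
    using homogeneous_series_bound[OF \<phi> R(3,2)] by blast
  have "0 < r / R" "r / R < 1" using r R by auto
  then obtain N where N: "\<And>k. norm (d k) * (r / R) ^ k \<le> N"
    using d unfolding subexponential_def by meson
  have "norm (d k * \<phi> k z) \<le> M * N" if "norm z \<le> r" for k z
  proof -
    have "norm (\<phi> k z) \<le> M * (r / R) ^ k"
      using M(2)[of k z] mult_left_mono[OF power_mono[of "norm z / R" "r / R" k] M(1)] that R
      by (simp add: divide_right_mono)
    then have "norm (d k * \<phi> k z) \<le> norm (d k) * (M * (r / R) ^ k)"
      unfolding norm_mult by (intro mult_left_mono) auto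
    also have "\<dots> = M * (norm (d k) * (r / R) ^ k)" by simp
    also have "\<dots> \<le> M * N" using N M(1) by (intro mult_left_mono)
    finally show ?thesis .
  qed
  then show "\<exists>M. \<forall>k z. norm z \<le> r \<longrightarrow> norm (d k * \<phi> k z) \<le> M" by blast
qed

lemma expansion_of_series:
  assumes "homogeneous_series \<phi>" and "\<And>z. z \<in> unit_ball \<Longrightarrow> f z = (\<Sum>k. \<phi> k z)"
  shows "expansion_of f \<phi>"
  unfolding expansion_of_def
proof (intro conjI ballI)
  fix z :: "complex ^ 'a" assume z: "z \<in> unit_ball"
  then have "summable (\<lambda>k. \<phi> k z)"
    by (intro summable_norm_cancel[OF homogeneous_series_summable[OF assms(1)]]) simp
  then show "(\<lambda>k. \<phi> k z) sums f z"
    unfolding assms(2)[OF z] by (rule summable_sums)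
qed (rule assms(1))

lemma subexponential_mult:
  assumes "subexponential d" "subexponential e"
  shows "subexponential (\<lambda>k. d k * e k)"
  unfolding subexponential_def
proof (intro allI impI)
  fix r :: real assume r: "0 < r" "r < 1"
  then have "0 < sqrt r" "sqrt r < 1" by auto
  then obtain M N where MN: "\<And>k. norm (d k) * sqrt r ^ k \<le> M" "\<And>k. norm (e k) * sqrt r ^ k \<le> N"
    using assms unfolding subexponential_def by meson
  have "norm (d k * e k) * r ^ k \<le> M * N" for k
  proof -
    have "r ^ k = sqrt r ^ k * sqrt r ^ k" using r by (simp flip: power_mult_distrib)
    then have "norm (d k * e k) * r ^ k = (norm (d k) * sqrt r ^ k) * (norm (e k) * sqrt r ^ k)"
      by (simp add: norm_mult)
    also have "\<dots> \<le> M * N"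
      using MN(1)[of k] MN(2)[of k] r order_trans[OF _ MN(1)[of k], of 0] by (intro mult_mono) auto
    finally show ?thesis .
  qed
  then show "\<exists>M. \<forall>k. norm (d k * e k) * r ^ k \<le> M" by blast
qed

lemma subexponential_summable:
  assumes "\<And>r. 0 < r \<Longrightarrow> r < 1 \<Longrightarrow> summable (\<lambda>k. norm (d k) * r ^ k)"
  shows "subexponential d"
  unfolding subexponential_def
proof (intro allI impI)
  fix r :: real assume r: "0 < r" "r < 1"
  have "Bseq (\<lambda>k. norm (d k) * r ^ k)"
    using assms[OF r] summable_LIMSEQ_zero convergent_imp_Bseq convergent_def by blast
  then obtain M where "\<And>k. norm (norm (d k) * r ^ k) \<le> M" unfolding Bseq_def by blast
  then show "\<exists>M. \<forall>k. norm (d k) * r ^ k \<le> M" using abs_le_D1 real_norm_def by metis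
qed

lemma subexponential_ratio:
  assumes lim: "(\<lambda>k. norm (d (Suc k)) / norm (d k)) \<longlonglongrightarrow> 1" and nz: "\<And>k. d k \<noteq> 0"
  shows "subexponential d"
proof (rule subexponential_summable)
  fix r :: real assume r: "0 < r" "r < 1"
  define c where "c = (1 + r) / 2"
  have c: "r < c" "c < 1" using r by (auto simp: c_def)
  have "1 < c / r" using r c by simp
  from order_tendstoD(2)[OF lim this] obtain N where N: "\<And>k. k \<ge> N \<Longrightarrow> norm (d (Suc k)) / norm (d k) < c / r"
    unfolding eventually_sequentially by blast
  show "summable (\<lambda>k. norm (d k) * r ^ k)"
  proof (rule summable_ratio_test[OF c(2)])
    fix k assume "N \<le> k"
    from N[OF this] have "norm (d (Suc k)) * r \<le> c * norm (d k)"
      using r nz[of k] by (simp add: field_simps)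
    then have "norm (d (Suc k)) * r * r ^ k \<le> c * norm (d k) * r ^ k"
      using r by (intro mult_right_mono) auto
    then show "norm (norm (d (Suc k)) * r ^ Suc k) \<le> c * norm (norm (d k) * r ^ k)"
      using r by (simp add: mult_ac)
  qed
qed

lemma subexponential_of_nat: "subexponential of_nat"
  unfolding subexponential_def
proof (intro allI impI)
  fix r :: real assume r: "0 < r" "r < 1"
  then have "(\<lambda>k. of_nat k * r ^ k) \<longlonglongrightarrow> 0" by (intro powser_times_n_limit_0) auto
  then have "Bseq (\<lambda>k. of_nat k * r ^ k)" using convergent_imp_Bseq convergent_def by blast
  then obtain M where "\<And>k. norm (of_nat k * r ^ k) \<le> M" unfolding Bseq_def by blast
  then show "\<exists>M. \<forall>k. norm (of_nat k :: complex) * r ^ k \<le> M" using abs_le_D1 real_norm_def norm_of_nat by metis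
qed

text \<open>Euler's identity: the radial derivative is the derivative along the slice through the point.\<close>

lemma expansion_of_radial_deriv:
  assumes f: "expansion_of f \<phi>"
  shows "expansion_of (radial_deriv f) (\<lambda>k z. of_nat k * \<phi> k z)"
  unfolding expansion_of_def
proof (intro conjI ballI)
  have hp: "homogeneous_poly k (\<phi> k)" for k
    using f by (simp add: expansion_of_def homogeneous_series_def)
  show ser: "homogeneous_series (\<lambda>k z. of_nat k * \<phi> k z)"
    using f by (intro homogeneous_series_multiplier subexponential_of_nat) (simp add: expansion_of_def)
  fix z :: "complex ^ 'a" assume z: "z \<in> unit_ball"
  obtain D where D: "(f has_derivative D) (at z)" "\<And>c v. D (c *s v) = c * D v"
    using expansion_imp_holomorphic[OF f] z unfolding holomorphic_in_ball_def by blast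
  have lin: "linear D" using D(1) by (rule has_derivative_linear)
  have pd: "partial_deriv i f z = D (axis i 1)" for i
  proof -
    have "((\<lambda>\<mu>. f ((z - (z $ i) *s axis i 1) + \<mu> *s axis i 1)) has_field_derivative D (axis i 1)) (at (z $ i))"
      by (rule has_field_derivative_line) (use D in simp_all)
    moreover have "(\<lambda>\<mu>. f ((z - (z $ i) *s axis i 1) + \<mu> *s axis i 1)) = (\<lambda>w. f (\<chi> j. if j = i then w else z $ j))"
      by (intro ext arg_cong[where f=f]) (simp add: vec_eq_iff axis_def)
    ultimately show ?thesis unfolding partial_deriv_def by (metis DERIV_imp_deriv)
  qed
  have "(\<Sum>i\<in>UNIV. (z $ i) *s axis i 1) = z"
    by (simp add: vec_eq_iff axis_def if_distrib sum.delta cong: if_cong)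
  then have "D z = radial_deriv f z"
    unfolding radial_deriv_def pd D(2)[symmetric] by (metis (no_types, lifting) lin linear_sum sum.cong)
  have "((\<lambda>\<mu>. f (0 + \<mu> *s z)) has_field_derivative D z) (at 1)"
    by (rule has_field_derivative_line) (use D in simp_all)
  then have d1: "((\<lambda>\<mu>. f (\<mu> *s z)) has_field_derivative D z) (at 1)" by simp
  define K where "K = 2 / (1 + norm z)"
  obtain x where x: "norm z = x" "0 \<le> x" "x < 1" using z by auto
  have "1 < K" using x by (auto simp: K_def less_divide_eq)
  have K: "norm \<mu> * norm z < 1" if "norm \<mu> < K" for \<mu> :: complex
  proof -
    have "norm \<mu> * norm z \<le> K * norm z" using that by (intro mult_right_mono) auto
    also have "\<dots> < 1" using x by (simp add: K_def divide_less_eq)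
    finally show ?thesis .
  qed
  have s: "(\<lambda>k. \<phi> k z * \<mu> ^ k) sums f (\<mu> *s z)" if "norm \<mu> < K" for \<mu>
  proof -
    have "\<mu> *s z \<in> unit_ball" using K[OF that] by simp
    then have "(\<lambda>k. \<phi> k (\<mu> *s z)) sums f (\<mu> *s z)" using f unfolding expansion_of_def by blast
    then show ?thesis by (simp add: homogeneous_poly_smult[OF hp] mult.commute)
  qed
  have "((\<lambda>\<mu>. \<Sum>k. \<phi> k z * \<mu> ^ k) has_field_derivative (\<Sum>k. diffs (\<lambda>k. \<phi> k z) k * 1 ^ k)) (at 1)"
    by (rule termdiffs_strong'[where K=K]) (use sums_summable[OF s] \<open>1 < K\<close> in simp_all)
  moreover have "\<forall>\<^sub>F \<mu> in nhds 1. (\<Sum>k. \<phi> k z * \<mu> ^ k) = f (\<mu> *s z)"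
  proof -
    have "\<forall>\<^sub>F \<mu> in nhds (1::complex). \<mu> \<in> ball 0 K" using \<open>1 < K\<close> by (intro eventually_nhds_in_open) auto
    then show ?thesis
    proof eventually_elim
      case (elim \<mu>)
      then have "norm \<mu> < K" by simp
      from s[OF this] show ?case by (rule sums_unique[symmetric])
    qed
  qed
  ultimately have "((\<lambda>\<mu>. f (\<mu> *s z)) has_field_derivative (\<Sum>k. diffs (\<lambda>k. \<phi> k z) k * 1 ^ k)) (at 1)"
    by (rule DERIV_cong_ev[OF refl _ refl, THEN iffD1, rotated])
  with d1 have Dz: "D z = (\<Sum>k. diffs (\<lambda>k. \<phi> k z) k * 1 ^ k)" by (rule DERIV_unique)
  have "summable (\<lambda>k. diffs (\<lambda>k. \<phi> k z) k * 1 ^ k)"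
  proof -
    have "summable (\<lambda>k. norm (of_nat k * \<phi> k z))"
      using homogeneous_series_summable[OF ser] z by simp
    then have "summable (\<lambda>k. of_nat k * \<phi> k z)" by (rule summable_norm_cancel)
    then have "summable (\<lambda>k. of_nat (Suc k) * \<phi> (Suc k) z)" by (subst summable_Suc_iff)
    then show ?thesis by (simp add: diffs_def)
  qed
  from diffs_equiv[OF this] show "(\<lambda>k. of_nat k * \<phi> k z) sums radial_deriv f z"
    unfolding Dz[symmetric] \<open>D z = radial_deriv f z\<close> by simp
qed

lemma expansion_of_radial_deriv_funpow:
  "expansion_of f \<phi> \<Longrightarrow> expansion_of ((radial_deriv ^^ N) f) (\<lambda>k z. of_nat k ^ N * \<phi> k z)"
proof (induction N)
  case (Suc N)
  from expansion_of_radial_deriv[OF Suc.IH[OF Suc.prems]] show ?case by (simp add: mult.assoc)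
qed simp

definition multiplier :: "complex \<Rightarrow> complex \<Rightarrow> nat \<Rightarrow> complex" where
  "multiplier a b k = pochhammer a k / pochhammer b k"

lemma pochhammer_neq_0: "a \<notin> \<int>\<^sub>\<le>\<^sub>0 \<Longrightarrow> pochhammer (a::complex) k \<noteq> 0"
  by (auto simp: pochhammer_eq_0_iff)

lemma multiplier_neq_0: "a \<notin> \<int>\<^sub>\<le>\<^sub>0 \<Longrightarrow> b \<notin> \<int>\<^sub>\<le>\<^sub>0 \<Longrightarrow> multiplier a b k \<noteq> 0"
  by (simp add: multiplier_def pochhammer_neq_0)

lemma subexponential_multiplier:
  assumes "a \<notin> \<int>\<^sub>\<le>\<^sub>0" "b \<notin> \<int>\<^sub>\<le>\<^sub>0"
  shows "subexponential (multiplier a b)"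
proof (rule subexponential_ratio)
  have "multiplier a b (Suc k) / multiplier a b k = (a + of_nat k) / (b + of_nat k)" for k
    using pochhammer_neq_0[OF assms(1), of k] pochhammer_neq_0[OF assms(2), of k]
    by (simp add: multiplier_def pochhammer_Suc)
  then have eq: "norm (multiplier a b (Suc k)) / norm (multiplier a b k) = norm ((a + of_nat k) / (b + of_nat k))" for k
    by (metis norm_divide)
  have lim: "(\<lambda>k. c / of_nat k) \<longlonglongrightarrow> 0" for c :: complex
    using tendsto_mult[OF tendsto_const[of c] lim_1_over_n] by simp
  have l1: "(\<lambda>k. (a / of_nat k + 1) / (b / of_nat k + 1)) \<longlonglongrightarrow> (0 + 1) / (0 + 1)"
    by (intro tendsto_intros lim) simp
  have l2: "\<forall>\<^sub>F k in sequentially. (a / of_nat k + 1) / (b / of_nat k + 1) = (a + of_nat k) / (b + of_nat k)"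
    using eventually_gt_at_top[of 0] 
  proof eventually_elim
    case (elim k)
    have "(a / of_nat k + 1) = (a + of_nat k) / of_nat k" "(b / of_nat k + 1) = (b + of_nat k) / of_nat k"
      using elim by (simp_all add: add_divide_distrib)
    then show ?case using elim by simp
  qed
  from tendsto_norm[OF Lim_transform_eventually[OF l1 l2]]
  show "(\<lambda>k. norm (multiplier a b (Suc k)) / norm (multiplier a b k)) \<longlonglongrightarrow> 1"
    unfolding eq by simp
  show "multiplier a b k \<noteq> 0" for k using assms by (rule multiplier_neq_0)
qed

lemma Rst_well_defined_nonpos_Ints:
  assumes "Rst_well_defined n s t"
  shows "of_nat n + 1 + s \<notin> \<int>\<^sub>\<le>\<^sub>0" "of_nat n + 1 + s + t \<notin> \<int>\<^sub>\<le>\<^sub>0"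
proof -
  have ne: "of_nat n + s \<noteq> - of_nat (Suc m)" "of_nat n + s + t \<noteq> - of_nat (Suc m)" for m
    using assms unfolding Rst_well_defined_def by blast+
  show "of_nat n + 1 + s \<notin> \<int>\<^sub>\<le>\<^sub>0"
  proof
    assume "of_nat n + 1 + s \<in> \<int>\<^sub>\<le>\<^sub>0"
    then obtain m where "of_nat n + 1 + s = - of_nat m" by (rule nonpos_Ints_cases')
    moreover have "of_nat n + s = (of_nat n + 1 + s) - 1" by simp
    ultimately have "of_nat n + s = - of_nat (Suc m)" by (simp only:) simp
    then show False using ne(1) by blast
  qed
  show "of_nat n + 1 + s + t \<notin> \<int>\<^sub>\<le>\<^sub>0"
  proof
    assume "of_nat n + 1 + s + t \<in> \<int>\<^sub>\<le>\<^sub>0"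
    then obtain m where "of_nat n + 1 + s + t = - of_nat m" by (rule nonpos_Ints_cases')
    moreover have "of_nat n + s + t = (of_nat n + 1 + s + t) - 1" by simp
    ultimately have "of_nat n + s + t = - of_nat (Suc m)" by (simp only:) simp
    then show False using ne(2) by blast
  qed
qed

text \<open>The quotients of Gamma values are quotients of rising factorials, so the operator is a coefficient multiplier.\<close>

lemma Rst_eq_multiplier:
  fixes f :: "complex ^ 'n \<Rightarrow> complex"
  assumes wd: "Rst_well_defined CARD('n) s t" and f: "expansion_of f \<phi>"
  shows "Rst s t f z = (\<Sum>k. multiplier (of_nat CARD('n) + 1 + s) (of_nat CARD('n) + 1 + s + t) k * \<phi> k z)"
proof -
  let ?a = "of_nat CARD('n) + 1 + s" and ?b = "of_nat CARD('n) + 1 + s + t"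
  have "Gamma ?b * Gamma (of_nat CARD('n) + 1 + of_nat k + s) / (Gamma ?a * Gamma (of_nat CARD('n) + 1 + of_nat k + s + t))
    = multiplier ?a ?b k" for k
    using Rst_well_defined_nonpos_Ints[OF wd]
    by (simp add: multiplier_def pochhammer_Gamma add_ac)
  then show ?thesis
    unfolding Rst_def Let_def homogeneous_expansion_eq[OF f] by simp
qed

section \<open>Reproducing integrals over the ball\<close>

lemma space_vol [simp]: "space (vol :: (complex ^ 'n) measure) = unit_ball"
  by (simp add: vol_def space_restrict_space)

lemma measurable_vol: "f \<in> borel \<rightarrow>\<^sub>M N \<Longrightarrow> f \<in> vol \<rightarrow>\<^sub>M N"
  unfolding vol_def by (rule measurable_restrict_space1) simp

lemma integrable_vol:
  fixes f :: "complex ^ 'n \<Rightarrow> 'b::{banach, second_countable_topology}"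
  shows "integrable vol f \<longleftrightarrow> integrable lborel (\<lambda>w. indicator unit_ball w *\<^sub>R f w)"
  unfolding vol_def by (rule integrable_restrict_space) simp

lemma integral_vol:
  fixes f :: "complex ^ 'n \<Rightarrow> 'b::{banach, second_countable_topology}"
  shows "(LINT w|vol. f w) = (LINT w|lborel. indicator unit_ball w *\<^sub>R f w)"
  unfolding vol_def by (rule integral_restrict_space) simp

lemma sets_vol_finite: "emeasure (vol :: (complex ^ 'n) measure) unit_ball < \<infinity>"
  using emeasure_lborel_ball_finite[of "0 :: complex ^ 'n" 1]
  by (simp add: vol_def emeasure_restrict_space)

lemma finite_measure_vol: "finite_measure (vol :: (complex ^ 'n) measure)"
  using sets_vol_finite[where 'n='n] by (intro finite_measureI) (simp add: less_top)

lemma integral_slice_orthogonal: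
  fixes f h :: "complex ^ 'n \<Rightarrow> complex"
  assumes f: "line_holomorphic 1 f"
    and h[measurable]: "h \<in> borel_measurable borel" and rot: "\<And>\<omega> w. norm \<omega> = 1 \<Longrightarrow> h (\<omega> *s w) = \<omega> ^ j * h w"
    and W[measurable]: "W \<in> borel_measurable borel"
    and int: "integrable vol (\<lambda>w. h w * W ((norm w)\<^sup>2))"
    and intf: "integrable vol (\<lambda>w. f w * cnj (h w) * W ((norm w)\<^sup>2))"
    and ints: "integrable vol (\<lambda>w. slice_coeff f j w * cnj (h w) * W ((norm w)\<^sup>2))"
  shows "(LINT w|vol. f w * cnj (h w) * W ((norm w)\<^sup>2))
    = (LINT w|vol. slice_coeff f j w * cnj (h w) * W ((norm w)\<^sup>2))"
proof -
  define r where "r = (\<lambda>m::nat. 1 - inverse (real (Suc (Suc m))))"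
  have r: "0 < r m" "r m < 1" for m
    by (auto simp: r_def field_simps)
  have lim: "(\<lambda>m. \<integral>w. indicator (ball 0 (r m)) w * H w \<partial>lborel) \<longlonglongrightarrow> (LINT w|vol. H w)"
    if H: "integrable vol H" for H :: "complex ^ 'n \<Rightarrow> complex"
    unfolding integral_vol
  proof (rule integral_dominated_convergence)
    have H': "integrable lborel (\<lambda>w. indicator unit_ball w *\<^sub>R H w)" using H by (simp add: integrable_vol)
    then show "integrable lborel (\<lambda>w. norm (indicator unit_ball w *\<^sub>R H w))" by (rule integrable_norm)
    have [measurable]: "(\<lambda>w. indicator unit_ball w *\<^sub>R H w) \<in> borel_measurable borel"
      using H' by simp
    have eq: "indicator (ball 0 (r m)) w * H w = indicator (ball 0 (r m)) w * (indicator unit_ball w *\<^sub>R H w)" for m w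
      using r(2)[of m] by (simp add: indicator_def)
    show "(\<lambda>w. indicator (ball 0 (r m)) w * H w) \<in> borel_measurable lborel" for m
      unfolding eq using H' by (intro borel_measurable_times borel_measurable_indicator) auto
    show "(\<lambda>w. indicator unit_ball w *\<^sub>R H w) \<in> borel_measurable lborel" using H' by simp
    show "AE w in lborel. norm (indicator (ball 0 (r m)) w * H w) \<le> norm (indicator unit_ball w *\<^sub>R H w)" for m
      using r(2)[of m] by (intro AE_I2) (simp add: indicator_def)
    have r1: "r \<longlonglongrightarrow> 1"
    proof -
      have "(\<lambda>m. 1 - inverse (real (Suc (Suc m)))) \<longlonglongrightarrow> 1 - 0"
        by (rule tendsto_diff[OF tendsto_const LIMSEQ_Suc[OF LIMSEQ_inverse_real_of_nat]])
      then show ?thesis by (simp add: r_def)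
    qed
    show "AE w in lborel. (\<lambda>m. indicator (ball 0 (r m)) w * H w) \<longlonglongrightarrow> indicator unit_ball w *\<^sub>R H w"
    proof (rule AE_I2)
      fix w :: "complex ^ 'n"
      show "(\<lambda>m. indicator (ball 0 (r m)) w * H w) \<longlonglongrightarrow> indicator unit_ball w *\<^sub>R H w"
      proof (cases "norm w < 1")
        case True
        then have "\<forall>\<^sub>F m in sequentially. norm w < r m" by (rule order_tendstoD(1)[OF r1])
        then have "\<forall>\<^sub>F m in sequentially. indicator (ball 0 (r m)) w * H w = indicator unit_ball w *\<^sub>R H w"
          by eventually_elim (simp add: indicator_def True)
        then show ?thesis by (rule tendsto_eventually)
      next
        case False
        have "\<not> norm w < r m" for m using False r(2)[of m] by linarith
        then have "(\<lambda>m. indicator (ball 0 (r m)) w * H w) = (\<lambda>m. 0)" by (auto simp: indicator_def)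
        then show ?thesis using False by (simp add: indicator_def)
      qed
    qed
  qed
  have "(\<integral>w. indicator (ball 0 (r m)) w * (f w * cnj (h w) * W ((norm w)\<^sup>2)) \<partial>lborel)
    = (\<integral>w. indicator (ball 0 (r m)) w * (slice_coeff f j w * cnj (h w) * W ((norm w)\<^sup>2)) \<partial>lborel)" for m
  proof (rule integral_slice_orthogonal_cutoff[OF f r h rot W])
    have "integrable lborel (\<lambda>w. indicator unit_ball w *\<^sub>R (h w * W ((norm w)\<^sup>2)))"
      using int by (simp add: integrable_vol)
    then show "integrable lborel (\<lambda>w. indicator (ball 0 (r m)) w * norm (h w * W ((norm w)\<^sup>2)))"
      by (rule Bochner_Integration.integrable_bound) (use r(2)[of m] in \<open>auto simp: indicator_def\<close>)
  qed
  with lim[OF intf] lim[OF ints] show ?thesis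
    using LIMSEQ_unique by simp
qed

text \<open>The substitution \<open>u = (norm w)\<^sup>2\<close> is built in, so that the moments of \<open>(1 - (norm w)\<^sup>2) powr \<gamma>\<close> are Beta integrals.\<close>

definition radial_moment :: "(real \<Rightarrow> complex) \<Rightarrow> nat \<Rightarrow> complex" where
  "radial_moment \<omega> m = (LINT u|lborel. indicator {0<..<1} u * (of_real u ^ m * \<omega> u))"

text \<open>The value that makes \<open>\<integral> F(w) cip z w ^ k \<omega>((norm w)\<^sup>2)\<close> equal to the moment times the component of \<open>F\<close> of degree \<open>k\<close>; it is obtained by comparison with the Gaussian weight, whose moments are known.\<close>

definition ball_moment :: "'n::finite itself \<Rightarrow> (real \<Rightarrow> complex) \<Rightarrow> nat \<Rightarrow> complex" where
  "ball_moment _ \<omega> k = of_real (gauss_const TYPE('n) * fact k / fact (CARD('n) + k - 1)) * radial_moment \<omega> (CARD('n) + k - 1)"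

lemma (in homogeneous_entire) integral_ball_moment:
  assumes [measurable]: "\<omega> \<in> borel_measurable borel" and int: "integrable vol (\<lambda>w::complex ^ 'n. \<omega> ((norm w)\<^sup>2))"
  shows "(LINT w|vol. \<phi> w * cip z w ^ k * \<omega> ((norm w)\<^sup>2)) = ball_moment TYPE('n) \<omega> k * \<phi> z"
proof -
  let ?n = "CARD('n)"
  define H where "H = (\<lambda>w. \<phi> w * cip z w ^ k)"
  have Hm[measurable]: "H \<in> borel_measurable borel" unfolding H_def by measurable
  have Hhom: "H (t *\<^sub>R w) = of_real (t ^ (2 * k)) * H w" if "0 < t" for t w
  proof -
    have "t *\<^sub>R w = of_real t *s w" unfolding vec_eq_iff by (simp, simp add: scaleR_conv_of_real)
    then have "\<phi> (t *\<^sub>R w) = of_real t ^ k * \<phi> w" using hom by simp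
    then show ?thesis by (simp add: H_def power_mult_distrib power_mult power2_eq_square mult_ac)
  qed
  define A where "A = of_nat ?n * (LINT w|lborel. indicator (ball 0 1) w * H (w /\<^sub>R norm w))"
  obtain M where M: "M \<ge> 0" "\<And>w. norm (\<phi> w) \<le> M * norm w ^ k" using growth_power by blast
  obtain M' where M': "M' \<ge> 0" "\<And>w. norm (\<phi> w) \<le> M' * exp (norm w)" using growth by blast
  have n: "0 < ?n" by simp
  have "(LINT w|lborel. H w * complex_of_real (exp (- ((norm w)\<^sup>2)))) =
     A * (LINT u|lborel. indicator {0<..} u * (of_real u ^ (?n + k - 1) * complex_of_real (exp (- u))))"
    unfolding A_def
  proof (rule integral_polar_homogeneous[OF DIM_complex_vec Hm _ Hhom])
    show "integrable lborel (\<lambda>w. H w * complex_of_real (exp (- ((norm w)\<^sup>2))))"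
    proof (rule integrable_gaussian_growth[OF Hm])
      fix w :: "complex ^ 'n"
      have "norm (cip z w) ^ k \<le> (norm z * norm w) ^ k" by (intro power_mono norm_cip_le) simp
      also have "\<dots> \<le> norm z ^ k * (fact k * exp (norm w))"
        unfolding power_mult_distrib by (intro mult_left_mono power_le_fact_exp) auto
      finally have "norm (H w) \<le> (M' * exp (norm w)) * (norm z ^ k * (fact k * exp (norm w)))"
        unfolding H_def norm_mult norm_power using M' by (intro mult_mono) auto
      also have "\<dots> = (M' * norm z ^ k * fact k) * exp (2 * norm w)"
        unfolding mult_2 exp_add by (simp only: mult_ac)
      finally show "norm (H w) \<le> (M' * norm z ^ k * fact k) * exp (2 * norm w)" .
    qed
  qed measurable
  also have "(LINT w|lborel. H w * complex_of_real (exp (- ((norm w)\<^sup>2)))) = of_real (gauss_const TYPE('n) * fact k) * \<phi> z"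
    unfolding H_def using fock_power by simp
  also have "(LINT u|lborel. indicator {0<..} u * (of_real u ^ (?n + k - 1) * complex_of_real (exp (- u)))) = fact (?n + k - 1)"
  proof -
    have "(\<lambda>u. indicator {0<..} u * (of_real u ^ (?n + k - 1) * complex_of_real (exp (- u))))
       = (\<lambda>u. complex_of_real (indicator {0<..} u * (u ^ (?n + k - 1) * exp (- u))))"
      by (auto simp: indicator_def)
    then have "(LINT u|lborel. indicator {0<..} u * (of_real u ^ (?n + k - 1) * complex_of_real (exp (- u))))
       = of_real (LINT u|lborel. indicator {0<..} u * (u ^ (?n + k - 1) * exp (- u :: real)))"
      by (simp only: integral_complex_of_real)
    also have "(LINT u|lborel. indicator {0<..} u * (u ^ (?n + k - 1) * exp (- u))) = (fact (?n + k - 1) :: real)"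
      by (rule has_bochner_integral_integral_eq[OF Gamma_integral_nat]) simp
    finally show ?thesis by simp
  qed
  finally have A: "A = of_real (gauss_const TYPE('n) * fact k / fact (?n + k - 1)) * \<phi> z"
    by (simp add: field_simps)
  let ?\<omega> = "\<lambda>u. indicator {..<1} u * \<omega> u"
  have ind: "indicator unit_ball w *\<^sub>R x = indicator {..<1} ((norm w)\<^sup>2) * x" for w :: "complex ^ 'n" and x :: complex
    by (simp add: indicator_def power_less_one_iff abs_square_less_1)
  have "(LINT w|vol. \<phi> w * cip z w ^ k * \<omega> ((norm w)\<^sup>2)) = (LINT w|lborel. H w * ?\<omega> ((norm w)\<^sup>2))"
    unfolding integral_vol ind H_def by (simp add: mult_ac)
  also have "\<dots> = A * (LINT u|lborel. indicator {0<..} u * (of_real u ^ (?n + k - 1) * ?\<omega> u))"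
    unfolding A_def
  proof (rule integral_polar_homogeneous[OF DIM_complex_vec Hm _ Hhom])
    have "integrable lborel (\<lambda>w::complex ^ 'n. (M * norm z ^ k) *\<^sub>R (indicator unit_ball w *\<^sub>R \<omega> ((norm w)\<^sup>2)))"
      using int unfolding integrable_vol by (intro integrable_scaleR_right)
    then show "integrable lborel (\<lambda>w. H w * ?\<omega> ((norm w)\<^sup>2))"
    proof (rule Bochner_Integration.integrable_bound)
      show "AE w in lborel. norm (H w * ?\<omega> ((norm w)\<^sup>2)) \<le> norm ((M * norm z ^ k) *\<^sub>R (indicator unit_ball w *\<^sub>R \<omega> ((norm w)\<^sup>2)))"
      proof (rule AE_I2)
        fix w :: "complex ^ 'n"
        show "norm (H w * ?\<omega> ((norm w)\<^sup>2)) \<le> norm ((M * norm z ^ k) *\<^sub>R (indicator unit_ball w *\<^sub>R \<omega> ((norm w)\<^sup>2)))"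
        proof (cases "norm w < 1")
          case True
          have "norm (\<phi> w) \<le> M * 1"
            using M(2)[of w] mult_left_mono[OF power_le_one[of "norm w" k] M(1)] True by simp
          moreover have "norm (cip z w) ^ k \<le> norm z ^ k"
            using norm_cip_le[of z w] mult_left_mono[of "norm w" 1 "norm z"] True by (intro power_mono) auto
          ultimately have "norm (H w) \<le> M * norm z ^ k"
            unfolding H_def norm_mult norm_power using M(1) by (intro mult_mono) auto
          then show ?thesis unfolding ind norm_mult norm_scaleR using M(1)
            by (intro mult_right_mono) auto
        qed (simp add: indicator_def power_less_one_iff abs_square_less_1)
      qed
    qed measurable
  qed measurable
  also have "(LINT u|lborel. indicator {0<..} u * (of_real u ^ (?n + k - 1) * ?\<omega> u)) = radial_moment \<omega> (?n + k - 1)"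
    unfolding radial_moment_def by (intro Bochner_Integration.integral_cong) (auto simp: indicator_def)
  finally show ?thesis unfolding A ball_moment_def by (simp add: mult_ac)
qed

lemma homogeneous_poly_entire: "homogeneous_poly k \<phi> \<Longrightarrow> homogeneous_entire \<phi> k"
  by unfold_locales (auto intro: line_holomorphic_cdiff cdiff_at_homogeneous_poly homogeneous_poly_smult)

text \<open>A radial weight sees, for the kernel \<open>cip z w ^ j\<close>, the component of degree \<open>j\<close> only; the factor is the moment of the weight and does not depend on the function.\<close>

lemma integral_against_cip_power:
  fixes F :: "complex ^ 'n \<Rightarrow> complex"
  assumes F: "expansion_of F \<phi>"
    and [measurable]: "\<omega> \<in> borel_measurable borel" and int\<omega>: "integrable vol (\<lambda>w::complex ^ 'n. \<omega> ((norm w)\<^sup>2))"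
    and intF: "integrable vol (\<lambda>w. F w * \<omega> ((norm w)\<^sup>2))"
  shows "(LINT w|vol. F w * cip z w ^ j * \<omega> ((norm w)\<^sup>2)) = ball_moment TYPE('n) \<omega> j * \<phi> j z"
proof -
  have hp: "homogeneous_poly j (\<phi> j)" using F by (simp add: expansion_of_def homogeneous_series_def)
  interpret homogeneous_entire "\<phi> j" j using hp by (rule homogeneous_poly_entire)
  define h where "h = (\<lambda>w. cip w z ^ j)"
  have [measurable]: "h \<in> borel_measurable borel" unfolding h_def by measurable
  have cnjh: "cnj (h w) = cip z w ^ j" for w by (simp add: h_def cnj_cip)
  have sl: "slice_coeff F j = \<phi> j" using expansion_of_slice_coeff_eq[OF F] by simp
  have h_bd: "norm (h w) \<le> norm z ^ j" if "w \<in> unit_ball" for w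
    using norm_cip_le[of w z] mult_right_mono[of "norm w" 1 "norm z"] that
    unfolding h_def norm_power by (intro power_mono) auto
  obtain M where M: "M \<ge> 0" "\<And>w. norm (\<phi> j w) \<le> M * norm w ^ j" using growth_power by blast
  have \<phi>_bd: "norm (\<phi> j w) \<le> M" if "w \<in> unit_ball" for w
    using M(2)[of w] mult_left_mono[OF power_le_one[of "norm w" j] M(1)] that by simp
  have Fm: "(\<lambda>w. F w * \<omega> ((norm w)\<^sup>2)) \<in> borel_measurable vol" using intF by simp
  have bd: "integrable vol (\<lambda>w. X w * Y w)" if X: "integrable vol X" and Y: "Y \<in> borel_measurable borel"
      and b: "\<And>w. w \<in> unit_ball \<Longrightarrow> norm (Y w) \<le> B" for X Y :: "complex ^ 'n \<Rightarrow> complex" and B :: real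
  proof (rule Bochner_Integration.integrable_bound)
    show "integrable vol (\<lambda>w. B *\<^sub>R X w)" using X by (rule integrable_scaleR_right)
    show "(\<lambda>w. X w * Y w) \<in> borel_measurable vol"
      using X measurable_vol[OF Y] by (intro borel_measurable_times) auto
    show "AE w in vol. norm (X w * Y w) \<le> norm (B *\<^sub>R X w)"
    proof (rule AE_I2)
      fix w :: "complex ^ 'n" assume "w \<in> space vol"
      then have "norm (Y w) \<le> B" by (intro b) simp
      then have "norm (X w) * norm (Y w) \<le> norm (X w) * \<bar>B\<bar>" by (intro mult_left_mono) auto
      then show "norm (X w * Y w) \<le> norm (B *\<^sub>R X w)" by (simp add: norm_mult mult.commute)
    qed
  qed
  have "(LINT w|vol. F w * cnj (h w) * \<omega> ((norm w)\<^sup>2)) = (LINT w|vol. slice_coeff F j w * cnj (h w) * \<omega> ((norm w)\<^sup>2))"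
  proof (rule integral_slice_orthogonal)
    show "line_holomorphic 1 F" by (intro holomorphic_in_ball_line expansion_imp_holomorphic[OF F])
    show "h (\<mu> *s w) = \<mu> ^ j * h w" for \<mu> w by (simp add: h_def power_mult_distrib)
    show "integrable vol (\<lambda>w. h w * \<omega> ((norm w)\<^sup>2))"
      using bd[OF int\<omega>, of h "norm z ^ j"] h_bd by (simp add: mult.commute)
    have "integrable vol (\<lambda>w. F w * \<omega> ((norm w)\<^sup>2) * cnj (h w))"
      by (rule bd[OF intF _ , where B="norm z ^ j"]) (use h_bd in auto)
    then show "integrable vol (\<lambda>w. F w * cnj (h w) * \<omega> ((norm w)\<^sup>2))" by (simp add: mult_ac)
    have "integrable vol (\<lambda>w. \<omega> ((norm w)\<^sup>2) * (\<phi> j w * cnj (h w)))"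
    proof (rule bd[OF int\<omega>, where B="M * norm z ^ j"])
      show "norm (\<phi> j w * cnj (h w)) \<le> M * norm z ^ j" if "w \<in> unit_ball" for w
        unfolding norm_mult using \<phi>_bd[OF that] h_bd[OF that] M(1) by (intro mult_mono) auto
    qed measurable
    then show "integrable vol (\<lambda>w. slice_coeff F j w * cnj (h w) * \<omega> ((norm w)\<^sup>2))" unfolding sl by (simp add: mult_ac)
  qed measurable
  also have "\<dots> = (LINT w|vol. \<phi> j w * cip z w ^ j * \<omega> ((norm w)\<^sup>2))"
    unfolding sl cnjh ..
  also have "\<dots> = ball_moment TYPE('n) \<omega> j * \<phi> j z"
    by (rule integral_ball_moment) (use int\<omega> in auto)
  finally show ?thesis unfolding cnjh .
qed

text \<open>Summing the previous formula over the degrees: a kernel that is a power series in \<open>cip z w\<close> acts as a coefficient multiplier.\<close>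

lemma integral_power_series_kernel:
  fixes F :: "complex ^ 'n \<Rightarrow> complex"
  assumes F: "expansion_of F \<phi>"
    and [measurable]: "\<omega> \<in> borel_measurable borel" and int\<omega>: "integrable vol (\<lambda>w::complex ^ 'n. \<omega> ((norm w)\<^sup>2))"
    and intF: "integrable vol (\<lambda>w. F w * \<omega> ((norm w)\<^sup>2))"
    and d: "\<And>x. norm x < 1 \<Longrightarrow> (\<lambda>j. d j * x ^ j) sums \<kappa> x"
    and z: "z \<in> unit_ball"
  shows "integrable vol (\<lambda>w. F w * \<omega> ((norm w)\<^sup>2) * \<kappa> (cip z w))"
    and "(\<lambda>j. d j * ball_moment TYPE('n) \<omega> j * \<phi> j z) sums (LINT w|vol. F w * \<omega> ((norm w)\<^sup>2) * \<kappa> (cip z w))"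
proof -
  let ?f = "\<lambda>j w. F w * \<omega> ((norm w)\<^sup>2) * (d j * cip z w ^ j)"
  obtain r where r: "norm z < r" "r < 1" using z dense[of "norm z" 1] by auto
  have r0: "0 < r" using r(1) norm_ge_zero[of z] by linarith
  have "summable (\<lambda>j. d j * of_real r ^ j)"
    using d[of "of_real r"] r r0 by (simp add: sums_iff)
  then have sm: "summable (\<lambda>j. norm (d j * of_real (norm z) ^ j))"
    by (rule powser_insidea) (use r r0 in auto)
  define S where "S = (\<Sum>j. norm (d j * of_real (norm z) ^ j))"
  have cz: "norm (cip z w) \<le> norm z" if "w \<in> unit_ball" for w
    using norm_cip_le[of z w] mult_left_mono[of "norm w" 1 "norm z"] that by simp
  note Fm = borel_measurable_integrable[OF intF]
  have cm: "(\<lambda>w. d j * cip z w ^ j) \<in> borel_measurable vol" for j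
    by (rule measurable_vol) measurable
  have m: "?f j \<in> borel_measurable vol" for j
    using Fm cm by (rule borel_measurable_times)
  have s: "(\<lambda>j. ?f j w) sums (F w * \<omega> ((norm w)\<^sup>2) * \<kappa> (cip z w))" if "w \<in> space vol" for w
  proof -
    have "norm (cip z w) < 1" using cz[of w] that r by simp
    then show ?thesis by (intro sums_mult d)
  qed
  have b: "norm (\<Sum>i<n. ?f i w) \<le> S * norm (F w * \<omega> ((norm w)\<^sup>2))" if "w \<in> space vol" for n w
  proof -
    have "norm (\<Sum>i<n. d i * cip z w ^ i) \<le> (\<Sum>i<n. norm (d i * of_real (norm z) ^ i))"
      using cz[of w] that by (intro sum_norm_le) (auto simp: norm_mult norm_power intro!: mult_left_mono power_mono)
    also have "\<dots> \<le> S" unfolding S_def by (intro sum_le_suminf sm) auto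
    finally have "norm (F w * \<omega> ((norm w)\<^sup>2) * (\<Sum>i<n. d i * cip z w ^ i)) \<le> norm (F w * \<omega> ((norm w)\<^sup>2)) * S"
      unfolding norm_mult[of "F w * \<omega> ((norm w)\<^sup>2)"] by (intro mult_left_mono) auto
    then show ?thesis by (simp add: sum_distrib_left mult.commute)
  qed
  have B: "integrable vol (\<lambda>w. S * norm (F w * \<omega> ((norm w)\<^sup>2)))"
    by (intro integrable_mult_right integrable_norm intF)
  show "integrable vol (\<lambda>w. F w * \<omega> ((norm w)\<^sup>2) * \<kappa> (cip z w))"
    by (rule integral_sums_dominated(1)[OF m s b B])
  have "(\<lambda>j. LINT w|vol. ?f j w) sums (LINT w|vol. F w * \<omega> ((norm w)\<^sup>2) * \<kappa> (cip z w))"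
    by (rule integral_sums_dominated(2)[OF m s b B])
  moreover have "(LINT w|vol. ?f j w) = d j * ball_moment TYPE('n) \<omega> j * \<phi> j z" for j
  proof -
    have "(LINT w|vol. ?f j w) = (LINT w|vol. d j * (F w * cip z w ^ j * \<omega> ((norm w)\<^sup>2)))"
      by (simp add: mult_ac)
    also have "\<dots> = d j * (LINT w|vol. F w * cip z w ^ j * \<omega> ((norm w)\<^sup>2))"
      by (rule integral_mult_right_zero)
    also have "\<dots> = d j * ball_moment TYPE('n) \<omega> j * \<phi> j z"
      using integral_against_cip_power[OF F _ int\<omega> intF, of z j] by simp
    finally show ?thesis .
  qed
  ultimately show "(\<lambda>j. d j * ball_moment TYPE('n) \<omega> j * \<phi> j z) sums (LINT w|vol. F w * \<omega> ((norm w)\<^sup>2) * \<kappa> (cip z w))"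
    by simp
qed

section \<open>Beta integrals and the Forelli-Rudin estimate\<close>

lemma radial_moment_powr_real:
  assumes "\<gamma> > -1"
  shows "radial_moment (\<lambda>u. of_real ((1 - u) powr \<gamma>)) m = of_real (fact m * Gamma (\<gamma> + 1) / Gamma (real m + \<gamma> + 2))"
    and "integrable lborel (\<lambda>u. indicator {0<..<1} u * (u ^ m * (1 - u) powr \<gamma>))"
proof -
  have si: "set_integrable lborel {0..1} (\<lambda>t. t powr (real m + 1 - 1) * (1 - t) powr (\<gamma> + 1 - 1))"
    by (rule integrable_Beta) (use assms in auto)
  have AE: "AE u in lborel. indicator {0..1} u *\<^sub>R (u powr (real m + 1 - 1) * (1 - u) powr (\<gamma> + 1 - 1))
      = indicator {0<..<1} u * (u ^ m * (1 - u) powr \<gamma>)"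
    using AE_lborel_singleton[of "0::real"] AE_lborel_singleton[of "1::real"]
    by eventually_elim (auto simp: indicator_def powr_realpow)
  show int: "integrable lborel (\<lambda>u. indicator {0<..<1} u * (u ^ m * (1 - u) powr \<gamma>))"
    using si AE unfolding set_integrable_def by (subst integrable_cong_AE[symmetric]) auto
  have "(LINT u|lborel. indicator {0<..<1} u * (u ^ m * (1 - u) powr \<gamma>))
     = (LINT u|lborel. indicator {0..1} u *\<^sub>R (u powr (real m + 1 - 1) * (1 - u) powr (\<gamma> + 1 - 1)))"
    using AE by (intro integral_cong_AE) auto
  also have "\<dots> = integral {0..1} (\<lambda>t. t powr (real m + 1 - 1) * (1 - t) powr (\<gamma> + 1 - 1))"
    using set_borel_integral_eq_integral(2)[OF si] unfolding set_lebesgue_integral_def .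
  also have "\<dots> = Beta (real m + 1) (\<gamma> + 1)"
    using assms by (intro integral_unique has_integral_Beta_real) auto
  also have "\<dots> = fact m * Gamma (\<gamma> + 1) / Gamma (real m + \<gamma> + 2)"
    using Gamma_fact[of m, where 'a=real] by (simp add: Beta_def add_ac)
  finally have *: "(LINT u|lborel. indicator {0<..<1} u * (u ^ m * (1 - u) powr \<gamma>)) = \<dots>" .
  have "(\<lambda>u. indicator {0<..<1} u * (of_real u ^ m * complex_of_real ((1 - u) powr \<gamma>)))
     = (\<lambda>u. complex_of_real (indicator {0<..<1} u * (u ^ m * (1 - u) powr \<gamma>)))"
    by (auto simp: indicator_def)
  then show "radial_moment (\<lambda>u. of_real ((1 - u) powr \<gamma>)) m = of_real (fact m * Gamma (\<gamma> + 1) / Gamma (real m + \<gamma> + 2))"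
    unfolding radial_moment_def by (simp only: integral_complex_of_real *)
qed

lemma integrable_vol_radial_iff:
  fixes \<psi> :: "real \<Rightarrow> 'b::{banach, second_countable_topology}"
  assumes [measurable]: "\<psi> \<in> borel_measurable borel"
  shows "integrable vol (\<lambda>w::complex ^ 'n. \<psi> ((norm w)\<^sup>2)) \<longleftrightarrow>
    integrable lborel (\<lambda>u. (indicator {0<..<1} u * u ^ (CARD('n) - 1)) *\<^sub>R \<psi> u)"
proof -
  have "integrable vol (\<lambda>w::complex ^ 'n. \<psi> ((norm w)\<^sup>2)) \<longleftrightarrow>
     integrable lborel (\<lambda>w::complex ^ 'n. indicator {..<1} ((norm w)\<^sup>2) *\<^sub>R \<psi> ((norm w)\<^sup>2))"
    unfolding integrable_vol
    by (intro Bochner_Integration.integrable_cong) (auto simp: indicator_def power_less_one_iff abs_square_less_1)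
  also have "\<dots> \<longleftrightarrow> integrable lborel (\<lambda>u. (indicator {0<..} u * u ^ (CARD('n) - 1)) *\<^sub>R (indicator {..<1} u *\<^sub>R \<psi> u))"
    by (rule integrable_radial_iff[OF DIM_complex_vec, of "\<lambda>u. indicator {..<1} u *\<^sub>R \<psi> u"]) measurable
  also have "\<dots> \<longleftrightarrow> integrable lborel (\<lambda>u. (indicator {0<..<1} u * u ^ (CARD('n) - 1)) *\<^sub>R \<psi> u)"
    by (intro Bochner_Integration.integrable_cong) (auto simp: indicator_def)
  finally show ?thesis .
qed

lemma integrable_vol_weight:
  assumes "\<gamma> > -1"
  shows "integrable vol (\<lambda>w::complex ^ 'n. (1 - (norm w)\<^sup>2) powr \<gamma>)"
  using radial_moment_powr_real(2)[OF assms]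
  by (subst integrable_vol_radial_iff[of "\<lambda>u. (1 - u) powr \<gamma>"]) (auto simp: mult.assoc)

text \<open>The Beta integral for a complex exponent, by recursion in \<open>m\<close> through integration by parts. Complex exponents are needed because the parameters of the operators are complex.\<close>

lemma radial_moment_powr_complex:
  assumes "Re b > 0"
  shows "radial_moment (\<lambda>u. of_real (1 - u) powr b) m = fact m / pochhammer (b + 1) (Suc m)"
proof -
  let ?I = "\<lambda>m b. integral {0..1} (\<lambda>u. complex_of_real u ^ m * of_real (1 - u) powr b)"
  have cont: "continuous_on {0..1} (\<lambda>u. complex_of_real u ^ m * of_real (1 - u) powr b)" if "Re b > 0" for m b
    using that by (intro continuous_intros continuous_on_powr_complex) auto
  have step: "((\<lambda>u. of_real (1 - u) powr (b + 1)) has_vector_derivative - ((b + 1) * of_real (1 - x) powr b)) (at x)"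
    if "x < 1" for b :: complex and x :: real
  proof -
    have "((\<lambda>w. (1 - w) powr (b + 1)) has_field_derivative - ((b + 1) * (1 - of_real x) powr b)) (at (complex_of_real x))"
      using that by (auto intro!: derivative_eq_intros simp: complex_nonpos_Reals_iff)
    from has_vector_derivative_real_field[OF this] show ?thesis by simp
  qed
  have I: "?I m b = fact m / pochhammer (b + 1) (Suc m)" if "Re b > 0" for m b
    using that
  proof (induction m arbitrary: b)
    case 0
    have nz: "b + 1 \<noteq> 0"
    proof
      assume "b + 1 = 0" then have "Re (b + 1) = 0" by simp
      then show False using 0 by simp
    qed
    have "((\<lambda>u. - (of_real (1 - u) powr (b + 1)) / (b + 1)) has_vector_derivative of_real (1 - x) powr b) (at x)"
      if "x \<in> {0<..<1}" for x :: real
    proof -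
      have A: "((\<lambda>u. (- inverse (b + 1)) * (of_real (1 - u) powr (b + 1))) has_vector_derivative (- inverse (b + 1)) * (- ((b + 1) * of_real (1 - x) powr b))) (at x)"
        using step[of x b] that by (intro has_vector_derivative_mult_right) auto
      have eq: "(- inverse (b + 1)) * (- ((b + 1) * of_real (1 - x) powr b)) = of_real (1 - x) powr b"
        using nz by (simp add: field_simps)
      show ?thesis using A unfolding eq by (simp add: divide_inverse mult.commute)
    qed
    then have "((\<lambda>u. of_real (1 - u) powr b) has_integral
       (- (of_real (1 - 1) powr (b + 1)) / (b + 1)) - (- (of_real (1 - 0) powr (b + 1)) / (b + 1))) {0..1}"
      using 0 by (intro fundamental_theorem_of_calculus_interior continuous_intros continuous_on_powr_complex) (auto simp: nz)
    then show ?case by (simp add: integral_unique)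
  next
    case (Suc m)
    have nz: "b + 1 \<noteq> 0"
    proof
      assume "b + 1 = 0" then have "Re (b + 1) = 0" by simp
      then show False using Suc.prems by simp
    qed
    let ?G = "\<lambda>u. - inverse (b + 1) * (complex_of_real u ^ Suc m * of_real (1 - u) powr (b + 1))"
    let ?g = "\<lambda>u. complex_of_real u ^ Suc m * of_real (1 - u) powr b - (of_nat (Suc m) / (b + 1)) * (complex_of_real u ^ m * of_real (1 - u) powr (b + 1))"
    have "(?G has_vector_derivative ?g x) (at x)" if x: "x \<in> {0<..<1}" for x :: real
    proof -
      have "((\<lambda>w. w ^ Suc m) has_field_derivative of_nat (Suc m) * of_real x ^ m) (at (complex_of_real x))"
        by (auto intro!: derivative_eq_intros) (cases m; simp add: algebra_simps)
      from has_vector_derivative_real_field[OF this]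
      have "((\<lambda>u. complex_of_real u ^ Suc m) has_vector_derivative of_nat (Suc m) * of_real x ^ m) (at x)" .
      from has_vector_derivative_mult_right[OF has_vector_derivative_mult[OF this step[of x b]], of "- inverse (b + 1)"] x
      have "(?G has_vector_derivative - inverse (b + 1) * (complex_of_real x ^ Suc m * (- ((b + 1) * of_real (1 - x) powr b))
           + of_nat (Suc m) * of_real x ^ m * of_real (1 - x) powr (b + 1))) (at x)" by simp
      moreover have "- inverse (b + 1) * (complex_of_real x ^ Suc m * (- ((b + 1) * of_real (1 - x) powr b))
           + of_nat (Suc m) * of_real x ^ m * of_real (1 - x) powr (b + 1)) = ?g x"
        using nz by (simp add: field_simps)
      ultimately show ?thesis by simp
    qed
    then have "(?g has_integral (?G 1 - ?G 0)) {0..1}"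
      using Suc.prems by (intro fundamental_theorem_of_calculus_interior continuous_intros continuous_on_powr_complex) auto
    then have g0: "(?g has_integral 0) {0..1}" by simp
    have i1: "(\<lambda>u. complex_of_real u ^ Suc m * of_real (1 - u) powr b) integrable_on {0..1}"
      using cont[OF Suc.prems] by (rule integrable_continuous_real)
    have i2: "(\<lambda>u. complex_of_real u ^ m * of_real (1 - u) powr (b + 1)) integrable_on {0..1}"
      using Suc.prems by (intro integrable_continuous_real cont) simp
    have "(?g has_integral (?I (Suc m) b - (of_nat (Suc m) / (b + 1)) * ?I m (b + 1))) {0..1}"
      by (intro has_integral_diff has_integral_mult_right integrable_integral i1 i2)
    from has_integral_unique[OF this g0]
    have "?I (Suc m) b = (of_nat (Suc m) / (b + 1)) * ?I m (b + 1)" by simp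
    also have "?I m (b + 1) = fact m / pochhammer (b + 1 + 1) (Suc m)"
      using Suc.prems by (intro Suc.IH) simp
    finally show ?case by (simp add: pochhammer_rec[of "b + 1" "Suc m"])
  qed
  have si: "set_integrable lborel {0..1} (\<lambda>u. complex_of_real u ^ m * of_real (1 - u) powr b)"
    unfolding set_integrable_def by (rule borel_integrable_compact[OF _ cont[OF assms]]) simp
  have "radial_moment (\<lambda>u. of_real (1 - u) powr b) m
     = (LINT u:{0..1}|lborel. complex_of_real u ^ m * of_real (1 - u) powr b)"
    unfolding radial_moment_def set_lebesgue_integral_def
  proof (rule integral_cong_AE)
    show "AE u in lborel. indicator {0<..<1} u * (of_real u ^ m * of_real (1 - u) powr b)
      = indicator {0..1} u *\<^sub>R (of_real u ^ m * of_real (1 - u) powr b)"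
      using AE_lborel_singleton[of "0::real"] AE_lborel_singleton[of "1::real"]
      by eventually_elim (auto simp: indicator_def)
  qed auto
  also have "\<dots> = ?I m b" by (rule set_borel_integral_eq_integral(2)[OF si])
  also have "\<dots> = fact m / pochhammer (b + 1) (Suc m)" by (rule I[OF assms])
  finally show ?thesis .
qed

text \<open>The moments of the weight with exponent \<open>b\<close> are the reciprocals, up to a constant, of the coefficients of the Bergman kernel with parameter \<open>b\<close>.\<close>

lemma ball_moment_powr_complex:
  assumes "Re b > 0"
  shows "ball_moment TYPE('n::finite) (\<lambda>u. of_real (1 - u) powr b) k =
    of_real (gauss_const TYPE('n)) / pochhammer (b + 1) CARD('n) * (fact k / pochhammer (of_nat CARD('n) + 1 + b) k)"
proof -
  have "Suc (CARD('n) + k - 1) = CARD('n) + k" by simp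
  then show ?thesis
    unfolding ball_moment_def radial_moment_powr_complex[OF assms]
    by (simp only: pochhammer_product'[of "b + 1" "CARD('n)" k]) (simp add: field_simps)
qed

lemma powr_binomial_series:
  fixes x :: complex assumes "norm x < 1"
  shows "(\<lambda>j. pochhammer a j / fact j * x ^ j) sums ((1 - x) powr (- a))"
proof -
  have "(\<lambda>j. (- a gchoose j) * (- x) ^ j) sums (1 + - x) powr (- a)"
    by (rule gen_binomial_complex) (use assms in simp)
  moreover have "(- a gchoose j) * (- x) ^ j = pochhammer a j / fact j * x ^ j" for j
    by (simp add: gbinomial_pochhammer power_minus[of x])
  ultimately show ?thesis by simp
qed

text \<open>Logarithmic convexity of the Gamma function.\<close>

lemma Gamma_midpoint:
  assumes "0 < x" "0 < (y::real)"
  shows "Gamma ((x + y) / 2) ^ 2 \<le> Gamma x * Gamma y"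
proof -
  have m: "0 < (x + y) / 2" using assms by simp
  have "(ln \<circ> Gamma) ((1 - 1/2) *\<^sub>R x + (1/2) *\<^sub>R y) \<le> (1 - 1/2) * (ln \<circ> Gamma) x + (1/2) * (ln \<circ> Gamma) y"
    by (rule convex_onD[OF log_convex_Gamma_real]) (use assms in auto)
  moreover have "(1 - 1/2) *\<^sub>R x + (1/2) *\<^sub>R y = (x + y) / 2" by (simp add: field_simps)
  ultimately have "2 * ln (Gamma ((x + y) / 2)) \<le> ln (Gamma x) + ln (Gamma y)"
    by (simp add: add_divide_distrib)
  also have "\<dots> = ln (Gamma x * Gamma y)" using Gamma_real_pos[OF assms(1)] Gamma_real_pos[OF assms(2)] by (simp add: ln_mult_pos)
  also have "2 * ln (Gamma ((x + y) / 2)) = ln (Gamma ((x + y) / 2) ^ 2)"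
    using Gamma_real_pos[OF m] by (simp add: ln_realpow)
  finally show ?thesis
    using Gamma_real_pos[OF m] Gamma_real_pos[OF assms(1)] Gamma_real_pos[OF assms(2)]
    by (subst (asm) ln_le_cancel_iff) auto
qed

lemma homogeneous_series_cip: 
  assumes z: "norm z \<le> 1" shows "homogeneous_series (\<lambda>k w. cip w z ^ k :: complex)"
  unfolding homogeneous_series_def
proof (intro conjI allI impI)
  fix k
  obtain c :: "('a \<Rightarrow> nat) \<Rightarrow> nat" where "\<And>w z :: complex ^ 'a. cip w z ^ k = (\<Sum>m | (\<Sum>i\<in>UNIV. m i) = k. of_nat (c m) * mon m w * cnj (mon m z))"
    using cip_power_multinomial[where 'n='a] by blast
  then show "homogeneous_poly k (\<lambda>w. cip w z ^ k)"
    unfolding homogeneous_poly_mon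
    by (intro exI[of _ "\<lambda>m. of_nat (c m) * cnj (mon m z)"]) (simp add: mult_ac)
next
  fix r :: real assume r: "0 < r" "r < 1"
  have "norm (cip w z ^ k) \<le> 1" if "norm w \<le> r" for k and w :: "complex ^ 'a"
  proof -
    have "norm w * norm z \<le> 1 * 1" using that r z by (intro mult_mono) auto
    then have "norm (cip w z) \<le> 1" using norm_cip_le[of w z] by linarith
    then show ?thesis by (simp add: norm_power power_le_one)
  qed
  then show "\<exists>M. \<forall>k w. norm (w :: complex ^ 'a) \<le> r \<longrightarrow> norm (cip w z ^ k) \<le> M" by blast
qed

lemma subexponential_sums:
  assumes "\<And>x. norm x < 1 \<Longrightarrow> (\<lambda>j. d j * x ^ j) sums \<kappa> x"
  shows "subexponential d"
proof (rule subexponential_summable)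
  fix r :: real assume r: "0 < r" "r < 1"
  then obtain R where R: "r < R" "R < 1" using dense by blast
  have "summable (\<lambda>j. d j * of_real R ^ j)" using assms[of "of_real R"] r R by (simp add: sums_iff)
  from powser_insidea[OF this, of "of_real r"] show "summable (\<lambda>j. norm (d j) * r ^ j)"
    using r R by (simp add: norm_mult norm_power)
qed

lemma one_minus_cip_nz: "z \<in> unit_ball \<Longrightarrow> w \<in> unit_ball \<Longrightarrow> norm (cip z w) < 1"
  using norm_cip_le[of z w] mult_strict_mono'[of "norm z" 1 "norm w" 1] by auto

text \<open>Writing the kernel as the square of the modulus of a power \<open>(1 - cip z w) powr (- l)\<close> turns the integral into a series with positive terms through the orthogonality of the degrees. Midpoint convexity of the Gamma function compares it with the binomial series of \<open>(1 - (norm z)\<^sup>2) powr (- c)\<close>.\<close>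

lemma Forelli_Rudin:
  assumes \<gamma>: "\<gamma> > -1" and c: "c > 0"
  shows "\<exists>C>0. \<forall>z\<in>(unit_ball :: (complex ^ 'n) set).
    integrable vol (\<lambda>w. (1 - (norm w)\<^sup>2) powr \<gamma> * norm (1 - cip z w) powr (- (real CARD('n) + 1 + \<gamma> + c))) \<and>
    (LINT w|vol. (1 - (norm w)\<^sup>2) powr \<gamma> * norm (1 - cip z w) powr (- (real CARD('n) + 1 + \<gamma> + c)))
      \<le> C * (1 - (norm z)\<^sup>2) powr (- c)"
proof -
  let ?n = "real CARD('n)"
  define l where "l = (?n + 1 + \<gamma> + c) / 2"
  have l: "0 < l" "2 * l = ?n + 1 + \<gamma> + c" using \<gamma> c by (auto simp: l_def)
  define a where "a = (\<lambda>j. complex_of_real (pochhammer l j / fact j))"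
  define \<kappa> where "\<kappa> = (\<lambda>x::complex. (1 - x) powr (- of_real l))"
  have \<kappa>: "(\<lambda>j. a j * x ^ j) sums \<kappa> x" if "norm x < 1" for x
    using powr_binomial_series[OF that, of "of_real l"] by (simp add: a_def \<kappa>_def pochhammer_of_real)
  define G where "G = gauss_const TYPE('n)"
  have G: "G > 0" unfolding G_def by (rule gauss_const_pos)
  define K where "K = G * Gamma (\<gamma> + 1) / (Gamma l)\<^sup>2 * Gamma c"
  have "Gamma l > 0" "Gamma c > 0" "Gamma (\<gamma> + 1) > 0"
    using \<gamma> c l(1) by (simp_all add: Gamma_real_pos)
  then have K: "K > 0" using G by (simp add: K_def)
  define \<omega> where "\<omega> = (\<lambda>u. complex_of_real ((1 - u) powr \<gamma>))"
  have \<omega>m: "\<omega> \<in> borel_measurable borel" unfolding \<omega>_def by measurable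
  have bm: "ball_moment TYPE('n) \<omega> j = of_real (G * fact j * Gamma (\<gamma> + 1) / Gamma (?n + 1 + \<gamma> + real j))" for j
  proof -
    have eq: "real (CARD('n) + j - 1) + \<gamma> + 2 = ?n + 1 + \<gamma> + real j"
      by (simp add: of_nat_diff Suc_le_eq)
    show ?thesis
      unfolding ball_moment_def \<omega>_def radial_moment_powr_real(1)[OF \<gamma>] G_def eq by simp
  qed
  have term_le: "pochhammer l j / fact j * (G * fact j * Gamma (\<gamma> + 1) / Gamma (?n + 1 + \<gamma> + real j)) * (pochhammer l j / fact j)
     \<le> K * (pochhammer c j / fact j)" for j
  proof -
    have nz: "l \<notin> \<int>\<^sub>\<le>\<^sub>0" "c \<notin> \<int>\<^sub>\<le>\<^sub>0" using l(1) c by (auto elim!: nonpos_Ints_cases)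
    have P: "pochhammer l j = Gamma (l + real j) / Gamma l" "pochhammer c j = Gamma (c + real j) / Gamma c"
      using nz by (simp_all add: pochhammer_Gamma)
    have pos: "Gamma l > 0" "Gamma c > 0" "Gamma (?n + 1 + \<gamma> + real j) > 0" "Gamma (\<gamma> + 1) > 0"
      using l c \<gamma> by (auto intro!: Gamma_real_pos)
    have "Gamma (((c + real j) + (?n + 1 + \<gamma> + real j)) / 2) ^ 2 \<le> Gamma (c + real j) * Gamma (?n + 1 + \<gamma> + real j)"
      by (rule Gamma_midpoint) (use c \<gamma> in auto)
    moreover have "((c + real j) + (?n + 1 + \<gamma> + real j)) / 2 = l + real j"
      using l(2) by (simp add: l_def field_simps)
    ultimately have g: "Gamma (l + real j) ^ 2 \<le> Gamma (c + real j) * Gamma (?n + 1 + \<gamma> + real j)" by (simp only:)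
    have "pochhammer l j / fact j * (G * fact j * Gamma (\<gamma> + 1) / Gamma (?n + 1 + \<gamma> + real j)) * (pochhammer l j / fact j)
      = (G * Gamma (\<gamma> + 1) / (Gamma l)\<^sup>2 / fact j / Gamma (?n + 1 + \<gamma> + real j)) * Gamma (l + real j) ^ 2"
      using pos unfolding P by (simp add: power2_eq_square mult_ac)
    also have "\<dots> \<le> (G * Gamma (\<gamma> + 1) / (Gamma l)\<^sup>2 / fact j / Gamma (?n + 1 + \<gamma> + real j)) * (Gamma (c + real j) * Gamma (?n + 1 + \<gamma> + real j))"
      using G pos by (intro mult_left_mono g) auto
    also have "\<dots> = K * (pochhammer c j / fact j)"
      using pos unfolding P K_def by simp
    finally show ?thesis .
  qed
  have "integrable vol (\<lambda>w. (1 - (norm w)\<^sup>2) powr \<gamma> * norm (1 - cip z w) powr (- (?n + 1 + \<gamma> + c))) \<and>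
    (LINT w|vol. (1 - (norm w)\<^sup>2) powr \<gamma> * norm (1 - cip z w) powr (- (?n + 1 + \<gamma> + c)))
      \<le> K * (1 - (norm z)\<^sup>2) powr (- c)" if z: "z \<in> unit_ball" for z :: "complex ^ 'n"
  proof -
    define F where "F = (\<lambda>w. \<kappa> (cip w z))"
    have F: "expansion_of F (\<lambda>j w. a j * cip w z ^ j)"
    proof (rule expansion_of_series)
      show "homogeneous_series (\<lambda>j w. a j * cip w z ^ j)"
        using z by (intro homogeneous_series_multiplier homogeneous_series_cip subexponential_sums[OF \<kappa>]) auto
      show "F w = (\<Sum>j. a j * cip w z ^ j)" if "w \<in> unit_ball" for w
        unfolding F_def using \<kappa>[OF one_minus_cip_nz[OF that z]] by (rule sums_unique)
    qed
    have int\<omega>: "integrable vol (\<lambda>w::complex ^ 'n. \<omega> ((norm w)\<^sup>2))"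
      unfolding \<omega>_def by (intro integrable_of_real integrable_vol_weight \<gamma>)
    define B where "B = (1 - norm z) powr (- l)"
    have Fb: "norm (F w) \<le> B" if "w \<in> unit_ball" for w
    proof -
      have "norm (cip w z) \<le> norm z"
        using norm_cip_le[of w z] mult_right_mono[of "norm w" 1 "norm z"] that by simp
      then have "1 - norm z \<le> norm (1 - cip w z)"
        using norm_triangle_ineq2[of 1 "cip w z"] by simp
      moreover have "norm (F w) = norm (1 - cip w z) powr (- l)"
        unfolding F_def \<kappa>_def by (subst norm_powr_real_powr') auto
      ultimately show ?thesis
        unfolding B_def using z l(1) by (auto intro!: powr_mono2')
    qed
    have Fmeas: "F \<in> borel_measurable vol"
    proof -
      have "(\<lambda>w. \<kappa> (cip w z)) \<in> borel_measurable borel" unfolding \<kappa>_def by measurable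
      then show ?thesis unfolding F_def by (rule measurable_vol)
    qed
    have intF: "integrable vol (\<lambda>w. F w * \<omega> ((norm w)\<^sup>2))"
    proof (rule Bochner_Integration.integrable_bound)
      show "integrable vol (\<lambda>w. B *\<^sub>R \<omega> ((norm (w::complex ^ 'n))\<^sup>2))" by (intro integrable_scaleR_right int\<omega>)
      show "(\<lambda>w. F w * \<omega> ((norm w)\<^sup>2)) \<in> borel_measurable vol"
        using Fmeas int\<omega> by (intro borel_measurable_times) auto
      show "AE w in vol. norm (F w * \<omega> ((norm w)\<^sup>2)) \<le> norm (B *\<^sub>R \<omega> ((norm w)\<^sup>2))"
      proof (rule AE_I2)
        fix w :: "complex ^ 'n" assume "w \<in> space vol"
        then have "norm (F w) \<le> \<bar>B\<bar>" using Fb[of w] by simp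
        then show "norm (F w * \<omega> ((norm w)\<^sup>2)) \<le> norm (B *\<^sub>R \<omega> ((norm w)\<^sup>2))"
          unfolding norm_mult norm_scaleR by (intro mult_right_mono) auto
      qed
    qed
    note REP = integral_power_series_kernel[OF F \<omega>m int\<omega> intF \<kappa> z]
    have prod: "F w * \<omega> ((norm w)\<^sup>2) * \<kappa> (cip z w) = of_real ((1 - (norm w)\<^sup>2) powr \<gamma> * norm (1 - cip z w) powr (- (?n + 1 + \<gamma> + c)))"
      if "w \<in> unit_ball" for w
    proof -
      have n1: "norm (cip z w) < 1" by (rule one_minus_cip_nz[OF z that])
      have "F w = cnj (\<kappa> (cip z w))"
        unfolding F_def \<kappa>_def
        using complex_Re_le_cmod[of "cip z w"] n1 by (subst cnj_powr) (auto simp: cnj_cip)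
      then have "F w * \<kappa> (cip z w) = of_real ((norm (\<kappa> (cip z w)))\<^sup>2)"
        by (simp add: complex_norm_square mult.commute del: of_real_power)
      also have "norm (\<kappa> (cip z w)) = norm (1 - cip z w) powr (- l)"
        unfolding \<kappa>_def by (subst norm_powr_real_powr') auto
      also have "(norm (1 - cip z w) powr (- l))\<^sup>2 = norm (1 - cip z w) powr (- (?n + 1 + \<gamma> + c))"
        unfolding power2_eq_square l(2)[symmetric] by (simp flip: powr_add)
      finally show ?thesis by (simp add: \<omega>_def mult_ac)
    qed
    let ?h = "\<lambda>w. (1 - (norm w)\<^sup>2) powr \<gamma> * norm (1 - cip z w) powr (- (?n + 1 + \<gamma> + c))"
    have "integrable vol (\<lambda>w. complex_of_real (?h w))"
      by (rule Bochner_Integration.integrable_cong[OF refl prod, THEN iffD1, OF _ REP(1)]) simp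
    then have 1: "integrable vol ?h" by (simp only: complex_of_real_integrable_eq)
    have "(LINT w|vol. F w * \<omega> ((norm w)\<^sup>2) * \<kappa> (cip z w)) = (LINT w|vol. complex_of_real (?h w))"
      by (intro Bochner_Integration.integral_cong refl prod) simp
    also have "\<dots> = of_real (LINT w|vol. ?h w)" by (rule integral_complex_of_real)
    finally have "(\<lambda>j. a j * ball_moment TYPE('n) \<omega> j * (a j * cip z z ^ j)) sums of_real (LINT w|vol. ?h w)"
      using REP(2) by simp
    then have "(\<lambda>j. of_real (pochhammer l j / fact j * (G * fact j * Gamma (\<gamma> + 1) / Gamma (?n + 1 + \<gamma> + real j)) * (pochhammer l j / fact j) * ((norm z)\<^sup>2) ^ j)) sums complex_of_real (LINT w|vol. ?h w)"
      unfolding bm a_def cip_self by (simp add: mult_ac)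
    then have s1: "(\<lambda>j. pochhammer l j / fact j * (G * fact j * Gamma (\<gamma> + 1) / Gamma (?n + 1 + \<gamma> + real j)) * (pochhammer l j / fact j) * ((norm z)\<^sup>2) ^ j) sums (LINT w|vol. ?h w)"
      by (simp only: sums_of_real_iff)
    have z2: "(norm z)\<^sup>2 < 1" using z by (simp add: abs_square_less_1)
    have "(\<lambda>j. pochhammer (complex_of_real c) j / fact j * of_real ((norm z)\<^sup>2) ^ j) sums ((1 - of_real ((norm z)\<^sup>2)) powr (- complex_of_real c))"
      by (rule powr_binomial_series) (use z2 in \<open>simp only: norm_of_real abs_power2\<close>)
    moreover have "(1 - of_real ((norm z)\<^sup>2)) powr (- complex_of_real c) = complex_of_real ((1 - (norm z)\<^sup>2) powr (- c))"
      using z2 powr_of_real[of "1 - (norm z)\<^sup>2" "- c"] by simp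
    moreover have "pochhammer (complex_of_real c) j / fact j * of_real ((norm z)\<^sup>2) ^ j = complex_of_real (pochhammer c j / fact j * ((norm z)\<^sup>2) ^ j)" for j
      by (simp add: pochhammer_of_real)
    ultimately have "(\<lambda>j. pochhammer c j / fact j * ((norm z)\<^sup>2) ^ j) sums ((1 - (norm z)\<^sup>2) powr (- c))"
      by (simp only: sums_of_real_iff)
    then have s2: "(\<lambda>j. K * (pochhammer c j / fact j * ((norm z)\<^sup>2) ^ j)) sums (K * (1 - (norm z)\<^sup>2) powr (- c))"
      by (rule sums_mult)
    have "(LINT w|vol. ?h w) \<le> K * (1 - (norm z)\<^sup>2) powr (- c)"
    proof (rule sums_le[OF _ s1 s2])
      show "pochhammer l j / fact j * (G * fact j * Gamma (\<gamma> + 1) / Gamma (?n + 1 + \<gamma> + real j)) * (pochhammer l j / fact j) * ((norm z)\<^sup>2) ^ j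
         \<le> K * (pochhammer c j / fact j * ((norm z)\<^sup>2) ^ j)" for j
        using mult_right_mono[OF term_le[of j], of "((norm z)\<^sup>2) ^ j"] by (simp only: mult.assoc) simp
    qed
    with 1 show ?thesis by blast
  qed
  with K show ?thesis by blast
qed

section \<open>Bergman type operators and the growth of kernels\<close>

lemma Hoelder_integral:
  fixes f g :: "'a \<Rightarrow> real"
  assumes pq: "1 < p" "1 < q" "1 / p + 1 / q = 1"
    and [measurable]: "f \<in> borel_measurable M" "g \<in> borel_measurable M"
    and nn: "\<And>x. 0 \<le> f x" "\<And>x. 0 \<le> g x"
    and f: "integrable M (\<lambda>x. f x powr p)" and g: "integrable M (\<lambda>x. g x powr q)"
  shows "integrable M (\<lambda>x. f x * g x)"
    and "(LINT x|M. f x * g x) \<le> (LINT x|M. f x powr p) powr (1 / p) * (LINT x|M. g x powr q) powr (1 / q)"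
proof -
  have young: "f x * g x \<le> f x powr p / p + g x powr q / q" for x
    by (rule Youngs_inequality) (use pq nn in auto)
  show int: "integrable M (\<lambda>x. f x * g x)"
  proof (rule Bochner_Integration.integrable_bound)
    show "integrable M (\<lambda>x. f x powr p / p + g x powr q / q)" using f g by simp
    show "AE x in M. norm (f x * g x) \<le> norm (f x powr p / p + g x powr q / q)"
    proof (rule AE_I2)
      fix x show "norm (f x * g x) \<le> norm (f x powr p / p + g x powr q / q)"
        using young[of x] nn[of x] by (simp add: abs_mult)
    qed
  qed measurable
  define A B where "A = (LINT x|M. f x powr p)" and "B = (LINT x|M. g x powr q)"
  have AB: "0 \<le> A" "0 \<le> B" by (simp_all add: A_def B_def)
  show "(LINT x|M. f x * g x) \<le> A powr (1 / p) * B powr (1 / q)"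
  proof (cases "A = 0 \<or> B = 0")
    case True
    have "AE x in M. f x * g x = 0"
      using True
    proof
      assume "A = 0"
      then have "AE x in M. f x powr p = 0"
        unfolding A_def using integral_nonneg_eq_0_iff_AE[OF f] by simp
      then show ?thesis by eventually_elim simp
    next
      assume "B = 0"
      then have "AE x in M. g x powr q = 0"
        unfolding B_def using integral_nonneg_eq_0_iff_AE[OF g] by simp
      then show ?thesis by eventually_elim simp
    qed
    then have "(LINT x|M. f x * g x) = (LINT x|M. 0)" by (intro integral_cong_AE) auto
    then show ?thesis by simp
  next
    case False
    define a b where "a = A powr (1 / p)" and "b = B powr (1 / q)"
    have pos: "0 < A" "0 < B" "0 < a" "0 < b" using False AB by (auto simp: a_def b_def)
    have ab: "a powr p = A" "b powr q = B" using pq pos by (auto simp: a_def b_def powr_powr)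
    have "f x * g x / (a * b) \<le> f x powr p / (A * p) + g x powr q / (B * q)" for x
    proof -
      have "(f x / a) * (g x / b) \<le> (f x / a) powr p / p + (g x / b) powr q / q"
        by (rule Youngs_inequality) (use pq nn[of x] pos in auto)
      then show ?thesis using nn[of x] pos by (simp add: powr_divide ab)
    qed
    then have "(LINT x|M. f x * g x / (a * b)) \<le> (LINT x|M. f x powr p / (A * p) + g x powr q / (B * q))"
      using int f g by (intro integral_mono) auto
    also have "\<dots> = A / (A * p) + B / (B * q)" using f g by (simp add: A_def B_def)
    also have "\<dots> = 1" using pos pq by simp
    finally have "(LINT x|M. f x * g x) / (a * b) \<le> 1" by simp
    then show ?thesis using pos by (simp add: divide_le_eq a_def b_def)
  qed
qed

abbreviation bdist :: "complex ^ 'n \<Rightarrow> real" where "bdist z \<equiv> 1 - (norm z)\<^sup>2"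

lemma bdist_pos: "z \<in> unit_ball \<Longrightarrow> 0 < bdist z"
  by (simp add: abs_square_less_1)

lemma norm_one_minus_cip_ge: "z \<in> unit_ball \<Longrightarrow> w \<in> unit_ball \<Longrightarrow> 1 - norm z \<le> norm (1 - cip z w)"
proof -
  assume "z \<in> unit_ball" "w \<in> unit_ball"
  then have "norm (cip z w) \<le> norm z"
    using norm_cip_le[of z w] mult_left_mono[of "norm w" 1 "norm z"] by simp
  then show ?thesis using norm_triangle_ineq2[of 1 "cip z w"] by simp
qed

lemma measurable_id_vol: "(\<lambda>x. x) \<in> vol \<rightarrow>\<^sub>M (borel :: (complex ^ 'n) measure)"
  by (rule measurable_vol) simp

lemma sigma_finite_vol: "sigma_finite_measure (vol :: (complex ^ 'n) measure)"
  using finite_measure_vol by (rule finite_measure.axioms(1))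

lemma integral_le_nn_integral_bound:
  fixes f :: "'a \<Rightarrow> real"
  assumes [measurable]: "f \<in> borel_measurable M" and nn: "\<And>x. 0 \<le> f x"
    and le: "(\<integral>\<^sup>+x. ennreal (f x) \<partial>M) \<le> ennreal C" and C: "0 \<le> C"
  shows "integrable M f" "(LINT x|M. f x) \<le> C"
proof -
  show "integrable M f"
    using le nn by (intro integrableI_nonneg) (auto intro: le_less_trans simp: ennreal_less_top)
  have "(LINT x|M. f x) = enn2real (\<integral>\<^sup>+x. ennreal (f x) \<partial>M)"
    by (rule integral_eq_nn_integral) (use nn in auto)
  also have "\<dots> \<le> C" using enn2real_mono[OF le] C by simp
  finally show "(LINT x|M. f x) \<le> C" .
qed

text \<open>The four conditions put \<open>s\<close> into the intersection of two intervals, which is nonempty exactly because of the two hypotheses on \<open>a\<close> and \<open>b\<close>.\<close>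

lemma Schur_test_exponent:
  fixes p q a b :: real
  assumes pq: "1 < p" "1 < q" "1 / p + 1 / q = 1" and a: "- (1 / p) < a" and b: "- (1 / q) < b"
  obtains s where "- 1 < b - s * q" "0 < a + s * q" "- 1 < a - s * p" "0 < b + s * p"
proof -
  have "max (- a / q) (- b / p) < min ((b + 1) / q) ((a + 1) / p)"
  proof -
    have "- a * (1 / p + 1 / q) < 1 / p" "- b * (1 / p + 1 / q) < 1 / q"
      unfolding pq(3) using a b by simp_all
    then have "- a / q < (a + 1) / p" "- b / p < (b + 1) / q"
      by (simp_all add: add_divide_distrib algebra_simps)
    moreover have "- a / q < (b + 1) / q" "- b / p < (a + 1) / p"
    proof -
      have "- 1 < a + b" using a b pq(3) by linarith
      then show "- a / q < (b + 1) / q" "- b / p < (a + 1) / p"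
        using divide_strict_right_mono[of "- a" "b + 1" q] divide_strict_right_mono[of "- b" "a + 1" p] pq by simp_all
    qed
    ultimately show ?thesis by simp
  qed
  then obtain s where "max (- a / q) (- b / p) < s" "s < min ((b + 1) / q) ((a + 1) / p)"
    using dense by blast
  then have "- a / q < s" "- b / p < s" "s < (b + 1) / q" "s < (a + 1) / p" by auto
  moreover have "0 < q" "0 < p" using pq by auto
  ultimately have "- a < s * q" "- b < s * p" "s * q < b + 1" "s * p < a + 1"
    by (simp_all only: pos_divide_less_eq pos_less_divide_eq)
  then show thesis by (intro that[of s]) auto
qed

text \<open>Schur's test: by Hoelder, with the powers \<open>bdist w powr (- s)\<close> as test functions, two applications of the Forelli-Rudin estimate give the bound, once the exponent \<open>s\<close> is chosen as above.\<close>

lemma Bergman_type_operator_bounded: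
  fixes p q a b :: real
  assumes pq: "1 < p" "1 < q" "1 / p + 1 / q = 1" and a: "- (1 / p) < a" and b: "- (1 / q) < b"
  shows "\<exists>C>0. \<forall>h :: complex ^ 'n \<Rightarrow> real. h \<in> borel_measurable vol \<longrightarrow> (\<forall>w. 0 \<le> h w) \<longrightarrow> integrable vol (\<lambda>w. h w powr p) \<longrightarrow>
    (\<forall>z\<in>unit_ball. integrable vol (\<lambda>w. h w * (bdist w powr b * norm (1 - cip z w) powr (- (real CARD('n) + 1 + a + b))))) \<and>
    integrable vol (\<lambda>z. (bdist z powr a * (LINT w|vol. h w * (bdist w powr b * norm (1 - cip z w) powr (- (real CARD('n) + 1 + a + b))))) powr p) \<and>
    (LINT z|vol. (bdist z powr a * (LINT w|vol. h w * (bdist w powr b * norm (1 - cip z w) powr (- (real CARD('n) + 1 + a + b))))) powr p)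
      \<le> C * (LINT w|vol. h w powr p)"
proof -
  let ?V = "vol :: (complex ^ 'n) measure"
  define m where "m = real CARD('n) + 1 + a + b"
  have m: "0 < m"
  proof -
    have "- 1 < a + b" using a b pq(3) by linarith
    then show ?thesis by (simp add: m_def)
  qed
  obtain s where s: "- 1 < b - s * q" "0 < a + s * q" "- 1 < a - s * p" "0 < b + s * p"
    using Schur_test_exponent[OF pq a b] .
  have m1: "real CARD('n) + 1 + (b - s * q) + (a + s * q) = m" "real CARD('n) + 1 + (a - s * p) + (b + s * p) = m"
    by (simp_all add: m_def)
  define k where "k = (\<lambda>z w :: complex ^ 'n. norm (1 - cip z w) powr (- m))"
  have k_nn: "0 \<le> k z w" for z w by (simp add: k_def)
  have k_sym: "k z w = k w z" for z w
  proof -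
    have "norm (1 - cip z w) = norm (cnj (1 - cip z w))" by (simp only: complex_mod_cnj)
    then show ?thesis by (simp add: k_def cnj_cip)
  qed
  obtain C1 where C1: "C1 > 0" "\<And>z. z \<in> unit_ball \<Longrightarrow> integrable ?V (\<lambda>w. bdist w powr (b - s * q) * k z w)"
     "\<And>z. z \<in> unit_ball \<Longrightarrow> (LINT w|vol. bdist w powr (b - s * q) * k z w) \<le> C1 * bdist z powr (- (a + s * q))"
    using Forelli_Rudin[where 'n='n, OF s(1,2)] unfolding m1 k_def by blast
  obtain C2 where C2: "C2 > 0" "\<And>w. w \<in> unit_ball \<Longrightarrow> integrable ?V (\<lambda>z. bdist z powr (a - s * p) * k w z)"
     "\<And>w. w \<in> unit_ball \<Longrightarrow> (LINT z|vol. bdist z powr (a - s * p) * k w z) \<le> C2 * bdist w powr (- (b + s * p))"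
    using Forelli_Rudin[where 'n='n, OF s(3,4)] unfolding m1 k_def by blast
  interpret V: sigma_finite_measure ?V by (rule sigma_finite_vol)
  interpret VV: pair_sigma_finite ?V ?V ..
  have [measurable]: "fst \<in> ?V \<Otimes>\<^sub>M ?V \<rightarrow>\<^sub>M borel" "snd \<in> ?V \<Otimes>\<^sub>M ?V \<rightarrow>\<^sub>M borel"
    by (rule measurable_compose[OF measurable_fst measurable_id_vol], rule measurable_compose[OF measurable_snd measurable_id_vol])
  have km[measurable]: "(\<lambda>x. k (fst x) (snd x)) \<in> borel_measurable (?V \<Otimes>\<^sub>M ?V)"
  proof -
    have "(\<lambda>x. (fst x, snd x)) \<in> ?V \<Otimes>\<^sub>M ?V \<rightarrow>\<^sub>M (borel \<Otimes>\<^sub>M borel :: ((complex ^ 'n) \<times> (complex ^ 'n)) measure)" by measurable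
    then have "(\<lambda>x. cip (fst x) (snd x)) \<in> borel_measurable (?V \<Otimes>\<^sub>M ?V)"
      using measurable_compose[OF _ borel_measurable_cip_pair] by fastforce
    then show ?thesis unfolding k_def by measurable
  qed
  have kmz[measurable]: "k z \<in> borel_measurable ?V" for z
    unfolding k_def by (rule measurable_vol) measurable
  have bm[measurable]: "(\<lambda>w. bdist w powr c) \<in> borel_measurable ?V" for c
    by (rule measurable_vol) measurable
  let ?C = "C1 powr (p / q) * C2"
  have main: "(\<forall>z\<in>unit_ball. integrable ?V (\<lambda>w. h w * (bdist w powr b * k z w))) \<and>
    integrable ?V (\<lambda>z. (bdist z powr a * (LINT w|vol. h w * (bdist w powr b * k z w))) powr p) \<and>
    (LINT z|vol. (bdist z powr a * (LINT w|vol. h w * (bdist w powr b * k z w))) powr p) \<le> ?C * (LINT w|vol. h w powr p)"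
    if h[measurable]: "h \<in> borel_measurable ?V" and h0: "\<And>w. 0 \<le> h w" and hp: "integrable ?V (\<lambda>w. h w powr p)" for h
  proof -
    have kb: "k z w \<le> (1 - norm z) powr (- m)" if "z \<in> unit_ball" "w \<in> unit_ball" for z w
      unfolding k_def using norm_one_minus_cip_ge[OF that] m that(1) by (intro powr_mono2') auto
    have int1: "integrable ?V (\<lambda>w. bdist w powr (b + s * p) * k z w * h w powr p)" if z: "z \<in> unit_ball" for z
    proof (rule Bochner_Integration.integrable_bound)
      show "integrable ?V (\<lambda>w. (1 - norm z) powr (- m) * h w powr p)" by (intro integrable_mult_right hp)
      show "AE w in ?V. norm (bdist w powr (b + s * p) * k z w * h w powr p) \<le> norm ((1 - norm z) powr (- m) * h w powr p)"
      proof (rule AE_I2)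
        fix w :: "complex ^ 'n" assume "w \<in> space ?V"
        then have w: "w \<in> unit_ball" by simp
        have "bdist w powr (b + s * p) \<le> 1 powr (b + s * p)"
          using s(4) bdist_pos[OF w] by (intro powr_mono2) auto
        then have "bdist w powr (b + s * p) * k z w \<le> 1 * (1 - norm z) powr (- m)"
          using kb[OF z w] k_nn by (intro mult_mono) auto
        then have "bdist w powr (b + s * p) * k z w * h w powr p \<le> (1 - norm z) powr (- m) * h w powr p"
          by (intro mult_right_mono) auto
        then show "norm (bdist w powr (b + s * p) * k z w * h w powr p) \<le> norm ((1 - norm z) powr (- m) * h w powr p)"
          using k_nn[of z w] by (simp add: abs_mult)
      qed
    qed measurable
    define I where "I = (\<lambda>z. LINT w|vol. bdist w powr (b + s * p) * k z w * h w powr p)"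
    define T where "T = (\<lambda>z. LINT w|vol. h w * (bdist w powr b * k z w))"
    have I0: "0 \<le> I z" for z unfolding I_def using k_nn by (intro integral_nonneg_AE AE_I2) auto
    have T0: "0 \<le> T z" for z unfolding T_def using k_nn h0 by (intro integral_nonneg_AE AE_I2) auto
    have hol: "integrable ?V (\<lambda>w. h w * (bdist w powr b * k z w))"
       "T z \<le> I z powr (1 / p) * (C1 * bdist z powr (- (a + s * q))) powr (1 / q)" if z: "z \<in> unit_ball" for z
    proof -
      let ?f = "\<lambda>w. (bdist w powr (b + s * p) * k z w) powr (1 / p) * h w"
      let ?g = "\<lambda>w. (bdist w powr (b - s * q) * k z w) powr (1 / q)"
      have fp: "?f w powr p = bdist w powr (b + s * p) * k z w * h w powr p" for w
        using pq h0[of w] k_nn[of z w] by (simp add: powr_mult powr_powr)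
      have gq: "?g w powr q = bdist w powr (b - s * q) * k z w" for w
        using pq k_nn[of z w] by (simp add: powr_powr)
      have fg: "?f w * ?g w = h w * (bdist w powr b * k z w)" if "w \<in> unit_ball" for w
      proof -
        have kpos: "k z w powr (1 / p) * k z w powr (1 / q) = k z w"
          using pq k_nn[of z w] by (simp flip: powr_add)
        have "(b + s * p) * (1 / p) + (b - s * q) * (1 / q) = b * (1 / p + 1 / q)"
          using pq by (simp add: field_simps)
        then have e: "(b + s * p) / p + (b - s * q) / q = b" using pq by simp
        have "bdist w powr ((b + s * p) / p) * bdist w powr ((b - s * q) / q) = bdist w powr b"
          by (simp only: e flip: powr_add)
        then show ?thesis
          using kpos k_nn[of z w] by (simp add: powr_mult powr_powr mult_ac)
      qed
      have H: "integrable ?V (\<lambda>w. ?f w * ?g w)" 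
         "(LINT w|vol. ?f w * ?g w) \<le> (LINT w|vol. ?f w powr p) powr (1 / p) * (LINT w|vol. ?g w powr q) powr (1 / q)"
      proof -
        have m1: "?f \<in> borel_measurable ?V" "?g \<in> borel_measurable ?V" by measurable
        have n1: "\<And>w. 0 \<le> ?f w" "\<And>w. 0 \<le> ?g w" using h0 by auto
        have i1: "integrable ?V (\<lambda>w. ?f w powr p)" unfolding fp by (rule int1[OF z])
        have i2: "integrable ?V (\<lambda>w. ?g w powr q)" unfolding gq by (rule C1(2)[OF z])
        show "integrable ?V (\<lambda>w. ?f w * ?g w)" 
         "(LINT w|vol. ?f w * ?g w) \<le> (LINT w|vol. ?f w powr p) powr (1 / p) * (LINT w|vol. ?g w powr q) powr (1 / q)"
          using Hoelder_integral[OF pq m1 n1 i1 i2] by auto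
      qed
      show "integrable ?V (\<lambda>w. h w * (bdist w powr b * k z w))"
        by (rule Bochner_Integration.integrable_cong[OF refl fg, THEN iffD1, OF _ H(1)]) simp
      have "T z = (LINT w|vol. ?f w * ?g w)"
        unfolding T_def by (rule Bochner_Integration.integral_cong[OF refl fg[symmetric]]) simp
      also note H(2)
      also have "(LINT w|vol. ?f w powr p) powr (1 / p) * (LINT w|vol. ?g w powr q) powr (1 / q)
        \<le> I z powr (1 / p) * (C1 * bdist z powr (- (a + s * q))) powr (1 / q)"
        unfolding fp gq I_def using C1(3)[OF z] k_nn pq
        by (intro mult_left_mono powr_mono2 integral_nonneg_AE AE_I2) auto
      finally show "T z \<le> I z powr (1 / p) * (C1 * bdist z powr (- (a + s * q))) powr (1 / q)" .
    qed
    have pw: "(bdist z powr a * T z) powr p \<le> C1 powr (p / q) * (bdist z powr (a - s * p) * I z)" if z: "z \<in> unit_ball" for z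
    proof -
      have "(bdist z powr a * T z) powr p \<le> (bdist z powr a * (I z powr (1 / p) * (C1 * bdist z powr (- (a + s * q))) powr (1 / q))) powr p"
        using hol(2)[OF z] T0[of z] pq by (intro powr_mono2 mult_left_mono) auto
      also have "\<dots> = C1 powr (p / q) * ((bdist z powr (a * p) * bdist z powr (- (a + s * q) * (p / q))) * I z)"
        using I0[of z] C1(1) pq by (simp add: powr_mult powr_powr mult_ac)
      also have "bdist z powr (a * p) * bdist z powr (- (a + s * q) * (p / q)) = bdist z powr (a - s * p)"
      proof -
        have e1: "p / q = p - 1" using pq by (simp add: field_simps)
        have e2: "s * q * (p / q) = s * p" using pq by simp
        have "(a + s * q) * (p / q) = a * (p - 1) + s * p"
          unfolding distrib_right e2 unfolding e1 ..
        then have "a * p + - (a + s * q) * (p / q) = a - s * p"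
          unfolding mult_minus_left by (simp add: algebra_simps)
        then show ?thesis by (simp flip: powr_add)
      qed
      finally show ?thesis .
    qed
    have Tm[measurable]: "T \<in> borel_measurable ?V"
    proof -
      have "(\<lambda>x. h (snd x) * (bdist (snd x) powr b * k (fst x) (snd x))) \<in> borel_measurable (?V \<Otimes>\<^sub>M ?V)"
        by measurable
      then show ?thesis unfolding T_def by (intro V.borel_measurable_lebesgue_integral) (simp add: case_prod_beta')
    qed
    have Im: "(\<lambda>x. ennreal (bdist (fst x) powr (a - s * p) * (bdist (snd x) powr (b + s * p) * k (fst x) (snd x) * h (snd x) powr p))) \<in> borel_measurable (?V \<Otimes>\<^sub>M ?V)"
      by measurable
    have "(\<integral>\<^sup>+z. ennreal ((bdist z powr a * T z) powr p) \<partial>vol)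
       \<le> (\<integral>\<^sup>+z. ennreal (C1 powr (p / q)) * (\<integral>\<^sup>+w. ennreal (bdist z powr (a - s * p) * (bdist w powr (b + s * p) * k z w * h w powr p)) \<partial>vol) \<partial>vol)"
    proof (rule nn_integral_mono)
      fix z :: "complex ^ 'n" assume "z \<in> space vol"
      then have z: "z \<in> unit_ball" by simp
      have "(\<integral>\<^sup>+w. ennreal (bdist z powr (a - s * p) * (bdist w powr (b + s * p) * k z w * h w powr p)) \<partial>vol) = ennreal (bdist z powr (a - s * p) * I z)"
        unfolding I_def using int1[OF z] k_nn
        by (subst nn_integral_eq_integral) auto
      then show "ennreal ((bdist z powr a * T z) powr p) \<le> ennreal (C1 powr (p / q)) * (\<integral>\<^sup>+w. ennreal (bdist z powr (a - s * p) * (bdist w powr (b + s * p) * k z w * h w powr p)) \<partial>vol)"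
        using pw[OF z] I0[of z] by (simp flip: ennreal_mult)
    qed
    also have "\<dots> = ennreal (C1 powr (p / q)) * (\<integral>\<^sup>+z. (\<integral>\<^sup>+w. ennreal (bdist z powr (a - s * p) * (bdist w powr (b + s * p) * k z w * h w powr p)) \<partial>vol) \<partial>vol)"
      using Im by (intro nn_integral_cmult V.borel_measurable_nn_integral) (simp add: case_prod_beta')
    also have "(\<integral>\<^sup>+z. (\<integral>\<^sup>+w. ennreal (bdist z powr (a - s * p) * (bdist w powr (b + s * p) * k z w * h w powr p)) \<partial>vol) \<partial>vol)
       = (\<integral>\<^sup>+w. (\<integral>\<^sup>+z. ennreal (bdist z powr (a - s * p) * (bdist w powr (b + s * p) * k z w * h w powr p)) \<partial>vol) \<partial>vol)"
      using VV.Fubini'[of "\<lambda>z w. ennreal (bdist z powr (a - s * p) * (bdist w powr (b + s * p) * k z w * h w powr p))"] Im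
      by (simp add: case_prod_beta')
    also have "\<dots> \<le> (\<integral>\<^sup>+w. ennreal (C2 * h w powr p) \<partial>vol)"
    proof (rule nn_integral_mono)
      fix w :: "complex ^ 'n" assume "w \<in> space vol"
      then have w: "w \<in> unit_ball" by simp
      have "(\<integral>\<^sup>+z. ennreal (bdist z powr (a - s * p) * (bdist w powr (b + s * p) * k z w * h w powr p)) \<partial>vol)
         = (\<integral>\<^sup>+z. ennreal ((bdist w powr (b + s * p) * h w powr p) * (bdist z powr (a - s * p) * k w z)) \<partial>vol)"
        by (intro nn_integral_cong) (simp add: k_sym[of w] mult_ac)
      also have "\<dots> = ennreal (LINT z|vol. (bdist w powr (b + s * p) * h w powr p) * (bdist z powr (a - s * p) * k w z))"
        using C2(2)[OF w] k_nn by (intro nn_integral_eq_integral) auto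
      also have "(LINT z|vol. (bdist w powr (b + s * p) * h w powr p) * (bdist z powr (a - s * p) * k w z))
         = (bdist w powr (b + s * p) * h w powr p) * (LINT z|vol. bdist z powr (a - s * p) * k w z)"
        by (rule integral_mult_right_zero)
      also have "\<dots> \<le> (bdist w powr (b + s * p) * h w powr p) * (C2 * bdist w powr (- (b + s * p)))"
        by (intro mult_left_mono C2(3) w) auto
      also have "\<dots> = C2 * h w powr p * (bdist w powr (b + s * p) * bdist w powr (- (b + s * p)))"
        by (simp only: mult_ac)
      also have "bdist w powr (b + s * p) * bdist w powr (- (b + s * p)) = 1"
        using bdist_pos[OF w] by (simp flip: powr_add)
      finally show "(\<integral>\<^sup>+z. ennreal (bdist z powr (a - s * p) * (bdist w powr (b + s * p) * k z w * h w powr p)) \<partial>vol) \<le> ennreal (C2 * h w powr p)"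
        by (simp add: ennreal_leI)
    qed
    also have "\<dots> = ennreal (C2 * (LINT w|vol. h w powr p))"
      using hp C2(1) by (subst nn_integral_eq_integral) auto
    finally have "(\<integral>\<^sup>+z. ennreal ((bdist z powr a * T z) powr p) \<partial>vol) \<le> ennreal (C1 powr (p / q)) * ennreal (C2 * (LINT w|vol. h w powr p))"
      by (simp add: mult_left_mono)
    also have "\<dots> = ennreal (?C * (LINT w|vol. h w powr p))"
      using C2(1) by (simp add: mult.assoc flip: ennreal_mult)
    finally have bound: "(\<integral>\<^sup>+z. ennreal ((bdist z powr a * T z) powr p) \<partial>vol) \<le> ennreal (?C * (LINT w|vol. h w powr p))" .
    have fm: "(\<lambda>z. (bdist z powr a * T z) powr p) \<in> borel_measurable ?V" by measurable
    have C0: "0 \<le> ?C * (LINT w|vol. h w powr p)" using C2(1) by simp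
    have fin: "integrable ?V (\<lambda>z. (bdist z powr a * T z) powr p)" "(LINT z|vol. (bdist z powr a * T z) powr p) \<le> ?C * (LINT w|vol. h w powr p)"
      by (rule integral_le_nn_integral_bound[OF fm _ bound C0], simp)+
    from hol(1) fin show ?thesis unfolding T_def by blast
  qed
  have "?C > 0" using C1(1) C2(1) by simp
  with main show ?thesis unfolding k_def m_def by blast
qed

text \<open>Growth of order \<open>A\<close> at the boundary point 1, for the power series with coefficients \<open>d\<close>.\<close>

definition kernel_order :: "real \<Rightarrow> (nat \<Rightarrow> complex) \<Rightarrow> bool" where
  "kernel_order A d \<longleftrightarrow> (\<exists>C. \<forall>x. norm x < 1 \<longrightarrow>
     summable (\<lambda>j. d j * x ^ j) \<and> norm (\<Sum>j. d j * x ^ j) \<le> C * norm (1 - x) powr (- A))"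

lemma kernel_order_mono:
  assumes "kernel_order A d" "A \<le> A'"
  shows "kernel_order A' d"
proof -
  obtain C where C: "\<And>x. norm x < 1 \<Longrightarrow> summable (\<lambda>j. d j * x ^ j) \<and> norm (\<Sum>j. d j * x ^ j) \<le> C * norm (1 - x) powr (- A)"
    using assms(1) unfolding kernel_order_def by blast
  have "norm (\<Sum>j. d j * x ^ j) \<le> (\<bar>C\<bar> * 2 powr (A' - A)) * norm (1 - x) powr (- A')" if "norm x < 1" for x
  proof -
    have x1: "norm (1 - x) > 0" using that by auto
    have "norm (1 - x) \<le> 2" using norm_triangle_ineq4[of 1 x] that by simp
    then have "norm (1 - x) powr (A' - A) \<le> 2 powr (A' - A)" using assms(2) by (intro powr_mono2) auto
    then have "norm (1 - x) powr (A' - A) * norm (1 - x) powr (- A') \<le> 2 powr (A' - A) * norm (1 - x) powr (- A')"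
      by (rule mult_right_mono) simp
    then have "norm (1 - x) powr (- A) \<le> 2 powr (A' - A) * norm (1 - x) powr (- A')"
      using x1 by (simp flip: powr_add)
    then have "\<bar>C\<bar> * norm (1 - x) powr (- A) \<le> \<bar>C\<bar> * (2 powr (A' - A) * norm (1 - x) powr (- A'))"
      by (rule mult_left_mono) simp
    moreover have "C * norm (1 - x) powr (- A) \<le> \<bar>C\<bar> * norm (1 - x) powr (- A)"
      by (rule mult_right_mono) auto
    ultimately show ?thesis using C[OF that] by (simp add: mult.assoc)
  qed
  then show ?thesis using C unfolding kernel_order_def by blast
qed

lemma kernel_order_add:
  assumes "kernel_order A d" "kernel_order A e"
  shows "kernel_order A (\<lambda>j. d j + e j)"
proof -
  obtain C where C: "\<And>x. norm x < 1 \<Longrightarrow> summable (\<lambda>j. d j * x ^ j) \<and> norm (\<Sum>j. d j * x ^ j) \<le> C * norm (1 - x) powr (- A)"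
    using assms(1) unfolding kernel_order_def by blast
  obtain D where D: "\<And>x. norm x < 1 \<Longrightarrow> summable (\<lambda>j. e j * x ^ j) \<and> norm (\<Sum>j. e j * x ^ j) \<le> D * norm (1 - x) powr (- A)"
    using assms(2) unfolding kernel_order_def by blast
  have "summable (\<lambda>j. (d j + e j) * x ^ j) \<and> norm (\<Sum>j. (d j + e j) * x ^ j) \<le> (C + D) * norm (1 - x) powr (- A)" if "norm x < 1" for x
  proof -
    have s: "(\<Sum>j. (d j + e j) * x ^ j) = (\<Sum>j. d j * x ^ j) + (\<Sum>j. e j * x ^ j)"
      unfolding distrib_right by (rule suminf_add[symmetric]) (use C[OF that] D[OF that] in auto)
    have "norm ((\<Sum>j. d j * x ^ j) + (\<Sum>j. e j * x ^ j)) \<le> C * norm (1 - x) powr (- A) + D * norm (1 - x) powr (- A)"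
      using C[OF that] D[OF that] by (intro norm_triangle_mono) auto
    then show ?thesis unfolding s using C[OF that] D[OF that] by (simp add: distrib_right summable_add)
  qed
  then show ?thesis unfolding kernel_order_def by blast
qed

lemma kernel_order_cmult:
  assumes "kernel_order A d"
  shows "kernel_order A (\<lambda>j. c * d j)"
proof -
  obtain C where C: "\<And>x. norm x < 1 \<Longrightarrow> summable (\<lambda>j. d j * x ^ j) \<and> norm (\<Sum>j. d j * x ^ j) \<le> C * norm (1 - x) powr (- A)"
    using assms(1) unfolding kernel_order_def by blast
  have "summable (\<lambda>j. c * d j * x ^ j) \<and> norm (\<Sum>j. c * d j * x ^ j) \<le> (norm c * C) * norm (1 - x) powr (- A)" if "norm x < 1" for x
  proof -
    have "(\<Sum>j. c * d j * x ^ j) = c * (\<Sum>j. d j * x ^ j)"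
      unfolding mult.assoc by (rule suminf_mult) (use C[OF that] in auto)
    moreover have "norm c * norm (\<Sum>j. d j * x ^ j) \<le> norm c * (C * norm (1 - x) powr (- A))"
      using C[OF that] by (intro mult_left_mono) auto
    ultimately show ?thesis using C[OF that] by (auto simp: norm_mult mult.assoc intro: summable_mult)
  qed
  then show ?thesis unfolding kernel_order_def by blast
qed

lemma kernel_order_single:
  assumes "0 \<le> A"
  shows "kernel_order A (\<lambda>j. if j = 0 then c else 0)"
proof -
  have "(\<lambda>j. (if j = 0 then c else 0) * x ^ j) sums c" for x :: complex
    using sums_single[of 0 "\<lambda>j. c"] by (rule sums_cong[THEN iffD1, rotated]) auto
  then have "kernel_order 0 (\<lambda>j. if j = 0 then c else 0)"
    unfolding kernel_order_def by (intro exI[of _ "norm c"]) (auto simp: sums_iff)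
  then show ?thesis using assms by (rule kernel_order_mono)
qed

text \<open>The series is the binomial series of \<open>(1 - x) powr (- l)\<close>. The imaginary part of \<open>l\<close> costs a bounded factor only, since \<open>1 - x\<close> stays in the right half plane.\<close>

lemma kernel_order_pochhammer:
  assumes "Re l \<le> A"
  shows "kernel_order A (\<lambda>j. pochhammer l j / fact j)"
proof (rule kernel_order_mono[OF _ assms])
  have "norm ((1 - x) powr (- l)) \<le> exp (\<bar>Im l\<bar> * pi) * norm (1 - x) powr (- Re l)" if "norm x < 1" for x
  proof -
    have nz: "1 - x \<noteq> 0" using that by auto
    have "\<bar>Im (Ln (1 - x))\<bar> \<le> pi"
      using mpi_less_Im_Ln[OF nz] Im_Ln_le_pi[OF nz] by linarith
    then have "\<bar>Im l\<bar> * \<bar>Im (Ln (1 - x))\<bar> \<le> \<bar>Im l\<bar> * pi" by (intro mult_left_mono) auto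
    then have "Im l * Im (Ln (1 - x)) \<le> \<bar>Im l\<bar> * pi" by (metis abs_le_D1 abs_mult)
    moreover have "norm ((1 - x) powr (- l)) = exp (- Re l * ln (norm (1 - x)) + Im l * Im (Ln (1 - x)))"
      using nz by (simp add: powr_def norm_exp_eq_Re)
    moreover have "norm (1 - x) powr (- Re l) = exp (- Re l * ln (norm (1 - x)))"
      using nz by (simp add: powr_def)
    ultimately show ?thesis by (simp add: mult_exp_exp mult.commute)
  qed
  then show "kernel_order (Re l) (\<lambda>j. pochhammer l j / fact j)"
    unfolding kernel_order_def using powr_binomial_series[of _ l]
    by (intro exI[of _ "exp (\<bar>Im l\<bar> * pi)"]) (auto simp: sums_iff)
qed

text \<open>Dividing the polynomial by \<open>l + x\<close> raises the parameter of the rising factorial by one for each degree.\<close>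

lemma kernel_order_poly_pochhammer:
  assumes "Re l + real (degree Q) \<le> A"
  shows "kernel_order A (\<lambda>j. poly Q (of_nat j) * (pochhammer l j / fact j))"
  using assms
proof (induction "degree Q" arbitrary: Q l rule: less_induct)
  case less
  have "[:- (- l), 1:] dvd Q - [:poly Q (- l):]" by (subst poly_eq_0_iff_dvd[symmetric]) simp
  then obtain Q1 where Q1: "Q - [:poly Q (- l):] = [:l, 1:] * Q1" by (auto elim: dvdE)
  have Q: "poly Q x = poly Q (- l) + (l + x) * poly Q1 x" for x
    using arg_cong[OF Q1, of "\<lambda>p. poly p x"] by (simp add: algebra_simps)
  have rec: "(l + of_nat j) * pochhammer l j = l * pochhammer (l + 1) j" for j
    using pochhammer_Suc[of l j] pochhammer_rec[of l j] by (simp add: mult.commute)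
  have const: "kernel_order A (\<lambda>j. poly Q (- l) * (pochhammer l j / fact j))"
    using less.prems by (intro kernel_order_cmult kernel_order_pochhammer) simp
  show ?case
  proof (cases "Q1 = 0")
    case True
    have "(\<lambda>j. poly Q (of_nat j) * (pochhammer l j / fact j)) = (\<lambda>j. poly Q (- l) * (pochhammer l j / fact j))"
      by (rule ext, subst Q) (simp only: True poly_0 mult_zero_right add_0_right)
    then show ?thesis using const by (simp only:)
  next
    case False
    then have "degree ([:l, 1:] * Q1) = 1 + degree Q1" by (subst degree_mult_eq) auto
    moreover have "degree ([:l, 1:] * Q1) \<le> degree Q"
      unfolding Q1[symmetric] by (rule degree_diff_le) auto
    ultimately have dg: "1 + degree Q1 \<le> degree Q" by simp
    then have "real (1 + degree Q1) \<le> real (degree Q)" by (simp only: of_nat_le_iff)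
    then have "kernel_order A (\<lambda>j. poly Q1 (of_nat j) * (pochhammer (l + 1) j / fact j))"
      using less.prems dg by (intro less.hyps) auto
    then have "kernel_order A (\<lambda>j. l * (poly Q1 (of_nat j) * (pochhammer (l + 1) j / fact j)))"
      by (rule kernel_order_cmult)
    from kernel_order_add[OF const this]
    have "kernel_order A (\<lambda>j. poly Q (- l) * (pochhammer l j / fact j) + l * (poly Q1 (of_nat j) * (pochhammer (l + 1) j / fact j)))" .
    moreover have "poly Q (- l) * (pochhammer l j / fact j) + l * (poly Q1 (of_nat j) * (pochhammer (l + 1) j / fact j))
       = poly Q (of_nat j) * (pochhammer l j / fact j)" for j
    proof -
      have "l * (poly Q1 (of_nat j) * (pochhammer (l + 1) j / fact j)) = poly Q1 (of_nat j) * (l * pochhammer (l + 1) j) / fact j"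
        by simp
      also have "\<dots> = (l + of_nat j) * poly Q1 (of_nat j) * (pochhammer l j / fact j)"
        unfolding rec[symmetric] by simp
      finally have e: "l * (poly Q1 (of_nat j) * (pochhammer (l + 1) j / fact j)) = (l + of_nat j) * poly Q1 (of_nat j) * (pochhammer l j / fact j)" .
      show ?thesis unfolding Q[of "of_nat j"] e by (rule distrib_right[symmetric])
    qed
    ultimately show ?thesis by (simp only:)
  qed
qed

text \<open>Division of the coefficients by the index is integration of the series along the radius, which does not increase the order of growth at 1.\<close>

lemma kernel_order_divide_nat:
  assumes d: "kernel_order A d" and A: "0 \<le> A"
  shows "kernel_order A (\<lambda>j. d j / of_nat j)"
proof -
  obtain C where C: "\<And>x. norm x < 1 \<Longrightarrow> summable (\<lambda>j. d j * x ^ j) \<and> norm (\<Sum>j. d j * x ^ j) \<le> C * norm (1 - x) powr (- A)"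
    using d unfolding kernel_order_def by blast
  define e where "e = (\<lambda>j. d j / of_nat j)"
  define E where "E = (\<lambda>x. \<Sum>j. e j * x ^ j)"
  define g where "g = (\<lambda>x. \<Sum>j. d (Suc j) * x ^ j)"
  have abs_d: "summable (\<lambda>j. norm (d j * x ^ j))" if "norm x < 1" for x
  proof -
    from dense[OF that] obtain r where r: "norm x < r" "r < 1" by blast
    then have r0: "0 < r" using norm_ge_zero[of x] by linarith
    have "summable (\<lambda>j. d j * of_real r ^ j)" using C[of "of_real r"] r r0 by (simp only: norm_of_real abs_of_pos)
    then show ?thesis by (rule powser_insidea) (use r r0 in \<open>simp only: norm_of_real abs_of_pos\<close>)
  qed
  have sm_e: "summable (\<lambda>j. e j * x ^ j)" if "norm x < 1" for x
  proof (rule summable_comparison_test'[OF abs_d[OF that], of 0])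
    fix j
    have "norm (e j) \<le> norm (d j)"
      by (cases "j = 0") (auto simp: e_def norm_divide divide_le_eq mult_le_cancel_left1)
    then show "norm (e j * x ^ j) \<le> norm (d j * x ^ j)" unfolding norm_mult by (rule mult_right_mono) simp
  qed
  have sm_g: "summable (\<lambda>j. norm (d (Suc j) * x ^ j))" if "norm x < 1" for x
  proof (cases "x = 0")
    case True
    have "(\<lambda>j. norm (d (Suc j) * x ^ j)) = (\<lambda>j. norm (d (Suc j) * 0 ^ j))" using True by simp
    moreover have "summable (\<lambda>j. norm (d (Suc j) * 0 ^ j))"
      by (rule summable_finite[of "{0}"]) auto
    ultimately show ?thesis by simp
  next
    case False
    have "summable (\<lambda>j. norm (d (Suc j) * x ^ Suc j) * inverse (norm x))"
      using abs_d[OF that] summable_Suc_iff[of "\<lambda>j. norm (d j * x ^ j)"] by (intro summable_mult2) auto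
    moreover have "norm (d (Suc j) * x ^ Suc j) * inverse (norm x) = norm (d (Suc j) * x ^ j)" for j
      using False by (simp add: norm_mult norm_power)
    ultimately show ?thesis by simp
  qed
  have xg: "x * g x = (\<Sum>j. d j * x ^ j) - d 0" if "norm x < 1" for x
  proof -
    have "(\<Sum>j. d j * x ^ j) = (\<Sum>j. d (Suc j) * x ^ Suc j) + d 0"
      using suminf_split_head[of "\<lambda>j. d j * x ^ j"] C[OF that] by simp
    also have "(\<Sum>j. d (Suc j) * x ^ Suc j) = (\<Sum>j. x * (d (Suc j) * x ^ j))" by (simp add: mult_ac)
    also have "\<dots> = x * g x"
      unfolding g_def by (rule suminf_mult) (rule summable_norm_cancel[OF sm_g[OF that]])
    finally show ?thesis by simp
  qed
  define S where "S = (\<Sum>j. norm (d (Suc j) * (1/2) ^ j))"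
  have S0: "0 \<le> S" unfolding S_def by (intro suminf_nonneg sm_g) auto
  define B where "B = (S + 2 * \<bar>C\<bar> + 2 * norm (d 0)) * 2 powr A"
  have pw1: "1 \<le> 2 powr A * norm (1 - y) powr (- A)" if "norm y < 1" for y :: complex
  proof -
    have "norm (1 - y) \<le> 2" using norm_triangle_ineq4[of 1 y] that by simp
    moreover have y1: "norm (1 - y) > 0" using that by auto
    ultimately have "norm (1 - y) powr A \<le> 2 powr A" using A by (intro powr_mono2) auto
    then have "norm (1 - y) powr A * norm (1 - y) powr (- A) \<le> 2 powr A * norm (1 - y) powr (- A)"
      by (rule mult_right_mono) simp
    then show ?thesis using y1 by (simp flip: powr_add)
  qed
  have gb: "norm (g y) \<le> B * norm (1 - y) powr (- A)" if y: "norm y < 1" for y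
  proof (cases "norm y \<le> 1/2")
    case True
    have "norm (g y) \<le> (\<Sum>j. norm (d (Suc j) * y ^ j))" unfolding g_def by (rule summable_norm[OF sm_g[OF y]])
    also have "\<dots> \<le> S"
      unfolding S_def
    proof (rule suminf_le)
      show "norm (d (Suc j) * y ^ j) \<le> norm (d (Suc j) * (1/2) ^ j)" for j
        unfolding norm_mult norm_power using True by (intro mult_left_mono power_mono) auto
    qed (rule sm_g[OF y], rule sm_g, simp)
    also have "\<dots> \<le> (S + 2 * \<bar>C\<bar> + 2 * norm (d 0)) * 1" by simp
    also have "\<dots> \<le> (S + 2 * \<bar>C\<bar> + 2 * norm (d 0)) * (2 powr A * norm (1 - y) powr (- A))"
      using pw1[OF y] S0 by (intro mult_left_mono) auto
    finally show ?thesis by (simp add: B_def mult.assoc)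
  next
    case False
    have "norm y * norm (g y) = norm ((\<Sum>j. d j * y ^ j) - d 0)" unfolding xg[OF y, symmetric] by (simp add: norm_mult)
    also have "\<dots> \<le> norm (\<Sum>j. d j * y ^ j) + norm (d 0)" by (rule norm_triangle_ineq4)
    finally have "norm (g y) \<le> 2 * norm (\<Sum>j. d j * y ^ j) + 2 * norm (d 0)"
      using False mult_right_mono[of "1/2" "norm y" "norm (g y)"] by simp
    also have "norm (\<Sum>j. d j * y ^ j) \<le> \<bar>C\<bar> * norm (1 - y) powr (- A)"
      using C[OF y] mult_right_mono[OF abs_ge_self[of C], of "norm (1 - y) powr (- A)"] by simp
    finally have g1: "norm (g y) \<le> 2 * \<bar>C\<bar> * norm (1 - y) powr (- A) + 2 * norm (d 0)" by simp
    have "2 * \<bar>C\<bar> * norm (1 - y) powr (- A) \<le> 2 * \<bar>C\<bar> * (2 powr A * norm (1 - y) powr (- A))"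
      using A by (intro mult_left_mono) (auto simp: mult_le_cancel_right1 ge_one_powr_ge_zero)
    moreover have "2 * norm (d 0) * 1 \<le> 2 * norm (d 0) * (2 powr A * norm (1 - y) powr (- A))"
      using pw1[OF y] by (intro mult_left_mono) auto
    moreover have "0 \<le> S * (2 powr A * norm (1 - y) powr (- A))" using S0 by simp
    ultimately have "norm (g y) \<le> S * (2 powr A * norm (1 - y) powr (- A)) + 2 * \<bar>C\<bar> * (2 powr A * norm (1 - y) powr (- A)) + 2 * norm (d 0) * (2 powr A * norm (1 - y) powr (- A))"
      using g1 by linarith
    then show ?thesis by (simp add: B_def distrib_right mult.assoc)
  qed
  have dE: "(E has_field_derivative g y) (at y)" if "norm y < 1" for y
  proof -
    have "((\<lambda>x. \<Sum>j. e j * x ^ j) has_field_derivative (\<Sum>j. diffs e j * y ^ j)) (at y)"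
      by (rule termdiffs_strong'[where K=1]) (use sm_e that in auto)
    moreover have "diffs e j = d (Suc j)" for j
      by (simp add: diffs_def e_def del: of_nat_Suc)
    ultimately show ?thesis by (simp add: E_def g_def)
  qed
  have seg: "norm y < 1 \<and> norm (1 - y) powr (- A) \<le> 2 powr A * norm (1 - x) powr (- A)"
    if x: "norm x < 1" and y: "y \<in> closed_segment 0 x" for x y :: complex
  proof -
    obtain \<tau> where \<tau>: "0 \<le> \<tau>" "\<tau> \<le> 1" "y = of_real \<tau> * x"
      using y by (auto simp: in_segment scaleR_conv_of_real)
    have ny: "norm y = \<tau> * norm x" using \<tau> by (simp add: norm_mult)
    have "\<tau> * norm x \<le> 1 * norm x" using \<tau> by (intro mult_right_mono) auto
    then have y1: "norm y < 1" using ny x by simp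
    have "1 - norm y \<le> norm (1 - y)" using norm_triangle_ineq2[of 1 y] by simp
    moreover have "\<tau> * norm x \<le> \<tau> * 1" using \<tau> x by (intro mult_left_mono) auto
    ultimately have a: "1 - \<tau> \<le> norm (1 - y)" using ny by simp
    have "1 - x = (1 - y) - (1 - of_real \<tau>) * x" using \<tau> by (simp add: algebra_simps)
    then have "norm (1 - x) \<le> norm (1 - y) + norm ((1 - of_real \<tau>) * x)"
      using norm_triangle_ineq4[of "1 - y" "(1 - of_real \<tau>) * x"] by (simp only:)
    also have "norm ((1 - of_real \<tau>) * x) = (1 - \<tau>) * norm x"
    proof -
      have "1 - complex_of_real \<tau> = of_real (1 - \<tau>)" by simp
      then have "norm (1 - complex_of_real \<tau>) = 1 - \<tau>" using \<tau> by (simp only: norm_of_real)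
      then show ?thesis by (simp add: norm_mult)
    qed
    also have "(1 - \<tau>) * norm x \<le> (1 - \<tau>) * 1" using \<tau> x by (intro mult_left_mono) auto
    finally have "norm (1 - x) \<le> 2 * norm (1 - y)" using a by simp
    then have "norm (1 - x) / 2 \<le> norm (1 - y)" by simp
    moreover have x1: "0 < norm (1 - x)" using x by auto
    ultimately have "norm (1 - y) powr (- A) \<le> (norm (1 - x) / 2) powr (- A)"
      using A by (intro powr_mono2') auto
    also have "\<dots> = 2 powr A * norm (1 - x) powr (- A)"
      using x1 by (simp add: powr_divide powr_minus field_simps)
    finally show ?thesis using y1 by blast
  qed
  have B0: "0 \<le> B" unfolding B_def using S0 by simp
  have "norm (E x) \<le> (B * 2 powr A) * norm (1 - x) powr (- A)" if x: "norm x < 1" for x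
  proof -
    have "norm (E x - E 0) \<le> (B * 2 powr A * norm (1 - x) powr (- A)) * norm (x - 0)"
    proof (rule field_differentiable_bound[where S="closed_segment 0 x" and f'=g])
      fix y assume y: "y \<in> closed_segment 0 x"
      show "(E has_field_derivative g y) (at y within closed_segment 0 x)"
        using dE seg[OF x y] by (blast intro: has_field_derivative_at_within)
      have "norm (g y) \<le> B * norm (1 - y) powr (- A)" using gb seg[OF x y] by blast
      also have "\<dots> \<le> B * (2 powr A * norm (1 - x) powr (- A))" using seg[OF x y] B0 by (intro mult_left_mono) auto
      finally show "norm (g y) \<le> B * 2 powr A * norm (1 - x) powr (- A)" by (simp add: mult.assoc)
    qed auto
    also have "\<dots> \<le> (B * 2 powr A * norm (1 - x) powr (- A)) * 1"
      using x B0 by (intro mult_left_mono) auto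
    finally have le: "norm (E x - E 0) \<le> B * 2 powr A * norm (1 - x) powr (- A)" by simp
    have "E 0 = e 0" unfolding E_def by (rule powser_zero)
    then have "E 0 = 0" by (simp add: e_def)
    with le show ?thesis by simp
  qed
  then show ?thesis unfolding kernel_order_def E_def e_def[symmetric] using sm_e by blast
qed

lemma kernel_order_divide_nat_power:
  assumes d: "kernel_order A d" and A: "0 \<le> A"
  shows "kernel_order A (\<lambda>j. d j / of_nat j ^ k)"
proof (induction k)
  case (Suc k)
  from kernel_order_divide_nat[OF this A] show ?case by (simp add: mult.commute)
qed (use d in simp)

lemma kernel_order_rational_pochhammer:
  assumes "0 \<le> A" "Re l \<le> A" "Re l + real (degree Q) - real k \<le> A"
  shows "kernel_order A (\<lambda>j. poly Q (of_nat j) / of_nat j ^ k * (pochhammer l j / fact j))"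
  using assms
proof (induction k arbitrary: Q)
  case 0
  then show ?case using kernel_order_poly_pochhammer[of l Q A] by simp
next
  case (Suc k)
  obtain a Q1 where Q: "Q = pCons a Q1" by (cases Q) auto
  have 1: "kernel_order A (\<lambda>j. a * (pochhammer l j / fact j) / of_nat j ^ Suc k)"
    using Suc.prems by (intro kernel_order_divide_nat_power kernel_order_cmult kernel_order_pochhammer) auto
  have 2: "kernel_order A (\<lambda>j. poly Q1 (of_nat j) / of_nat j ^ k * (pochhammer l j / fact j))"
  proof (rule Suc.IH)
    show "Re l + real (degree Q1) - real k \<le> A"
      using Suc.prems unfolding Q by (cases "Q1 = 0") (auto simp: degree_pCons_eq)
  qed (use Suc.prems in auto)
  have 3: "kernel_order A (\<lambda>j. if j = 0 then - (poly Q1 0 / 0 ^ k) else 0)"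
    by (rule kernel_order_single[OF Suc.prems(1)])
  have "poly Q (of_nat j) / of_nat j ^ Suc k * (pochhammer l j / fact j) =
     a * (pochhammer l j / fact j) / of_nat j ^ Suc k + poly Q1 (of_nat j) / of_nat j ^ k * (pochhammer l j / fact j)
     + (if j = 0 then - (poly Q1 0 / 0 ^ k) else 0)" for j
  proof (cases "j = 0")
    case False
    then have "(of_nat j :: complex) \<noteq> 0" by simp
    then show ?thesis using False by (simp add: Q add_divide_distrib distrib_right)
  qed (simp add: Q)
  then show ?case using kernel_order_add[OF kernel_order_add[OF 1 2] 3] by simp
qed

section \<open>Coefficient multipliers between weighted spaces\<close>

text \<open>The space \<open>bergman p 0\<close>, with the norm taken from \<open>L\<close> directly.\<close>

definition Ap :: "real \<Rightarrow> (complex ^ 'n \<Rightarrow> complex) set" where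
  "Ap p = {G. holomorphic_in_ball G \<and> (\<forall>z. z \<notin> unit_ball \<longrightarrow> G z = 0) \<and> integrable vol (\<lambda>z. norm (G z) powr p)}"

definition Ap_norm :: "real \<Rightarrow> (complex ^ 'n \<Rightarrow> complex) \<Rightarrow> real" where
  "Ap_norm p G = (LINT z|vol. norm (G z) powr p) powr (1 / p)"

definition apply_multiplier :: "(nat \<Rightarrow> complex) \<Rightarrow> (complex ^ 'n \<Rightarrow> complex) \<Rightarrow> complex ^ 'n \<Rightarrow> complex" where
  "apply_multiplier d f z = (if z \<in> unit_ball then \<Sum>k. d k * slice_coeff f k z else 0)"

lemma expansion_of_apply_multiplier:
  assumes f: "expansion_of f \<phi>" and d: "subexponential d"
  shows "expansion_of (apply_multiplier d f) (\<lambda>k z. d k * \<phi> k z)"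
proof (rule expansion_of_series)
  show "homogeneous_series (\<lambda>k z. d k * \<phi> k z)"
    using f d by (intro homogeneous_series_multiplier) (simp_all add: expansion_of_def)
  show "apply_multiplier d f z = (\<Sum>k. d k * \<phi> k z)" if "z \<in> unit_ball" for z
    using that expansion_of_slice_coeff_eq[OF f] by (simp add: apply_multiplier_def)
qed

lemma measurable_vol_continuous:
  fixes f :: "complex ^ 'n \<Rightarrow> complex"
  assumes "continuous_on unit_ball f"
  shows "f \<in> borel_measurable vol"
proof -
  have "f \<in> borel_measurable (restrict_space borel unit_ball)"
    using assms by (rule borel_measurable_continuous_on_restrict)
  moreover have "sets (restrict_space borel unit_ball) = sets (vol :: (complex ^ 'n) measure)"
    unfolding vol_def by (rule sets_restrict_space_cong) simp
  ultimately show ?thesis by (simp cong: measurable_cong_sets)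
qed

lemma expansion_of_continuous: "expansion_of f \<phi> \<Longrightarrow> continuous_on unit_ball f"
  using holomorphic_in_ball_line[OF expansion_imp_holomorphic] unfolding line_holomorphic_def by blast

lemma expansion_of_measurable: "expansion_of f \<phi> \<Longrightarrow> f \<in> borel_measurable vol"
  by (intro measurable_vol_continuous expansion_of_continuous)

lemma le_one_plus_powr: "1 \<le> p \<Longrightarrow> 0 \<le> (x::real) \<Longrightarrow> x \<le> 1 + x powr p"
proof (cases "x \<le> 1")
  case True
  then show ?thesis using powr_ge_zero[of x p] by linarith
next
  case False
  assume "1 \<le> p"
  then have "x powr 1 \<le> x powr p" using False by (intro powr_mono) auto
  then show ?thesis using False by simp
qed

text \<open>A coefficient multiplier whose coefficients are those of a kernel \<open>d\<close> divided by those of the Bergman kernel with parameter \<open>b\<close> is an integral operator with kernel \<open>\<Sum>j. d j * cip z w ^ j\<close> against the weight with exponent \<open>b\<close>. The growth of the kernel at 1 reduces its boundedness to a Bergman type operator.\<close>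

lemma multiplier_bound:
  fixes p q x y :: real and b :: complex
  assumes pq: "1 < p" "1 < q" "1 / p + 1 / q = 1" and x: "- (1 / p) < x"
    and b: "0 < Re b" "- (1 / q) < Re b - y" "y \<le> Re b"
    and d: "kernel_order (real CARD('n) + 1 + Re b + x - y) d"
    and delta: "\<And>j. d j * (fact j / pochhammer (of_nat CARD('n) + 1 + b) j) = \<delta> j"
    and sub: "subexponential \<delta>"
  shows "\<exists>C>0. \<forall>(F :: complex ^ 'n \<Rightarrow> complex) \<phi> S. expansion_of F \<phi> \<longrightarrow> integrable vol (\<lambda>z. (bdist z powr y * norm (F z)) powr p) \<longrightarrow>
     (\<forall>z\<in>unit_ball. S z = (\<Sum>j. \<delta> j * \<phi> j z)) \<longrightarrow>
     integrable vol (\<lambda>z. (bdist z powr x * norm (S z)) powr p) \<and>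
     (LINT z|vol. (bdist z powr x * norm (S z)) powr p) \<le> C * (LINT z|vol. (bdist z powr y * norm (F z)) powr p)"
proof -
  let ?V = "vol :: (complex ^ 'n) measure"
  define m where "m = real CARD('n) + 1 + x + (Re b - y)"
  obtain C0 where C0: "C0 > 0" "\<And>h :: complex ^ 'n \<Rightarrow> real. h \<in> borel_measurable vol \<Longrightarrow> (\<forall>w. 0 \<le> h w) \<Longrightarrow> integrable vol (\<lambda>w. h w powr p) \<Longrightarrow>
    (\<forall>z\<in>unit_ball. integrable vol (\<lambda>w. h w * (bdist w powr (Re b - y) * norm (1 - cip z w) powr (- m)))) \<and>
    integrable vol (\<lambda>z. (bdist z powr x * (LINT w|vol. h w * (bdist w powr (Re b - y) * norm (1 - cip z w) powr (- m)))) powr p) \<and>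
    (LINT z|vol. (bdist z powr x * (LINT w|vol. h w * (bdist w powr (Re b - y) * norm (1 - cip z w) powr (- m)))) powr p)
      \<le> C0 * (LINT w|vol. h w powr p)"
    using Bergman_type_operator_bounded[where 'n='n, OF pq x b(2)] unfolding m_def by blast
  define \<kappa> where "\<kappa> = (\<lambda>x. \<Sum>j. d j * x ^ j)"
  obtain C1 where C1: "\<And>x. norm x < 1 \<Longrightarrow> summable (\<lambda>j. d j * x ^ j) \<and> norm (\<kappa> x) \<le> C1 * norm (1 - x) powr (- m)"
    using d unfolding kernel_order_def \<kappa>_def m_def by (auto simp: algebra_simps)
  have \<kappa>: "(\<lambda>j. d j * x ^ j) sums \<kappa> x" if "norm x < 1" for x
    using C1[OF that] unfolding \<kappa>_def by (intro summable_sums) blast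
  define \<omega> where "\<omega> = (\<lambda>u. complex_of_real (1 - u) powr b)"
  have \<omega>m: "\<omega> \<in> borel_measurable borel" unfolding \<omega>_def by measurable
  have \<omega>n: "norm (\<omega> ((norm w)\<^sup>2)) = bdist w powr Re b" if "w \<in> unit_ball" for w :: "complex ^ 'n"
    unfolding \<omega>_def using bdist_pos[OF that] by (subst norm_powr_real_powr) auto
  have meas\<omega>: "(\<lambda>w::complex ^ 'n. \<omega> ((norm w)\<^sup>2)) \<in> borel_measurable ?V"
    by (rule measurable_vol, rule measurable_compose[OF _ \<omega>m]) measurable
  have int\<omega>: "integrable ?V (\<lambda>w. \<omega> ((norm w)\<^sup>2))"
  proof (rule Bochner_Integration.integrable_bound[OF _ meas\<omega>])
    show "integrable ?V (\<lambda>w. bdist w powr Re b)" using b(1) by (intro integrable_vol_weight) simp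
    show "AE w in ?V. norm (\<omega> ((norm w)\<^sup>2)) \<le> norm (bdist w powr Re b)"
      by (rule AE_I2) (simp add: \<omega>n)
  qed
  define \<beta> where "\<beta> = complex_of_real (gauss_const TYPE('n)) / pochhammer (b + 1) CARD('n)"
  have "b + 1 \<notin> \<int>\<^sub>\<le>\<^sub>0"
  proof
    assume "b + 1 \<in> \<int>\<^sub>\<le>\<^sub>0"
    then obtain k where "b + 1 = - of_nat k" by (rule nonpos_Ints_cases')
    then have "Re (b + 1) = - real k" by simp
    then show False using b(1) by simp
  qed
  then have \<beta>0: "\<beta> \<noteq> 0"
    unfolding \<beta>_def using gauss_const_pos[where 'n='n] pochhammer_neq_0 by simp
  define K where "K = \<bar>C1\<bar> / norm \<beta>"
  have K0: "0 \<le> K" by (simp add: K_def)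
  have main: "integrable ?V (\<lambda>z. (bdist z powr x * norm (S z)) powr p) \<and>
     (LINT z|vol. (bdist z powr x * norm (S z)) powr p) \<le> (K powr p * C0) * (LINT z|vol. (bdist z powr y * norm (F z)) powr p)"
    if F: "expansion_of F \<phi>" and iF: "integrable ?V (\<lambda>z. (bdist z powr y * norm (F z)) powr p)"
      and S: "\<forall>z\<in>unit_ball. S z = (\<Sum>j. \<delta> j * \<phi> j z)" for F \<phi> S
  proof -
    define h where "h = (\<lambda>w. bdist w powr y * norm (F w))"
    have Fm[measurable]: "F \<in> borel_measurable ?V" by (rule expansion_of_measurable[OF F])
    have bm[measurable]: "(\<lambda>w::complex ^ 'n. bdist w powr c) \<in> borel_measurable ?V" for c
      by (rule measurable_vol) measurable
    have hm: "h \<in> borel_measurable ?V" unfolding h_def by measurable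
    have h0: "\<forall>w. 0 \<le> h w" by (simp add: h_def)
    have hp: "integrable ?V (\<lambda>w. h w powr p)" using iF by (simp add: h_def)
    note op = C0(2)[OF hm h0 hp]
    define T where "T = (\<lambda>z. LINT w|vol. h w * (bdist w powr (Re b - y) * norm (1 - cip z w) powr (- m)))"
    have T0: "0 \<le> T z" for z unfolding T_def using h0 by (intro integral_nonneg_AE AE_I2) auto
    have F\<omega>: "norm (F w * \<omega> ((norm w)\<^sup>2)) = h w * bdist w powr (Re b - y)" if "w \<in> unit_ball" for w
      unfolding norm_mult \<omega>n[OF that] h_def by (simp add: mult_ac flip: powr_add)
    have intF: "integrable ?V (\<lambda>w. F w * \<omega> ((norm w)\<^sup>2))"
    proof (rule Bochner_Integration.integrable_bound)
      show "integrable ?V (\<lambda>w. 1 + h w powr p)"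
        using hp finite_measure.integrable_const[OF finite_measure_vol] by (intro Bochner_Integration.integrable_add)
      show "(\<lambda>w. F w * \<omega> ((norm w)\<^sup>2)) \<in> borel_measurable ?V"
        using Fm meas\<omega> by (rule borel_measurable_times)
      show "AE w in ?V. norm (F w * \<omega> ((norm w)\<^sup>2)) \<le> norm (1 + h w powr p)"
      proof (rule AE_I2)
        fix w :: "complex ^ 'n" assume "w \<in> space ?V"
        then have w: "w \<in> unit_ball" by simp
        have "bdist w powr (Re b - y) \<le> 1 powr (Re b - y)"
          using b(3) bdist_pos[OF w] by (intro powr_mono2) auto
        then have "h w * bdist w powr (Re b - y) \<le> h w * 1" using h0 by (intro mult_left_mono) auto
        also have "\<dots> \<le> 1 + h w powr p" using le_one_plus_powr[of p "h w"] pq h0 by simp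
        finally show "norm (F w * \<omega> ((norm w)\<^sup>2)) \<le> norm (1 + h w powr p)" unfolding F\<omega>[OF w] by simp
      qed
    qed
    have Sb: "norm (S z) \<le> K * T z" if z: "z \<in> unit_ball" for z
    proof -
      note REP = integral_power_series_kernel[OF F \<omega>m int\<omega> intF \<kappa> z]
      have "d j * ball_moment TYPE('n) \<omega> j * \<phi> j z = \<beta> * (\<delta> j * \<phi> j z)" for j
        unfolding \<omega>_def ball_moment_powr_complex[OF b(1)] delta[symmetric] \<beta>_def by simp
      then have s: "(\<lambda>j. \<beta> * (\<delta> j * \<phi> j z)) sums (LINT w|vol. F w * \<omega> ((norm w)\<^sup>2) * \<kappa> (cip z w))"
        using REP(2) by (simp only:)
      have sm: "summable (\<lambda>j. \<delta> j * \<phi> j z)"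
        by (rule summable_norm_cancel, rule homogeneous_series_summable[OF homogeneous_series_multiplier[OF _ sub]])
          (use F z in \<open>simp_all add: expansion_of_def\<close>)
      have "\<beta> * S z = (LINT w|vol. F w * \<omega> ((norm w)\<^sup>2) * \<kappa> (cip z w))"
        using sums_unique[OF s] suminf_mult[OF sm, of \<beta>] S z by simp
      then have "norm \<beta> * norm (S z) = norm (LINT w|vol. F w * \<omega> ((norm w)\<^sup>2) * \<kappa> (cip z w))"
        by (metis norm_mult)
      also have "\<dots> \<le> (LINT w|vol. norm (F w * \<omega> ((norm w)\<^sup>2) * \<kappa> (cip z w)))"
        by (rule integral_norm_bound)
      also have "\<dots> \<le> (LINT w|vol. \<bar>C1\<bar> * (h w * (bdist w powr (Re b - y) * norm (1 - cip z w) powr (- m))))"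
      proof (rule integral_mono)
        show "integrable ?V (\<lambda>w. norm (F w * \<omega> ((norm w)\<^sup>2) * \<kappa> (cip z w)))"
          using REP(1) by (rule integrable_norm)
        show "integrable ?V (\<lambda>w. \<bar>C1\<bar> * (h w * (bdist w powr (Re b - y) * norm (1 - cip z w) powr (- m))))"
          using op z by (intro integrable_mult_right) blast
        fix w :: "complex ^ 'n" assume "w \<in> space ?V"
        then have w: "w \<in> unit_ball" by simp
        have "norm (\<kappa> (cip z w)) \<le> C1 * norm (1 - cip z w) powr (- m)"
          using C1[OF one_minus_cip_nz[OF z w]] by blast
        also have "\<dots> \<le> \<bar>C1\<bar> * norm (1 - cip z w) powr (- m)" by (intro mult_right_mono) auto
        finally have "(h w * bdist w powr (Re b - y)) * norm (\<kappa> (cip z w)) \<le> (h w * bdist w powr (Re b - y)) * (\<bar>C1\<bar> * norm (1 - cip z w) powr (- m))"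
          using h0 by (intro mult_left_mono) auto
        then show "norm (F w * \<omega> ((norm w)\<^sup>2) * \<kappa> (cip z w)) \<le> \<bar>C1\<bar> * (h w * (bdist w powr (Re b - y) * norm (1 - cip z w) powr (- m)))"
          unfolding norm_mult[of "F w * \<omega> ((norm w)\<^sup>2)"] F\<omega>[OF w] by (simp only: mult_ac)
      qed
      also have "\<dots> = \<bar>C1\<bar> * T z" unfolding T_def by (rule integral_mult_right_zero)
      finally show ?thesis using \<beta>0 by (simp add: K_def field_simps)
    qed
    have Sexp: "expansion_of S (\<lambda>j z. \<delta> j * \<phi> j z)"
      using F S by (intro expansion_of_series homogeneous_series_multiplier sub) (simp_all add: expansion_of_def)
    have Sm[measurable]: "S \<in> borel_measurable ?V" by (rule expansion_of_measurable[OF Sexp])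
    have le: "(bdist z powr x * norm (S z)) powr p \<le> K powr p * (bdist z powr x * T z) powr p" if "z \<in> unit_ball" for z
    proof -
      have "bdist z powr x * norm (S z) \<le> K * (bdist z powr x * T z)"
        using mult_left_mono[OF Sb[OF that], of "bdist z powr x"] by (simp add: mult_ac)
      then have "(bdist z powr x * norm (S z)) powr p \<le> (K * (bdist z powr x * T z)) powr p"
        using pq by (intro powr_mono2) auto
      then show ?thesis using K0 T0[of z] by (simp add: powr_mult)
    qed
    have iT: "integrable ?V (\<lambda>z. K powr p * (bdist z powr x * T z) powr p)"
      using op unfolding T_def by (intro integrable_mult_right) blast
    have 1: "integrable ?V (\<lambda>z. (bdist z powr x * norm (S z)) powr p)"
    proof (rule Bochner_Integration.integrable_bound[OF iT])
      show "AE z in ?V. norm ((bdist z powr x * norm (S z)) powr p) \<le> norm (K powr p * (bdist z powr x * T z) powr p)"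
        by (rule AE_I2) (use le in simp)
    qed measurable
    have "(LINT z|vol. (bdist z powr x * norm (S z)) powr p) \<le> (LINT z|vol. K powr p * (bdist z powr x * T z) powr p)"
      by (rule integral_mono[OF 1 iT]) (use le in simp)
    also have "\<dots> = K powr p * (LINT z|vol. (bdist z powr x * T z) powr p)" by (rule integral_mult_right_zero)
    also have "\<dots> \<le> K powr p * (C0 * (LINT w|vol. h w powr p))"
      using op unfolding T_def by (intro mult_left_mono) auto
    finally show ?thesis using 1 by (simp add: h_def mult.assoc)
  qed
  show ?thesis
  proof (intro exI[of _ "K powr p * C0 + 1"] conjI allI impI)
    show "0 < K powr p * C0 + 1" using C0(1) by (intro add_nonneg_pos mult_nonneg_nonneg) auto
    fix F :: "complex ^ 'n \<Rightarrow> complex" and \<phi> S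
    assume A: "expansion_of F \<phi>" "integrable ?V (\<lambda>z. (bdist z powr y * norm (F z)) powr p)" "\<forall>z\<in>unit_ball. S z = (\<Sum>j. \<delta> j * \<phi> j z)"
    show "integrable ?V (\<lambda>z. (bdist z powr x * norm (S z)) powr p)" using main[OF A] by blast
    have "0 \<le> (LINT z|vol. (bdist z powr y * norm (F z)) powr p)" by simp
    then show "(LINT z|vol. (bdist z powr x * norm (S z)) powr p) \<le> (K powr p * C0 + 1) * (LINT z|vol. (bdist z powr y * norm (F z)) powr p)"
      using main[OF A] unfolding distrib_right by linarith
  qed
qed

text \<open>The rising factorial \<open>pochhammer (c + x) J\<close> as a polynomial in \<open>x\<close>.\<close>

definition rising_poly :: "complex \<Rightarrow> nat \<Rightarrow> complex poly" where
  "rising_poly c J = (\<Prod>i=0..<J. [:c + of_nat i, 1:])"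

lemma poly_rising_poly: "poly (rising_poly c J) x = pochhammer (c + x) J"
  by (simp add: rising_poly_def poly_prod pochhammer_prod add_ac)

lemma degree_rising_poly: "degree (rising_poly c J) \<le> J"
proof -
  have "degree (rising_poly c J) \<le> (\<Sum>i=0..<J. degree [:c + of_nat i, 1:])"
    unfolding rising_poly_def by (rule degree_prod_sum_le[unfolded o_def]) simp
  then show ?thesis by simp
qed

text \<open>A quotient of rising factorials with parameters that differ by an integer \<open>J\<close> is a polynomial of degree \<open>J\<close> in the index. Raising the parameter of the weight by an integer thus costs a polynomial factor only.\<close>

lemma pochhammer_shift_quotient:
  assumes "c \<notin> \<int>\<^sub>\<le>\<^sub>0"
  shows "pochhammer (c + of_nat J) j / pochhammer c j = pochhammer (c + of_nat j) J / pochhammer (c::complex) J"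
proof -
  have "pochhammer c J * pochhammer (c + of_nat J) j = pochhammer c j * pochhammer (c + of_nat j) J"
    using pochhammer_product'[of c J j] pochhammer_product'[of c j J] by (simp add: add.commute)
  then show ?thesis
    using pochhammer_neq_0[OF assms] by (simp add: field_simps)
qed

lemma subexponential_of_nat_power: "subexponential (\<lambda>j. of_nat j ^ N)"
proof (induction N)
  case 0
  show ?case unfolding subexponential_def
    by (intro allI impI exI[of _ 1]) (simp add: power_le_one)
next
  case (Suc N)
  from subexponential_mult[OF subexponential_of_nat this] show ?case by simp
qed

lemma subexponential_le:
  assumes "subexponential d" "\<And>k. norm (e k) \<le> norm (d k)"
  shows "subexponential e"
  unfolding subexponential_def
proof (intro allI impI)
  fix r :: real assume r: "0 < r" "r < 1"
  then obtain M where M: "\<And>k. norm (d k) * r ^ k \<le> M" using assms(1) unfolding subexponential_def by meson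
  have "norm (e k) * r ^ k \<le> M" for k
    by (rule order_trans[OF mult_right_mono[OF assms(2)[of k]] M]) (use r in simp)
  then show "\<exists>M. \<forall>k. norm (e k) * r ^ k \<le> M" by blast
qed

lemma exists_large_nat: "\<exists>J::nat. x \<le> real J \<and> y \<le> real J \<and> z \<le> real J"
proof -
  obtain J :: nat where "max x (max y z) \<le> real J" using real_arch_simple by blast
  then show ?thesis by auto
qed

text \<open>The operator that inverts \<open>Rst\<close>, followed by \<open>N\<close> radial derivatives, is a coefficient multiplier whose kernel has the order of growth that the weight \<open>bdist z powr (real N + t)\<close> compensates. The weight parameter \<open>b = s + J\<close> is shifted by an integer to have positive real part.\<close>

lemma backward_bound:
  fixes p q t :: real and s :: complex and N :: nat
  assumes pq: "1 < p" "1 < q" "1 / p + 1 / q = 1" and wd: "Rst_well_defined CARD('n) s (of_real t)"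
    and N: "- (1 / p) < real N + t"
  shows "\<exists>C>0. \<forall>(G :: complex ^ 'n \<Rightarrow> complex) \<phi> f. expansion_of G \<phi> \<longrightarrow> integrable vol (\<lambda>z. norm (G z) powr p) \<longrightarrow>
     expansion_of f (\<lambda>j z. multiplier (of_nat CARD('n) + 1 + s + of_real t) (of_nat CARD('n) + 1 + s) j * \<phi> j z) \<longrightarrow>
     integrable vol (\<lambda>z. (bdist z powr (real N + t) * norm ((radial_deriv ^^ N) f z)) powr p) \<and>
     (LINT z|vol. (bdist z powr (real N + t) * norm ((radial_deriv ^^ N) f z)) powr p) \<le> C * (LINT z|vol. norm (G z) powr p)"
proof -
  let ?c = "of_nat CARD('n) + 1 + s"
  let ?ct = "of_nat CARD('n) + 1 + s + complex_of_real t"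
  note nz = Rst_well_defined_nonpos_Ints[OF wd]
  obtain J :: nat where J: "1 - Re s \<le> real J" using real_arch_simple by blast
  define b where "b = s + of_nat J"
  have b: "0 < Re b" using J by (simp add: b_def)
  have bc: "of_nat CARD('n) + 1 + b = ?c + of_nat J" by (simp add: b_def)
  define \<delta> where "\<delta> = (\<lambda>j. of_nat j ^ N * multiplier ?ct ?c j)"
  define Q where "Q = smult (inverse (pochhammer ?c J)) (monom 1 N * rising_poly ?c J)"
  define d where "d = (\<lambda>j. poly Q (of_nat j) * (pochhammer ?ct j / fact j))"
  have "degree Q \<le> N + J"
    unfolding Q_def using degree_smult_le degree_mult_le degree_rising_poly[of ?c J] degree_monom_le[of "1::complex" N]
    by (meson add_mono order_trans)
  then have "Re ?ct + real (degree Q) \<le> real CARD('n) + 1 + Re b + (real N + t) - 0"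
    by (simp add: b_def)
  then have ko: "kernel_order (real CARD('n) + 1 + Re b + (real N + t) - 0) d"
    unfolding d_def by (rule kernel_order_poly_pochhammer)
  have cJ: "?c + of_nat J \<notin> \<int>\<^sub>\<le>\<^sub>0"
  proof
    assume "?c + of_nat J \<in> \<int>\<^sub>\<le>\<^sub>0"
    then obtain k where "?c + of_nat J = - of_nat k" by (rule nonpos_Ints_cases')
    then have "Re (?c + of_nat J) = - real k" by simp
    then show False using b by (simp add: b_def)
  qed
  have dd: "d j * (fact j / pochhammer (of_nat CARD('n) + 1 + b) j) = \<delta> j" for j
  proof -
    have e: "pochhammer (?c + of_nat j) J / pochhammer ?c J = pochhammer (?c + of_nat J) j / pochhammer ?c j"
      by (rule pochhammer_shift_quotient[OF nz(1), symmetric])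
    have "poly Q (of_nat j) = of_nat j ^ N * (pochhammer (?c + of_nat j) J / pochhammer ?c J)"
      by (simp add: Q_def poly_monom poly_rising_poly divide_inverse mult_ac)
    also have "\<dots> = of_nat j ^ N * (pochhammer (?c + of_nat J) j / pochhammer ?c j)" by (simp only: e)
    finally show ?thesis
      unfolding d_def \<delta>_def bc multiplier_def using pochhammer_neq_0[OF cJ, of j] by simp
  qed
  have sub: "subexponential \<delta>"
    unfolding \<delta>_def by (intro subexponential_mult subexponential_of_nat_power subexponential_multiplier nz)
  have q: "0 < 1 / q" using pq by simp
  obtain C where C: "C > 0" "\<forall>(F :: complex ^ 'n \<Rightarrow> complex) \<phi> S. expansion_of F \<phi> \<longrightarrow> integrable vol (\<lambda>z. (bdist z powr 0 * norm (F z)) powr p) \<longrightarrow>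
     (\<forall>z\<in>unit_ball. S z = (\<Sum>j. \<delta> j * \<phi> j z)) \<longrightarrow>
     integrable vol (\<lambda>z. (bdist z powr (real N + t) * norm (S z)) powr p) \<and>
     (LINT z|vol. (bdist z powr (real N + t) * norm (S z)) powr p) \<le> C * (LINT z|vol. (bdist z powr 0 * norm (F z)) powr p)"
    using multiplier_bound[where 'n='n and y=0, OF pq N b _ _ ko dd sub] b q by auto
  have b0: "(bdist z powr 0 * norm (G z)) powr p = norm (G z) powr p" if "z \<in> unit_ball" for z and G :: "complex ^ 'n \<Rightarrow> complex"
    using bdist_pos[OF that] by simp
  have i0: "integrable vol (\<lambda>z. (bdist z powr 0 * norm (G z)) powr p) \<longleftrightarrow> integrable vol (\<lambda>z. norm (G z) powr p)"
    "(LINT z|vol. (bdist z powr 0 * norm (G z)) powr p) = (LINT z|vol. norm (G z) powr p)" for G :: "complex ^ 'n \<Rightarrow> complex"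
    by (rule Bochner_Integration.integrable_cong[OF refl b0], simp, rule Bochner_Integration.integral_cong[OF refl b0], simp)
  show ?thesis
  proof (intro exI[of _ C] conjI[OF C(1)] allI impI)
    fix G :: "complex ^ 'n \<Rightarrow> complex" and \<phi> f
    assume G: "expansion_of G \<phi>" "integrable vol (\<lambda>z. norm (G z) powr p)" and f: "expansion_of f (\<lambda>j z. multiplier ?ct ?c j * \<phi> j z)"
    have "(radial_deriv ^^ N) f z = (\<Sum>j. \<delta> j * \<phi> j z)" if "z \<in> unit_ball" for z
      using expansion_of_radial_deriv_funpow[OF f, of N] that
      by (simp add: expansion_of_def sums_iff \<delta>_def mult.assoc)
    then show "integrable vol (\<lambda>z. (bdist z powr (real N + t) * norm ((radial_deriv ^^ N) f z)) powr p) \<and>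
     (LINT z|vol. (bdist z powr (real N + t) * norm ((radial_deriv ^^ N) f z)) powr p) \<le> C * (LINT z|vol. norm (G z) powr p)"
      using C(2)[rule_format, of G \<phi> "(radial_deriv ^^ N) f"] G unfolding i0 by blast
  qed
qed

text \<open>Conversely \<open>Rst\<close> is recovered from the \<open>k\<close>-th radial derivative by dividing the coefficients by \<open>of_nat j ^ k\<close>. That is impossible for the component of degree 0, which is therefore estimated separately by \<open>norm (f 0)\<close>.\<close>

lemma forward_bound:
  fixes p q t :: real and s :: complex and k :: nat
  assumes pq: "1 < p" "1 < q" "1 / p + 1 / q = 1" and wd: "Rst_well_defined CARD('n) s (of_real t)"
    and k: "- (1 / p) < real k + t"
  shows "\<exists>C>0. \<forall>(f :: complex ^ 'n \<Rightarrow> complex) \<phi> G. expansion_of f \<phi> \<longrightarrow>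
     integrable vol (\<lambda>z. (bdist z powr (real k + t) * norm ((radial_deriv ^^ k) f z)) powr p) \<longrightarrow>
     expansion_of G (\<lambda>j z. multiplier (of_nat CARD('n) + 1 + s) (of_nat CARD('n) + 1 + s + of_real t) j * \<phi> j z) \<longrightarrow>
     integrable vol (\<lambda>z. norm (G z) powr p) \<and>
     (LINT z|vol. norm (G z) powr p) \<le> C * (norm (f 0) powr p + (LINT z|vol. (bdist z powr (real k + t) * norm ((radial_deriv ^^ k) f z)) powr p))"
proof -
  let ?V = "vol :: (complex ^ 'n) measure"
  let ?c = "of_nat CARD('n) + 1 + s"
  let ?ct = "of_nat CARD('n) + 1 + s + complex_of_real t"
  note nz = Rst_well_defined_nonpos_Ints[OF wd]
  obtain J :: nat where J: "1 + real k - Re s \<le> real J" "1 - Re s - t \<le> real J" "real k \<le> real J"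
    using exists_large_nat by blast
  define b where "b = s + of_real t + of_nat J"
  have b: "0 < Re b" using J by (simp add: b_def)
  have bc: "of_nat CARD('n) + 1 + b = ?ct + of_nat J" by (simp add: b_def)
  define \<gamma> where "\<gamma> = multiplier ?c ?ct"
  define \<delta> where "\<delta> = (\<lambda>j. \<gamma> j / of_nat j ^ k)"
  define Q where "Q = smult (inverse (pochhammer ?ct J)) (rising_poly ?ct J)"
  define d where "d = (\<lambda>j. poly Q (of_nat j) / of_nat j ^ k * (pochhammer ?c j / fact j))"
  have dQ: "degree Q \<le> J"
    unfolding Q_def using degree_smult_le degree_rising_poly[of ?ct J] order_trans by blast
  have A: "real CARD('n) + 1 + Re b + 0 - (real k + t) = real CARD('n) + 1 + Re s + real J - real k"
    by (simp add: b_def)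
  have ko: "kernel_order (real CARD('n) + 1 + Re b + 0 - (real k + t)) d"
    unfolding d_def A
  proof (rule kernel_order_rational_pochhammer)
    show "0 \<le> real CARD('n) + 1 + Re s + real J - real k" using J by simp
    show "Re ?c \<le> real CARD('n) + 1 + Re s + real J - real k" using J by simp
    show "Re ?c + real (degree Q) - real k \<le> real CARD('n) + 1 + Re s + real J - real k" using dQ by simp
  qed
  have cJ: "?ct + of_nat J \<notin> \<int>\<^sub>\<le>\<^sub>0"
  proof
    assume "?ct + of_nat J \<in> \<int>\<^sub>\<le>\<^sub>0"
    then obtain k where "?ct + of_nat J = - of_nat k" by (rule nonpos_Ints_cases')
    then have "Re (?ct + of_nat J) = - real k" by simp
    then show False using b by (simp add: b_def)
  qed
  have dd: "d j * (fact j / pochhammer (of_nat CARD('n) + 1 + b) j) = \<delta> j" for j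
  proof -
    have e: "pochhammer (?ct + of_nat j) J / pochhammer ?ct J = pochhammer (?ct + of_nat J) j / pochhammer ?ct j"
      by (rule pochhammer_shift_quotient[OF nz(2), symmetric])
    have "poly Q (of_nat j) = pochhammer (?ct + of_nat j) J / pochhammer ?ct J"
      by (simp add: Q_def poly_rising_poly divide_inverse mult_ac)
    also have "\<dots> = pochhammer (?ct + of_nat J) j / pochhammer ?ct j" by (simp only: e)
    finally show ?thesis
      unfolding d_def \<delta>_def \<gamma>_def bc multiplier_def using pochhammer_neq_0[OF cJ, of j] by simp
  qed
  have sub: "subexponential \<delta>"
  proof (rule subexponential_le)
    show "subexponential \<gamma>" unfolding \<gamma>_def by (intro subexponential_multiplier nz)
    show "norm (\<delta> j) \<le> norm (\<gamma> j)" for j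
    proof (cases "j = 0")
      case True
      then show ?thesis by (cases k) (auto simp: \<delta>_def)
    next
      case False
      then have "1 \<le> real j ^ k" by (intro one_le_power) simp
      then show ?thesis by (simp add: \<delta>_def norm_divide norm_power divide_le_eq mult_le_cancel_left1)
    qed
  qed
  have q: "0 < 1 / q" "0 < 1 / p" using pq by simp_all
  have x0: "- (1 / p) < 0" using q by simp
  have "- (1 / q) < 0" using q by simp
  moreover have c2b: "real k + t \<le> Re b" using J by (simp add: b_def)
  ultimately have c2: "- (1 / q) < Re b - (real k + t)" "real k + t \<le> Re b" by linarith+
  obtain C where C: "C > 0" "\<forall>(F :: complex ^ 'n \<Rightarrow> complex) \<phi> S. expansion_of F \<phi> \<longrightarrow> integrable vol (\<lambda>z. (bdist z powr (real k + t) * norm (F z)) powr p) \<longrightarrow>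
     (\<forall>z\<in>unit_ball. S z = (\<Sum>j. \<delta> j * \<phi> j z)) \<longrightarrow>
     integrable vol (\<lambda>z. (bdist z powr 0 * norm (S z)) powr p) \<and>
     (LINT z|vol. (bdist z powr 0 * norm (S z)) powr p) \<le> C * (LINT z|vol. (bdist z powr (real k + t) * norm (F z)) powr p)"
    using multiplier_bound[where 'n='n, OF pq x0 b c2 ko dd sub] by blast
  have b0: "(bdist z powr 0 * norm (G z)) powr p = norm (G z) powr p" if "z \<in> unit_ball" for z and G :: "complex ^ 'n \<Rightarrow> complex"
    using bdist_pos[OF that] by simp
  have i0: "integrable vol (\<lambda>z. (bdist z powr 0 * norm (G z)) powr p) \<longleftrightarrow> integrable vol (\<lambda>z. norm (G z) powr p)"
    "(LINT z|vol. (bdist z powr 0 * norm (G z)) powr p) = (LINT z|vol. norm (G z) powr p)" for G :: "complex ^ 'n \<Rightarrow> complex"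
    by (rule Bochner_Integration.integrable_cong[OF refl b0], simp, rule Bochner_Integration.integral_cong[OF refl b0], simp)
  define D where "D = 2 powr p * (C + measure ?V unit_ball)"
  have D0: "D > 0" using C(1) by (auto simp: D_def intro!: mult_pos_pos add_pos_nonneg)
  show ?thesis
  proof (intro exI[of _ D] conjI[OF D0] allI impI)
    fix f :: "complex ^ 'n \<Rightarrow> complex" and \<phi> G
    assume f: "expansion_of f \<phi>" and int: "integrable vol (\<lambda>z. (bdist z powr (real k + t) * norm ((radial_deriv ^^ k) f z)) powr p)"
      and G: "expansion_of G (\<lambda>j z. multiplier ?c ?ct j * \<phi> j z)"
    define I where "I = (LINT z|vol. (bdist z powr (real k + t) * norm ((radial_deriv ^^ k) f z)) powr p)"
    define a where "a = (if k = 0 then 0 else f 0)"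
    define S where "S = (\<lambda>z. \<Sum>j. \<delta> j * (of_nat j ^ k * \<phi> j z))"
    note Rf = expansion_of_radial_deriv_funpow[OF f, of k]
    have S: "integrable vol (\<lambda>z. norm (S z) powr p)" "(LINT z|vol. norm (S z) powr p) \<le> C * I"
      using C(2)[rule_format, OF Rf int, of S] unfolding i0 S_def I_def by blast+
    have Sexp: "expansion_of S (\<lambda>j z. \<delta> j * (of_nat j ^ k * \<phi> j z))"
    proof (rule expansion_of_series)
      have "homogeneous_series (\<lambda>j z. of_nat j ^ k * \<phi> j z)" using Rf by (simp add: expansion_of_def)
      then show "homogeneous_series (\<lambda>j z. \<delta> j * (of_nat j ^ k * \<phi> j z))" by (rule homogeneous_series_multiplier[OF _ sub])
    qed (simp add: S_def)
    have Gz: "G z = S z + a" if z: "z \<in> unit_ball" for z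
    proof -
      have s1: "(\<lambda>j. \<delta> j * (of_nat j ^ k * \<phi> j z)) sums S z" using Sexp z unfolding expansion_of_def by blast
      have s2: "(\<lambda>j. if j = 0 then a else 0) sums a" using sums_single[of 0 "\<lambda>_. a"] by simp
      have "\<delta> j * (of_nat j ^ k * \<phi> j z) + (if j = 0 then a else 0) = \<gamma> j * \<phi> j z" for j
      proof (cases "j = 0")
        case True
        have "\<gamma> 0 = 1" "\<phi> 0 z = f 0" using expansion_of_0[OF f] by (simp_all add: \<gamma>_def multiplier_def)
        then show ?thesis using True by (cases k) (simp_all add: \<delta>_def a_def)
      qed (simp add: \<delta>_def)
      then have "(\<lambda>j. \<gamma> j * \<phi> j z) sums (S z + a)" using sums_add[OF s1 s2] by simp
      moreover have "(\<lambda>j. \<gamma> j * \<phi> j z) sums G z" using G z unfolding expansion_of_def \<gamma>_def by blast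
      ultimately show ?thesis by (rule sums_unique2[symmetric])
    qed
    have na: "norm a powr p \<le> norm (f 0) powr p" using pq by (auto simp: a_def)
    have pt: "norm (G z) powr p \<le> 2 powr p * (norm (S z) powr p + norm (f 0) powr p)" if z: "z \<in> unit_ball" for z
    proof -
      have "norm (G z) \<le> norm (S z) + norm a" unfolding Gz[OF z] by (rule norm_triangle_ineq)
      also have "\<dots> \<le> 2 * max (norm (S z)) (norm a)" by simp
      finally have "norm (G z) powr p \<le> (2 * max (norm (S z)) (norm a)) powr p" using pq by (intro powr_mono2) auto
      also have "\<dots> = 2 powr p * max (norm (S z)) (norm a) powr p" by (simp add: powr_mult le_max_iff_disj)
      also have "max (norm (S z)) (norm a) powr p \<le> norm (S z) powr p + norm a powr p"
        by (simp add: max_def)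
      finally have "norm (G z) powr p \<le> 2 powr p * (norm (S z) powr p + norm a powr p)" by simp
      also have "\<dots> \<le> 2 powr p * (norm (S z) powr p + norm (f 0) powr p)"
        using na by (intro mult_left_mono add_left_mono) auto
      finally show ?thesis .
    qed
    have iB: "integrable ?V (\<lambda>z. 2 powr p * (norm (S z) powr p + norm (f 0) powr p))"
      using S(1) finite_measure.integrable_const[OF finite_measure_vol]
      by (intro integrable_mult_right Bochner_Integration.integrable_add)
    have Gm[measurable]: "G \<in> borel_measurable ?V" by (rule expansion_of_measurable[OF G])
    have iG: "integrable ?V (\<lambda>z. norm (G z) powr p)"
    proof (rule Bochner_Integration.integrable_bound[OF iB])
      show "AE z in ?V. norm (norm (G z) powr p) \<le> norm (2 powr p * (norm (S z) powr p + norm (f 0) powr p))"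
        by (rule AE_I2) (use pt in \<open>simp add: abs_mult\<close>)
    qed measurable
    have "(LINT z|vol. norm (G z) powr p) \<le> (LINT z|vol. 2 powr p * (norm (S z) powr p + norm (f 0) powr p))"
      by (rule integral_mono[OF iG iB]) (use pt in simp)
    also have "\<dots> = 2 powr p * ((LINT z|vol. norm (S z) powr p) + norm (f 0) powr p * measure ?V unit_ball)"
    proof -
      have ic: "integrable ?V (\<lambda>z. norm (f 0) powr p)" by (rule finite_measure.integrable_const[OF finite_measure_vol])
      have "(LINT z|?V. norm (S z) powr p + norm (f 0) powr p) = (LINT z|?V. norm (S z) powr p) + (LINT z|?V. norm (f 0) powr p)"
        by (rule Bochner_Integration.integral_add[OF S(1) ic])
      also have "(LINT z|?V. norm (f 0) powr p) = norm (f 0) powr p * measure ?V unit_ball"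
        by (simp only: lebesgue_integral_const space_vol real_scaleR_def mult.commute)
      finally show ?thesis by (simp only: integral_mult_right_zero)
    qed
    also have "\<dots> \<le> 2 powr p * (C * I + norm (f 0) powr p * measure ?V unit_ball)"
      using S(2) by (intro mult_left_mono add_right_mono) auto
    also have "\<dots> \<le> D * (norm (f 0) powr p + I)"
    proof -
      have I0: "0 \<le> I" by (simp add: I_def)
      have "C * I + norm (f 0) powr p * measure ?V unit_ball \<le> (C + measure ?V unit_ball) * (norm (f 0) powr p + I)"
        using C(1) I0 by (simp add: algebra_simps)
      then show ?thesis unfolding D_def mult.assoc by (intro mult_left_mono) auto
    qed
    finally show "integrable vol (\<lambda>z. norm (G z) powr p) \<and>
     (LINT z|vol. norm (G z) powr p) \<le> D * (norm (f 0) powr p + (LINT z|vol. (bdist z powr (real k + t) * norm ((radial_deriv ^^ k) f z)) powr p))"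
      using iG by (simp add: I_def)
  qed
qed

section \<open>Weighted spaces as images of the unweighted one\<close>

lemma measure_vol_pos: "0 < measure (vol :: (complex ^ 'n) measure) unit_ball"
  using content_ball_pos[of 1 "0 :: complex ^ 'n"]
  by (simp add: vol_def measure_restrict_space)

lemma wvol_const_pos: "0 < wvol_const TYPE('n::finite) \<alpha>"
proof (cases "\<alpha> > -1")
  case True
  let ?V = "vol :: (complex ^ 'n) measure"
  have int: "integrable ?V (\<lambda>z. bdist z powr \<alpha>)" by (rule integrable_vol_weight[OF True])
  have "(LINT z|?V. bdist z powr \<alpha>) \<noteq> 0"
  proof
    assume "(LINT z|?V. bdist z powr \<alpha>) = 0"
    then have "AE z in ?V. bdist z powr \<alpha> = 0" using integral_nonneg_eq_0_iff_AE[OF int] by simp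
    moreover have "AE z in ?V. bdist z powr \<alpha> \<noteq> 0"
      by (rule AE_I2) (use bdist_pos in fastforce)
    ultimately have "AE z in ?V. False" by eventually_elim simp
    then have "emeasure ?V (space ?V) = 0" unfolding eventually_False ae_filter_eq_bot_iff .
    then show False using measure_vol_pos[where 'n='n] by (simp add: measure_def)
  qed
  moreover have "0 \<le> (LINT z|?V. bdist z powr \<alpha>)" by simp
  ultimately have "0 < (LINT z|?V. bdist z powr \<alpha>)" by linarith
  then show ?thesis using True by (simp add: wvol_const_def)
qed (simp add: wvol_const_def)

lemma
  fixes u :: "complex ^ 'n \<Rightarrow> real"
  assumes [measurable]: "u \<in> borel_measurable vol"
  shows integrable_wvol: "integrable (wvol \<alpha>) u \<longleftrightarrow> integrable vol (\<lambda>z. bdist z powr \<alpha> * u z)"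
    and integral_wvol: "(LINT z|wvol \<alpha>. u z) = wvol_const TYPE('n) \<alpha> * (LINT z|vol. bdist z powr \<alpha> * u z)"
proof -
  have [measurable]: "(\<lambda>z::complex ^ 'n. wvol_const TYPE('n) \<alpha> * bdist z powr \<alpha>) \<in> borel_measurable vol"
    by (rule measurable_vol) measurable
  have nn: "AE z::complex ^ 'n in vol. 0 \<le> wvol_const TYPE('n) \<alpha> * bdist z powr \<alpha>"
    using wvol_const_pos[where 'n='n, of \<alpha>] by simp
  have "integrable (wvol \<alpha>) u \<longleftrightarrow> integrable vol (\<lambda>z. wvol_const TYPE('n) \<alpha> * (bdist z powr \<alpha> * u z))"
    unfolding wvol_def by (subst integrable_density[OF _ _ nn]) (simp_all add: mult.assoc)
  then show "integrable (wvol \<alpha>) u \<longleftrightarrow> integrable vol (\<lambda>z. bdist z powr \<alpha> * u z)"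
    using wvol_const_pos[where 'n='n, of \<alpha>] by simp
  have "(LINT z|wvol \<alpha>. u z) = (LINT z|vol. wvol_const TYPE('n) \<alpha> * (bdist z powr \<alpha> * u z))"
    unfolding wvol_def by (subst integral_density[OF _ _ nn]) (simp_all add: mult.assoc)
  then show "(LINT z|wvol \<alpha>. u z) = wvol_const TYPE('n) \<alpha> * (LINT z|vol. bdist z powr \<alpha> * u z)" by simp
qed

lemma weight_powr:
  fixes z :: "complex ^ 'n"
  assumes "0 < p" "z \<in> unit_ball" "0 \<le> x"
  shows "bdist z powr \<alpha> * (bdist z powr (p * real k) * x powr p) = (bdist z powr (real k + \<alpha> / p) * x) powr p"
proof -
  have "(bdist z powr (real k + \<alpha> / p) * x) powr p = bdist z powr ((real k + \<alpha> / p) * p) * x powr p"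
    using assms by (simp add: powr_mult powr_powr)
  also have "(real k + \<alpha> / p) * p = \<alpha> + p * real k" using assms by (simp add: field_simps)
  finally show ?thesis by (simp add: powr_add)
qed

lemma exponent_condition: "0 < p \<Longrightarrow> p * real k + \<alpha> > -1 \<longleftrightarrow> - (1 / p) < real k + \<alpha> / p"
  by (simp add: field_simps)

lemma bergman_iff:
  assumes p: "0 < p"
  shows "f \<in> bergman p \<alpha> \<longleftrightarrow> holomorphic_in_ball f \<and> (\<forall>z. z \<notin> unit_ball \<longrightarrow> f z = 0) \<and>
    (\<exists>k::nat. - (1 / p) < real k + \<alpha> / p \<and> integrable vol (\<lambda>z. (bdist z powr (real k + \<alpha> / p) * norm ((radial_deriv ^^ k) f z)) powr p))"
proof (cases "holomorphic_in_ball f")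
  case True
  have "in_Lp (wvol \<alpha>) p (\<lambda>z. of_real ((1 - (norm z)\<^sup>2) ^ k) * (radial_deriv ^^ k) f z) \<longleftrightarrow>
     integrable vol (\<lambda>z. (bdist z powr (real k + \<alpha> / p) * norm ((radial_deriv ^^ k) f z)) powr p)" for k
  proof -
    have Rm: "(radial_deriv ^^ k) f \<in> borel_measurable vol"
      by (rule expansion_of_measurable[OF expansion_of_radial_deriv_funpow[OF expansion_of_slice_coeff[OF True]]])
    have wm: "(\<lambda>z. complex_of_real ((1 - (norm z)\<^sup>2) ^ k)) \<in> borel_measurable vol" by (rule measurable_vol) measurable
    have um: "(\<lambda>z. of_real ((1 - (norm z)\<^sup>2) ^ k) * (radial_deriv ^^ k) f z) \<in> borel_measurable vol"
      using wm Rm by (rule borel_measurable_times)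
    have "in_Lp (wvol \<alpha>) p (\<lambda>z. of_real ((1 - (norm z)\<^sup>2) ^ k) * (radial_deriv ^^ k) f z) \<longleftrightarrow>
       integrable (wvol \<alpha>) (\<lambda>z. norm (of_real ((1 - (norm z)\<^sup>2) ^ k) * (radial_deriv ^^ k) f z) powr p)"
      unfolding in_Lp_def using um by (simp add: wvol_def)
    also have "\<dots> \<longleftrightarrow> integrable vol (\<lambda>z. bdist z powr \<alpha> * norm (of_real ((1 - (norm z)\<^sup>2) ^ k) * (radial_deriv ^^ k) f z) powr p)"
    proof (rule integrable_wvol)
      note [measurable] = um
      show "(\<lambda>z. norm (of_real ((1 - (norm z)\<^sup>2) ^ k) * (radial_deriv ^^ k) f z) powr p) \<in> borel_measurable vol" by measurable
    qed
    also have "\<dots> \<longleftrightarrow> integrable vol (\<lambda>z. (bdist z powr (real k + \<alpha> / p) * norm ((radial_deriv ^^ k) f z)) powr p)"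
    proof (rule Bochner_Integration.integrable_cong[OF refl])
      fix z :: "complex ^ 'a" assume "z \<in> space vol"
      then have z: "z \<in> unit_ball" by simp
      have "norm (of_real ((1 - (norm z)\<^sup>2) ^ k) * (radial_deriv ^^ k) f z) powr p = bdist z powr (p * real k) * norm ((radial_deriv ^^ k) f z) powr p"
        using bdist_pos[OF z] p
        by (simp add: norm_mult norm_power powr_mult powr_powr mult.commute del: of_real_power of_real_diff flip: powr_realpow)
      then show "bdist z powr \<alpha> * norm (of_real ((1 - (norm z)\<^sup>2) ^ k) * (radial_deriv ^^ k) f z) powr p = (bdist z powr (real k + \<alpha> / p) * norm ((radial_deriv ^^ k) f z)) powr p"
        using weight_powr[OF p z] by simp
    qed
    finally show ?thesis .
  qed
  then show ?thesis unfolding bergman_def using exponent_condition[OF p] by simp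
qed (simp add: bergman_def)

lemma bergman_norm_eq:
  fixes f :: "complex ^ 'n \<Rightarrow> complex"
  assumes p: "0 < p" and f: "holomorphic_in_ball f" and N: "N = (LEAST N::nat. p * real N + \<alpha> > -1)"
  shows "bergman_norm p \<alpha> f = norm (f 0) + (wvol_const TYPE('n) \<alpha> *
    (LINT z|vol. (bdist z powr (real N + \<alpha> / p) * norm ((radial_deriv ^^ N) f z)) powr p)) powr (1 / p)"
proof -
  have Rm: "(radial_deriv ^^ N) f \<in> borel_measurable vol"
    by (rule expansion_of_measurable[OF expansion_of_radial_deriv_funpow[OF expansion_of_slice_coeff[OF f]]])
  have wm: "(\<lambda>z. (1 - (norm z)\<^sup>2) powr (p * real N)) \<in> borel_measurable vol" by (rule measurable_vol) measurable
  have "(LINT z|wvol \<alpha>. (1 - (norm z)\<^sup>2) powr (p * real N) * norm ((radial_deriv ^^ N) f z) powr p)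
    = wvol_const TYPE('n) \<alpha> * (LINT z|vol. bdist z powr \<alpha> * ((1 - (norm z)\<^sup>2) powr (p * real N) * norm ((radial_deriv ^^ N) f z) powr p))"
  proof (rule integral_wvol)
    note [measurable] = Rm wm
    show "(\<lambda>z. (1 - (norm z)\<^sup>2) powr (p * real N) * norm ((radial_deriv ^^ N) f z) powr p) \<in> borel_measurable vol" by measurable
  qed
  also have "(LINT z|vol. bdist z powr \<alpha> * ((1 - (norm z)\<^sup>2) powr (p * real N) * norm ((radial_deriv ^^ N) f z) powr p))
    = (LINT z|vol. (bdist z powr (real N + \<alpha> / p) * norm ((radial_deriv ^^ N) f z)) powr p)"
    by (rule Bochner_Integration.integral_cong[OF refl], rule weight_powr[OF p]) simp_all
  finally show ?thesis unfolding bergman_norm_def Let_def N[symmetric] by simp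
qed

lemma Least_exponent:
  assumes p: "0 < p" and N: "N = (LEAST N::nat. p * real N + \<alpha> > -1)"
  shows "- (1 / p) < real N + \<alpha> / p"
proof -
  obtain k :: nat where "- \<alpha> / p < real k" using reals_Archimedean2 by blast
  then have "- \<alpha> < real k * p" by (simp only: pos_divide_less_eq[OF p])
  then have "p * real k + \<alpha> > -1" by (simp add: mult.commute)
  then have "p * real N + \<alpha> > -1" unfolding N by (rule LeastI)
  then show ?thesis using exponent_condition[OF p] by blast
qed

lemma Ap_norm_powr: "0 < p \<Longrightarrow> Ap_norm p G powr p = (LINT z|vol. norm (G z) powr p)"
  by (simp add: Ap_norm_def powr_powr)

lemma Ap_norm_nonneg: "0 \<le> Ap_norm p G"
  by (simp add: Ap_norm_def)

lemma integrable_norm_Lp: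
  fixes G :: "complex ^ 'n \<Rightarrow> complex"
  assumes "1 \<le> p" and Gm: "G \<in> borel_measurable vol" and G: "integrable vol (\<lambda>z. norm (G z) powr p)"
  shows "integrable vol G"
proof (rule Bochner_Integration.integrable_bound[OF _ Gm])
  show "integrable vol (\<lambda>z. 1 + norm (G z) powr p)"
    using G finite_measure.integrable_const[OF finite_measure_vol] by (intro Bochner_Integration.integrable_add)
  show "AE z in vol. norm (G z) \<le> norm (1 + norm (G z) powr p)"
    by (rule AE_I2) (use le_one_plus_powr[OF assms(1)] in simp)
qed

text \<open>The mean value property and Hoelder's inequality.\<close>

lemma point_evaluation_0:
  assumes pq: "1 < p" "1 < q" "1 / p + 1 / q = 1"
  shows "\<exists>C>0. \<forall>(G :: complex ^ 'n \<Rightarrow> complex) \<phi>. expansion_of G \<phi> \<longrightarrow> integrable vol (\<lambda>z. norm (G z) powr p) \<longrightarrow> norm (G 0) \<le> C * Ap_norm p G"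
proof -
  let ?V = "vol :: (complex ^ 'n) measure"
  define \<omega> where "\<omega> = (\<lambda>u. complex_of_real ((1 - u) powr 0))"
  have \<omega>1: "\<omega> ((norm w)\<^sup>2) = 1" if "w \<in> unit_ball" for w :: "complex ^ 'n"
    using bdist_pos[OF that] by (simp add: \<omega>_def)
  define \<beta> where "\<beta> = ball_moment TYPE('n) \<omega> 0"
  have np: "1 + real CARD('n) \<notin> \<int>\<^sub>\<le>\<^sub>0"
  proof
    assume "1 + real CARD('n) \<in> \<int>\<^sub>\<le>\<^sub>0"
    then obtain m where "1 + real CARD('n) = of_int m" "m \<le> 0" by (elim nonpos_Ints_cases)
    then show False by linarith
  qed
  have "\<beta> \<noteq> 0"
    using gauss_const_pos[where 'n='n] Gamma_real_pos[of "real (CARD('n) - 1) + 2"]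
    unfolding \<beta>_def ball_moment_def \<omega>_def by (subst radial_moment_powr_real(1)) (use np in \<open>simp_all add: Gamma_eq_zero_iff\<close>)
  define B where "B = measure ?V unit_ball powr (1 / q)"
  define C where "C = B / norm \<beta>"
  have C0: "C > 0" unfolding C_def B_def using measure_vol_pos[where 'n='n] \<open>\<beta> \<noteq> 0\<close> by simp
  have "norm (G 0) \<le> C * Ap_norm p G"
    if G: "expansion_of G \<phi>" and iG: "integrable ?V (\<lambda>z. norm (G z) powr p)" for G :: "complex ^ 'n \<Rightarrow> complex" and \<phi>
  proof -
    have Gm[measurable]: "G \<in> borel_measurable ?V" by (rule expansion_of_measurable[OF G])
    have \<omega>m: "\<omega> \<in> borel_measurable borel" unfolding \<omega>_def by measurable
    have i\<omega>: "integrable ?V (\<lambda>w. \<omega> ((norm w)\<^sup>2))"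
      unfolding \<omega>_def by (intro integrable_of_real integrable_vol_weight) simp
    have GI: "integrable ?V G" using pq Gm iG by (intro integrable_norm_Lp) auto
    have iG\<omega>: "integrable ?V (\<lambda>w. G w * \<omega> ((norm w)\<^sup>2))"
      by (rule Bochner_Integration.integrable_cong[OF refl, THEN iffD1, OF _ GI]) (simp add: \<omega>1)
    have "(LINT w|vol. G w * cip 0 w ^ 0 * \<omega> ((norm w)\<^sup>2)) = \<beta> * \<phi> 0 0"
      unfolding \<beta>_def by (rule integral_against_cip_power[OF G \<omega>m i\<omega> iG\<omega>])
    moreover have "(LINT w|vol. G w * cip 0 w ^ 0 * \<omega> ((norm w)\<^sup>2)) = (LINT w|vol. G w)"
      by (rule Bochner_Integration.integral_cong[OF refl]) (simp add: \<omega>1)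
    ultimately have "\<beta> * G 0 = (LINT w|vol. G w)" using expansion_of_0[OF G] by simp
    then have "norm \<beta> * norm (G 0) = norm (LINT w|vol. G w)" by (metis norm_mult)
    also have "\<dots> \<le> (LINT w|vol. norm (G w))" by (rule integral_norm_bound)
    also have "\<dots> = (LINT w|vol. norm (G w) * 1)" by simp
    also have "\<dots> \<le> (LINT w|vol. norm (G w) powr p) powr (1 / p) * (LINT w|?V. 1 powr q) powr (1 / q)"
      using iG finite_measure.integrable_const[OF finite_measure_vol] by (intro Hoelder_integral(2)[OF pq]) auto
    also have "\<dots> = Ap_norm p G * B" by (simp add: Ap_norm_def B_def)
    finally show ?thesis using \<open>\<beta> \<noteq> 0\<close> by (simp add: C_def field_simps)
  qed
  with C0 show ?thesis by blast
qed

text \<open>The operator extended by 0 outside the ball, so that equality of images is equality on the ball.\<close>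

definition Rst_ball :: "complex \<Rightarrow> complex \<Rightarrow> (complex ^ 'n \<Rightarrow> complex) \<Rightarrow> complex ^ 'n \<Rightarrow> complex" where
  "Rst_ball s t f z = (if z \<in> unit_ball then Rst s t f z else 0)"

lemma expansion_of_Rst_ball:
  fixes f :: "complex ^ 'n \<Rightarrow> complex"
  assumes wd: "Rst_well_defined CARD('n) s t" and f: "expansion_of f \<phi>"
  shows "expansion_of (Rst_ball s t f) (\<lambda>k z. multiplier (of_nat CARD('n) + 1 + s) (of_nat CARD('n) + 1 + s + t) k * \<phi> k z)"
proof (rule expansion_of_series)
  show "homogeneous_series (\<lambda>k z. multiplier (of_nat CARD('n) + 1 + s) (of_nat CARD('n) + 1 + s + t) k * \<phi> k z)"
    using f Rst_well_defined_nonpos_Ints[OF wd]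
    by (intro homogeneous_series_multiplier subexponential_multiplier) (simp_all add: expansion_of_def)
qed (simp add: Rst_ball_def Rst_eq_multiplier[OF wd f])

lemma Rst_ball_inj:
  fixes f g :: "complex ^ 'n \<Rightarrow> complex"
  assumes wd: "Rst_well_defined CARD('n) s t" and f: "holomorphic_in_ball f" "\<And>z. z \<notin> unit_ball \<Longrightarrow> f z = 0"
    and g: "holomorphic_in_ball g" "\<And>z. z \<notin> unit_ball \<Longrightarrow> g z = 0" and eq: "Rst_ball s t f = Rst_ball s t g"
  shows "f = g"
proof
  fix z
  note F = expansion_of_slice_coeff[OF f(1)] and G = expansion_of_slice_coeff[OF g(1)]
  note nz = multiplier_neq_0[OF Rst_well_defined_nonpos_Ints[OF wd]]
  have "(\<lambda>k z. multiplier (of_nat CARD('n) + 1 + s) (of_nat CARD('n) + 1 + s + t) k * slice_coeff f k z)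
      = (\<lambda>k z. multiplier (of_nat CARD('n) + 1 + s) (of_nat CARD('n) + 1 + s + t) k * slice_coeff g k z)"
    using expansion_of_Rst_ball[OF wd F] expansion_of_Rst_ball[OF wd G] unfolding eq by (rule expansion_of_unique)
  from fun_cong[OF fun_cong[OF this]] have sc: "slice_coeff f k z = slice_coeff g k z" for k
    using nz[of k] mult_left_cancel by blast
  show "f z = g z"
  proof (cases "z \<in> unit_ball")
    case True
    then have "(\<lambda>k. slice_coeff f k z) sums f z" "(\<lambda>k. slice_coeff g k z) sums g z"
      using F G unfolding expansion_of_def by blast+
    then show ?thesis unfolding sc by (rule sums_unique2)
  qed (use f g in simp)
qed

text \<open>The inverse multiplier produces the preimage, and the backward estimate bounds its norm. The integrability for the smallest admissible order is recorded because membership in \<open>bergman\<close> only asserts integrability for some order.\<close>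

lemma Rst_ball_surj:
  assumes pq: "1 < p" "1 < q" "1 / p + 1 / q = 1" and wd: "Rst_well_defined CARD('n) s (of_real (\<alpha> / p))"
  shows "\<exists>C>0. \<forall>G\<in>(Ap p :: (complex ^ 'n \<Rightarrow> complex) set). \<exists>f\<in>bergman p \<alpha>. Rst_ball s (of_real (\<alpha> / p)) f = G \<and>
     bergman_norm p \<alpha> f \<le> C * Ap_norm p G \<and>
     integrable vol (\<lambda>z. (bdist z powr (real (LEAST N::nat. p * real N + \<alpha> > -1) + \<alpha> / p) * norm ((radial_deriv ^^ (LEAST N::nat. p * real N + \<alpha> > -1)) f z)) powr p)"
proof -
  let ?c = "of_nat CARD('n) + 1 + s"
  let ?ct = "of_nat CARD('n) + 1 + s + complex_of_real (\<alpha> / p)"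
  note nz = Rst_well_defined_nonpos_Ints[OF wd]
  define N where "N = (LEAST N::nat. p * real N + \<alpha> > -1)"
  have p: "0 < p" using pq by simp
  have Nc: "- (1 / p) < real N + \<alpha> / p" by (rule Least_exponent[OF p N_def])
  obtain C1 where C1: "C1 > 0" "\<forall>(G :: complex ^ 'n \<Rightarrow> complex) \<phi> f. expansion_of G \<phi> \<longrightarrow> integrable vol (\<lambda>z. norm (G z) powr p) \<longrightarrow>
     expansion_of f (\<lambda>j z. multiplier ?ct ?c j * \<phi> j z) \<longrightarrow>
     integrable vol (\<lambda>z. (bdist z powr (real N + \<alpha> / p) * norm ((radial_deriv ^^ N) f z)) powr p) \<and>
     (LINT z|vol. (bdist z powr (real N + \<alpha> / p) * norm ((radial_deriv ^^ N) f z)) powr p) \<le> C1 * (LINT z|vol. norm (G z) powr p)"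
    using backward_bound[OF pq wd Nc] by blast
  obtain C2 where C2: "C2 > 0" "\<forall>(G :: complex ^ 'n \<Rightarrow> complex) \<phi>. expansion_of G \<phi> \<longrightarrow> integrable vol (\<lambda>z. norm (G z) powr p) \<longrightarrow> norm (G 0) \<le> C2 * Ap_norm p G"
    using point_evaluation_0[where 'n='n, OF pq] by blast
  define \<kappa> where "\<kappa> = wvol_const TYPE('n) \<alpha>"
  have \<kappa>: "\<kappa> > 0" unfolding \<kappa>_def by (rule wvol_const_pos)
  define C where "C = C2 + (\<kappa> * C1) powr (1 / p)"
  have C0: "C > 0" unfolding C_def using C2(1) by (intro add_pos_nonneg) auto
  have "\<exists>f\<in>bergman p \<alpha>. Rst_ball s (of_real (\<alpha> / p)) f = G \<and> bergman_norm p \<alpha> f \<le> C * Ap_norm p G \<and>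
     integrable vol (\<lambda>z. (bdist z powr (real N + \<alpha> / p) * norm ((radial_deriv ^^ N) f z)) powr p)"
    if GA: "G \<in> Ap p" for G :: "complex ^ 'n \<Rightarrow> complex"
  proof -
    have hG: "holomorphic_in_ball G" and G0: "\<And>z. z \<notin> unit_ball \<Longrightarrow> G z = 0" and iG: "integrable vol (\<lambda>z. norm (G z) powr p)"
      using GA by (auto simp: Ap_def)
    define \<phi> where "\<phi> = slice_coeff G"
    have G: "expansion_of G \<phi>" unfolding \<phi>_def by (rule expansion_of_slice_coeff[OF hG])
    define f where "f = apply_multiplier (multiplier ?ct ?c) G"
    have f: "expansion_of f (\<lambda>j z. multiplier ?ct ?c j * \<phi> j z)"
      unfolding f_def by (rule expansion_of_apply_multiplier[OF G subexponential_multiplier[OF nz(2,1)]])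
    have hf: "holomorphic_in_ball f" by (rule expansion_imp_holomorphic[OF f])
    have f0: "f z = 0" if "z \<notin> unit_ball" for z using that by (simp add: f_def apply_multiplier_def)
    have If: "integrable vol (\<lambda>z. (bdist z powr (real N + \<alpha> / p) * norm ((radial_deriv ^^ N) f z)) powr p)"
      "(LINT z|vol. (bdist z powr (real N + \<alpha> / p) * norm ((radial_deriv ^^ N) f z)) powr p) \<le> C1 * (LINT z|vol. norm (G z) powr p)"
      using C1(2)[rule_format, OF G iG f] by blast+
    have "f \<in> bergman p \<alpha>" unfolding bergman_iff[OF p] using hf f0 If(1) Nc by blast
    moreover have "Rst_ball s (of_real (\<alpha> / p)) f = G"
    proof
      fix z
      show "Rst_ball s (of_real (\<alpha> / p)) f z = G z"
      proof (cases "z \<in> unit_ball")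
        case True
        have "(\<lambda>k. multiplier ?c ?ct k * (multiplier ?ct ?c k * \<phi> k z)) sums Rst_ball s (of_real (\<alpha> / p)) f z"
          using expansion_of_Rst_ball[OF wd f] True unfolding expansion_of_def by blast
        moreover have "multiplier ?c ?ct k * (multiplier ?ct ?c k * \<phi> k z) = \<phi> k z" for k
          using pochhammer_neq_0[OF nz(1), of k] pochhammer_neq_0[OF nz(2), of k] by (simp add: multiplier_def)
        ultimately have "(\<lambda>k. \<phi> k z) sums Rst_ball s (of_real (\<alpha> / p)) f z" by (simp only:)
        moreover have "(\<lambda>k. \<phi> k z) sums G z" using G True unfolding expansion_of_def by blast
        ultimately show ?thesis by (rule sums_unique2)
      qed (simp add: Rst_ball_def G0)
    qed
    moreover have "bergman_norm p \<alpha> f \<le> C * Ap_norm p G"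
    proof -
      have "norm (f 0) = norm (G 0)"
        using expansion_of_0[OF f, of 0] expansion_of_0[OF G, of 0] by (simp add: multiplier_def)
      then have 1: "norm (f 0) \<le> C2 * Ap_norm p G" using C2(2)[rule_format, OF G iG] by (simp only:)
      define I where "I = (LINT z|vol. (bdist z powr (real N + \<alpha> / p) * norm ((radial_deriv ^^ N) f z)) powr p)"
      have "(\<kappa> * I) powr (1 / p) \<le> ((\<kappa> * C1) * Ap_norm p G powr p) powr (1 / p)"
        using If(2) \<kappa> p by (intro powr_mono2) (auto simp: I_def Ap_norm_powr[OF p] mult.assoc)
      also have "\<dots> = (\<kappa> * C1) powr (1 / p) * Ap_norm p G"
        using \<kappa> C1(1) p Ap_norm_nonneg[of p G] by (simp add: powr_mult powr_powr)
      finally have 2: "(\<kappa> * I) powr (1 / p) \<le> (\<kappa> * C1) powr (1 / p) * Ap_norm p G" .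
      have "bergman_norm p \<alpha> f = norm (f 0) + (\<kappa> * I) powr (1 / p)"
        unfolding bergman_norm_eq[OF p hf N_def] \<kappa>_def I_def ..
      then show ?thesis using 1 2 by (simp add: C_def distrib_right)
    qed
    ultimately show ?thesis using If(1) by blast
  qed
  with C0 show ?thesis unfolding N_def by blast
qed

text \<open>Membership may come from an order \<open>k\<close> different from the one in the norm. The forward estimate with \<open>k\<close> places the image into the unweighted space; surjectivity and injectivity then recover integrability for the order in the norm.\<close>

lemma Rst_ball_bounded:
  assumes pq: "1 < p" "1 < q" "1 / p + 1 / q = 1" and wd: "Rst_well_defined CARD('n) s (of_real (\<alpha> / p))"
  shows "\<exists>C>0. \<forall>f\<in>(bergman p \<alpha> :: (complex ^ 'n \<Rightarrow> complex) set). Rst_ball s (of_real (\<alpha> / p)) f \<in> Ap p \<and>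
     Ap_norm p (Rst_ball s (of_real (\<alpha> / p)) f) \<le> C * bergman_norm p \<alpha> f"
proof -
  have p: "0 < p" using pq by simp
  define N where "N = (LEAST N::nat. p * real N + \<alpha> > -1)"
  have Nc: "- (1 / p) < real N + \<alpha> / p" by (rule Least_exponent[OF p N_def])
  define \<kappa> where "\<kappa> = wvol_const TYPE('n) \<alpha>"
  have \<kappa>: "\<kappa> > 0" unfolding \<kappa>_def by (rule wvol_const_pos)
  let ?R = "Rst_ball s (of_real (\<alpha> / p)) :: (complex ^ 'n \<Rightarrow> complex) \<Rightarrow> _"
  have mem: "?R f \<in> Ap p" if fb: "f \<in> bergman p \<alpha>" for f
  proof -
    obtain k :: nat where hf: "holomorphic_in_ball f" and k: "- (1 / p) < real k + \<alpha> / p"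
      and int: "integrable vol (\<lambda>z. (bdist z powr (real k + \<alpha> / p) * norm ((radial_deriv ^^ k) f z)) powr p)"
      using fb unfolding bergman_iff[OF p] by blast
    note f = expansion_of_slice_coeff[OF hf]
    note R = expansion_of_Rst_ball[OF wd f]
    have "integrable vol (\<lambda>z. norm (?R f z) powr p)"
      using forward_bound[OF pq wd k] f int R by blast
    then show ?thesis using expansion_imp_holomorphic[OF R] by (simp add: Ap_def Rst_ball_def)
  qed
  obtain D where D: "D > 0" "\<forall>(f :: complex ^ 'n \<Rightarrow> complex) \<phi> G. expansion_of f \<phi> \<longrightarrow>
     integrable vol (\<lambda>z. (bdist z powr (real N + \<alpha> / p) * norm ((radial_deriv ^^ N) f z)) powr p) \<longrightarrow>
     expansion_of G (\<lambda>j z. multiplier (of_nat CARD('n) + 1 + s) (of_nat CARD('n) + 1 + s + of_real (\<alpha> / p)) j * \<phi> j z) \<longrightarrow>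
     integrable vol (\<lambda>z. norm (G z) powr p) \<and>
     (LINT z|vol. norm (G z) powr p) \<le> D * (norm (f 0) powr p + (LINT z|vol. (bdist z powr (real N + \<alpha> / p) * norm ((radial_deriv ^^ N) f z)) powr p))"
    using forward_bound[OF pq wd Nc] by blast
  define C where "C = (D * (1 + 1 / \<kappa>)) powr (1 / p)"
  have "0 < 1 + 1 / \<kappa>" using \<kappa> by (intro add_pos_pos) auto
  then have C0: "C > 0" unfolding C_def using D(1) by simp
  have "Ap_norm p (?R f) \<le> C * bergman_norm p \<alpha> f" if fb: "f \<in> bergman p \<alpha>" for f
  proof -
    have hf: "holomorphic_in_ball f" and f0: "\<And>z. z \<notin> unit_ball \<Longrightarrow> f z = 0" using fb unfolding bergman_iff[OF p] by auto
    obtain g where g: "g \<in> bergman p \<alpha>" "?R g = ?R f"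
        and gi: "integrable vol (\<lambda>z. (bdist z powr (real N + \<alpha> / p) * norm ((radial_deriv ^^ N) g z)) powr p)"
      using Rst_ball_surj[OF pq wd] mem[OF fb] unfolding N_def by blast
    have hg: "holomorphic_in_ball g" and g0: "\<And>z. z \<notin> unit_ball \<Longrightarrow> g z = 0" using g(1) unfolding bergman_iff[OF p] by auto
    have "g = f" by (rule Rst_ball_inj[OF wd hg g0 hf f0 g(2)])
    with gi have int: "integrable vol (\<lambda>z. (bdist z powr (real N + \<alpha> / p) * norm ((radial_deriv ^^ N) f z)) powr p)" by simp
    note f = expansion_of_slice_coeff[OF hf]
    define I where "I = (LINT z|vol. (bdist z powr (real N + \<alpha> / p) * norm ((radial_deriv ^^ N) f z)) powr p)"
    have I0: "0 \<le> I" by (simp add: I_def)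
    define \<nu> where "\<nu> = bergman_norm p \<alpha> f"
    have \<nu>: "\<nu> = norm (f 0) + (\<kappa> * I) powr (1 / p)"
      unfolding \<nu>_def bergman_norm_eq[OF p hf N_def] \<kappa>_def I_def ..
    have \<nu>0: "0 \<le> \<nu>" unfolding \<nu> by simp
    have 1: "norm (f 0) powr p \<le> \<nu> powr p" using p unfolding \<nu> by (intro powr_mono2) auto
    have "((\<kappa> * I) powr (1 / p)) powr p \<le> \<nu> powr p" using p unfolding \<nu> by (intro powr_mono2) auto
    then have "\<kappa> * I \<le> \<nu> powr p" using p \<kappa> I0 by (simp add: powr_powr)
    then have 2: "I \<le> (1 / \<kappa>) * \<nu> powr p" using \<kappa> by (simp add: field_simps)
    have "(LINT z|vol. norm (?R f z) powr p) \<le> D * (norm (f 0) powr p + I)"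
      unfolding I_def using D(2) f int expansion_of_Rst_ball[OF wd f] by blast
    also have "\<dots> \<le> D * (\<nu> powr p + (1 / \<kappa>) * \<nu> powr p)" using 1 2 D(1) by (intro mult_left_mono add_mono) auto
    also have "\<dots> = D * (1 + 1 / \<kappa>) * \<nu> powr p" by (simp add: algebra_simps)
    finally have "Ap_norm p (?R f) \<le> (D * (1 + 1 / \<kappa>) * \<nu> powr p) powr (1 / p)"
      unfolding Ap_norm_def using p by (intro powr_mono2) auto
    also have "\<dots> = C * \<nu>" unfolding C_def using p D(1) \<kappa> \<nu>0 by (simp add: powr_mult powr_powr)
    finally show ?thesis by (simp add: \<nu>_def)
  qed
  with mem C0 show ?thesis by blast
qed

section \<open>Dilations\<close>

definition cut :: "(complex ^ 'n \<Rightarrow> complex) \<Rightarrow> complex ^ 'n \<Rightarrow> complex" where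
  "cut f z = (if z \<in> unit_ball then f z else 0)"

text \<open>The dilation \<open>f(r z)\<close>, cut off outside the ball.\<close>

definition dil :: "real \<Rightarrow> (complex ^ 'n \<Rightarrow> complex) \<Rightarrow> complex ^ 'n \<Rightarrow> complex" where
  "dil r f = cut (\<lambda>z. f (of_real r *s z))"

lemma norm_add_powr_le:
  fixes a b :: complex
  assumes "0 < p"
  shows "norm (a + b) powr p \<le> 2 powr p * (norm a powr p + norm b powr p)"
proof -
  have "norm (a + b) \<le> 2 * max (norm a) (norm b)" using norm_triangle_ineq[of a b] by linarith
  then have "norm (a + b) powr p \<le> (2 * max (norm a) (norm b)) powr p" using assms by (intro powr_mono2) auto
  also have "\<dots> = 2 powr p * max (norm a) (norm b) powr p" by (simp add: powr_mult le_max_iff_disj)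
  also have "\<dots> \<le> 2 powr p * (norm a powr p + norm b powr p)"
    by (intro mult_left_mono) (auto simp: max_def)
  finally show ?thesis .
qed

text \<open>Pointwise convergence and convergence of the norms imply convergence in the mean. The part of \<open>norm (f m x) powr p\<close> above \<open>norm (g x) powr p\<close> has an integral tending to 0, and what remains of \<open>norm (f m x - g x) powr p\<close> is dominated by a multiple of \<open>norm (g x) powr p\<close>.\<close>

lemma Lp_convergence:
  fixes f :: "nat \<Rightarrow> 'a \<Rightarrow> complex"
  assumes p: "0 < p" and fm[measurable]: "\<And>m. f m \<in> borel_measurable M" and gm[measurable]: "g \<in> borel_measurable M"
    and lim: "\<And>x. x \<in> space M \<Longrightarrow> (\<lambda>m. f m x) \<longlonglongrightarrow> g x"
    and fi: "\<And>m. integrable M (\<lambda>x. norm (f m x) powr p)" and gi: "integrable M (\<lambda>x. norm (g x) powr p)"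
    and le: "\<And>m. (LINT x|M. norm (f m x) powr p) \<le> a m * (LINT x|M. norm (g x) powr p)" and a: "a \<longlonglongrightarrow> 1"
  shows "\<And>m. integrable M (\<lambda>x. norm (f m x - g x) powr p)"
    and "(\<lambda>m. LINT x|M. norm (f m x - g x) powr p) \<longlonglongrightarrow> 0"
proof -
  have pt: "norm (f m x - g x) powr p \<le> 2 powr p * (norm (f m x) powr p + norm (g x) powr p)" for m x
    using norm_add_powr_le[OF p, of "f m x" "- g x"] by simp
  show id: "integrable M (\<lambda>x. norm (f m x - g x) powr p)" for m
  proof (rule Bochner_Integration.integrable_bound)
    show "integrable M (\<lambda>x. 2 powr p * (norm (f m x) powr p + norm (g x) powr p))"
      by (intro integrable_mult_right Bochner_Integration.integrable_add fi gi)
    show "AE x in M. norm (norm (f m x - g x) powr p) \<le> norm (2 powr p * (norm (f m x) powr p + norm (g x) powr p))"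
      by (rule AE_I2) (use pt in \<open>simp add: abs_mult\<close>)
  qed measurable
  define I where "I = (LINT x|M. norm (g x) powr p)"
  define u where "u = (\<lambda>m x. min (norm (f m x) powr p) (norm (g x) powr p))"
  define w where "w = (\<lambda>m x. max 0 (norm (f m x - g x) powr p - 2 powr p * (norm (f m x) powr p - u m x)))"
  have um[measurable]: "u m \<in> borel_measurable M" for m unfolding u_def by measurable
  have wm[measurable]: "w m \<in> borel_measurable M" for m unfolding w_def by measurable
  have limf: "(\<lambda>m. norm (f m x) powr p) \<longlonglongrightarrow> norm (g x) powr p" if "x \<in> space M" for x
    using p by (intro tendsto_powr' tendsto_norm lim[OF that]) auto
  have limu: "(\<lambda>m. u m x) \<longlonglongrightarrow> norm (g x) powr p" if "x \<in> space M" for x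
    using tendsto_min[OF limf[OF that] tendsto_const[of "norm (g x) powr p"]] by (simp add: u_def)
  have limd: "(\<lambda>m. norm (f m x - g x) powr p) \<longlonglongrightarrow> 0" if "x \<in> space M" for x
  proof -
    have "(\<lambda>m. norm (f m x - g x) powr p) \<longlonglongrightarrow> norm (g x - g x) powr p"
      using p by (intro tendsto_powr' tendsto_norm tendsto_diff lim[OF that] tendsto_const) auto
    then show ?thesis by simp
  qed
  have limw: "(\<lambda>m. w m x) \<longlonglongrightarrow> 0" if "x \<in> space M" for x
  proof -
    have "(\<lambda>m. w m x) \<longlonglongrightarrow> max 0 (0 - 2 powr p * (norm (g x) powr p - norm (g x) powr p))"
      unfolding w_def by (intro tendsto_max tendsto_diff tendsto_mult tendsto_const limd limf limu that)
    then show ?thesis by simp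
  qed
  have U: "(\<lambda>m. LINT x|M. u m x) \<longlonglongrightarrow> I"
    unfolding I_def
  proof (rule integral_dominated_convergence[where w="\<lambda>x. norm (g x) powr p"])
    show "AE x in M. (\<lambda>m. u m x) \<longlonglongrightarrow> norm (g x) powr p" using limu by (rule AE_I2)
    show "AE x in M. norm (u m x) \<le> norm (g x) powr p" for m by (rule AE_I2) (simp add: u_def)
  qed (use gi in measurable)
  have wb: "norm (w m x) \<le> 2 * 2 powr p * norm (g x) powr p" for m x
  proof -
    have "u m x \<le> norm (g x) powr p" by (simp add: u_def)
    then have "2 powr p * u m x \<le> 2 powr p * norm (g x) powr p" by (intro mult_left_mono) auto
    then have "norm (f m x - g x) powr p - 2 powr p * (norm (f m x) powr p - u m x) \<le> 2 * 2 powr p * norm (g x) powr p"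
      using pt[of m x] unfolding distrib_left right_diff_distrib by linarith
    then show ?thesis by (simp add: w_def)
  qed
  have gi2: "integrable M (\<lambda>x. 2 * 2 powr p * norm (g x) powr p)" by (intro integrable_mult_right gi)
  have W: "(\<lambda>m. LINT x|M. w m x) \<longlonglongrightarrow> (LINT x|M. 0)"
  proof (rule integral_dominated_convergence[where w="\<lambda>x. 2 * 2 powr p * norm (g x) powr p", OF _ wm gi2])
    show "AE x in M. (\<lambda>m. w m x) \<longlonglongrightarrow> 0" using limw by (rule AE_I2)
    show "AE x in M. norm (w m x) \<le> 2 * 2 powr p * norm (g x) powr p" for m using wb by (rule AE_I2)
  qed simp
  have ui: "integrable M (u m)" for m
    by (rule Bochner_Integration.integrable_bound[OF gi um]) (auto simp: u_def)
  have wi: "integrable M (w m)" for m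
    by (rule Bochner_Integration.integrable_bound[OF gi2 wm]) (use wb in auto)
  have ub: "(LINT x|M. norm (f m x - g x) powr p) \<le> (LINT x|M. w m x) + 2 powr p * (a m * I - (LINT x|M. u m x))" for m
  proof -
    have ii: "integrable M (\<lambda>x. 2 powr p * (norm (f m x) powr p - u m x))"
      by (intro integrable_mult_right Bochner_Integration.integrable_diff fi ui)
    have "(LINT x|M. norm (f m x - g x) powr p) \<le> (LINT x|M. w m x + 2 powr p * (norm (f m x) powr p - u m x))"
      by (rule integral_mono[OF id Bochner_Integration.integrable_add[OF wi ii]]) (simp add: w_def)
    also have "\<dots> = (LINT x|M. w m x) + (LINT x|M. 2 powr p * (norm (f m x) powr p - u m x))"
      by (rule Bochner_Integration.integral_add[OF wi ii])
    also have "(LINT x|M. 2 powr p * (norm (f m x) powr p - u m x)) = 2 powr p * ((LINT x|M. norm (f m x) powr p) - (LINT x|M. u m x))"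
      by (simp only: integral_mult_right_zero Bochner_Integration.integral_diff[OF fi ui])
    finally have "(LINT x|M. norm (f m x - g x) powr p)
        \<le> (LINT x|M. w m x) + 2 powr p * ((LINT x|M. norm (f m x) powr p) - (LINT x|M. u m x))" .
    moreover have "2 powr p * (LINT x|M. norm (f m x) powr p) \<le> 2 powr p * (a m * I)"
      unfolding I_def by (intro mult_left_mono le) simp
    ultimately show ?thesis unfolding right_diff_distrib by linarith
  qed
  have "(\<lambda>m. (LINT x|M. w m x) + 2 powr p * (a m * I - (LINT x|M. u m x))) \<longlonglongrightarrow> (LINT x|M. 0) + 2 powr p * (1 * I - I)"
    by (intro tendsto_intros W U a)
  then have "(\<lambda>m. (LINT x|M. w m x) + 2 powr p * (a m * I - (LINT x|M. u m x))) \<longlonglongrightarrow> 0" by simp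
  from tendsto_sandwich[OF _ _ tendsto_const this] show "(\<lambda>m. LINT x|M. norm (f m x - g x) powr p) \<longlonglongrightarrow> 0"
    using ub by simp
qed

lemma Fatou_Lp:
  fixes f :: "nat \<Rightarrow> 'a \<Rightarrow> complex"
  assumes p: "0 < p" and fm[measurable]: "\<And>m. f m \<in> borel_measurable M" and gm[measurable]: "g \<in> borel_measurable M"
    and lim: "\<And>x. x \<in> space M \<Longrightarrow> (\<lambda>m. f m x) \<longlonglongrightarrow> g x"
    and fi: "\<And>m. integrable M (\<lambda>x. norm (f m x) powr p)"
    and le: "\<And>m. (LINT x|M. norm (f m x) powr p) \<le> K" and K: "0 \<le> K"
  shows "integrable M (\<lambda>x. norm (g x) powr p)" "(LINT x|M. norm (g x) powr p) \<le> K"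
proof -
  have "(\<integral>\<^sup>+x. ennreal (norm (g x) powr p) \<partial>M) = (\<integral>\<^sup>+x. liminf (\<lambda>m. ennreal (norm (f m x) powr p)) \<partial>M)"
  proof (rule nn_integral_cong)
    fix x assume "x \<in> space M"
    then have "(\<lambda>m. ennreal (norm (f m x) powr p)) \<longlonglongrightarrow> ennreal (norm (g x) powr p)"
      using p by (intro tendsto_ennrealI tendsto_powr' tendsto_norm lim) auto
    then show "ennreal (norm (g x) powr p) = liminf (\<lambda>m. ennreal (norm (f m x) powr p))"
      by (metis lim_imp_Liminf sequentially_bot)
  qed
  also have "\<dots> \<le> liminf (\<lambda>m. \<integral>\<^sup>+x. ennreal (norm (f m x) powr p) \<partial>M)"
    by (rule nn_integral_liminf) measurable
  also have "\<dots> \<le> limsup (\<lambda>m. \<integral>\<^sup>+x. ennreal (norm (f m x) powr p) \<partial>M)"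
    by (rule Liminf_le_Limsup) simp
  also have "\<dots> \<le> ennreal K"
    by (rule Limsup_bounded) (use le in \<open>simp add: nn_integral_eq_integral[OF fi] ennreal_leI\<close>)
  finally have n: "(\<integral>\<^sup>+x. ennreal (norm (g x) powr p) \<partial>M) \<le> ennreal K" .
  have m: "(\<lambda>x. norm (g x) powr p) \<in> borel_measurable M" by measurable
  show "integrable M (\<lambda>x. norm (g x) powr p)" "(LINT x|M. norm (g x) powr p) \<le> K"
    using integral_le_nn_integral_bound[OF m _ n K] by simp_all
qed

lemma ApI:
  assumes "expansion_of G \<phi>" "\<And>z. z \<notin> unit_ball \<Longrightarrow> G z = 0" "integrable vol (\<lambda>z. norm (G z) powr p)"
  shows "G \<in> Ap p"
  using assms expansion_imp_holomorphic by (auto simp: Ap_def)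

lemma Ap_expansion: "G \<in> Ap p \<Longrightarrow> expansion_of G (slice_coeff G)"
  by (simp add: Ap_def expansion_of_slice_coeff)

lemma Ap_measurable: "G \<in> Ap p \<Longrightarrow> G \<in> borel_measurable vol"
  by (rule expansion_of_measurable[OF Ap_expansion])

lemma Ap_outside: "G \<in> Ap p \<Longrightarrow> z \<notin> unit_ball \<Longrightarrow> G z = 0"
  by (auto simp: Ap_def)

lemma Ap_integrable: "G \<in> Ap p \<Longrightarrow> integrable vol (\<lambda>z. norm (G z) powr p)"
  by (simp add: Ap_def)

lemma expansion_of_cmult: "expansion_of f \<phi> \<Longrightarrow> expansion_of (\<lambda>z. c * f z) (\<lambda>k z. c * \<phi> k z)"
proof -
  assume f: "expansion_of f \<phi>"
  have "subexponential (\<lambda>_. c)"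
    unfolding subexponential_def
  proof (intro allI impI exI[of _ "norm c"])
    fix r :: real and k :: nat assume "0 < r" "r < 1"
    then show "norm c * r ^ k \<le> norm c" by (intro mult_left_le) (auto intro: power_le_one)
  qed
  with f show ?thesis
    unfolding expansion_of_def by (auto intro: homogeneous_series_multiplier sums_mult)
qed

lemma Ap_add:
  assumes "0 < p" "f \<in> Ap p" "g \<in> Ap p"
  shows "(\<lambda>z. f z + g z) \<in> Ap p"
proof (rule ApI)
  show "expansion_of (\<lambda>z. f z + g z) (\<lambda>k z. slice_coeff f k z + slice_coeff g k z)"
    by (intro expansion_of_add Ap_expansion[OF assms(2)] Ap_expansion[OF assms(3)])
  note [measurable] = Ap_measurable[OF assms(2)] Ap_measurable[OF assms(3)]
  show "integrable vol (\<lambda>z. norm (f z + g z) powr p)"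
  proof (rule Bochner_Integration.integrable_bound)
    show "integrable vol (\<lambda>z. 2 powr p * (norm (f z) powr p + norm (g z) powr p))"
      by (intro integrable_mult_right Bochner_Integration.integrable_add Ap_integrable assms)
    show "AE z in vol. norm (norm (f z + g z) powr p) \<le> norm (2 powr p * (norm (f z) powr p + norm (g z) powr p))"
      using norm_add_powr_le[OF assms(1)] by (simp add: abs_mult)
  qed measurable
qed (use assms in \<open>simp add: Ap_outside\<close>)

lemma Ap_cmult:
  assumes "f \<in> Ap p"
  shows "(\<lambda>z. c * f z) \<in> Ap p"
proof (rule ApI[OF expansion_of_cmult[OF Ap_expansion[OF assms]]])
  show "integrable vol (\<lambda>z. norm (c * f z) powr p)"
    using Ap_integrable[OF assms] by (simp add: norm_mult powr_mult)
qed (use assms in \<open>simp add: Ap_outside\<close>)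

lemma Ap_bounded:
  fixes G :: "complex ^ 'n \<Rightarrow> complex"
  assumes p: "0 < p" and G: "expansion_of G \<phi>" "\<And>z. z \<notin> unit_ball \<Longrightarrow> G z = 0"
    and B: "0 \<le> B" "\<And>z. z \<in> unit_ball \<Longrightarrow> norm (G z) \<le> B"
  shows "G \<in> Ap p" "Ap_norm p G \<le> B * measure (vol :: (complex ^ 'n) measure) unit_ball powr (1 / p)"
proof -
  let ?V = "vol :: (complex ^ 'n) measure"
  note [measurable] = expansion_of_measurable[OF G(1)]
  have le: "norm (G z) powr p \<le> B powr p" if "z \<in> unit_ball" for z
    using p B(2)[OF that] by (intro powr_mono2) auto
  have ic: "integrable ?V (\<lambda>z. B powr p)" by (rule finite_measure.integrable_const[OF finite_measure_vol])
  have i: "integrable ?V (\<lambda>z. norm (G z) powr p)"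
    by (rule Bochner_Integration.integrable_bound[OF ic]) (measurable, rule AE_I2, use le in simp)
  then show "G \<in> Ap p" by (intro ApI[OF G])
  have "(LINT z|?V. norm (G z) powr p) \<le> (LINT z|?V. B powr p)"
    by (rule integral_mono[OF i ic]) (use le in simp)
  also have "\<dots> = B powr p * measure ?V unit_ball"
    by (simp only: lebesgue_integral_const space_vol real_scaleR_def mult.commute)
  finally have "Ap_norm p G \<le> (B powr p * measure ?V unit_ball) powr (1 / p)"
    unfolding Ap_norm_def using p by (intro powr_mono2) auto
  also have "\<dots> = B * measure ?V unit_ball powr (1 / p)"
    using p B(1) by (simp add: powr_mult powr_powr)
  finally show "Ap_norm p G \<le> B * measure ?V unit_ball powr (1 / p)" .
qed

lemma expansion_of_cut:
  "expansion_of f \<phi> \<Longrightarrow> expansion_of (cut f) \<phi>"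
  by (simp add: expansion_of_def cut_def)

lemma expansion_of_homogeneous_poly:
  assumes h: "homogeneous_poly k h"
  shows "expansion_of h (\<lambda>j z. if j = k then h z else 0)"
proof -
  have z: "homogeneous_poly j (\<lambda>_. 0)" for j :: nat
    unfolding homogeneous_poly_def by (rule exI[of _ "\<lambda>_. 0"]) simp
  have hs: "homogeneous_series (\<lambda>j z. if j = k then h z else 0)"
    unfolding homogeneous_series_def
  proof (intro conjI allI impI)
    fix j show "homogeneous_poly j (\<lambda>z. if j = k then h z else 0)"
      using h z[of j] by (cases "j = k") simp_all
  next
    fix r :: real
    have "continuous_on (cball 0 r) h" by (rule continuous_on_homogeneous_poly[OF h])
    then have "bounded (h ` cball 0 r)" by (intro compact_imp_bounded compact_continuous_image) auto
    then obtain M where "\<And>z. z \<in> cball 0 r \<Longrightarrow> norm (h z) \<le> M" unfolding bounded_iff by blast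
    then have "norm (if j = k then h z else 0) \<le> max M 0" if "norm z \<le> r" for j and z
      using that by (force simp: le_max_iff_disj)
    then show "\<exists>M. \<forall>j z. norm z \<le> r \<longrightarrow> norm (if j = k then h z else 0) \<le> M" by blast
  qed
  have "(\<lambda>j. if j = k then h z else 0) sums h z" for z by (rule sums_single)
  with hs show ?thesis by (simp add: expansion_of_def)
qed

lemma real_smult_eq_scaleR: "of_real r *s (z :: complex ^ 'n) = r *\<^sub>R z"
  by (simp add: vec_eq_iff scaleR_conv_of_real[where 'a = complex])

lemma dil_in_ball: "0 < r \<Longrightarrow> r < 1 \<Longrightarrow> z \<in> unit_ball \<Longrightarrow> of_real r *s (z :: complex ^ 'n) \<in> unit_ball"
  using mult_strict_mono[of r 1 "norm z" 1] by simp

lemma expansion_of_dil: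
  assumes f: "expansion_of f \<phi>" and r: "0 < r" "r < 1"
  shows "expansion_of (dil r f) (\<lambda>k z. of_real r ^ k * \<phi> k z)"
proof -
  have "subexponential (\<lambda>k. of_real r ^ k)"
    unfolding subexponential_def
  proof (intro allI impI exI[of _ 1])
    fix t :: real and k :: nat assume "0 < t" "t < 1"
    then show "norm (complex_of_real r ^ k) * t ^ k \<le> 1"
      using r by (simp add: norm_power power_mult_distrib[symmetric] power_le_one mult_le_one)
  qed
  then have "homogeneous_series (\<lambda>k z. of_real r ^ k * \<phi> k z)"
    using f by (intro homogeneous_series_multiplier) (auto simp: expansion_of_def)
  moreover have "(\<lambda>k. of_real r ^ k * \<phi> k z) sums dil r f z" if z: "z \<in> unit_ball" for z
  proof -
    have "(\<lambda>k. \<phi> k (of_real r *s z)) sums f (of_real r *s z)"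
      using f dil_in_ball[OF r z] unfolding expansion_of_def by blast
    moreover have "\<phi> k (of_real r *s z) = of_real r ^ k * \<phi> k z" for k
      using f by (intro homogeneous_poly_smult) (simp add: expansion_of_def homogeneous_series_def)
    moreover have "dil r f z = f (of_real r *s z)" using z unfolding dil_def cut_def by (rule if_P)
    ultimately show ?thesis by simp
  qed
  ultimately show ?thesis by (simp add: expansion_of_def)
qed

lemma dil_bounded:
  assumes f: "expansion_of f \<phi>" and r: "0 < r" "r < 1"
  shows "\<exists>B\<ge>0. \<forall>z\<in>unit_ball. norm (dil r f z) \<le> B"
proof -
  have "continuous_on (cball 0 r) f"
    by (rule continuous_on_subset[OF expansion_of_continuous[OF f]]) (use r in auto)
  then have "bounded (f ` cball 0 r)" by (intro compact_imp_bounded compact_continuous_image) auto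
  then obtain B where B: "\<And>z. z \<in> cball 0 r \<Longrightarrow> norm (f z) \<le> B" unfolding bounded_iff by blast
  have "norm (dil r f z) \<le> max B 0" if z: "z \<in> unit_ball" for z
  proof -
    have "of_real r *s z \<in> cball 0 r" using r z by (simp add: mult_left_le)
    from B[OF this] show ?thesis by (simp add: dil_def cut_def le_max_iff_disj)
  qed
  then show ?thesis by (intro exI[of _ "max B 0"]) auto
qed

lemma dil_outside: "z \<notin> unit_ball \<Longrightarrow> dil r f z = 0"
  unfolding dil_def cut_def by (rule if_not_P)

lemma dil_Ap:
  assumes "0 < p" "expansion_of f \<phi>" "0 < r" "r < 1"
  shows "dil r f \<in> Ap p"
  using dil_bounded[OF assms(2-4)] Ap_bounded(1)[OF assms(1) expansion_of_dil[OF assms(2-4)] dil_outside] by blast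

text \<open>Change of variables: the dilated integral runs over a smaller ball.\<close>

lemma dil_integral_le:
  fixes f :: "complex ^ 'n \<Rightarrow> complex"
  assumes p: "0 < p" and f: "f \<in> Ap p" and r: "0 < r" "r < 1"
  shows "(LINT z|vol. norm (dil r f z) powr p) \<le> (1 / r) ^ (2 * CARD('n)) * (LINT z|vol. norm (f z) powr p)"
proof -
  let ?V = "vol :: (complex ^ 'n) measure"
  define I where "I = (LINT z|?V. norm (f z) powr p)"
  define D where "D = 2 * CARD('n)"
  define u where "u = (\<lambda>x. indicator unit_ball x *\<^sub>R norm (f x) powr p)"
  define v where "v = (\<lambda>x. indicator unit_ball x *\<^sub>R norm (dil r f x) powr p)"
  have mb: "(\<lambda>x. indicator unit_ball x *\<^sub>R norm (g x) powr p) \<in> borel_measurable lborel"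
    if "g \<in> borel_measurable ?V" for g :: "complex ^ 'n \<Rightarrow> complex"
  proof -
    note [measurable] = that
    have "(\<lambda>x. norm (g x) powr p) \<in> borel_measurable ?V" by measurable
    then show ?thesis unfolding vol_def by (subst (asm) borel_measurable_restrict_space_iff) simp_all
  qed
  have um: "u \<in> borel_measurable borel"
    using mb[OF Ap_measurable[OF f]] by (simp add: u_def)
  have vm: "v \<in> borel_measurable lborel"
    using mb[OF expansion_of_measurable[OF expansion_of_dil[OF Ap_expansion[OF f] r]]] by (simp add: v_def)
  have ui: "integrable lborel u" using Ap_integrable[OF f] unfolding integrable_vol u_def .
  have uI: "(LINT x|lborel. u x) = I" unfolding I_def integral_vol u_def ..
  have I0: "0 \<le> I" by (simp add: I_def)
  have le: "v x \<le> u (0 + r *\<^sub>R x)" for x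
  proof (cases "x \<in> unit_ball")
    case True
    then show ?thesis
      using dil_in_ball[OF r True] by (simp add: u_def v_def dil_def cut_def real_smult_eq_scaleR)
  qed (simp add: u_def v_def)
  have "(\<integral>\<^sup>+x. ennreal (u x) \<partial>lborel) = ennreal (\<bar>r\<bar> ^ DIM(complex ^ 'n)) * (\<integral>\<^sup>+x. ennreal (u (0 + r *\<^sub>R x)) \<partial>lborel)"
    using um r by (intro nn_integral_lborel_affine) auto
  moreover have "(\<integral>\<^sup>+x. ennreal (u x) \<partial>lborel) = ennreal I"
    unfolding uI[symmetric] by (rule nn_integral_eq_integral[OF ui]) (simp add: u_def)
  ultimately have e: "ennreal I = ennreal (r ^ D) * (\<integral>\<^sup>+x. ennreal (u (0 + r *\<^sub>R x)) \<partial>lborel)"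
    using r by (simp add: D_def DIM_complex_vec mult.commute)
  have "(\<integral>\<^sup>+x. ennreal (u (0 + r *\<^sub>R x)) \<partial>lborel)
      = ennreal ((1 / r) ^ D * r ^ D) * (\<integral>\<^sup>+x. ennreal (u (0 + r *\<^sub>R x)) \<partial>lborel)"
    using r by (simp add: power_mult_distrib[symmetric])
  also have "\<dots> = ennreal ((1 / r) ^ D) * ennreal I" using r by (simp only: e ennreal_mult'' mult.assoc zero_le_power less_imp_le)
  also have "\<dots> = ennreal ((1 / r) ^ D * I)" using r I0 by (simp add: ennreal_mult)
  finally have n: "(\<integral>\<^sup>+x. ennreal (u (0 + r *\<^sub>R x)) \<partial>lborel) = ennreal ((1 / r) ^ D * I)" .
  have n2: "(\<integral>\<^sup>+x. ennreal (v x) \<partial>lborel) \<le> ennreal ((1 / r) ^ D * I)"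
    unfolding n[symmetric] by (intro nn_integral_mono ennreal_leI le)
  have v0: "0 \<le> v x" for x by (simp add: v_def)
  have "(LINT x|lborel. v x) \<le> (1 / r) ^ D * I"
    by (rule integral_le_nn_integral_bound(2)[OF vm v0 n2]) (use r I0 in simp)
  then show ?thesis unfolding integral_vol[of "\<lambda>z. norm (dil r f z) powr p"] v_def D_def I_def .
qed

definition dil_radius :: "nat \<Rightarrow> real" where "dil_radius m = 1 - 1 / (real m + 2)"

lemma dil_radius: "0 < dil_radius m" "1 / 2 \<le> dil_radius m" "dil_radius m < 1" "dil_radius \<longlonglongrightarrow> 1"
proof -
  show "1 / 2 \<le> dil_radius m" by (simp add: dil_radius_def field_simps)
  then show "0 < dil_radius m" by linarith
  show "dil_radius m < 1" by (simp add: dil_radius_def)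
  show "dil_radius \<longlonglongrightarrow> 1" unfolding dil_radius_def by real_asymp
qed

lemma dil_tendsto_pointwise:
  assumes f: "expansion_of f \<phi>" and z: "z \<in> unit_ball"
  shows "(\<lambda>m. dil (dil_radius m) f z) \<longlonglongrightarrow> f z"
proof -
  have "(\<lambda>m. dil_radius m *\<^sub>R z) \<longlonglongrightarrow> 1 *\<^sub>R z" by (intro tendsto_scaleR dil_radius tendsto_const)
  moreover have "isCont f z"
    using expansion_of_continuous[OF f] z by (simp add: continuous_on_eq_continuous_at)
  ultimately have "(\<lambda>m. f (dil_radius m *\<^sub>R z)) \<longlonglongrightarrow> f z" by (intro isCont_tendsto_compose[of z f]) simp_all
  then show ?thesis using z by (simp add: dil_def cut_def real_smult_eq_scaleR)
qed

lemma dil_Lp_convergence: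
  fixes f :: "complex ^ 'n \<Rightarrow> complex"
  assumes p: "0 < p" and f: "f \<in> Ap p"
  shows "integrable vol (\<lambda>z. norm (dil (dil_radius m) f z - f z) powr p)"
    and "(\<lambda>m. Ap_norm p (\<lambda>z. dil (dil_radius m) f z - f z)) \<longlonglongrightarrow> 0"
proof -
  note E = Ap_expansion[OF f]
  have a: "(\<lambda>m. (1 / dil_radius m) ^ (2 * CARD('n))) \<longlonglongrightarrow> 1"
  proof -
    have "(\<lambda>m. (1 / dil_radius m) ^ (2 * CARD('n))) \<longlonglongrightarrow> (1 / 1) ^ (2 * CARD('n))"
      by (intro tendsto_intros dil_radius) simp
    then show ?thesis by simp
  qed
  note L = Lp_convergence[where M = "vol :: (complex ^ 'n) measure" and f = "\<lambda>m. dil (dil_radius m) f" and g = f, OF p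
     expansion_of_measurable[OF expansion_of_dil[OF E dil_radius(1,3)]] Ap_measurable[OF f]
     dil_tendsto_pointwise[OF E, folded space_vol] Ap_integrable[OF dil_Ap[OF p E dil_radius(1,3)]] Ap_integrable[OF f]
     dil_integral_le[OF p f dil_radius(1,3)] a]
  show "integrable vol (\<lambda>z. norm (dil (dil_radius m) f z - f z) powr p)" by (rule L(1))
  have "(\<lambda>m. (LINT z|vol. norm (dil (dil_radius m) f z - f z) powr p) powr (1 / p)) \<longlonglongrightarrow> 0 powr (1 / p)"
    using p by (intro tendsto_powr' L(2) tendsto_const) auto
  then show "(\<lambda>m. Ap_norm p (\<lambda>z. dil (dil_radius m) f z - f z)) \<longlonglongrightarrow> 0" by (simp add: Ap_norm_def)
qed

lemma dil_norm_le:
  fixes f :: "complex ^ 'n \<Rightarrow> complex"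
  assumes p: "0 < p" and f: "f \<in> Ap p"
  shows "Ap_norm p (dil (dil_radius m) f) \<le> (2 ^ (2 * CARD('n))) powr (1 / p) * Ap_norm p f"
proof -
  have "1 / dil_radius m \<le> 2" using dil_radius(1,2)[of m] by (simp add: field_simps)
  then have "(1 / dil_radius m) ^ (2 * CARD('n)) \<le> 2 ^ (2 * CARD('n))"
    using dil_radius(1)[of m] by (intro power_mono) auto
  then have "(LINT z|vol. norm (dil (dil_radius m) f z) powr p) \<le> 2 ^ (2 * CARD('n)) * (LINT z|vol. norm (f z) powr p)"
    using dil_integral_le[OF p f dil_radius(1,3)[of m]] mult_right_mono[of "(1 / dil_radius m) ^ (2 * CARD('n))" "2 ^ (2 * CARD('n))" "LINT z|vol. norm (f z) powr p"]
    by (auto intro: order_trans)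
  then have "Ap_norm p (dil (dil_radius m) f) \<le> (2 ^ (2 * CARD('n)) * (LINT z|vol. norm (f z) powr p)) powr (1 / p)"
    unfolding Ap_norm_def using p by (intro powr_mono2) auto
  also have "\<dots> = (2 ^ (2 * CARD('n))) powr (1 / p) * Ap_norm p f"
    by (simp add: powr_mult Ap_norm_def)
  finally show ?thesis .
qed

section \<open>The Bergman projection\<close>

text \<open>The coefficients of the Bergman kernel for unnormalized volume, the reciprocals of the moments of the ball.\<close>

definition bergman_coeff :: "'n::finite itself \<Rightarrow> nat \<Rightarrow> real" where
  "bergman_coeff _ j = fact (CARD('n) + j) / (gauss_const TYPE('n) * fact j)"

lemma bergman_coeff_pos: "0 < bergman_coeff TYPE('n::finite) j"
  using gauss_const_pos[where 'n='n] by (simp add: bergman_coeff_def)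

lemma ball_moment_one:
  "ball_moment TYPE('n::finite) (\<lambda>u. of_real ((1 - u) powr 0)) j = of_real (1 / bergman_coeff TYPE('n) j)"
proof -
  have C: "0 < CARD('n)" by simp
  then obtain k where k: "CARD('n) + j = Suc k" by (cases "CARD('n) + j") auto
  have "real (CARD('n) + j - 1) + 0 + 2 = 1 + of_nat (CARD('n) + j)" unfolding k by simp
  then have G: "Gamma (real (CARD('n) + j - 1) + 0 + 2) = fact (CARD('n) + j)" by (simp only: Gamma_fact)
  have "radial_moment (\<lambda>u. of_real ((1 - u) powr 0)) (CARD('n) + j - 1)
     = of_real (fact (CARD('n) + j - 1) * Gamma (0 + 1) / Gamma (real (CARD('n) + j - 1) + 0 + 2))"
    by (rule radial_moment_powr_real(1)) simp
  also have "Gamma (0 + 1 :: real) = 1" by simp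
  finally show ?thesis unfolding ball_moment_def G by (simp add: bergman_coeff_def)
qed

lemma bergman_coeff_pochhammer:
  "complex_of_real (bergman_coeff TYPE('n::finite) j)
    = of_real (fact CARD('n) / gauss_const TYPE('n)) * (pochhammer (of_nat CARD('n) + 1) j / fact j)"
proof -
  have "(fact (CARD('n) + j) :: complex) = fact CARD('n) * pochhammer (1 + of_nat CARD('n)) j"
    unfolding pochhammer_fact by (rule pochhammer_product')
  then show ?thesis by (simp add: bergman_coeff_def add.commute)
qed

text \<open>The coefficients are the reciprocals of the moments of the ball, and the kernel is a multiple of \<open>(1 - x) powr (- (real CARD('n) + 1))\<close>.\<close>

lemma bergman_kernel:
  "\<exists>C\<ge>0. \<forall>x. norm x < 1 \<longrightarrow> summable (\<lambda>j. of_real (bergman_coeff TYPE('n::finite) j) * x ^ j) \<and>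
     norm (\<Sum>j. of_real (bergman_coeff TYPE('n) j) * x ^ j) \<le> C * norm (1 - x :: complex) powr (- (real CARD('n) + 1))"
proof -
  define \<kappa> where "\<kappa> = fact CARD('n) / gauss_const TYPE('n)"
  have \<kappa>: "0 < \<kappa>" using gauss_const_pos[where 'n='n] by (simp add: \<kappa>_def)
  define P where "P = (\<lambda>j. pochhammer (of_nat CARD('n) + 1) j / fact j :: complex)"
  have "kernel_order (real CARD('n) + 1) P"
    unfolding P_def by (rule kernel_order_pochhammer) simp
  then obtain C where C: "\<forall>x. norm x < 1 \<longrightarrow> summable (\<lambda>j. P j * x ^ j) \<and>
     norm (\<Sum>j. P j * x ^ j) \<le> C * norm (1 - x) powr (- (real CARD('n) + 1))"
    unfolding kernel_order_def by (elim exE)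
  have e: "of_real (bergman_coeff TYPE('n) j) * x ^ j = of_real \<kappa> * (P j * x ^ j)" for x :: complex and j
    unfolding bergman_coeff_pochhammer \<kappa>_def P_def by (rule mult.assoc)
  show ?thesis
    unfolding e
  proof (intro exI[of _ "\<kappa> * max C 0"] conjI allI impI)
    show "0 \<le> \<kappa> * max C 0" using \<kappa> by simp
    fix x :: complex assume x: "norm x < 1"
    have S: "summable (\<lambda>j. P j * x ^ j)" and
      B: "norm (\<Sum>j. P j * x ^ j) \<le> C * norm (1 - x) powr (- (real CARD('n) + 1))" using C x by auto
    show "summable (\<lambda>j. of_real \<kappa> * (P j * x ^ j))" by (rule summable_mult[OF S])
    have "norm (\<Sum>j. of_real \<kappa> * (P j * x ^ j)) = \<kappa> * norm (\<Sum>j. P j * x ^ j)"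
      by (simp only: suminf_mult[OF S] norm_mult norm_of_real abs_of_pos[OF \<kappa>])
    also have "\<dots> \<le> \<kappa> * (C * norm (1 - x) powr (- (real CARD('n) + 1)))"
      using \<kappa> by (intro mult_left_mono B) simp
    also have "\<dots> \<le> \<kappa> * (max C 0 * norm (1 - x) powr (- (real CARD('n) + 1)))"
      using \<kappa> by (intro mult_left_mono mult_right_mono) simp_all
    finally show "norm (\<Sum>j. of_real \<kappa> * (P j * x ^ j)) \<le> \<kappa> * max C 0 * norm (1 - x) powr (- (real CARD('n) + 1))"
      by (simp only: mult.assoc)
  qed
qed

lemma summable_bergman_kernel:
  fixes x :: complex
  assumes "norm x < 1"
  shows "summable (\<lambda>j. of_real (bergman_coeff TYPE('n::finite) j) * x ^ j)"
proof -
  obtain C where "\<forall>x. norm x < 1 \<longrightarrow> summable (\<lambda>j. of_real (bergman_coeff TYPE('n) j) * x ^ j) \<and>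
     norm (\<Sum>j. of_real (bergman_coeff TYPE('n) j) * x ^ j) \<le> C * norm (1 - x :: complex) powr (- (real CARD('n) + 1))"
    using bergman_kernel[where 'n='n] by blast
  with assms show ?thesis by simp
qed

lemma summable_bergman_coeff:
  assumes "0 \<le> r" "r < 1"
  shows "summable (\<lambda>j. bergman_coeff TYPE('n::finite) j * r ^ j)"
proof -
  have "summable (\<lambda>j. of_real (bergman_coeff TYPE('n) j) * complex_of_real r ^ j)"
    by (rule summable_bergman_kernel) (use assms in simp)
  then have "summable (\<lambda>j. complex_of_real (bergman_coeff TYPE('n) j * r ^ j))" by simp
  then show ?thesis by (simp only: summable_of_real_iff)
qed

lemma subexponential_bergman_coeff: "subexponential (\<lambda>j. of_real (bergman_coeff TYPE('n::finite) j))"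
proof (rule subexponential_sums)
  fix x :: complex assume "norm x < 1"
  then show "(\<lambda>j. of_real (bergman_coeff TYPE('n) j) * x ^ j) sums (\<Sum>j. of_real (bergman_coeff TYPE('n) j) * x ^ j)"
    by (intro summable_sums summable_bergman_kernel)
qed

definition bergman_proj :: "(complex ^ 'n \<Rightarrow> complex) \<Rightarrow> complex ^ 'n \<Rightarrow> complex" where
  "bergman_proj h = cut (\<lambda>z. \<Sum>j. of_real (bergman_coeff TYPE('n) j) * (LINT v|vol. h v * cip z v ^ j))"

lemma integrable_norm_power_vol:
  assumes "integrable vol (h :: complex ^ 'n \<Rightarrow> complex)"
  shows "integrable vol (\<lambda>v. norm (h v) * norm v ^ k)"
proof -
  have [measurable]: "h \<in> borel_measurable vol" using assms by auto
  have [measurable]: "(\<lambda>v. norm v ^ k) \<in> borel_measurable (vol :: (complex ^ 'n) measure)" by (rule measurable_vol) measurable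
  show ?thesis
  proof (rule Bochner_Integration.integrable_bound[OF integrable_norm[OF assms]])
    show "AE v in vol. norm (norm (h v) * norm v ^ k) \<le> norm (norm (h v))"
      by (rule AE_I2) (simp add: mult_left_le power_le_one)
  qed measurable
qed

lemma norm_integral_cip_power_le:
  fixes h :: "complex ^ 'n \<Rightarrow> complex"
  assumes h: "integrable vol h"
  shows "norm (LINT v|vol. h v * cip z v ^ j) \<le> norm z ^ j * (LINT v|vol. norm (h v))"
proof -
  have hm: "h \<in> borel_measurable vol" using h by auto
  obtain c :: "('n \<Rightarrow> nat) \<Rightarrow> nat" where c: "\<And>z w :: complex ^ 'n. cip z w ^ j = (\<Sum>m | (\<Sum>i\<in>UNIV. m i) = j. of_nat (c m) * mon m z * cnj (mon m w))"
    using cip_power_multinomial[where 'n='n, of j] by blast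
  have i: "integrable vol (\<lambda>v. h v * cip z v ^ j)"
    by (rule homogeneous_poly_cip_expand(1)[OF c hm measurable_id_vol integrable_norm_power_vol[OF h]])
  have "norm (LINT v|vol. h v * cip z v ^ j) \<le> (LINT v|vol. norm (h v * cip z v ^ j))" by (rule integral_norm_bound)
  also have "\<dots> \<le> (LINT v|vol. norm z ^ j * norm (h v))"
  proof (rule integral_mono)
    fix v :: "complex ^ 'n" assume "v \<in> space vol"
    then have "norm (cip z v) \<le> norm z"
      using norm_cip_le[of z v] mult_left_le[of "norm v" "norm z"] by (simp add: order_trans[OF norm_cip_le])
    then have "norm (cip z v) ^ j \<le> norm z ^ j" by (intro power_mono) auto
    then show "norm (h v * cip z v ^ j) \<le> norm z ^ j * norm (h v)"
      by (simp add: norm_mult norm_power mult.commute mult_left_mono)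
  qed (use i h in auto)
  finally show ?thesis by simp
qed

lemma homogeneous_series_integral_cip:
  fixes h :: "complex ^ 'n \<Rightarrow> complex"
  assumes h: "integrable vol h"
  shows "homogeneous_series (\<lambda>j z. LINT v|vol. h v * cip z v ^ j)"
  unfolding homogeneous_series_def
proof (intro conjI allI impI)
  fix k show "homogeneous_poly k (\<lambda>z. LINT v|vol. h v * cip z v ^ k)"
    by (rule homogeneous_poly_integral_cip[OF _ measurable_id_vol integrable_norm_power_vol[OF h]]) (use h in auto)
next
  fix r :: real assume r: "0 < r" "r < 1"
  show "\<exists>M. \<forall>k z. norm z \<le> r \<longrightarrow> norm (LINT v|vol. h v * cip z v ^ k) \<le> M"
  proof (intro exI allI impI)
    fix k and z :: "complex ^ 'n" assume "norm z \<le> r"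
    then have "norm z ^ k \<le> 1" using r by (intro power_le_one) auto
    then have "norm z ^ k * (LINT v|vol. norm (h v)) \<le> (LINT v|vol. norm (h v))" by (intro mult_left_le_one_le) auto
    with norm_integral_cip_power_le[OF h, of z k]
    show "norm (LINT v|vol. h v * cip z v ^ k) \<le> (LINT v|vol. norm (h v))" by linarith
  qed
qed

lemma expansion_of_bergman_proj:
  fixes h :: "complex ^ 'n \<Rightarrow> complex"
  assumes h: "integrable vol h"
  shows "expansion_of (bergman_proj h) (\<lambda>j z. of_real (bergman_coeff TYPE('n) j) * (LINT v|vol. h v * cip z v ^ j))"
proof (rule expansion_of_series)
  show "homogeneous_series (\<lambda>j z. of_real (bergman_coeff TYPE('n) j) * (LINT v|vol. h v * cip z v ^ j))"
    by (rule homogeneous_series_multiplier[OF homogeneous_series_integral_cip[OF h] subexponential_bergman_coeff])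
  show "bergman_proj h z = (\<Sum>j. of_real (bergman_coeff TYPE('n) j) * (LINT v|vol. h v * cip z v ^ j))" if "z \<in> unit_ball" for z
    using that unfolding bergman_proj_def cut_def by (rule if_P)
qed

lemma bergman_proj_kernel_bound:
  fixes h :: "complex ^ 'n \<Rightarrow> complex"
  assumes h: "integrable vol h" and z: "z \<in> unit_ball"
    and C: "\<And>x. norm x < 1 \<Longrightarrow> norm (\<Sum>j. of_real (bergman_coeff TYPE('n) j) * x ^ j) \<le> C * norm (1 - x :: complex) powr (- (real CARD('n) + 1))"
    and i: "integrable vol (\<lambda>v. norm (h v) * norm (1 - cip z v) powr (- (real CARD('n) + 1)))"
  shows "norm (bergman_proj h z) \<le> C * (LINT v|vol. norm (h v) * norm (1 - cip z v) powr (- (real CARD('n) + 1)))"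
proof -
  let ?d = "\<lambda>j. complex_of_real (bergman_coeff TYPE('n) j)"
  have hm[measurable]: "h \<in> borel_measurable vol" using h by auto
  have [measurable]: "(\<lambda>v. cip z v) \<in> borel_measurable vol" by (rule measurable_vol) (rule borel_measurable_cip_right)
  have ball: "norm (cip z v) < 1" if "v \<in> unit_ball" for v using one_minus_cip_nz[OF z that] .
  define B where "B = (\<Sum>j. bergman_coeff TYPE('n) j * norm z ^ j)"
  have sB: "summable (\<lambda>j. bergman_coeff TYPE('n) j * norm z ^ j)" by (rule summable_bergman_coeff) (use z in auto)
  have sd: "(\<lambda>j. h v * (?d j * cip z v ^ j)) sums (h v * (\<Sum>j. ?d j * cip z v ^ j))" if "v \<in> unit_ball" for v
    by (intro sums_mult summable_sums summable_bergman_kernel ball that)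
  have pb: "norm (\<Sum>j<k. h v * (?d j * cip z v ^ j)) \<le> norm (h v) * B" if "v \<in> unit_ball" for v k
  proof -
    have "norm (cip z v) \<le> norm z"
      using norm_cip_le[of z v] mult_left_le[of "norm v" "norm z"] that by simp
    then have "norm (\<Sum>j<k. ?d j * cip z v ^ j) \<le> (\<Sum>j<k. bergman_coeff TYPE('n) j * norm z ^ j)"
      using less_imp_le[OF bergman_coeff_pos[where 'n='n]]
      by (intro sum_norm_le) (simp add: norm_mult norm_power mult_left_mono power_mono)
    also have "\<dots> \<le> B" unfolding B_def
      by (rule sum_le_suminf[OF sB]) (use bergman_coeff_pos[where 'n='n] in \<open>simp_all add: less_imp_le\<close>)
    finally show ?thesis unfolding sum_distrib_left[symmetric] by (simp add: norm_mult mult_left_mono)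
  qed
  have mm: "\<And>j. (\<lambda>v. h v * (?d j * cip z v ^ j)) \<in> borel_measurable vol" by measurable
  have iB: "integrable vol (\<lambda>v. norm (h v) * B)" using h by simp
  note I = integral_sums_dominated[where M="vol :: (complex ^ 'n) measure", OF mm, unfolded space_vol, OF sd pb iB]
  have q: "(LINT v|vol. h v * (?d j * cip z v ^ j)) = ?d j * (LINT v|vol. h v * cip z v ^ j)" for j
    unfolding integral_mult_right_zero[symmetric] by (rule Bochner_Integration.integral_cong) (simp_all add: mult_ac)
  have "(\<lambda>j. ?d j * (LINT v|vol. h v * cip z v ^ j)) sums (LINT v|vol. h v * (\<Sum>j. ?d j * cip z v ^ j))"
    using I(2) unfolding q .
  moreover have "(\<lambda>j. ?d j * (LINT v|vol. h v * cip z v ^ j)) sums bergman_proj h z"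
    using expansion_of_bergman_proj[OF h] z unfolding expansion_of_def by blast
  ultimately have "bergman_proj h z = (LINT v|vol. h v * (\<Sum>j. ?d j * cip z v ^ j))" using sums_unique2 by blast
  also have "norm \<dots> \<le> (LINT v|vol. norm (h v * (\<Sum>j. ?d j * cip z v ^ j)))" by (rule integral_norm_bound)
  also have "\<dots> \<le> (LINT v|vol. C * (norm (h v) * norm (1 - cip z v) powr (- (real CARD('n) + 1))))"
  proof (rule integral_mono[OF integrable_norm[OF I(1)] integrable_mult_right[OF i]])
    fix v :: "complex ^ 'n" assume "v \<in> space vol"
    then have "norm (\<Sum>j. ?d j * cip z v ^ j) \<le> C * norm (1 - cip z v) powr (- (real CARD('n) + 1))"
      by (intro C ball) simp
    from mult_left_mono[OF this norm_ge_zero[of "h v"]]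
    show "norm (h v * (\<Sum>j. ?d j * cip z v ^ j)) \<le> C * (norm (h v) * norm (1 - cip z v) powr (- (real CARD('n) + 1)))"
      by (simp only: norm_mult mult_ac)
  qed
  finally show ?thesis by (simp only: integral_mult_right_zero)
qed

text \<open>The kernel is dominated by that of the Bergman type operator without weights.\<close>

lemma bergman_proj_bounded:
  assumes pq: "1 < p" "1 < q" "1 / p + 1 / q = 1"
  shows "\<exists>C>0. \<forall>h :: complex ^ 'n \<Rightarrow> complex. h \<in> borel_measurable vol \<longrightarrow> integrable vol (\<lambda>z. norm (h z) powr p) \<longrightarrow>
    bergman_proj h \<in> Ap p \<and> Ap_norm p (bergman_proj h) \<le> C * Ap_norm p h"
proof -
  have p: "0 < p" and a: "- (1 / p) < 0" "- (1 / q) < 0" using pq by auto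
  let ?V = "vol :: (complex ^ 'n) measure"
  let ?e = "- (real CARD('n) + 1)"
  obtain D where D: "D > 0" "\<forall>h :: complex ^ 'n \<Rightarrow> real. h \<in> borel_measurable vol \<longrightarrow> (\<forall>w. 0 \<le> h w) \<longrightarrow> integrable vol (\<lambda>w. h w powr p) \<longrightarrow>
    (\<forall>z\<in>unit_ball. integrable vol (\<lambda>w. h w * (bdist w powr 0 * norm (1 - cip z w) powr (- (real CARD('n) + 1 + 0 + 0))))) \<and>
    integrable vol (\<lambda>z. (bdist z powr 0 * (LINT w|vol. h w * (bdist w powr 0 * norm (1 - cip z w) powr (- (real CARD('n) + 1 + 0 + 0))))) powr p) \<and>
    (LINT z|vol. (bdist z powr 0 * (LINT w|vol. h w * (bdist w powr 0 * norm (1 - cip z w) powr (- (real CARD('n) + 1 + 0 + 0))))) powr p)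
      \<le> D * (LINT w|vol. h w powr p)"
    using Bergman_type_operator_bounded[where 'n='n, OF pq a] by blast
  obtain K where K: "K \<ge> 0" "\<And>x. norm x < 1 \<Longrightarrow> norm (\<Sum>j. of_real (bergman_coeff TYPE('n) j) * x ^ j) \<le> K * norm (1 - x :: complex) powr ?e"
    using bergman_kernel[where 'n='n] by blast
  define C where "C = (K + 1) * D powr (1 / p)"
  have C0: "C > 0" unfolding C_def using K(1) D(1) by (intro mult_pos_pos) auto
  have "bergman_proj h \<in> Ap p \<and> Ap_norm p (bergman_proj h) \<le> C * Ap_norm p h"
    if hm[measurable]: "h \<in> borel_measurable ?V" and hi: "integrable ?V (\<lambda>z. norm (h z) powr p)" for h
  proof -
    have h: "integrable ?V h" using pq hi by (intro integrable_norm_Lp hm) auto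
    define T where "T = (\<lambda>z. LINT w|?V. norm (h w) * norm (1 - cip z w) powr ?e)"
    define T' where "T' = (\<lambda>z. LINT w|?V. norm (h w) * (bdist w powr 0 * norm (1 - cip z w) powr (- (real CARD('n) + 1 + 0 + 0))))"
    have one: "norm (h w) * (bdist w powr 0 * norm (1 - cip z w) powr (- (real CARD('n) + 1 + 0 + 0))) = norm (h w) * norm (1 - cip z w) powr ?e"
      if "w \<in> space ?V" for w z using bdist_pos[of w] that by simp
    have TT: "T' z = T z" for z unfolding T_def T'_def by (rule Bochner_Integration.integral_cong[OF refl one])
    have T'z: "(LINT w|?V. norm (h w) * (bdist w powr 0 * norm (1 - cip z w) powr (- (real CARD('n) + 1 + 0 + 0)))) = T' z" for z
      unfolding T'_def ..
    have ic: "integrable ?V (\<lambda>w. norm (h w) * (bdist w powr 0 * norm (1 - cip z w) powr (- (real CARD('n) + 1 + 0 + 0))))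
       \<longleftrightarrow> integrable ?V (\<lambda>w. norm (h w) * norm (1 - cip z w) powr ?e)" for z
      by (rule Bochner_Integration.integrable_cong[OF refl one])
    have "(\<lambda>w. norm (h w)) \<in> borel_measurable ?V" by measurable
    then have DD: "\<forall>z\<in>unit_ball. integrable ?V (\<lambda>w. norm (h w) * norm (1 - cip z w) powr ?e)"
      "integrable ?V (\<lambda>z. (bdist z powr 0 * T' z) powr p)"
      "(LINT z|?V. (bdist z powr 0 * T' z) powr p) \<le> D * (LINT w|?V. norm (h w) powr p)"
      using D(2)[rule_format, of "\<lambda>w. norm (h w)", OF _ norm_ge_zero hi] unfolding T'z ic by simp_all
    have i1: "integrable ?V (\<lambda>w. norm (h w) * norm (1 - cip z w) powr ?e)" if "z \<in> unit_ball" for z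
      using DD(1) that by blast
    have T0: "0 \<le> T z" for z by (simp add: T_def)
    have e: "(bdist z powr 0 * T' z) powr p = T z powr p" if "z \<in> space ?V" for z
      using bdist_pos[of z] that by (simp add: TT)
    have ie: "integrable ?V (\<lambda>z. (bdist z powr 0 * T' z) powr p) \<longleftrightarrow> integrable ?V (\<lambda>z. T z powr p)"
      "(LINT z|?V. (bdist z powr 0 * T' z) powr p) = (LINT z|?V. T z powr p)"
      by (rule Bochner_Integration.integrable_cong[OF refl e] Bochner_Integration.integral_cong[OF refl e]; assumption)+
    have i2: "integrable ?V (\<lambda>z. T z powr p)" using DD(2) unfolding ie .
    have l2: "(LINT z|?V. T z powr p) \<le> D * (LINT w|?V. norm (h w) powr p)"
      using DD(3) unfolding ie .
    have pt: "norm (bergman_proj h z) powr p \<le> (K + 1) powr p * T z powr p" if z: "z \<in> unit_ball" for z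
    proof -
      have "norm (bergman_proj h z) \<le> K * T z"
        unfolding T_def by (rule bergman_proj_kernel_bound[OF h z K(2) i1[OF z]])
      also have "\<dots> \<le> (K + 1) * T z" using T0[of z] by (simp add: distrib_right)
      finally have "norm (bergman_proj h z) powr p \<le> ((K + 1) * T z) powr p" using p by (intro powr_mono2) auto
      then show ?thesis using K(1) T0[of z] by (simp add: powr_mult)
    qed
    note E = expansion_of_bergman_proj[OF h]
    note [measurable] = expansion_of_measurable[OF E]
    have i3: "integrable ?V (\<lambda>z. (K + 1) powr p * T z powr p)" by (intro integrable_mult_right i2)
    have i4: "integrable ?V (\<lambda>z. norm (bergman_proj h z) powr p)"
      by (rule Bochner_Integration.integrable_bound[OF i3]) (measurable, rule AE_I2, use pt in \<open>simp add: abs_mult\<close>)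
    have mem: "bergman_proj h \<in> Ap p" by (rule ApI[OF E _ i4]) (simp add: bergman_proj_def cut_def)
    have "(LINT z|?V. norm (bergman_proj h z) powr p) \<le> (LINT z|?V. (K + 1) powr p * T z powr p)"
      by (rule integral_mono[OF i4 i3]) (use pt in simp)
    also have "\<dots> \<le> (K + 1) powr p * (D * (LINT w|?V. norm (h w) powr p))"
      using l2 by (simp add: mult_left_mono)
    finally have "Ap_norm p (bergman_proj h) \<le> ((K + 1) powr p * (D * (LINT w|?V. norm (h w) powr p))) powr (1 / p)"
      unfolding Ap_norm_def using p by (intro powr_mono2) auto
    also have "\<dots> = C * Ap_norm p h"
      using K(1) D(1) p by (simp add: powr_mult powr_powr C_def Ap_norm_def)
    finally show ?thesis using mem by blast
  qed
  with C0 show ?thesis by blast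
qed

text \<open>The kernel coefficients cancel the moments of the ball degree by degree.\<close>

lemma bergman_proj_reproduces:
  fixes f :: "complex ^ 'n \<Rightarrow> complex"
  assumes p: "1 \<le> p" and f: "f \<in> Ap p"
  shows "bergman_proj f = f"
    and "(LINT v|vol. f v * cip z v ^ j) = of_real (1 / bergman_coeff TYPE('n) j) * slice_coeff f j z"
proof -
  define \<omega> where "\<omega> = (\<lambda>u. complex_of_real ((1 - u) powr 0))"
  have \<omega>1: "\<omega> ((norm w)\<^sup>2) = 1" if "w \<in> space (vol :: (complex ^ 'n) measure)" for w :: "complex ^ 'n"
    using bdist_pos[of w] that by (simp add: \<omega>_def)
  have fi: "integrable vol f" by (rule integrable_norm_Lp[OF p Ap_measurable[OF f] Ap_integrable[OF f]])
  have \<omega>m: "\<omega> \<in> borel_measurable borel" unfolding \<omega>_def by measurable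
  have i\<omega>: "integrable vol (\<lambda>w :: complex ^ 'n. \<omega> ((norm w)\<^sup>2))"
    unfolding \<omega>_def by (intro integrable_of_real integrable_vol_weight) simp
  have f\<omega>: "integrable vol (\<lambda>w. f w * \<omega> ((norm w)\<^sup>2))"
    using fi by (subst Bochner_Integration.integrable_cong[OF refl, of _ _ f]) (simp_all add: \<omega>1 del: space_vol)
  show m: "(LINT v|vol. f v * cip z v ^ j) = of_real (1 / bergman_coeff TYPE('n) j) * slice_coeff f j z" for z j
  proof -
    have "(LINT v|vol. f v * cip z v ^ j) = (LINT v|vol. f v * cip z v ^ j * \<omega> ((norm v)\<^sup>2))"
      by (rule Bochner_Integration.integral_cong[OF refl]) (simp add: \<omega>1 del: space_vol)
    also have "\<dots> = ball_moment TYPE('n) \<omega> j * slice_coeff f j z"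
      by (rule integral_against_cip_power[OF Ap_expansion[OF f] \<omega>m i\<omega> f\<omega>])
    finally show ?thesis unfolding \<omega>_def ball_moment_one .
  qed
  have "expansion_of (bergman_proj f) (\<lambda>j z. slice_coeff f j z)"
    using expansion_of_bergman_proj[OF fi] bergman_coeff_pos[where 'n='n, THEN less_imp_neq] unfolding m by simp
  then have "bergman_proj f z = f z" if "z \<in> unit_ball" for z
    using Ap_expansion[OF f] that sums_unique2 unfolding expansion_of_def by blast
  moreover have "bergman_proj f z = f z" if "z \<notin> unit_ball" for z
    using that Ap_outside[OF f that] by (simp add: bergman_proj_def cut_def)
  ultimately show "bergman_proj f = f" by blast
qed

lemma pairing_Hoelder:
  fixes u v :: "complex ^ 'n \<Rightarrow> complex"
  assumes pq: "1 < p" "1 < q" "1 / p + 1 / q = 1"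
    and um[measurable]: "u \<in> borel_measurable vol" and vm[measurable]: "v \<in> borel_measurable vol"
    and ui: "integrable vol (\<lambda>z. norm (u z) powr p)" and vi: "integrable vol (\<lambda>z. norm (v z) powr q)"
  shows "integrable vol (\<lambda>z. u z * cnj (v z))"
    and "norm (LINT z|vol. u z * cnj (v z)) \<le> Ap_norm p u * Ap_norm q v"
proof -
  have m1: "(\<lambda>z. norm (u z)) \<in> borel_measurable vol" and m2: "(\<lambda>z. norm (v z)) \<in> borel_measurable vol" by measurable
  note H = Hoelder_integral[OF pq m1 m2 norm_ge_zero norm_ge_zero ui vi]
  have cm: "(\<lambda>z. u z * cnj (v z)) \<in> borel_measurable vol" by (intro borel_measurable_times um borel_measurable_cnj vm)
  show "integrable vol (\<lambda>z. u z * cnj (v z))"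
    by (rule Bochner_Integration.integrable_bound[OF H(1) cm]) (simp add: norm_mult)
  have "norm (LINT z|vol. u z * cnj (v z)) \<le> (LINT z|vol. norm (u z * cnj (v z)))" by (rule integral_norm_bound)
  also have "\<dots> = (LINT z|vol. norm (u z) * norm (v z))" by (simp add: norm_mult)
  finally show "norm (LINT z|vol. u z * cnj (v z)) \<le> Ap_norm p u * Ap_norm q v" using H(2) by (simp add: Ap_norm_def)
qed

section \<open>The dual of the unweighted space\<close>

lemma homogeneous_poly_mon_single: "homogeneous_poly (\<Sum>i\<in>UNIV. m i) (mon m :: complex ^ 'n \<Rightarrow> complex)"
proof -
  have "mon m z = (\<Sum>m' | (\<Sum>i\<in>UNIV. m' i) = (\<Sum>i\<in>UNIV. m i). (if m' = m then 1 else 0) * mon m' z)" for z :: "complex ^ 'n"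
    by (simp add: if_distrib[of "\<lambda>x. x * _"] sum.delta[OF finite_multiindices] cong: if_cong)
  then show ?thesis unfolding homogeneous_poly_mon by (intro exI[of _ "\<lambda>m'. if m' = m then 1 else 0"] allI)
qed

lemma homogeneous_poly_cut_Ap:
  fixes h :: "complex ^ 'n \<Rightarrow> complex"
  assumes p: "0 < p" and h: "homogeneous_poly k h" and B: "0 \<le> B" "\<And>z. z \<in> unit_ball \<Longrightarrow> norm (h z) \<le> B"
  shows "cut h \<in> Ap p" "Ap_norm p (cut h) \<le> B * measure (vol :: (complex ^ 'n) measure) unit_ball powr (1 / p)"
proof -
  have b: "norm (cut h z) \<le> B" if "z \<in> unit_ball" for z using B(2)[OF that] that by (simp add: cut_def)
  have o: "cut h z = 0" if "z \<notin> unit_ball" for z using that by (simp add: cut_def)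
  show "cut h \<in> Ap p" "Ap_norm p (cut h) \<le> B * measure (vol :: (complex ^ 'n) measure) unit_ball powr (1 / p)"
    by (rule Ap_bounded[OF p expansion_of_cut[OF expansion_of_homogeneous_poly[OF h]] o B(1) b]; assumption)+
qed

lemma cut_mon_Ap: "0 < p \<Longrightarrow> cut (mon m :: complex ^ 'n \<Rightarrow> complex) \<in> Ap p"
proof (rule homogeneous_poly_cut_Ap(1)[OF _ homogeneous_poly_mon_single])
  fix z :: "complex ^ 'n" assume "z \<in> unit_ball"
  then have "norm z ^ (\<Sum>i\<in>UNIV. m i) \<le> 1" by (intro power_le_one) auto
  then show "norm (mon m z) \<le> 1" using norm_mon_le[OF refl, of m z] by linarith
qed auto

lemma cut_cip_power_Ap:
  fixes z :: "complex ^ 'n"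
  assumes p: "0 < p" and z: "norm z \<le> 1"
  shows "cut (\<lambda>w. cip w z ^ j) \<in> Ap p"
    and "Ap_norm p (cut (\<lambda>w. cip w z ^ j)) \<le> norm z ^ j * measure (vol :: (complex ^ 'n) measure) unit_ball powr (1 / p)"
proof -
  have h: "homogeneous_poly j (\<lambda>w. cip w z ^ j)"
    using homogeneous_series_cip[OF z] by (simp add: homogeneous_series_def)
  have b: "norm (cip w z ^ j) \<le> norm z ^ j" if "w \<in> unit_ball" for w
  proof -
    have "norm (cip w z) \<le> norm z"
      using norm_cip_le[of w z] mult_left_le_one_le[of "norm z" "norm w"] that by simp
    then show ?thesis by (simp add: norm_power power_mono)
  qed
  show "cut (\<lambda>w. cip w z ^ j) \<in> Ap p"
    "Ap_norm p (cut (\<lambda>w. cip w z ^ j)) \<le> norm z ^ j * measure (vol :: (complex ^ 'n) measure) unit_ball powr (1 / p)"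
    by (rule homogeneous_poly_cut_Ap[OF p h _ b]; simp)+
qed

locale Ap_functional =
  fixes p q :: real and F :: "(complex ^ 'n \<Rightarrow> complex) \<Rightarrow> complex" and M :: real
  assumes pq: "1 < p" "1 < q" "1 / p + 1 / q = 1"
    and F_add: "\<And>f g. f \<in> Ap p \<Longrightarrow> g \<in> Ap p \<Longrightarrow> F (\<lambda>z. f z + g z) = F f + F g"
    and F_cmult: "\<And>c f. f \<in> Ap p \<Longrightarrow> F (\<lambda>z. c * f z) = c * F f"
    and F_le: "\<And>f. f \<in> Ap p \<Longrightarrow> norm (F f) \<le> M * Ap_norm p f"
    and M_nonneg: "0 \<le> M"
begin

definition V where "V = measure (vol :: (complex ^ 'n) measure) unit_ball powr (1 / p)"

lemma V_nonneg: "0 \<le> V" by (simp add: V_def)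

lemma p_pos: "0 < p" and q_pos: "0 < q" using pq by auto

lemma F_sum:
  assumes "finite A" "\<And>a. a \<in> A \<Longrightarrow> u a \<in> Ap p"
  shows "(\<lambda>z. \<Sum>a\<in>A. c a * u a z) \<in> Ap p \<and> F (\<lambda>z. \<Sum>a\<in>A. c a * u a z) = (\<Sum>a\<in>A. c a * F (u a))"
  using assms
proof (induction A rule: finite_induct)
  case empty
  have m: "cut (mon (\<lambda>_. 0)) \<in> Ap p" by (rule cut_mon_Ap[OF p_pos])
  from Ap_cmult[OF m, of 0] F_cmult[OF m, of 0] show ?case by simp
next
  case (insert a A)
  have IH: "(\<lambda>z. \<Sum>a\<in>A. c a * u a z) \<in> Ap p" "F (\<lambda>z. \<Sum>a\<in>A. c a * u a z) = (\<Sum>a\<in>A. c a * F (u a))"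
    using insert by auto
  have ua: "u a \<in> Ap p" using insert.prems by auto
  show ?case
    using Ap_add[OF p_pos Ap_cmult[OF ua, of "c a"] IH(1)] F_add[OF Ap_cmult[OF ua, of "c a"] IH(1)] F_cmult[OF ua, of "c a"] IH(2) insert.hyps
    by simp
qed

lemma F_diff:
  assumes "f \<in> Ap p" "g \<in> Ap p"
  shows "(\<lambda>z. f z - g z) \<in> Ap p" "F (\<lambda>z. f z - g z) = F f - F g"
  using Ap_add[OF p_pos assms(1) Ap_cmult[OF assms(2), of "-1"]] F_add[OF assms(1) Ap_cmult[OF assms(2), of "-1"]] F_cmult[OF assms(2), of "-1"]
  by simp_all

text \<open>A bounded functional passes through a series that converges uniformly on the ball, because the uniform norm dominates the norm of the space.\<close>

lemma F_sums:
  assumes G: "G \<in> Ap p" and u: "\<And>j. u j \<in> Ap p"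
    and s: "\<And>z. z \<in> unit_ball \<Longrightarrow> (\<lambda>j. u j z) sums G z"
    and a: "\<And>j z. z \<in> unit_ball \<Longrightarrow> norm (u j z) \<le> a j" and sa: "summable a"
  shows "(\<lambda>j. F (u j)) sums F G"
proof -
  define t where "t = (\<lambda>J. \<Sum>j. a (j + J))"
  have a0: "0 \<le> a j" for j using a[of 0 j] norm_ge_zero[of "u j 0"] by (simp add: order_trans[OF norm_ge_zero])
  have "(\<lambda>J. suminf a - sum a {..<J}) \<longlonglongrightarrow> suminf a - suminf a"
    by (intro tendsto_diff tendsto_const summable_LIMSEQ sa)
  then have t0: "t \<longlonglongrightarrow> 0" unfolding t_def suminf_minus_initial_segment[OF sa] by simp
  have S: "(\<lambda>z. \<Sum>j<J. u j z) \<in> Ap p" "F (\<lambda>z. \<Sum>j<J. u j z) = (\<Sum>j<J. F (u j))" for J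
    using F_sum[of "{..<J}" u "\<lambda>_. 1"] u by auto
  have "norm ((\<Sum>j<J. F (u j)) - F G) \<le> M * (t J * V)" for J
  proof -
    note D = F_diff[OF S(1)[of J] G]
    have b: "norm ((\<Sum>j<J. u j z) - G z) \<le> t J" if z: "z \<in> unit_ball" for z
    proof -
      have su: "summable (\<lambda>j. u j z)" "G z = (\<Sum>j. u j z)" using s[OF z] by (auto simp: sums_iff)
      have "norm ((\<Sum>j<J. u j z) - G z) = norm (\<Sum>j. u (j + J) z)"
        unfolding su(2) suminf_minus_initial_segment[OF su(1)] by (rule norm_minus_commute)
      also have "\<dots> \<le> t J" unfolding t_def
        by (rule norm_suminf_le) (use a[OF z] sa in \<open>simp_all add: summable_ignore_initial_segment\<close>)
      finally show ?thesis .
    qed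
    have tn: "0 \<le> t J" unfolding t_def by (intro suminf_nonneg summable_ignore_initial_segment sa a0)
    have "norm ((\<Sum>j<J. F (u j)) - F G) = norm (F (\<lambda>z. (\<Sum>j<J. u j z) - G z))" by (simp add: D(2) S(2))
    also have "\<dots> \<le> M * Ap_norm p (\<lambda>z. (\<Sum>j<J. u j z) - G z)" by (rule F_le[OF D(1)])
    also have "\<dots> \<le> M * (t J * V)" unfolding V_def
      by (intro mult_left_mono M_nonneg Ap_bounded(2)[OF p_pos Ap_expansion[OF D(1)] Ap_outside[OF D(1)] tn b])
    finally show ?thesis .
  qed
  then have ev: "\<forall>\<^sub>F J in sequentially. norm ((\<Sum>j<J. F (u j)) - F G) \<le> M * (t J * V)"
    by (intro always_eventually allI)
  have "(\<lambda>J. M * (t J * V)) \<longlonglongrightarrow> M * (0 * V)"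
    by (intro tendsto_mult_left tendsto_mult_right t0)
  then have "(\<lambda>J. M * (t J * V)) \<longlonglongrightarrow> 0" by (simp only: mult_zero_left mult_zero_right)
  with ev have "(\<lambda>J. (\<Sum>j<J. F (u j)) - F G) \<longlonglongrightarrow> 0" by (rule Lim_null_comparison)
  then show ?thesis unfolding sums_def by (rule LIM_zero_cancel)
qed

text \<open>The values of the functional on the powers of the pairing; up to conjugation and the kernel coefficients these are the components of the representing function.\<close>

definition \<Theta> :: "nat \<Rightarrow> complex ^ 'n \<Rightarrow> complex" where "\<Theta> j z = F (cut (\<lambda>w. cip w z ^ j))"

lemma \<Theta>_le: "norm z \<le> 1 \<Longrightarrow> norm (\<Theta> j z) \<le> M * V * norm z ^ j"
proof -
  assume z: "norm z \<le> 1"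
  have "norm (\<Theta> j z) \<le> M * Ap_norm p (cut (\<lambda>w. cip w z ^ j))"
    unfolding \<Theta>_def by (rule F_le[OF cut_cip_power_Ap(1)[OF p_pos z]])
  also have "\<dots> \<le> M * (norm z ^ j * V)"
    unfolding V_def by (intro mult_left_mono cut_cip_power_Ap(2)[OF p_pos z] M_nonneg)
  finally show ?thesis by (simp add: mult_ac)
qed

lemma \<Theta>_expand:
  assumes c: "\<And>z w :: complex ^ 'n. cip z w ^ j = (\<Sum>m | (\<Sum>i\<in>UNIV. m i) = j. of_nat (c m) * mon m z * cnj (mon m w))"
  shows "\<Theta> j z = (\<Sum>m | (\<Sum>i\<in>UNIV. m i) = j. of_nat (c m) * cnj (mon m z) * F (cut (mon m)))"
proof -
  have "cut (\<lambda>w. cip w z ^ j) = (\<lambda>w. \<Sum>m | (\<Sum>i\<in>UNIV. m i) = j. (of_nat (c m) * cnj (mon m z)) * cut (mon m) w)"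
    by (rule ext) (simp add: cut_def c mult_ac)
  then show ?thesis
    unfolding \<Theta>_def using F_sum[OF finite_multiindices, of j "\<lambda>m. cut (mon m)" "\<lambda>m. of_nat (c m) * cnj (mon m z)", OF cut_mon_Ap[OF p_pos]] by simp
qed

lemma \<Theta>_homogeneous: "homogeneous_poly j (\<lambda>z. cnj (\<Theta> j z))"
proof -
  obtain c :: "('n \<Rightarrow> nat) \<Rightarrow> nat" where c: "\<And>z w :: complex ^ 'n. cip z w ^ j = (\<Sum>m | (\<Sum>i\<in>UNIV. m i) = j. of_nat (c m) * mon m z * cnj (mon m w))"
    using cip_power_multinomial[where 'n='n, of j] by blast
  show ?thesis unfolding homogeneous_poly_mon
    by (intro exI[of _ "\<lambda>m. of_nat (c m) * cnj (F (cut (mon m)))"] allI) (simp add: \<Theta>_expand[OF c] mult_ac)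
qed

lemma \<Theta>_measurable: "\<Theta> j \<in> borel_measurable borel"
proof -
  have "(\<lambda>z. cnj (\<Theta> j z)) \<in> borel_measurable borel"
    by (intro borel_measurable_continuous_onI continuous_on_homogeneous_poly[OF \<Theta>_homogeneous])
  from borel_measurable_cnj[OF this] show ?thesis by simp
qed

text \<open>The functional may be moved under the integral since the kernel separates into finitely many monomials.\<close>

lemma F_integral_cip:
  fixes h :: "complex ^ 'n \<Rightarrow> complex"
  assumes h: "integrable vol h"
  shows "cut (\<lambda>z. LINT v|vol. h v * cip z v ^ j) \<in> Ap p"
    and "F (cut (\<lambda>z. LINT v|vol. h v * cip z v ^ j)) = (LINT v|vol. h v * \<Theta> j v)"
proof -
  have hm: "h \<in> borel_measurable vol" using h by auto
  obtain c :: "('n \<Rightarrow> nat) \<Rightarrow> nat" where c: "\<And>z w :: complex ^ 'n. cip z w ^ j = (\<Sum>m | (\<Sum>i\<in>UNIV. m i) = j. of_nat (c m) * mon m z * cnj (mon m w))"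
    using cip_power_multinomial[where 'n='n, of j] by blast
  note E = homogeneous_poly_cip_expand[OF c hm measurable_id_vol integrable_norm_power_vol[OF h]]
  have e: "cut (\<lambda>z. LINT v|vol. h v * cip z v ^ j)
     = (\<lambda>z. \<Sum>m | (\<Sum>i\<in>UNIV. m i) = j. (of_nat (c m) * (LINT v|vol. h v * cnj (mon m v))) * cut (mon m) z)"
    by (rule ext) (simp add: cut_def E(3))
  note S = F_sum[OF finite_multiindices, of j "\<lambda>m. cut (mon m)" "\<lambda>m. of_nat (c m) * (LINT v|vol. h v * cnj (mon m v))", OF cut_mon_Ap[OF p_pos], folded e]
  show "cut (\<lambda>z. LINT v|vol. h v * cip z v ^ j) \<in> Ap p" using S by blast
  have i: "integrable vol (\<lambda>v. of_nat (c m) * F (cut (mon m)) * (h v * cnj (mon m v)))" if "(\<Sum>i\<in>UNIV. m i) = j" for m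
    by (rule integrable_mult_right[OF E(2)[OF that]])
  have "(LINT v|vol. h v * \<Theta> j v) = (LINT v|vol. (\<Sum>m | (\<Sum>i\<in>UNIV. m i) = j. of_nat (c m) * F (cut (mon m)) * (h v * cnj (mon m v))))"
    by (rule Bochner_Integration.integral_cong[OF refl]) (simp add: \<Theta>_expand[OF c] sum_distrib_left mult_ac)
  also have "\<dots> = (\<Sum>m | (\<Sum>i\<in>UNIV. m i) = j. (LINT v|vol. of_nat (c m) * F (cut (mon m)) * (h v * cnj (mon m v))))"
    by (rule Bochner_Integration.integral_sum) (use i in blast)
  also have "\<dots> = (\<Sum>m | (\<Sum>i\<in>UNIV. m i) = j. (of_nat (c m) * (LINT v|vol. h v * cnj (mon m v))) * F (cut (mon m)))"
    by (simp only: integral_mult_right_zero) (simp only: mult_ac)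
  finally show "F (cut (\<lambda>z. LINT v|vol. h v * cip z v ^ j)) = (LINT v|vol. h v * \<Theta> j v)" using S by simp
qed

definition rep :: "complex ^ 'n \<Rightarrow> complex" where
  "rep = cut (\<lambda>z. \<Sum>j. of_real (bergman_coeff TYPE('n) j) * cnj (\<Theta> j z))"

lemma expansion_of_rep: "expansion_of rep (\<lambda>j z. of_real (bergman_coeff TYPE('n) j) * cnj (\<Theta> j z))"
proof (rule expansion_of_series)
  have "homogeneous_series (\<lambda>j z. cnj (\<Theta> j z))"
    unfolding homogeneous_series_def
  proof (intro conjI allI impI \<Theta>_homogeneous exI[of _ "M * V"])
    fix r :: real and k and z :: "complex ^ 'n" assume r: "0 < r" "r < 1" "norm z \<le> r"
    then have "norm z ^ k \<le> 1" by (intro power_le_one) auto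
    then have "M * V * norm z ^ k \<le> M * V" using M_nonneg V_nonneg by (intro mult_left_le) auto
    moreover have "norm (\<Theta> k z) \<le> M * V * norm z ^ k" by (rule \<Theta>_le) (use r in simp)
    ultimately show "norm (cnj (\<Theta> k z)) \<le> M * V" by simp
  qed
  then show "homogeneous_series (\<lambda>j z. of_real (bergman_coeff TYPE('n) j) * cnj (\<Theta> j z))"
    by (rule homogeneous_series_multiplier[OF _ subexponential_bergman_coeff])
  show "rep z = (\<Sum>j. of_real (bergman_coeff TYPE('n) j) * cnj (\<Theta> j z))" if "z \<in> unit_ball" for z
    using that unfolding rep_def cut_def by (rule if_P)
qed

lemma rep_outside: "z \<notin> unit_ball \<Longrightarrow> rep z = 0"
  unfolding rep_def cut_def by (rule if_not_P)

text \<open>The dilation makes the series of the projection converge uniformly on the ball, so that the functional can be applied term by term. This identity, for arbitrary integrable \<open>h\<close>, is where the representing function comes from.\<close>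

lemma F_dil_bergman_proj:
  fixes h :: "complex ^ 'n \<Rightarrow> complex"
  assumes h: "integrable vol h" and r: "0 < r" "r < 1"
  shows "F (dil r (bergman_proj h)) = (LINT v|vol. h v * cnj (dil r rep v))"
proof -
  let ?d = "bergman_coeff TYPE('n)"
  define \<psi> where "\<psi> = (\<lambda>j. cut (\<lambda>z. LINT v|vol. h v * cip z v ^ j))"
  define H where "H = (LINT v|vol. norm (h v))"
  have hm[measurable]: "h \<in> borel_measurable vol" using h by auto
  have d0: "0 \<le> ?d j" for j using bergman_coeff_pos[where 'n='n, of j] by simp
  have sd: "summable (\<lambda>j. ?d j * r ^ j)" by (rule summable_bergman_coeff) (use r in auto)
  define u where "u = (\<lambda>j z. (of_real r ^ j * of_real (?d j)) * \<psi> j z)"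
  note E = expansion_of_dil[OF expansion_of_bergman_proj[OF h] r]
  have uA: "u j \<in> Ap p" for j unfolding u_def \<psi>_def by (intro Ap_cmult F_integral_cip(1) h)
  have L: "(\<lambda>j. F (u j)) sums F (dil r (bergman_proj h))"
  proof (rule F_sums[OF dil_Ap[OF p_pos expansion_of_bergman_proj[OF h] r] uA])
    fix z :: "complex ^ 'n" assume z: "z \<in> unit_ball"
    show "(\<lambda>j. u j z) sums dil r (bergman_proj h) z"
      using E z unfolding expansion_of_def u_def \<psi>_def cut_def by (simp add: mult.assoc)
    show "norm (u j z) \<le> (?d j * r ^ j) * H" for j
    proof -
      have "norm z ^ j \<le> 1" using z by (intro power_le_one) auto
      then have "norm z ^ j * H \<le> H" unfolding H_def by (intro mult_left_le_one_le) auto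
      then have "norm (\<psi> j z) \<le> H"
        using norm_integral_cip_power_le[OF h, of z j] z by (simp add: \<psi>_def cut_def H_def)
      from mult_left_mono[OF this, of "?d j * r ^ j"] show ?thesis
        using d0[of j] r by (simp add: u_def norm_mult norm_power mult_ac)
    qed
  qed (use summable_mult2[OF sd, of H] in simp)
  have Fu: "F (u j) = (LINT v|vol. h v * ((of_real r ^ j * of_real (?d j)) * \<Theta> j v))" for j
  proof -
    have "F (u j) = (of_real r ^ j * of_real (?d j)) * (LINT v|vol. h v * \<Theta> j v)"
      unfolding u_def \<psi>_def by (subst F_cmult[OF F_integral_cip(1)[OF h]]) (simp only: F_integral_cip(2)[OF h])
    also have "\<dots> = (LINT v|vol. (of_real r ^ j * of_real (?d j)) * (h v * \<Theta> j v))"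
      by (rule integral_mult_right_zero[symmetric])
    also have "\<dots> = (LINT v|vol. h v * ((of_real r ^ j * of_real (?d j)) * \<Theta> j v))"
      by (simp only: mult_ac)
    finally show ?thesis .
  qed
  define S where "S = (\<Sum>j. ?d j * r ^ j)"
  have "(\<lambda>j. LINT v|vol. h v * ((of_real r ^ j * of_real (?d j)) * \<Theta> j v)) sums (LINT v|vol. h v * cnj (dil r rep v))"
  proof (rule integral_sums_dominated(2)[where B="\<lambda>v. norm (h v) * (S * (M * V))"])
    have "\<Theta> j \<in> borel_measurable vol" for j by (rule measurable_vol[OF \<Theta>_measurable])
    then show "(\<lambda>v. h v * ((of_real r ^ j * of_real (?d j)) * \<Theta> j v)) \<in> borel_measurable vol" for j
      by (intro borel_measurable_times hm borel_measurable_const)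
    show "integrable vol (\<lambda>v. norm (h v) * (S * (M * V)))" using h by simp
  next
    fix v :: "complex ^ 'n" assume "v \<in> space vol"
    then have v: "v \<in> unit_ball" by simp
    have "(\<lambda>j. of_real r ^ j * (of_real (?d j) * cnj (\<Theta> j v))) sums dil r rep v"
      using expansion_of_dil[OF expansion_of_rep r] v unfolding expansion_of_def by blast
    then have "(\<lambda>j. cnj (of_real r ^ j * (of_real (?d j) * cnj (\<Theta> j v)))) sums cnj (dil r rep v)"
      by (simp only: sums_cnj)
    then have "(\<lambda>j. (of_real r ^ j * of_real (?d j)) * \<Theta> j v) sums cnj (dil r rep v)" by (simp add: mult.assoc)
    then show "(\<lambda>j. h v * ((of_real r ^ j * of_real (?d j)) * \<Theta> j v)) sums (h v * cnj (dil r rep v))"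
      by (rule sums_mult)
  next
    fix k and v :: "complex ^ 'n" assume "v \<in> space vol"
    then have v: "norm v \<le> 1" by simp
    have "norm ((of_real r ^ j * of_real (?d j)) * \<Theta> j v) \<le> (?d j * r ^ j) * (M * V)" for j
    proof -
      have "norm v ^ j \<le> 1" using v by (intro power_le_one) auto
      then have "M * V * norm v ^ j \<le> M * V" using M_nonneg V_nonneg by (intro mult_left_le) auto
      then have "norm (\<Theta> j v) \<le> M * V" using \<Theta>_le[OF v, of j] by linarith
      from mult_left_mono[OF this, of "?d j * r ^ j"] show ?thesis
        using d0[of j] r by (simp add: norm_mult norm_power mult_ac)
    qed
    then have "norm (\<Sum>j<k. (of_real r ^ j * of_real (?d j)) * \<Theta> j v) \<le> (\<Sum>j<k. (?d j * r ^ j) * (M * V))"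
      by (rule sum_norm_le)
    also have "\<dots> = (\<Sum>j<k. ?d j * r ^ j) * (M * V)" by (simp only: sum_distrib_right)
    also have "\<dots> \<le> S * (M * V)" unfolding S_def
      using M_nonneg V_nonneg d0 r by (intro mult_right_mono sum_le_suminf[OF sd]) auto
    finally show "norm (\<Sum>j<k. h v * ((of_real r ^ j * of_real (?d j)) * \<Theta> j v)) \<le> norm (h v) * (S * (M * V))"
      unfolding sum_distrib_left[symmetric] norm_mult[of "h v"] by (intro mult_left_mono) auto
  qed
  with L show ?thesis unfolding Fu using sums_unique2 by blast
qed

text \<open>Testing with \<open>h = norm g powr (q - 2) * g\<close> for a dilated \<open>g\<close>, which is bounded, extracts its norm in \<open>L\<close> with exponent \<open>q\<close>; the bound does not depend on the radius of the dilation, and Fatou's lemma removes the dilation.\<close>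

lemma rep_bound:
  assumes K: "0 \<le> K" "\<And>h :: complex ^ 'n \<Rightarrow> complex. h \<in> borel_measurable vol \<Longrightarrow> integrable vol (\<lambda>z. norm (h z) powr p) \<Longrightarrow>
    bergman_proj h \<in> Ap p \<and> Ap_norm p (bergman_proj h) \<le> K * Ap_norm p h"
  shows "rep \<in> Ap q" "Ap_norm q rep \<le> (2 ^ (2 * CARD('n))) powr (1 / p) * K * M"
proof -
  define E where "E = (2 ^ (2 * CARD('n)) :: real) powr (1 / p)"
  have E0: "0 \<le> E" by (simp add: E_def)
  define L where "L = E * K * M"
  have L0: "0 \<le> L" unfolding L_def using E0 K(1) M_nonneg by simp
  note R = expansion_of_rep
  have qp: "(q - 1) * p = q" using pq p_pos q_pos by (simp add: field_simps)
  have main: "(LINT z|vol. norm (dil (dil_radius m) rep z) powr q) \<le> L powr q" for m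
  proof -
    define g where "g = dil (dil_radius m) rep"
    define X where "X = (LINT z|vol. norm (g z) powr q)"
    have gA: "g \<in> Ap q" unfolding g_def by (rule dil_Ap[OF q_pos R dil_radius(1,3)])
    note gm[measurable] = Ap_measurable[OF gA]
    define h where "h = (\<lambda>z. of_real (norm (g z) powr (q - 2)) * g z)"
    have hm[measurable]: "h \<in> borel_measurable vol" unfolding h_def by measurable
    have nh: "norm (h z) powr p = norm (g z) powr q" for z
    proof (cases "g z = 0")
      case False
      have "norm (h z) = norm (g z) powr (q - 2) * norm (g z) powr 1" using False by (simp add: h_def norm_mult)
      also have "\<dots> = norm (g z) powr (q - 1)" by (simp only: powr_add[symmetric]) simp
      finally show ?thesis by (simp add: powr_powr qp)
    qed (use p_pos q_pos in \<open>simp add: h_def\<close>)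
    have hg: "h z * cnj (g z) = of_real (norm (g z) powr q)" for z
    proof (cases "g z = 0")
      case False
      have "h z * cnj (g z) = of_real (norm (g z) powr (q - 2)) * (g z * cnj (g z))" by (simp add: h_def)
      also have "g z * cnj (g z) = of_real (norm (g z) powr 2)"
        using False by (simp add: complex_norm_square[symmetric])
      also have "complex_of_real (norm (g z) powr (q - 2)) * of_real (norm (g z) powr 2) = of_real (norm (g z) powr q)"
        by (simp only: of_real_mult[symmetric] powr_add[symmetric]) simp
      finally show ?thesis .
    qed (use q_pos in simp)
    have hi: "integrable vol (\<lambda>z. norm (h z) powr p)" unfolding nh by (rule Ap_integrable[OF gA])
    have h1: "integrable vol h" using pq hi by (intro integrable_norm_Lp hm) auto
    have X0: "0 \<le> X" by (simp add: X_def)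
    have Ah: "Ap_norm p h = X powr (1 / p)" by (simp add: Ap_norm_def nh X_def)
    have PA: "bergman_proj h \<in> Ap p" "Ap_norm p (bergman_proj h) \<le> K * X powr (1 / p)" using K(2)[OF hm hi] Ah by auto
    have "complex_of_real X = (LINT v|vol. h v * cnj (g v))" unfolding hg X_def by (rule integral_complex_of_real[symmetric])
    also have "\<dots> = F (dil (dil_radius m) (bergman_proj h))"
      unfolding g_def by (rule F_dil_bergman_proj[OF h1 dil_radius(1,3), symmetric])
    finally have "X = norm (F (dil (dil_radius m) (bergman_proj h)))" using X0 by (metis norm_of_real abs_of_nonneg)
    also have "\<dots> \<le> M * Ap_norm p (dil (dil_radius m) (bergman_proj h))"
      by (rule F_le[OF dil_Ap[OF p_pos Ap_expansion[OF PA(1)] dil_radius(1,3)]])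
    also have "\<dots> \<le> M * (E * (K * X powr (1 / p)))"
      using order_trans[OF dil_norm_le[OF p_pos PA(1), of m, folded E_def] mult_left_mono[OF PA(2) E0]] M_nonneg
      by (rule mult_left_mono)
    also have "\<dots> = L * X powr (1 / p)" by (simp add: L_def)
    finally have XL: "X \<le> L * X powr (1 / p)" .
    have "X \<le> L powr q"
    proof (cases "X = 0")
      case False
      then have Xp: "0 < X" using X0 by simp
      have e1: "1 / q + 1 / p = 1" using pq by simp
      have "X powr (1 / q) * X powr (1 / p) = X" using Xp by (simp only: powr_add[symmetric] e1) simp
      with XL have "X powr (1 / q) * X powr (1 / p) \<le> L * X powr (1 / p)" by simp
      then have "X powr (1 / q) \<le> L" using Xp by (simp add: mult_le_cancel_right)
      then have "(X powr (1 / q)) powr q \<le> L powr q" using q_pos by (intro powr_mono2) auto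
      then show ?thesis using Xp q_pos by (simp add: powr_powr)
    qed simp
    then show ?thesis by (simp add: X_def g_def)
  qed
  note Fa = Fatou_Lp[where M="vol :: (complex ^ 'n) measure" and f="\<lambda>m. dil (dil_radius m) rep" and g=rep, OF q_pos
     expansion_of_measurable[OF expansion_of_dil[OF R dil_radius(1,3)]] expansion_of_measurable[OF R]
     dil_tendsto_pointwise[OF R, folded space_vol] Ap_integrable[OF dil_Ap[OF q_pos R dil_radius(1,3)]] main powr_ge_zero]
  show "rep \<in> Ap q" by (rule ApI[OF R rep_outside Fa(1)])
  have "Ap_norm q rep \<le> (L powr q) powr (1 / q)"
    unfolding Ap_norm_def using q_pos Fa(2) by (intro powr_mono2) auto
  also have "\<dots> = L" using q_pos L0 by (simp add: powr_powr)
  finally show "Ap_norm q rep \<le> (2 ^ (2 * CARD('n))) powr (1 / p) * K * M" by (simp add: L_def E_def)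
qed

text \<open>The projection fixes \<open>f\<close>, and both sides of the identity for dilations converge as the radius tends to 1.\<close>

lemma rep_represents:
  assumes g: "rep \<in> Ap q" and f: "f \<in> Ap p"
  shows "F f = (LINT v|vol. f v * cnj (rep v))"
proof -
  let ?f = "\<lambda>m. dil (dil_radius m) f"
  let ?g = "\<lambda>m. dil (dil_radius m) rep"
  have fi: "integrable vol f" using pq by (intro integrable_norm_Lp[OF _ Ap_measurable[OF f] Ap_integrable[OF f]]) auto
  have P: "bergman_proj f = f" using pq by (intro bergman_proj_reproduces(1)[OF _ f]) auto
  have e: "F (?f m) = (LINT v|vol. f v * cnj (?g m v))" for m
    using F_dil_bergman_proj[OF fi dil_radius(1,3)] unfolding P .
  have fA: "?f m \<in> Ap p" for m by (rule dil_Ap[OF p_pos Ap_expansion[OF f] dil_radius(1,3)])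
  have gA: "?g m \<in> Ap q" for m by (rule dil_Ap[OF q_pos Ap_expansion[OF g] dil_radius(1,3)])
  have "(\<lambda>m. F (?f m) - F f) \<longlonglongrightarrow> 0"
  proof (rule Lim_null_comparison)
    show "\<forall>\<^sub>F m in sequentially. norm (F (?f m) - F f) \<le> M * Ap_norm p (\<lambda>z. ?f m z - f z)"
      using F_le[OF F_diff(1)[OF fA f]] F_diff(2)[OF fA f] by simp
    show "(\<lambda>m. M * Ap_norm p (\<lambda>z. ?f m z - f z)) \<longlonglongrightarrow> 0"
      using tendsto_mult_left[OF dil_Lp_convergence(2)[OF p_pos f], of M] by simp
  qed
  then have l1: "(\<lambda>m. F (?f m)) \<longlonglongrightarrow> F f" by (rule LIM_zero_cancel)
  have "(\<lambda>m. (LINT v|vol. f v * cnj (?g m v)) - (LINT v|vol. f v * cnj (rep v))) \<longlonglongrightarrow> 0"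
  proof (rule Lim_null_comparison)
    show "(\<lambda>m. Ap_norm p f * Ap_norm q (\<lambda>z. ?g m z - rep z)) \<longlonglongrightarrow> 0"
      using tendsto_mult_left[OF dil_Lp_convergence(2)[OF q_pos g], of "Ap_norm p f"] by simp
    have "norm ((LINT v|vol. f v * cnj (?g m v)) - (LINT v|vol. f v * cnj (rep v))) \<le> Ap_norm p f * Ap_norm q (\<lambda>z. ?g m z - rep z)" for m
    proof -
      have i1: "integrable vol (\<lambda>v. f v * cnj (?g m v))"
        by (rule pairing_Hoelder(1)[OF pq Ap_measurable[OF f] Ap_measurable[OF gA] Ap_integrable[OF f] Ap_integrable[OF gA]])
      have i2: "integrable vol (\<lambda>v. f v * cnj (rep v))"
        by (rule pairing_Hoelder(1)[OF pq Ap_measurable[OF f] Ap_measurable[OF g] Ap_integrable[OF f] Ap_integrable[OF g]])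
      have "(LINT v|vol. f v * cnj (?g m v)) - (LINT v|vol. f v * cnj (rep v)) = (LINT v|vol. f v * cnj (?g m v - rep v))"
        unfolding Bochner_Integration.integral_diff[OF i1 i2, symmetric] by (simp add: algebra_simps)
      moreover have "norm (LINT v|vol. f v * cnj (?g m v - rep v)) \<le> Ap_norm p f * Ap_norm q (\<lambda>z. ?g m z - rep z)"
        by (rule pairing_Hoelder(2)[OF pq Ap_measurable[OF f] borel_measurable_diff[OF Ap_measurable[OF gA] Ap_measurable[OF g]]
              Ap_integrable[OF f] dil_Lp_convergence(1)[OF q_pos g]])
      ultimately show ?thesis by simp
    qed
    then show "\<forall>\<^sub>F m in sequentially. norm ((LINT v|vol. f v * cnj (?g m v)) - (LINT v|vol. f v * cnj (rep v)))
        \<le> Ap_norm p f * Ap_norm q (\<lambda>z. ?g m z - rep z)" by simp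
  qed
  then have "(\<lambda>m. F (?f m)) \<longlonglongrightarrow> (LINT v|vol. f v * cnj (rep v))" unfolding e by (rule LIM_zero_cancel)
  with l1 show ?thesis by (rule LIMSEQ_unique)
qed

end

lemma Ap_dual:
  assumes pq: "1 < p" "1 < q" "1 / p + 1 / q = 1"
  shows "\<exists>C>0. \<forall>F M. Ap_functional p q (F :: (complex ^ 'n \<Rightarrow> complex) \<Rightarrow> complex) M \<longrightarrow>
    (\<exists>g\<in>Ap q. Ap_norm q g \<le> C * M \<and> (\<forall>f\<in>Ap p. F f = (LINT v|vol. f v * cnj (g v))))"
proof -
  obtain K where K: "K > 0" "\<forall>h :: complex ^ 'n \<Rightarrow> complex. h \<in> borel_measurable vol \<longrightarrow> integrable vol (\<lambda>z. norm (h z) powr p) \<longrightarrow>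
    bergman_proj h \<in> Ap p \<and> Ap_norm p (bergman_proj h) \<le> K * Ap_norm p h"
    using bergman_proj_bounded[where 'n='n, OF pq] by blast
  show ?thesis
  proof (intro exI[of _ "(2 ^ (2 * CARD('n))) powr (1 / p) * K"] conjI allI impI)
    show "0 < (2 ^ (2 * CARD('n)) :: real) powr (1 / p) * K" using K(1) by simp
    fix F :: "(complex ^ 'n \<Rightarrow> complex) \<Rightarrow> complex" and M
    assume "Ap_functional p q F M"
    then interpret Ap_functional p q F M .
    have K0: "0 \<le> K" using K(1) by simp
    note B = rep_bound[OF K0 K(2)[rule_format]]
    show "\<exists>g\<in>Ap q. Ap_norm q g \<le> (2 ^ (2 * CARD('n))) powr (1 / p) * K * M \<and> (\<forall>f\<in>Ap p. F f = (LINT v|vol. f v * cnj (g v)))"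
      using B rep_represents[OF B(1)] by blast
  qed
qed

text \<open>The powers \<open>cip w z ^ j\<close> are admissible test functions and recover every component of \<open>g\<close> at \<open>z\<close>.\<close>

lemma Ap_pairing_nondegenerate:
  fixes g :: "complex ^ 'n \<Rightarrow> complex"
  assumes pq: "1 < p" "1 < q" and g: "g \<in> Ap q" and z0: "\<And>f. f \<in> Ap p \<Longrightarrow> (LINT v|vol. f v * cnj (g v)) = 0"
  shows "g = (\<lambda>_. 0)"
proof -
  have p: "0 < p" using pq by simp
  have sc: "slice_coeff g j z = 0" if z: "z \<in> unit_ball" for j z
  proof -
    have "0 = (LINT v|vol. cut (\<lambda>w. cip w z ^ j) v * cnj (g v))"
      by (rule z0[symmetric], rule cut_cip_power_Ap(1)[OF p]) (use z in simp)
    also have "\<dots> = (LINT v|vol. cnj (g v * cip z v ^ j))"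
      by (rule Bochner_Integration.integral_cong[OF refl]) (simp add: cut_def cnj_cip mult.commute)
    also have "\<dots> = cnj (LINT v|vol. g v * cip z v ^ j)" by (rule Bochner_Integration.integral_cnj)
    finally have "(LINT v|vol. g v * cip z v ^ j) = 0" by simp
    moreover have "(LINT v|vol. g v * cip z v ^ j) = of_real (1 / bergman_coeff TYPE('n) j) * slice_coeff g j z"
      using pq by (intro bergman_proj_reproduces(2)[OF _ g]) auto
    ultimately show ?thesis using bergman_coeff_pos[where 'n='n, of j] by simp
  qed
  show ?thesis
  proof
    fix z show "g z = 0"
    proof (cases "z \<in> unit_ball")
      case True
      then have "(\<lambda>j. slice_coeff g j z) sums g z" using Ap_expansion[OF g] unfolding expansion_of_def by blast
      then show ?thesis unfolding sc[OF True] using sums_unique2[OF sums_zero] by metis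
    qed (rule Ap_outside[OF g])
  qed
qed

section \<open>The duality theorem\<close>

lemma
  fixes f g :: "complex ^ 'n \<Rightarrow> complex"
  assumes wd: "Rst_well_defined CARD('n) s t" and f: "holomorphic_in_ball f"
  shows Rst_ball_cmult: "Rst_ball s t (\<lambda>z. c * f z) = (\<lambda>z. c * Rst_ball s t f z)"
    and Rst_ball_add: "holomorphic_in_ball g \<Longrightarrow> Rst_ball s t (\<lambda>z. f z + g z) = (\<lambda>z. Rst_ball s t f z + Rst_ball s t g z)"
proof -
  let ?m = "multiplier (of_nat CARD('n) + 1 + s) (of_nat CARD('n) + 1 + s + t)"
  note F = expansion_of_slice_coeff[OF f]
  have S: "(\<lambda>k. ?m k * \<phi> k z) sums Rst_ball s t u z" if "expansion_of u \<phi>" "z \<in> unit_ball" for u :: "complex ^ 'n \<Rightarrow> complex" and \<phi> z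
    using expansion_of_Rst_ball[OF wd that(1)] that(2) unfolding expansion_of_def by blast
  have o: "Rst_ball s t u z = 0" if "z \<notin> unit_ball" for u :: "complex ^ 'n \<Rightarrow> complex" and z using that unfolding Rst_ball_def by (rule if_not_P)
  show "Rst_ball s t (\<lambda>z. c * f z) = (\<lambda>z. c * Rst_ball s t f z)"
  proof
    fix z
    show "Rst_ball s t (\<lambda>z. c * f z) z = c * Rst_ball s t f z"
    proof (cases "z \<in> unit_ball")
      case True
      from sums_mult[OF S[OF F True], of c] S[OF expansion_of_cmult[OF F] True, of c]
      show ?thesis by (simp only: mult.left_commute[of c]) (rule sums_unique2)
    next
      case False
      show ?thesis unfolding o[OF False] by simp
    qed
  qed
  show "Rst_ball s t (\<lambda>z. f z + g z) = (\<lambda>z. Rst_ball s t f z + Rst_ball s t g z)" if g: "holomorphic_in_ball g"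
  proof
    fix z
    note G = expansion_of_slice_coeff[OF g]
    show "Rst_ball s t (\<lambda>z. f z + g z) z = Rst_ball s t f z + Rst_ball s t g z"
    proof (cases "z \<in> unit_ball")
      case True
      from S[OF expansion_of_add[OF F G] True] sums_add[OF S[OF F True] S[OF G True]]
      show ?thesis by (simp only: distrib_left) (rule sums_unique2)
    next
      case False
      show ?thesis unfolding o[OF False] by simp
    qed
  qed
qed

lemma bergman_norm_nonneg: "0 \<le> bergman_norm p \<alpha> f"
  by (simp add: bergman_norm_def Let_def)

theorem theorem23:
  fixes p q \<alpha> \<beta> :: real and s1 s2 :: complex
  assumes "1 < p"
    and "1 / p + 1 / q = 1"
    and "Rst_well_defined CARD('n::finite) s1 (of_real (\<alpha> / p))"
    and "Rst_well_defined CARD('n) s2 (of_real (\<beta> / q))"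
  shows "(\<forall>f \<in> bergman p \<alpha> :: (complex ^ 'n \<Rightarrow> complex) set. \<forall>g \<in> bergman q \<beta>.
            integrable vol (\<lambda>z. Rst s1 (of_real (\<alpha> / p)) f z * cnj (Rst s2 (of_real (\<beta> / q)) g z)))
       \<and> dual_under_pairing
            (bergman p \<alpha> :: (complex ^ 'n \<Rightarrow> complex) set) (bergman_norm p \<alpha>)
            (bergman q \<beta>) (bergman_norm q \<beta>)
            (\<lambda>f g. LINT z|vol. Rst s1 (of_real (\<alpha> / p)) f z * cnj (Rst s2 (of_real (\<beta> / q)) g z))"
proof -
  have q: "1 < q"
  proof -
    have "1 / p < 1" "0 < 1 / p" using assms(1) by auto
    with assms(2) have "0 < 1 / q" "1 / q < 1" by linarith+
    then show ?thesis by (simp add: divide_less_eq split: if_splits)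
  qed
  have pq: "1 < p" "1 < q" "1 / p + 1 / q = 1" and qp: "1 < q" "1 < p" "1 / q + 1 / p = 1" using assms(1,2) q by auto
  have p0: "0 < p" "0 < q" using pq by auto
  define X where "X = (bergman p \<alpha> :: (complex ^ 'n \<Rightarrow> complex) set)"
  define Y where "Y = (bergman q \<beta> :: (complex ^ 'n \<Rightarrow> complex) set)"
  define P where "P = (Rst_ball s1 (of_real (\<alpha> / p)) :: (complex ^ 'n \<Rightarrow> complex) \<Rightarrow> _)"
  define Q where "Q = (Rst_ball s2 (of_real (\<beta> / q)) :: (complex ^ 'n \<Rightarrow> complex) \<Rightarrow> _)"
  define B where "B = (\<lambda>f g :: complex ^ 'n \<Rightarrow> complex. LINT z|vol. Rst s1 (of_real (\<alpha> / p)) f z * cnj (Rst s2 (of_real (\<beta> / q)) g z))"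
  define \<nu> where "\<nu> = (bergman_norm p \<alpha> :: (complex ^ 'n \<Rightarrow> complex) \<Rightarrow> _)"
  define \<mu> where "\<mu> = (bergman_norm q \<beta> :: (complex ^ 'n \<Rightarrow> complex) \<Rightarrow> _)"
  have \<nu>0: "0 \<le> \<nu> f" and \<mu>0: "0 \<le> \<mu> f" for f by (simp_all add: \<nu>_def \<mu>_def bergman_norm_nonneg)
  have Xh: "holomorphic_in_ball f" "z \<notin> unit_ball \<Longrightarrow> f z = 0" if "f \<in> X" for f z using that by (auto simp: X_def bergman_def)
  have Yh: "holomorphic_in_ball f" "z \<notin> unit_ball \<Longrightarrow> f z = 0" if "f \<in> Y" for f z using that by (auto simp: Y_def bergman_def)
  obtain C1 where C1: "C1 > 0" "\<And>f. f \<in> X \<Longrightarrow> P f \<in> Ap p" "\<And>f. f \<in> X \<Longrightarrow> Ap_norm p (P f) \<le> C1 * \<nu> f"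
    using Rst_ball_bounded[OF pq assms(3)] unfolding X_def P_def \<nu>_def by blast
  obtain C2 where C2: "C2 > 0" "\<And>f. f \<in> Y \<Longrightarrow> Q f \<in> Ap q" "\<And>f. f \<in> Y \<Longrightarrow> Ap_norm q (Q f) \<le> C2 * \<mu> f"
    using Rst_ball_bounded[OF qp assms(4)] unfolding Y_def Q_def \<mu>_def by blast
  obtain D1 where D1: "D1 > 0" "\<And>G. G \<in> Ap p \<Longrightarrow> \<exists>f\<in>X. P f = G \<and> \<nu> f \<le> D1 * Ap_norm p G"
    using Rst_ball_surj[OF pq assms(3)] unfolding X_def P_def \<nu>_def by blast
  obtain D2 where D2: "D2 > 0" "\<And>G. G \<in> Ap q \<Longrightarrow> \<exists>f\<in>Y. Q f = G \<and> \<mu> f \<le> D2 * Ap_norm q G"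
    using Rst_ball_surj[OF qp assms(4)] unfolding Y_def Q_def \<mu>_def by blast
  have Qinj: "f = g" if "f \<in> Y" "g \<in> Y" "Q f = Q g" for f g
    by (rule Rst_ball_inj[OF assms(4) Yh(1)[OF that(1)] Yh(2)[OF that(1)] Yh(1)[OF that(2)] Yh(2)[OF that(2)] that(3)[unfolded Q_def]])
  have Pinj: "f = g" if "holomorphic_in_ball f" "\<And>z. z \<notin> unit_ball \<Longrightarrow> f z = 0" "holomorphic_in_ball g" "\<And>z. z \<notin> unit_ball \<Longrightarrow> g z = 0" "P f = P g" for f g
    by (rule Rst_ball_inj[OF assms(3) that(1-4) that(5)[unfolded P_def]])
  have Padd: "P (\<lambda>z. f z + g z) = (\<lambda>z. P f z + P g z)" if "f \<in> X" "g \<in> X" for f g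
    unfolding P_def by (rule Rst_ball_add[OF assms(3) Xh(1)[OF that(1)] Xh(1)[OF that(2)]])
  have Pcmult: "P (\<lambda>z. c * f z) = (\<lambda>z. c * P f z)" if "f \<in> X" for f c
    unfolding P_def by (rule Rst_ball_cmult[OF assms(3) Xh(1)[OF that]])
  have eqPQ: "Rst s1 (of_real (\<alpha> / p)) f z * cnj (Rst s2 (of_real (\<beta> / q)) g z) = P f z * cnj (Q g z)" if "z \<in> space vol" for f g z
    using that by (simp add: P_def Q_def Rst_ball_def)
  have BPQ: "B f g = (LINT z|vol. P f z * cnj (Q g z))" for f g
    unfolding B_def by (rule Bochner_Integration.integral_cong[OF refl eqPQ])
  have Hi: "integrable vol (\<lambda>z. u z * cnj (v z))" and Hn: "norm (LINT z|vol. u z * cnj (v z)) \<le> Ap_norm p u * Ap_norm q v"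
    if "u \<in> Ap p" "v \<in> Ap q" for u v :: "complex ^ 'n \<Rightarrow> complex"
    using pairing_Hoelder[OF pq Ap_measurable[OF that(1)] Ap_measurable[OF that(2)] Ap_integrable[OF that(1)] Ap_integrable[OF that(2)]] by auto
  have ieq: "integrable vol (\<lambda>z. Rst s1 (of_real (\<alpha> / p)) f z * cnj (Rst s2 (of_real (\<beta> / q)) g z))
      \<longleftrightarrow> integrable vol (\<lambda>z. P f z * cnj (Q g z))" for f g
    by (rule Bochner_Integration.integrable_cong[OF refl eqPQ])
  have int: "integrable vol (\<lambda>z. Rst s1 (of_real (\<alpha> / p)) f z * cnj (Rst s2 (of_real (\<beta> / q)) g z))" if "f \<in> X" "g \<in> Y" for f g
    unfolding ieq by (rule Hi[OF C1(2)[OF that(1)] C2(2)[OF that(2)]])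
  have Bn: "norm (B f g) \<le> (C1 * C2 * \<mu> g) * \<nu> f" if "f \<in> X" "g \<in> Y" for f g
  proof -
    have "norm (B f g) \<le> Ap_norm p (P f) * Ap_norm q (Q g)"
      unfolding BPQ by (rule Hn[OF C1(2)[OF that(1)] C2(2)[OF that(2)]])
    also have "\<dots> \<le> (C1 * \<nu> f) * (C2 * \<mu> g)"
      using C1(1) C1(3)[OF that(1)] C2(3)[OF that(2)] \<nu>0[of f] by (intro mult_mono) (auto simp: Ap_norm_nonneg)
    finally show ?thesis by (simp only: mult_ac)
  qed
  have Badd: "B (\<lambda>z. f z + f' z) g = B f g + B f' g" if "f \<in> X" "f' \<in> X" "g \<in> Y" for f f' g
    unfolding BPQ Padd[OF that(1,2)] distrib_right
    by (rule Bochner_Integration.integral_add[OF Hi[OF C1(2)[OF that(1)] C2(2)[OF that(3)]] Hi[OF C1(2)[OF that(2)] C2(2)[OF that(3)]]])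
  have Bcmult: "B (\<lambda>z. c * f z) g = c * B f g" if "f \<in> X" "g \<in> Y" for f g c
    unfolding BPQ Pcmult[OF that(1)] mult.assoc by (rule integral_mult_right_zero)
  have uniq: "g = g'" if g: "g \<in> Y" "g' \<in> Y" and e: "\<And>f. f \<in> X \<Longrightarrow> B f g = B f g'" for g g'
  proof -
    have d: "(\<lambda>z. Q g z + (-1) * Q g' z) \<in> Ap q"
      by (rule Ap_add[OF p0(2) C2(2)[OF g(1)] Ap_cmult[OF C2(2)[OF g(2)]]])
    have d0: "(\<lambda>z. Q g z + (-1) * Q g' z) = (\<lambda>_. 0)"
    proof (rule Ap_pairing_nondegenerate[OF pq(1,2) d])
      fix G :: "complex ^ 'n \<Rightarrow> complex" assume G: "G \<in> Ap p"
      then obtain f where f: "f \<in> X" "P f = G" using D1(2) by blast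
      note i1 = Hi[OF G C2(2)[OF g(1)]] and i2 = Hi[OF G C2(2)[OF g(2)]]
      have "(LINT v|vol. G v * cnj (Q g v + (-1) * Q g' v)) = (LINT v|vol. G v * cnj (Q g v) - G v * cnj (Q g' v))"
        by (simp add: algebra_simps)
      also have "\<dots> = B f g - B f g'"
        unfolding BPQ f(2) by (rule Bochner_Integration.integral_diff[OF i1 i2])
      finally show "(LINT v|vol. G v * cnj (Q g v + (-1) * Q g' v)) = 0" using e[OF f(1)] by simp
    qed
    have "Q g z = Q g' z" for z using fun_cong[OF d0, of z] by simp
    then have "Q g = Q g'" by (rule ext)
    then show ?thesis by (rule Qinj[OF g])
  qed
  obtain K where K: "K > 0" "\<And>F M. Ap_functional p q (F :: (complex ^ 'n \<Rightarrow> complex) \<Rightarrow> complex) M \<Longrightarrow>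
      \<exists>g\<in>Ap q. Ap_norm q g \<le> K * M \<and> (\<forall>f\<in>Ap p. F f = (LINT v|vol. f v * cnj (g v)))"
    using Ap_dual[where 'n='n, OF pq] by blast
  have dual: "\<exists>g\<in>Y. \<mu> g \<le> D2 * K * D1 * C \<and> (\<forall>f\<in>X. F f = B f g)"
    if Fadd: "\<And>f g. f \<in> X \<Longrightarrow> g \<in> X \<Longrightarrow> F (\<lambda>z. f z + g z) = F f + F g"
      and Fcmult: "\<And>c f. f \<in> X \<Longrightarrow> F (\<lambda>z. c * f z) = c * F f"
      and Fle: "\<And>f. f \<in> X \<Longrightarrow> norm (F f) \<le> C * \<nu> f" and C: "0 \<le> C" for F :: "(complex ^ 'n \<Rightarrow> complex) \<Rightarrow> complex" and C
  proof -
    define I where "I = (\<lambda>G. SOME f. f \<in> X \<and> P f = G \<and> \<nu> f \<le> D1 * Ap_norm p G)"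
    have I': "I G \<in> X \<and> P (I G) = G \<and> \<nu> (I G) \<le> D1 * Ap_norm p G" if "G \<in> Ap p" for G
    proof -
      have e: "\<exists>f. f \<in> X \<and> P f = G \<and> \<nu> f \<le> D1 * Ap_norm p G" using D1(2)[OF that] by blast
      show ?thesis unfolding I_def by (rule someI_ex[OF e])
    qed
    have I: "I G \<in> X" "P (I G) = G" "\<nu> (I G) \<le> D1 * Ap_norm p G" if "G \<in> Ap p" for G
      using I'[OF that] by auto
    have IP: "I (P f) = f" if "f \<in> X" for f
    proof -
      note m = C1(2)[OF that]
      show ?thesis
        by (rule Pinj[OF Xh(1)[OF I(1)[OF m]] Xh(2)[OF I(1)[OF m]] Xh(1)[OF that] Xh(2)[OF that] I(2)[OF m]])
    qed
    have af: "Ap_functional p q (\<lambda>G. F (I G)) (C * D1)"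
    proof (unfold_locales)
      show "1 < p" "1 < q" "1 / p + 1 / q = 1" by (fact pq)+
      show "0 \<le> C * D1" using C D1(1) by simp
      fix f :: "complex ^ 'n \<Rightarrow> complex" assume f: "f \<in> Ap p"
      have "norm (F (I f)) \<le> C * (D1 * Ap_norm p f)"
        by (rule order_trans[OF Fle[OF I(1)[OF f]] mult_left_mono[OF I(3)[OF f] C]])
      then show "norm (F (I f)) \<le> C * D1 * Ap_norm p f" by (simp only: mult.assoc)
      show "F (I (\<lambda>z. c * f z)) = c * F (I f)" for c
      proof -
        note cf = Ap_cmult[OF f, of c]
        have "I (\<lambda>z. c * f z) = (\<lambda>z. c * I f z)"
        proof (rule Pinj[OF Xh(1)[OF I(1)[OF cf]] Xh(2)[OF I(1)[OF cf]]])
          show "holomorphic_in_ball (\<lambda>z. c * I f z)"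
            by (rule expansion_imp_holomorphic[OF expansion_of_cmult[OF expansion_of_slice_coeff[OF Xh(1)[OF I(1)[OF f]]]]])
          show "P (I (\<lambda>z. c * f z)) = P (\<lambda>z. c * I f z)"
            unfolding I(2)[OF cf] Pcmult[OF I(1)[OF f]] I(2)[OF f] ..
        qed (simp_all add: Xh(2)[OF I(1)[OF f]])
        then show ?thesis using Fcmult[OF I(1)[OF f]] by simp
      qed
      fix g :: "complex ^ 'n \<Rightarrow> complex" assume g: "g \<in> Ap p"
      note fg = Ap_add[OF p0(1) f g]
      have "I (\<lambda>z. f z + g z) = (\<lambda>z. I f z + I g z)"
      proof (rule Pinj[OF Xh(1)[OF I(1)[OF fg]] Xh(2)[OF I(1)[OF fg]]])
        show "holomorphic_in_ball (\<lambda>z. I f z + I g z)"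
          by (rule expansion_imp_holomorphic[OF expansion_of_add[OF expansion_of_slice_coeff[OF Xh(1)[OF I(1)[OF f]]] expansion_of_slice_coeff[OF Xh(1)[OF I(1)[OF g]]]]])
        show "P (I (\<lambda>z. f z + g z)) = P (\<lambda>z. I f z + I g z)"
          unfolding I(2)[OF fg] Padd[OF I(1)[OF f] I(1)[OF g]] I(2)[OF f] I(2)[OF g] ..
      qed (simp_all add: Xh(2)[OF I(1)[OF f]] Xh(2)[OF I(1)[OF g]])
      then show "F (I (\<lambda>z. f z + g z)) = F (I f) + F (I g)" using Fadd[OF I(1)[OF f] I(1)[OF g]] by simp
    qed
    obtain G where G: "G \<in> Ap q" "Ap_norm q G \<le> K * (C * D1)" "\<And>f. f \<in> Ap p \<Longrightarrow> F (I f) = (LINT v|vol. f v * cnj (G v))"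
      using K(2)[OF af] by blast
    obtain g where g: "g \<in> Y" "Q g = G" "\<mu> g \<le> D2 * Ap_norm q G" using D2(2)[OF G(1)] by blast
    have "\<mu> g \<le> D2 * (K * (C * D1))" using order_trans[OF g(3) mult_left_mono[OF G(2)]] D2(1) by simp
    then have "\<mu> g \<le> D2 * K * D1 * C" by (simp only: mult_ac)
    moreover have "F f = B f g" if "f \<in> X" for f
      using G(3)[OF C1(2)[OF that]] unfolding IP[OF that] BPQ g(2) .
    ultimately show ?thesis using g(1) by blast
  qed
  define S where "S = (\<lambda>g. {C. 0 \<le> C \<and> (\<forall>f\<in>X. norm (B f g) \<le> C * \<nu> f)})"
  have fn: "functional_norm X \<nu> (\<lambda>f. B f g) = Inf (S g)" for g by (simp add: functional_norm_def S_def)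
  have Smem: "C1 * C2 * \<mu> g \<in> S g" if "g \<in> Y" for g
    unfolding S_def using Bn[OF _ that] C1(1) C2(1) \<mu>0[of g] by simp
  have bf: "bounded_functional X \<nu> (\<lambda>f. B f g)" if "g \<in> Y" for g
    unfolding bounded_functional_def
    by (intro conjI ballI allI exI[of _ "C1 * C2 * \<mu> g"]) (rule Badd Bcmult Bn; (assumption | rule that))+
  have ex1: "\<exists>!g. g \<in> Y \<and> (\<forall>f\<in>X. F f = B f g)" if F: "bounded_functional X \<nu> F" for F
  proof -
    obtain C where C: "\<And>f. f \<in> X \<Longrightarrow> norm (F f) \<le> C * \<nu> f" using F unfolding bounded_functional_def by blast
    have C': "norm (F f) \<le> max C 0 * \<nu> f" if "f \<in> X" for f
      by (rule order_trans[OF C[OF that] mult_right_mono[OF max.cobounded1 \<nu>0]])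
    have Fa: "F (\<lambda>z. f z + g z) = F f + F g" if "f \<in> X" "g \<in> X" for f g using F that unfolding bounded_functional_def by blast
    have Fc: "F (\<lambda>z. c * f z) = c * F f" if "f \<in> X" for f c using F that unfolding bounded_functional_def by blast
    obtain g where g: "g \<in> Y" "\<forall>f\<in>X. F f = B f g" using dual[OF Fa Fc C' max.cobounded2] by blast
    show ?thesis
    proof (rule ex1I[of _ g])
      show "g \<in> Y \<and> (\<forall>f\<in>X. F f = B f g)" using g by blast
      fix g' assume g': "g' \<in> Y \<and> (\<forall>f\<in>X. F f = B f g')"
      show "g' = g" by (rule uniq) (use g g' in auto)
    qed
  qed
  define c where "c = 1 / (D2 * K * D1)"
  have c0: "c > 0" using D1(1) D2(1) K(1) by (simp add: c_def)
  have lower: "c * \<mu> g \<le> functional_norm X \<nu> (\<lambda>f. B f g)" if g: "g \<in> Y" for g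
    unfolding fn
  proof (rule cInf_greatest)
    show "S g \<noteq> {}" using Smem[OF g] by blast
    fix C assume "C \<in> S g"
    then have C: "0 \<le> C" "\<And>f. f \<in> X \<Longrightarrow> norm (B f g) \<le> C * \<nu> f" by (auto simp: S_def)
    obtain g' where g': "g' \<in> Y" "\<mu> g' \<le> D2 * K * D1 * C" "\<forall>f\<in>X. B f g = B f g'"
      using dual[of "\<lambda>f. B f g" C, OF Badd[OF _ _ g] Bcmult[OF _ g] C(2) C(1)] by blast
    have "g' = g" by (rule uniq[OF g'(1) g]) (use g'(3) in simp)
    with g'(2) have "\<mu> g \<le> D2 * K * D1 * C" by simp
    then show "c * \<mu> g \<le> C" using D1(1) D2(1) K(1) by (simp add: c_def field_simps)
  qed
  have upper: "functional_norm X \<nu> (\<lambda>f. B f g) \<le> (C1 * C2) * \<mu> g" if g: "g \<in> Y" for g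
    unfolding fn
  proof (rule cInf_lower[OF Smem[OF g]])
    show "bdd_below (S g)" by (rule bdd_belowI[of _ 0]) (simp add: S_def)
  qed
  have CC: "0 < C1 * C2" using C1(1) C2(1) by (rule mult_pos_pos)
  have D: "dual_under_pairing X \<nu> Y \<mu> B"
    unfolding dual_under_pairing_def
  proof (intro conjI)
    show "\<forall>g\<in>Y. bounded_functional X \<nu> (\<lambda>f. B f g)" by (intro ballI bf)
    show "\<forall>F. bounded_functional X \<nu> F \<longrightarrow> (\<exists>!g. g \<in> Y \<and> (\<forall>f\<in>X. F f = B f g))"
      by (intro allI impI) (rule ex1)
    show "\<exists>c>0. \<exists>C>0. \<forall>g\<in>Y. c * \<mu> g \<le> functional_norm X \<nu> (\<lambda>f. B f g) \<and> functional_norm X \<nu> (\<lambda>f. B f g) \<le> C * \<mu> g"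
      by (rule exI[of _ c], rule conjI[OF c0], rule exI[of _ "C1 * C2"], rule conjI[OF CC])
        (intro ballI conjI lower upper)
  qed
  show ?thesis
    unfolding X_def[symmetric] Y_def[symmetric] \<nu>_def[symmetric] \<mu>_def[symmetric] B_def[symmetric]
    by (intro conjI ballI int D)
qed


end
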